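(* Let $X\subset\mathbb S^n$ be a non-empty volume-critical smooth properly embedded submanifold of dimension $k$. Then for every $t>0$ $$\mathrm{vol}(X+t)\ \ge\ \mathrm{vol}(\mathbb S^k+t),$$ where $\mathbb S^k\subset\mathbb S^n$ is standardly embedded.
   Context: $\mathbb S^n$ is the unit round sphere with its intrinsic Riemannian structure and $\mathrm{vol}$ is its $n$-dimensional Riemannian volume. Properly embedded means embedded, without boundary, and closed as a subset (hence compact). Volume-critical means that $X$ is a critical point of the $k$-dimensional Riemannian volume: its first variation vanishes for every smooth variation of $X$ in $\mathbb S^n$. For $Y\subset\mathbb S^n$, $Y+t$ denotes the $t$-neighborhood of $Y$ in the geodesic metric of $\mathbb S^n$ (points at geodesic distance at most $t$ from $Y$). The standardly embedded $\mathbb S^k\subset\mathbb S^n$ is the intersection of $\mathbb S^n\subset\mathbb R^{n+1}$ with a $(k+1)$-dimensional linear subspace.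
   Formalization: The dimension k is taken to be at least 1 (hence n ≥ 1): for k = 0 the claim fails, since a single point is trivially volume-critical while S^0 is two antipodal points, whose t-neighborhood has twice the volume for t < π/2. *)

theory Defs
  imports "HOL-Analysis.Analysis"
begin

section \<open>Smooth maps\<close>

text \<open>Meant for open \<open>S\<close> and finite-dimensional \<open>'a\<close>, where it is \<open>C\<^sup>m\<close> in the usual sense:
  the second clause asks that all directional derivatives be \<open>C\<^sup>m\<close> again.\<close>

primrec times_differentiable_on ::
    "nat \<Rightarrow> ('a::euclidean_space \<Rightarrow> 'b::real_normed_vector) \<Rightarrow> 'a set \<Rightarrow> bool" where
  "times_differentiable_on 0 f S \<longleftrightarrow> continuous_on S f"
| "times_differentiable_on (Suc m) f S \<longleftrightarrow>
     (\<forall>x\<in>S. f differentiable (at x)) \<and>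
     (\<forall>v. times_differentiable_on m (\<lambda>x. frechet_derivative f (at x) v) S)"

definition smooth_on_open :: "'a::euclidean_space set \<Rightarrow> ('a \<Rightarrow> 'b::real_normed_vector) \<Rightarrow> bool" where
  "smooth_on_open U f \<longleftrightarrow> open U \<and> (\<forall>m. times_differentiable_on m f U)"

text \<open>Smoothness of a map on an arbitrary subset of a Euclidean space: local smooth extendability.\<close>

definition smooth_map_on :: "'a::euclidean_space set \<Rightarrow> ('a \<Rightarrow> 'b::real_normed_vector) \<Rightarrow> bool" where
  "smooth_map_on S f \<longleftrightarrow>
     (\<forall>x\<in>S. \<exists>U g. x \<in> U \<and> smooth_on_open U g \<and> (\<forall>y\<in>U \<inter> S. g y = f y))"

section \<open>Embedded submanifolds of a Euclidean space\<close>

text \<open>The dimension of a submanifold is \<open>CARD('k)\<close>, where \<open>real^'k\<close> is the parameter space.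
  As index types are nonempty, it is at least 1.\<close>

definition local_parametrization ::
    "'a::euclidean_space set \<Rightarrow> (real^'k) set \<Rightarrow> (real^'k \<Rightarrow> 'a) \<Rightarrow> bool" where
  "local_parametrization M U \<phi> \<longleftrightarrow>
     smooth_on_open U \<phi> \<and>
     (\<forall>u\<in>U. inj (frechet_derivative \<phi> (at u))) \<and>
     openin (top_of_set M) (\<phi> ` U) \<and>
     (\<exists>\<psi>. homeomorphism U (\<phi> ` U) \<phi> \<psi>)"

definition embedded_submanifold :: "'k::finite itself \<Rightarrow> 'a::euclidean_space set \<Rightarrow> bool" where
  "embedded_submanifold K M \<longleftrightarrow>
     (\<forall>x\<in>M. \<exists>U (\<phi> :: real^'k \<Rightarrow> 'a). local_parametrization M U \<phi> \<and> x \<in> \<phi> ` U)"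

text \<open>For submanifolds \<open>X \<subseteq> M\<close> of the Euclidean space, being an embedded submanifold of \<open>M\<close> is the
  same as being one of the Euclidean space.\<close>

definition properly_embedded_submanifold ::
    "'k::finite itself \<Rightarrow> 'a::euclidean_space set \<Rightarrow> 'a set \<Rightarrow> bool" where
  "properly_embedded_submanifold K M X \<longleftrightarrow>
     X \<subseteq> M \<and> closedin (top_of_set M) X \<and> embedded_submanifold K X"

section \<open>Riemannian volume\<close>

text \<open>The density \<open>sqrt (det g)\<close>, with \<open>g\<close> the metric induced from the Euclidean space.\<close>

definition volume_density :: "(real^'k \<Rightarrow> 'a::euclidean_space) \<Rightarrow> real^'k \<Rightarrow> real" where
  "volume_density \<phi> u =
     sqrt (det (\<chi> i j. frechet_derivative \<phi> (at u) (axis i 1) \<bullet> frechet_derivative \<phi> (at u) (axis j 1)))"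

definition is_riemannian_volume ::
    "'k::finite itself \<Rightarrow> 'a::euclidean_space set \<Rightarrow> 'a measure \<Rightarrow> bool" where
  "is_riemannian_volume K M \<mu> \<longleftrightarrow>
     sets \<mu> = sets (restrict_space borel M) \<and>
     (\<forall>U (\<phi> :: real^'k \<Rightarrow> 'a). local_parametrization M U \<phi> \<longrightarrow>
        (\<forall>E\<in>sets borel. E \<subseteq> U \<longrightarrow>
           emeasure \<mu> (\<phi> ` E) = (\<integral>\<^sup>+u\<in>E. ennreal (volume_density \<phi> u) \<partial>lborel)))"

text \<open>On an embedded submanifold such a measure exists by the change of variables formula, and it is
  unique because countably many parametrizations cover \<open>M\<close>.\<close>

definition riemannian_volume :: "'k::finite itself \<Rightarrow> 'a::euclidean_space set \<Rightarrow> 'a measure" where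
  "riemannian_volume K M = (THE \<mu>. is_riemannian_volume K M \<mu>)"

section \<open>Volume-critical submanifolds\<close>

definition smooth_variation ::
    "'a::euclidean_space set \<Rightarrow> 'a set \<Rightarrow> real \<Rightarrow> (real \<Rightarrow> 'a \<Rightarrow> 'a) \<Rightarrow> bool" where
  "smooth_variation M X \<epsilon> F \<longleftrightarrow>
     \<epsilon> > 0 \<and>
     smooth_map_on ({-\<epsilon><..<\<epsilon>} \<times> X) (\<lambda>(s, x). F s x) \<and>
     (\<forall>s\<in>{-\<epsilon><..<\<epsilon>}. \<forall>x\<in>X. F s x \<in> M) \<and>
     (\<forall>x\<in>X. F 0 x = x)"

text \<open>For compact \<open>X\<close>, the maps \<open>F s\<close> of a smooth variation are embeddings for all small \<open>s\<close>, so
  \<open>F s ` X\<close> is then a compact embedded submanifold; only these \<open>s\<close> affect the derivative at \<open>0\<close>.\<close>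

definition volume_critical ::
    "'k::finite itself \<Rightarrow> 'a::euclidean_space set \<Rightarrow> 'a set \<Rightarrow> bool" where
  "volume_critical K M X \<longleftrightarrow>
     (\<forall>\<epsilon> F. smooth_variation M X \<epsilon> F \<longrightarrow>
        ((\<lambda>s. measure (riemannian_volume K (F s ` X)) (F s ` X)) has_real_derivative 0) (at 0))"

section \<open>Geodesic distance and neighbourhoods\<close>

definition curve_length :: "(real \<Rightarrow> 'a::euclidean_space) \<Rightarrow> real" where
  "curve_length \<gamma> = integral {0..1} (\<lambda>s. norm (vector_derivative \<gamma> (at s)))"

text \<open>Meant for connected submanifolds \<open>M\<close>, where any two points are joined by a \<open>C\<^sup>1\<close> curve.\<close>

definition geodesic_dist :: "'a::euclidean_space set \<Rightarrow> 'a \<Rightarrow> 'a \<Rightarrow> real" where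
  "geodesic_dist M x y =
     Inf {curve_length \<gamma> | \<gamma>. \<gamma> C1_differentiable_on {0..1} \<and> \<gamma> ` {0..1} \<subseteq> M \<and> \<gamma> 0 = x \<and> \<gamma> 1 = y}"

definition geodesic_neighbourhood :: "'a::euclidean_space set \<Rightarrow> 'a set \<Rightarrow> real \<Rightarrow> 'a set" where
  "geodesic_neighbourhood M Y t = {p \<in> M. (INF y\<in>Y. geodesic_dist M p y) \<le> t}"

end

theory Submission
  imports Defs
begin

text \<open>
  Geodesic distance on the unit sphere is the angle, so the \<open>t\<close>-neighbourhood of \<open>X\<close> is a superlevel set
  of \<open>m p = max {x \<bullet> p | x \<in> X}\<close>, and the neighbourhood of a great subsphere \<open>T\<close> lies in a superlevel set
  of \<open>v p\<close>, the squared length of the projection of \<open>p\<close> to the linear span of \<open>T\<close>. The theorem says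
  that the distribution of \<open>m\<^sup>2\<close> under the volume of the sphere is stochastically larger than that of
  \<open>v\<close>. Instead of comparing Jacobians of the normal exponential map, which would need
  focal points and cut loci, the proof compares the Laplacians of functions of \<open>m\<^sup>2\<close> and of \<open>v\<close> weakly.

  For a polynomial \<open>\<Theta>\<close> the Laplacian of \<open>\<Theta>(v)\<close> on the sphere is \<open>(L \<Theta>)(v)\<close> with the ordinary
  differential operator \<open>L \<Theta> = 4 v (1 - v) \<Theta>'' + (2 (k + 1) - 2 (n + 1) v) \<Theta>'\<close> (\<open>jacobi_op\<close>), hence
  \<open>(L \<Theta>)(v)\<close> has integral zero (\<open>projection_integral\<close>). If \<open>\<Theta>\<close> is increasing then
  \<open>\<Theta>(m\<^sup>2)\<close> has Laplacian at least \<open>(L \<Theta>)(m\<^sup>2)\<close> in the barrier sense wherever \<open>m > 0\<close> (\<open>barrier\<close>).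
  Criticality enters here: near a maximizer \<open>x\<close> of \<open>y \<bullet> p\<close> one replaces the maximum by the value at a point
  that moves in \<open>X\<close>, and the resulting second derivative involves \<open>X\<close> only through the trace of the
  Hessian of \<open>y \<bullet> p\<close> on \<open>X\<close>; as the mean curvature vanishes, this trace is \<open>-k (x \<bullet> p)\<close>
  (\<open>critical_trace\<close>), the same number as for a great subsphere. The same trace shows \<open>m \<ge> 0\<close>.
  Averaging second differences along rotations, which preserve the volume, turns the pointwise
  inequality into \<open>\<integral> (L \<Theta>)(m\<^sup>2) \<le> 0\<close> (\<open>rotation_inequality\<close>, \<open>jacobi_integral_nonpos\<close>).

  Finally, every polynomial is \<open>L \<Theta>\<close> plus a constant (\<open>jacobi_op_surj\<close>), and if it is decreasing then
  \<open>\<Theta>\<close> is increasing, by a minimum principle for \<open>\<Theta>'\<close> (\<open>jacobi_op_monotone\<close>). So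
  \<open>\<integral> g(m\<^sup>2) \<le> \<integral> g(v)\<close> for every decreasing polynomial \<open>g\<close> (\<open>decreasing_integral_le\<close>), and polynomials
  \<open>(1 - v^M)^N\<close> approximate step functions, which gives the inequality for sublevel sets.

  The vanishing of the mean curvature is derived from the first variation along cut-off rotations
  \<open>x \<mapsto> R(s \<eta>(x)) x\<close> of the sphere. A rotation field is Killing, so only the gradient of \<open>\<eta>\<close> contributes to the first
  variation; by the divergence theorem in a chart, the divergence of the tangential part of the field
  vanishes, and this divergence is the mean curvature in the direction of the field at a point where
  the field is normal to \<open>X\<close>.
\<close>

section \<open>Calculus of smooth maps\<close>

lemma times_differentiable_on_Suc_has_derivative:
  "times_differentiable_on (Suc m) f S \<Longrightarrow> x \<in> S \<Longrightarrow> (f has_derivative frechet_derivative f (at x)) (at x)"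
  using frechet_derivative_works by (metis times_differentiable_on.simps(2))

lemma times_differentiable_on_cong:
  assumes "open S" "\<And>x. x \<in> S \<Longrightarrow> f x = g x" "times_differentiable_on m f S"
  shows "times_differentiable_on m g S"
  using assms(2,3)
proof (induction m arbitrary: f g)
  case 0
  then show ?case using continuous_on_cong[of S S f g] by simp
next
  case (Suc m)
  have g: "(g has_derivative frechet_derivative f (at x)) (at x)" if "x \<in> S" for x
    using has_derivative_transform_within_open[of f _ x UNIV S g] Suc.prems \<open>open S\<close> that
      frechet_derivative_works by fastforce
  then have "frechet_derivative f (at x) v = frechet_derivative g (at x) v" if "x \<in> S" for x v
    using frechet_derivative_at that by metis
  then have "times_differentiable_on m (\<lambda>x. frechet_derivative g (at x) v) S" for v
    using Suc.IH[of "\<lambda>x. frechet_derivative f (at x) v" "\<lambda>x. frechet_derivative g (at x) v"] Suc.prems(2)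
    by simp
  then show ?case
    using g by (auto intro: differentiableI)
qed

lemma times_differentiable_on_Suc_iff:
  assumes "open S" "\<And>x. x \<in> S \<Longrightarrow> (f has_derivative f' x) (at x)"
  shows "times_differentiable_on (Suc m) f S \<longleftrightarrow> (\<forall>v. times_differentiable_on m (\<lambda>x. f' x v) S)"
proof -
  have eq: "f' x v = frechet_derivative f (at x) v" if "x \<in> S" for x v
    using frechet_derivative_at[OF assms(2)[OF that]] by simp
  have "times_differentiable_on m (\<lambda>x. frechet_derivative f (at x) v) S \<longleftrightarrow>
        times_differentiable_on m (\<lambda>x. f' x v) S" for v
    using times_differentiable_on_cong[OF assms(1), of "\<lambda>x. frechet_derivative f (at x) v" "\<lambda>x. f' x v" m]
      times_differentiable_on_cong[OF assms(1), of "\<lambda>x. f' x v" "\<lambda>x. frechet_derivative f (at x) v" m]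
      eq by auto
  then show ?thesis
    using assms(2) by (auto intro: differentiableI)
qed

lemma times_differentiable_on_lower:
  assumes "times_differentiable_on (Suc m) f S"
  shows "times_differentiable_on m f S"
  using assms
proof (induction m arbitrary: f)
  case 0
  then show ?case
    by (simp add: continuous_at_imp_continuous_on differentiable_imp_continuous_within)
next
  case (Suc m)
  then show ?case by (metis times_differentiable_on.simps(2))
qed

lemma times_differentiable_on_const: "open S \<Longrightarrow> times_differentiable_on m (\<lambda>x. c) S"
proof (induction m arbitrary: c)
  case (Suc m)
  then show ?case by (subst times_differentiable_on_Suc_iff[where f' = "\<lambda>_ _. 0"]) auto
qed auto

lemma times_differentiable_on_add:
  assumes "open S" "times_differentiable_on m f S" "times_differentiable_on m g S"
  shows "times_differentiable_on m (\<lambda>x. f x + g x) S"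
  using assms(2,3)
proof (induction m arbitrary: f g)
  case 0
  then show ?case by (simp add: continuous_on_add)
next
  case (Suc m)
  have "((\<lambda>x. f x + g x) has_derivative
      (\<lambda>v. frechet_derivative f (at x) v + frechet_derivative g (at x) v)) (at x)" if "x \<in> S" for x
    using times_differentiable_on_Suc_has_derivative[OF Suc.prems(1) that] times_differentiable_on_Suc_has_derivative[OF Suc.prems(2) that]
    by (rule has_derivative_add)
  then show ?case
    using Suc \<open>open S\<close>
    by (subst times_differentiable_on_Suc_iff) auto
qed

lemma (in bounded_linear) times_differentiable_on:
  assumes "open S" "times_differentiable_on m g S"
  shows "times_differentiable_on m (\<lambda>x. f (g x)) S"
  using assms(2)
proof (induction m arbitrary: g)
  case 0
  then show ?case by (simp add: continuous_on)
next
  case (Suc m)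
  have "((\<lambda>x. f (g x)) has_derivative
      (\<lambda>v. f (frechet_derivative g (at x) v))) (at x)" if "x \<in> S" for x
    using times_differentiable_on_Suc_has_derivative[OF Suc.prems that] by (intro has_derivative)
  then show ?case
    using Suc \<open>open S\<close>
    by (subst times_differentiable_on_Suc_iff) auto
qed

lemma times_differentiable_on_ident: "open S \<Longrightarrow> times_differentiable_on m (\<lambda>x. x) S"
proof (cases m)
  case (Suc m')
  assume "open S"
  then show ?thesis unfolding Suc
    by (subst times_differentiable_on_Suc_iff[where f' = "\<lambda>_ v. v"]) (auto simp: times_differentiable_on_const)
qed auto

lemma (in bounded_bilinear) times_differentiable_on:
  assumes "open S" "times_differentiable_on m f S" "times_differentiable_on m g S"
  shows "times_differentiable_on m (\<lambda>x. prod (f x) (g x)) S"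
  using assms(2,3)
proof (induction m arbitrary: f g)
  case 0
  then show ?case by (simp add: continuous_on)
next
  case (Suc m)
  have "((\<lambda>x. prod (f x) (g x)) has_derivative
      (\<lambda>v. prod (f x) (frechet_derivative g (at x) v) + prod (frechet_derivative f (at x) v) (g x))) (at x)"
    if "x \<in> S" for x
    using times_differentiable_on_Suc_has_derivative[OF Suc.prems(1) that] times_differentiable_on_Suc_has_derivative[OF Suc.prems(2) that]
    by (rule FDERIV)
  moreover have "times_differentiable_on m f S" "times_differentiable_on m g S"
    using Suc.prems times_differentiable_on_lower by blast+
  ultimately show ?case
    using Suc \<open>open S\<close>
    by (subst times_differentiable_on_Suc_iff) (auto intro!: times_differentiable_on_add)
qed

lemma times_differentiable_on_sum:
  assumes "open S" "\<And>i. i \<in> I \<Longrightarrow> times_differentiable_on m (f i) S"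
  shows "times_differentiable_on m (\<lambda>x. \<Sum>i\<in>I. f i x) S"
proof (cases "finite I")
  case True
  then show ?thesis using assms(2)
    by (induction I rule: finite_induct)
      (auto simp: times_differentiable_on_const times_differentiable_on_add assms(1))
qed (simp add: times_differentiable_on_const assms(1))

lemma times_differentiable_on_compose:
  fixes f :: "'b::euclidean_space \<Rightarrow> 'c::real_normed_vector" and g :: "'a::euclidean_space \<Rightarrow> 'b"
  assumes "open S" "open T" "g ` S \<subseteq> T"
    and "times_differentiable_on m f T" "times_differentiable_on m g S"
  shows "times_differentiable_on m (\<lambda>x. f (g x)) S"
  using assms(4,5)
proof (induction m arbitrary: f)
  case 0
  then show ?case using assms(3) continuous_on_compose2 by (metis times_differentiable_on.simps(1))
next
  case (Suc m)
  let ?f' = "\<lambda>y. frechet_derivative f (at y)" and ?g' = "\<lambda>x. frechet_derivative g (at x)"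
  have "((\<lambda>x. f (g x)) has_derivative (\<lambda>v. \<Sum>b\<in>Basis. (?g' x v \<bullet> b) *\<^sub>R ?f' (g x) b)) (at x)"
    if "x \<in> S" for x
  proof -
    have g: "(g has_derivative ?g' x) (at x)" and f: "(f has_derivative ?f' (g x)) (at (g x))"
      using Suc.prems that assms(3) times_differentiable_on_Suc_has_derivative by blast+
    have "linear (?f' (g x))"
      using f has_derivative_linear by blast
    have eq: "?f' (g x) y = (\<Sum>b\<in>Basis. (y \<bullet> b) *\<^sub>R ?f' (g x) b)" for y
    proof -
      have "?f' (g x) y = ?f' (g x) (\<Sum>b\<in>Basis. (y \<bullet> b) *\<^sub>R b)"
        by (simp only: euclidean_representation)
      also have "\<dots> = (\<Sum>b\<in>Basis. ?f' (g x) ((y \<bullet> b) *\<^sub>R b))"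
        by (rule linear_sum[OF \<open>linear (?f' (g x))\<close>])
      finally show ?thesis by (simp only: linear_scale[OF \<open>linear (?f' (g x))\<close>])
    qed
    have "?f' (g x) \<circ> ?g' x = (\<lambda>v. \<Sum>b\<in>Basis. (?g' x v \<bullet> b) *\<^sub>R ?f' (g x) b)"
      unfolding o_def by (intro ext eq)
    with diff_chain_at[OF g f] show ?thesis by (simp only: o_def)
  qed
  moreover have "times_differentiable_on m (\<lambda>x. (?g' x v \<bullet> b) *\<^sub>R ?f' (g x) b) S" for v b
  proof -
    have "times_differentiable_on m g S" using Suc.prems times_differentiable_on_lower by blast
    then have "times_differentiable_on m (\<lambda>x. ?f' (g x) b) S"
      using Suc.IH[of "\<lambda>y. ?f' y b"] Suc.prems(1) by simp
    moreover have "times_differentiable_on m (\<lambda>x. ?g' x v \<bullet> b) S"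
      using Suc.prems bounded_linear.times_differentiable_on[OF bounded_linear_inner_left \<open>open S\<close>]
      by (metis times_differentiable_on.simps(2))
    ultimately show ?thesis
      by (intro bounded_bilinear.times_differentiable_on[OF bounded_bilinear_scaleR] \<open>open S\<close>)
  qed
  ultimately show ?case
    using \<open>open S\<close>
    by (subst times_differentiable_on_Suc_iff) (auto intro!: times_differentiable_on_sum)
qed

lemma times_differentiable_on_subset:
  "times_differentiable_on m f S \<Longrightarrow> T \<subseteq> S \<Longrightarrow> times_differentiable_on m f T"
  by (induction m arbitrary: f) (auto intro: continuous_on_subset)

lemma smooth_on_open_subset: "smooth_on_open S f \<Longrightarrow> open T \<Longrightarrow> T \<subseteq> S \<Longrightarrow> smooth_on_open T f"
  unfolding smooth_on_open_def using times_differentiable_on_subset by blast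

lemma smooth_on_open_const: "open S \<Longrightarrow> smooth_on_open S (\<lambda>x. c)"
  by (simp add: smooth_on_open_def times_differentiable_on_const)

lemma smooth_on_open_ident: "open S \<Longrightarrow> smooth_on_open S (\<lambda>x. x)"
  by (simp add: smooth_on_open_def times_differentiable_on_ident)

lemma smooth_on_open_linear: "bounded_linear h \<Longrightarrow> smooth_on_open S g \<Longrightarrow> smooth_on_open S (\<lambda>x. h (g x))"
  using bounded_linear.times_differentiable_on unfolding smooth_on_open_def by blast

lemma smooth_on_open_add:
  "smooth_on_open S f \<Longrightarrow> smooth_on_open S g \<Longrightarrow> smooth_on_open S (\<lambda>x. f x + g x)"
  by (simp add: smooth_on_open_def times_differentiable_on_add)

lemma smooth_on_open_bilinear:
  "bounded_bilinear h \<Longrightarrow> smooth_on_open S f \<Longrightarrow> smooth_on_open S g \<Longrightarrow> smooth_on_open S (\<lambda>x. h (f x) (g x))"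
  using bounded_bilinear.times_differentiable_on unfolding smooth_on_open_def by blast

lemmas smooth_on_open_scaleR = smooth_on_open_bilinear[OF bounded_bilinear_scaleR]
  and smooth_on_open_inner = smooth_on_open_bilinear[OF bounded_bilinear_inner]
  and smooth_on_open_mult = smooth_on_open_bilinear[OF bounded_bilinear_mult]

lemma smooth_on_open_diff:
  "smooth_on_open S f \<Longrightarrow> smooth_on_open S g \<Longrightarrow> smooth_on_open S (\<lambda>x. f x - g x)"
  using smooth_on_open_add[OF _ smooth_on_open_linear[OF bounded_linear_minus[OF bounded_linear_ident]], of S f g]
  by simp

lemma smooth_on_open_compose:
  "smooth_on_open T f \<Longrightarrow> smooth_on_open S g \<Longrightarrow> g ` S \<subseteq> T \<Longrightarrow> smooth_on_open S (\<lambda>x. f (g x))"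
  using times_differentiable_on_compose unfolding smooth_on_open_def by blast

lemma smooth_on_open_derivative_chain:
  fixes h :: "nat \<Rightarrow> real \<Rightarrow> real"
  assumes "open T" "\<And>j y. y \<in> T \<Longrightarrow> (h j has_real_derivative h (Suc j) y) (at y)"
  shows "smooth_on_open T (h j)"
proof -
  have "times_differentiable_on m (h j) T" for m
  proof (induction m arbitrary: j)
    case 0
    then show ?case using assms(2)
      by (auto intro!: continuous_at_imp_continuous_on DERIV_isCont)
  next
    case (Suc m)
    have "(h j has_derivative (\<lambda>v. h (Suc j) y * v)) (at y)" if "y \<in> T" for y
      using assms(2)[OF that] by (simp add: has_field_derivative_def)
    then show ?case
      using Suc assms(1) times_differentiable_on_const
      by (subst times_differentiable_on_Suc_iff)
        (auto intro!: bounded_linear.times_differentiable_on[OF bounded_linear_mult_left])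
  qed
  then show ?thesis using assms(1) by (simp add: smooth_on_open_def)
qed

lemma smooth_on_open_sin: "smooth_on_open UNIV (sin :: real \<Rightarrow> real)"
proof -
  have "smooth_on_open UNIV (\<lambda>y. sin (y + real 0 * (pi/2)))"
    by (rule smooth_on_open_derivative_chain[where h = "\<lambda>j y. sin (y + real j * (pi/2))"])
      (auto intro!: derivative_eq_intros simp: algebra_simps sin_add cos_add add_divide_distrib)
  then show ?thesis by simp
qed

lemma smooth_on_open_cos: "smooth_on_open UNIV (cos :: real \<Rightarrow> real)"
proof -
  have "smooth_on_open UNIV (\<lambda>y. cos (y + real 0 * (pi/2)))"
    by (rule smooth_on_open_derivative_chain[where h = "\<lambda>j y. cos (y + real j * (pi/2))"])
      (auto intro!: derivative_eq_intros simp: algebra_simps sin_add cos_add add_divide_distrib)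
  then show ?thesis by simp
qed

lemma smooth_on_open_sqrt: "smooth_on_open {0<..} sqrt"
proof -
  have "smooth_on_open {0<..} ((\<lambda>j y. (\<Prod>i<j. (1/2 - real i)) * y powr (1/2 - real j)) 0)"
    by (rule smooth_on_open_derivative_chain)
      (auto intro!: derivative_eq_intros simp: algebra_simps)
  then have "smooth_on_open {0<..} (\<lambda>y::real. y powr (1/2))" by simp
  then show ?thesis
    unfolding smooth_on_open_def
    using times_differentiable_on_cong[of "{0<..}" "\<lambda>y::real. y powr (1/2)" sqrt]
    by (auto simp: powr_half_sqrt)
qed

text \<open>The standard smooth function vanishing exactly at the nonpositive numbers; \<open>flat_bump (c - \<tau>)\<close>
  cuts off to the region where \<open>c > \<tau>\<close>.\<close>

definition flat_bump :: "real \<Rightarrow> real" where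
  "flat_bump x = (if x > 0 then exp (- 1 / x) else 0)"

lemma tendsto_poly_exp: "((\<lambda>x. poly p x * exp (- x)) \<longlongrightarrow> (0::real)) at_top"
proof (induction p)
  case 0
  then show ?case by simp
next
  case (pCons a p)
  have "((\<lambda>x. a * exp (-x) + x * (poly p x * exp (-x))) \<longlongrightarrow> 0) at_top"
  proof -
    have *: "((\<lambda>x::real. x * (poly p x * exp (-x))) \<longlongrightarrow> 0) at_top"
    proof -
      have eq: "x * (poly p x * exp (-x)) = (\<Sum>i\<le>degree p. coeff p i * (x ^ (Suc i) / exp x))" for x :: real
        by (simp add: poly_altdef sum_distrib_left sum_distrib_right exp_minus field_simps)
      have "((\<lambda>x::real. coeff p i * (x ^ (Suc i) / exp x)) \<longlongrightarrow> coeff p i * 0) at_top" for i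
        by (intro tendsto_mult tendsto_const tendsto_power_div_exp_0)
      then have "((\<lambda>x::real. (\<Sum>i\<le>degree p. coeff p i * (x ^ (Suc i) / exp x))) \<longlongrightarrow> (\<Sum>i\<le>degree p. 0)) at_top"
        by (intro tendsto_sum) auto
      then show ?thesis unfolding eq by simp
    qed
    have "((\<lambda>x::real. exp (-x)) \<longlongrightarrow> 0) at_top"
      using filterlim_compose[OF exp_at_bot filterlim_uminus_at_bot_at_top] by simp
    then have "((\<lambda>x::real. a * exp (-x)) \<longlongrightarrow> 0) at_top"
      by (rule tendsto_mult_right_zero)
    from tendsto_add[OF this *] show ?thesis by simp
  qed
  then show ?case by (simp add: algebra_simps)
qed

text \<open>All derivatives of \<open>flat_bump\<close> on the positive half-line are \<open>poly q (1 / x) * exp (- 1 / x)\<close>, and the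
  exponential beats every polynomial at \<open>0\<close>; so the class of these functions, continued by \<open>0\<close>, is closed under differentiation.\<close>

lemma smooth_on_open_flat_bump: "smooth_on_open UNIV flat_bump"
proof -
  define P :: "nat \<Rightarrow> real poly" where "P = rec_nat 1 (\<lambda>_ p. [:0,0,1:] * (p - pderiv p))"
  define h where "h j x = (if x > 0 then poly (P j) (1/x) * exp (- (1/x)) else 0)" for j and x :: real
  have [simp]: "P 0 = 1" "P (Suc j) = [:0,0,1:] * (P j - pderiv (P j))" for j
    by (simp_all add: P_def)
  have der: "(h j has_real_derivative h (Suc j) x) (at x)" for j x
  proof -
    consider "x > 0" | "x < 0" | "x = 0" by linarith
    then show ?thesis
    proof cases
      case 1
      have "((\<lambda>x. poly (P j) (1/x) * exp (- (1/x))) has_real_derivative h (Suc j) x) (at x)"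
        using 1 unfolding h_def
        by (auto intro!: derivative_eq_intros simp: field_simps power2_eq_square)
      moreover have "eventually (\<lambda>y. y > 0) (nhds x)"
        using 1 eventually_nhds_in_open[of "{0<..}" x] by simp
      ultimately show ?thesis
        by (subst DERIV_cong_ev[where g = "\<lambda>x. poly (P j) (1/x) * exp (- (1/x))"])
          (auto elim!: eventually_mono simp: h_def)
    next
      case 2
      have "eventually (\<lambda>y. y < 0) (nhds x)"
        using 2 eventually_nhds_in_open[of "{..<0}" x] by simp
      then have "eventually (\<lambda>y. h j y = 0) (nhds x)"
        by (auto elim!: eventually_mono simp: h_def)
      then show ?thesis
        using 2 by (subst DERIV_cong_ev[where g = "\<lambda>x. 0"]) (auto simp: h_def)
    next
      case 3
      have "((\<lambda>y. h j y / y) \<longlongrightarrow> 0) (at_right 0)"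
      proof -
        have "((\<lambda>x. poly ([:0,1:] * P j) x * exp (- x)) \<longlongrightarrow> 0) at_top"
          by (rule tendsto_poly_exp)
        from filterlim_compose[OF this filterlim_inverse_at_top_right]
        have "((\<lambda>y. poly ([:0,1:] * P j) (inverse y) * exp (- inverse y)) \<longlongrightarrow> 0) (at_right 0)" .
        moreover have "eventually (\<lambda>y. poly ([:0,1:] * P j) (inverse y) * exp (- inverse y) = h j y / y) (at_right 0)"
          by (auto simp: eventually_at_filter h_def field_simps)
        ultimately show ?thesis by (rule Lim_transform_eventually)
      qed
      moreover have "((\<lambda>y. h j y / y) \<longlongrightarrow> 0) (at_left 0)"
      proof -
        have "eventually (\<lambda>y. h j y / y = 0) (at_left (0::real))"
          by (auto simp: eventually_at_filter h_def)
        then show ?thesis by (rule tendsto_eventually)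
      qed
      ultimately have "((\<lambda>y. h j y / y) \<longlongrightarrow> 0) (at 0)"
        using filterlim_split_at by blast
      then show ?thesis
        unfolding 3 has_field_derivative_iff by (simp add: h_def)
    qed
  qed
  have "smooth_on_open UNIV (h 0)"
    by (rule smooth_on_open_derivative_chain) (use der in auto)
  moreover have "h 0 = flat_bump" by (auto simp: h_def flat_bump_def)
  ultimately show ?thesis by simp
qed

lemma smooth_on_open_continuous_on: "smooth_on_open S f \<Longrightarrow> continuous_on S f"
  unfolding smooth_on_open_def using times_differentiable_on.simps(1) by blast

lemma smooth_on_open_has_derivative:
  "smooth_on_open S f \<Longrightarrow> x \<in> S \<Longrightarrow> (f has_derivative frechet_derivative f (at x)) (at x)"
  unfolding smooth_on_open_def using times_differentiable_on.simps(2) frechet_derivative_works by blast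

lemma smooth_on_open_frechet_derivative:
  "smooth_on_open S f \<Longrightarrow> smooth_on_open S (\<lambda>x. frechet_derivative f (at x) v)"
  unfolding smooth_on_open_def using times_differentiable_on.simps(2) by blast

section \<open>Change of variables\<close>

text \<open>The change of variables theorem is stated for index types in the class \<open>wellorder\<close>. A copy of
  an arbitrary finite type, ordered by an enumeration, transfers it to all finite index types.\<close>

typedef 'k wo = "UNIV :: 'k set" morphisms un_wo mk_wo by simp

lemma un_wo_mk_wo [simp]: "un_wo (mk_wo i) = i"
  by (simp add: mk_wo_inverse)

lemma mk_wo_un_wo [simp]: "mk_wo (un_wo i) = i"
  by (rule un_wo_inverse)

lemma bij_un_wo: "bij (un_wo :: 'k wo \<Rightarrow> 'k)"
  by (rule o_bij[of mk_wo]) (auto simp: fun_eq_iff)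

instance wo :: (finite) finite
proof
  show "finite (UNIV :: 'a wo set)"
    by (rule inj_on_finite[of un_wo _ UNIV]) (auto simp: inj_on_def un_wo_inject)
qed

definition wo_rank :: "'k::finite wo \<Rightarrow> nat" where
  "wo_rank i = (SOME f :: 'k \<Rightarrow> nat. inj f) (un_wo i)"

lemma inj_wo_rank: "inj (wo_rank :: 'k::finite wo \<Rightarrow> nat)"
proof -
  have "\<exists>f :: 'k \<Rightarrow> nat. inj f"
    using finite_imp_inj_to_nat_seg[of "UNIV :: 'k set"] by auto
  then have *: "inj (SOME f :: 'k \<Rightarrow> nat. inj f)" by (rule someI_ex[where P = inj])
  show ?thesis unfolding wo_rank_def by (rule injI) (auto dest: injD[OF *] simp: un_wo_inject)
qed

instantiation wo :: (finite) wellorder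
begin

definition less_eq_wo :: "'a wo \<Rightarrow> 'a wo \<Rightarrow> bool" where
  "less_eq_wo i j \<longleftrightarrow> wo_rank i \<le> wo_rank j"

definition less_wo :: "'a wo \<Rightarrow> 'a wo \<Rightarrow> bool" where
  "less_wo i j \<longleftrightarrow> wo_rank i < wo_rank j"

instance
proof
  fix P :: "'a wo \<Rightarrow> bool" and a
  assume *: "\<And>x. (\<And>y. y < x \<Longrightarrow> P y) \<Longrightarrow> P x"
  show "P a"
    by (induction a rule: measure_induct_rule[of wo_rank]) (rule *, simp add: less_wo_def)
qed (auto simp: less_eq_wo_def less_wo_def intro: injD[OF inj_wo_rank])

end

lemma det_reindex:
  fixes A :: "'c::comm_ring_1^'k::finite^'k" and f :: "'m::finite \<Rightarrow> 'k"
  assumes "bij f"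
  shows "det (\<chi> i j. A $ f i $ f j) = det A"
proof -
  have inj: "inj f" and f: "bij_betw f UNIV UNIV" using assms bij_def by auto
  have inv[simp]: "inv f (f i) = i" "f (inv f k) = k" for i k
    using assms by (auto simp: bij_is_inj bij_is_surj surj_f_inv_f)
  have mp: "map_permutation UNIV f p = f \<circ> p \<circ> inv f" if "p permutes UNIV" for p
    using assms by (auto simp: map_permutation_def restrict_id_def bij_is_surj)
  have bij: "bij_betw (map_permutation UNIV f) {p. p permutes UNIV} {p. p permutes UNIV}"
  proof (rule bij_betw_byWitness[where f' = "\<lambda>q. inv f \<circ> q \<circ> f"])
    show "\<forall>p\<in>{p. p permutes UNIV}. inv f \<circ> map_permutation UNIV f p \<circ> f = p"
      by (auto simp: mp fun_eq_iff)
    show "map_permutation UNIV f ` {p. p permutes UNIV} \<subseteq> {p. p permutes UNIV}"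
      using map_permutation_permutes[OF f] by auto
    show *: "(\<lambda>q. inv f \<circ> q \<circ> f) ` {p. p permutes UNIV} \<subseteq> {p. p permutes UNIV}"
      using assms by (auto intro!: bij_imp_permutes bij_comp bij_imp_bij_inv dest: permutes_bij)
    then show "\<forall>q\<in>{p. p permutes UNIV}. map_permutation UNIV f (inv f \<circ> q \<circ> f) = q"
      by (auto simp: image_subset_iff mp fun_eq_iff)
  qed
  have "det A = (\<Sum>p | p permutes (UNIV::'m set). of_int (sign (map_permutation UNIV f p)) *
      (\<Prod>i\<in>UNIV. A $ i $ map_permutation UNIV f p i))"
    unfolding det_def by (rule sum.reindex_bij_betw[OF bij, symmetric])
  also have "\<dots> = (\<Sum>p | p permutes (UNIV::'m set). of_int (sign p) * (\<Prod>i\<in>UNIV. A $ f i $ f (p i)))"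
  proof (intro sum.cong refl arg_cong2[where f = "(*)"])
    fix p :: "'m \<Rightarrow> 'm" assume p: "p \<in> {p. p permutes UNIV}"
    show "of_int (sign (map_permutation UNIV f p)) = (of_int (sign p) :: 'c)"
      using sign_map_permutation[OF inj, of p] p by simp
    show "(\<Prod>i\<in>UNIV. A $ i $ map_permutation UNIV f p i) = (\<Prod>i\<in>UNIV. A $ f i $ f (p i))"
      using p by (subst prod.reindex_bij_betw[OF f, symmetric]) (simp add: mp)
  qed
  finally show ?thesis by (simp add: det_def)
qed

definition to_wo :: "real^'k::finite \<Rightarrow> real^'k wo" where "to_wo x = (\<chi> i. x $ un_wo i)"
definition from_wo :: "real^'k::finite wo \<Rightarrow> real^'k" where "from_wo x = (\<chi> i. x $ mk_wo i)"

lemma to_from_wo [simp]: "to_wo (from_wo x) = x" "from_wo (to_wo y) = y"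
  by (simp_all add: to_wo_def from_wo_def vec_eq_iff)

lemma linear_to_wo: "linear to_wo" and linear_from_wo: "linear from_wo"
  by (auto intro!: linearI simp: to_wo_def from_wo_def vec_eq_iff)

lemma prod_Basis_vec: "(\<Prod>b\<in>(Basis :: (real^'k) set). h b) = (\<Prod>i\<in>UNIV. h (axis i 1))"
proof -
  have "Basis = range (\<lambda>i::'k. axis i (1::real))"
    by (auto simp: Basis_vec_def)
  moreover have "inj (\<lambda>i::'k. axis i (1::real))" by (auto simp: inj_def axis_eq_axis)
  note prod.reindex[OF this, of h]
  ultimately show ?thesis by (simp only: o_def)
qed

lemma continuous_on_linear_compose:
  fixes f :: "'a::euclidean_space \<Rightarrow> 'b::euclidean_space"
  shows "linear f \<Longrightarrow> continuous_on S f"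
  by (simp add: linear_continuous_on linear_linear)

lemma borel_measurable_linear:
  fixes f :: "'a::euclidean_space \<Rightarrow> 'b::euclidean_space"
  shows "linear f \<Longrightarrow> f \<in> borel_measurable borel"
  by (intro borel_measurable_continuous_onI continuous_on_linear_compose)

lemma distr_to_wo: "distr lborel borel (to_wo :: real^'k::finite \<Rightarrow> _) = lborel"
proof (rule lborel_eqI[symmetric])
  fix l u :: "real^'k wo"
  assume lu: "\<And>b. b \<in> Basis \<Longrightarrow> l \<bullet> b \<le> u \<bullet> b"
  have le: "l $ i \<le> u $ i" for i
    using lu[of "axis i 1"] by (simp add: axis_in_Basis_iff inner_axis)
  have vim: "to_wo -` box l u = box (from_wo l) (from_wo u)"
    by (auto simp: mem_box_cart to_wo_def from_wo_def) (metis un_wo_mk_wo mk_wo_un_wo)+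
  have "emeasure (distr lborel borel to_wo) (box l u) = emeasure lborel (box (from_wo l) (from_wo u))"
    by (subst emeasure_distr) (auto simp: vim borel_measurable_linear linear_to_wo)
  also have "\<dots> = ennreal (\<Prod>b\<in>Basis. (from_wo u - from_wo l) \<bullet> b)"
    using le by (intro emeasure_lborel_box) (auto simp: Basis_vec_def inner_axis from_wo_def)
  also have "(\<Prod>b\<in>Basis. (from_wo u - from_wo l) \<bullet> b) = (\<Prod>i\<in>UNIV. (from_wo u - from_wo l) $ i)"
    by (simp add: prod_Basis_vec inner_axis)
  also have "\<dots> = (\<Prod>i\<in>UNIV. (u - l) $ i)"
    by (subst prod.reindex_bij_betw[OF bij_un_wo[unfolded bij_betw_def[symmetric]], symmetric])
      (simp add: from_wo_def)
  also have "\<dots> = (\<Prod>b\<in>Basis. (u - l) \<bullet> b)"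
    by (simp add: prod_Basis_vec inner_axis)
  finally show "emeasure (distr lborel borel to_wo) (box l u) = ennreal (\<Prod>b\<in>Basis. (u - l) \<bullet> b)" .
qed simp

lemma emeasure_to_wo: "E \<in> sets borel \<Longrightarrow> emeasure lborel (to_wo ` E) = emeasure lborel E"
proof -
  assume E: "E \<in> sets borel"
  have *: "to_wo ` E = from_wo -` E" 
    by (auto simp: image_iff) (metis to_from_wo(1))
  have "from_wo -` E \<in> sets borel"
    using measurable_sets[OF borel_measurable_linear[OF linear_from_wo] E] by simp
  moreover have "to_wo -` (from_wo -` E) = E" by auto
  ultimately show ?thesis
    unfolding * by (subst distr_to_wo[symmetric]) (auto simp: emeasure_distr borel_measurable_linear linear_to_wo)
qed

text \<open>The Henstock-Kurzweil change of variables formula needs finite measure in advance; the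
  infinite case follows because finiteness of either side forces that of the other.\<close>

lemma emeasure_differentiable_image_wellorder:
  fixes \<tau> :: "real^'m::{finite,wellorder} \<Rightarrow> real^'m::_"
  assumes E: "E \<in> sets borel" and der: "\<And>w. w \<in> E \<Longrightarrow> (\<tau> has_derivative D w) (at w within E)"
    and inj: "inj_on \<tau> E" and img: "\<tau> ` E \<in> sets borel"
    and meas: "(\<lambda>w. indicator E w * \<bar>det (matrix (D w))\<bar>) \<in> borel_measurable borel"
  shows "emeasure lborel (\<tau> ` E) = (\<integral>\<^sup>+w. ennreal (indicator E w * \<bar>det (matrix (D w))\<bar>) \<partial>lborel)"
proof -
  let ?g = "\<lambda>w. indicator E w * \<bar>det (matrix (D w))\<bar>"
  have cov: "\<tau> ` E \<in> lmeasurable \<and> measure lebesgue (\<tau> ` E) = m \<longleftrightarrow> (?g has_integral m) UNIV" for m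
  proof -
    have "(?g has_integral m) UNIV \<longleftrightarrow> ((\<lambda>x. if x \<in> E then \<bar>det (matrix (D x))\<bar> else 0) has_integral m) UNIV"
      by (intro has_integral_cong) auto
    also have "\<dots> \<longleftrightarrow> ((\<lambda>x. \<bar>det (matrix (D x))\<bar>) has_integral m) E"
      by (rule has_integral_restrict_UNIV)
    finally show ?thesis
      using has_measure_differentiable_image[OF _ der inj, of m] E by auto
  qed
  have eml: "emeasure lborel (\<tau> ` E) = emeasure lebesgue (\<tau> ` E)"
    using img by simp
  show ?thesis
  proof (cases "\<tau> ` E \<in> lmeasurable")
    case True
    then have int: "(?g has_integral measure lebesgue (\<tau> ` E)) UNIV"
      using cov by blast
    have "(\<integral>\<^sup>+w. ennreal (?g w) \<partial>lborel) = measure lebesgue (\<tau> ` E)"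
      by (rule nn_integral_has_integral_lborel[OF _ _ int]) (use meas in auto)
    then show ?thesis
      using eml True by (simp add: emeasure_eq_measure2)
  next
    case False
    have "(\<integral>\<^sup>+w. ennreal (?g w) \<partial>lborel) = \<infinity>"
    proof (rule ccontr)
      assume "(\<integral>\<^sup>+w. ennreal (?g w) \<partial>lborel) \<noteq> \<infinity>"
      then have "integrable lborel ?g"
        using meas by (intro integrableI_nonneg) (auto simp: top.not_eq_extremum)
      then have "(?g has_integral integral\<^sup>L lborel ?g) UNIV"
        by (rule has_integral_integral_lborel)
      then show False using cov False by blast
    qed
    moreover have "\<not> emeasure lebesgue (\<tau> ` E) < \<infinity>"
      using False img fmeasurableI[of "\<tau> ` E" lebesgue] by auto
    then have "emeasure lborel (\<tau> ` E) = \<infinity>"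
      unfolding eml by (simp add: not_less top_unique)
    ultimately show ?thesis by simp
  qed
qed

lemma emeasure_differentiable_image:
  fixes \<tau> :: "real^'k::finite \<Rightarrow> real^'k"
  assumes E: "E \<in> sets borel" and der: "\<And>w. w \<in> E \<Longrightarrow> (\<tau> has_derivative D w) (at w)"
    and inj: "inj_on \<tau> E" and img: "\<tau> ` E \<in> sets borel"
    and meas: "(\<lambda>w. indicator E w * \<bar>det (matrix (D w))\<bar>) \<in> borel_measurable borel"
  shows "emeasure lborel (\<tau> ` E) = (\<integral>\<^sup>+w. ennreal (indicator E w * \<bar>det (matrix (D w))\<bar>) \<partial>lborel)"
proof -
  let ?E = "to_wo ` E" and ?t = "to_wo \<circ> \<tau> \<circ> from_wo" and ?D = "\<lambda>w. to_wo \<circ> D (from_wo w) \<circ> from_wo"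
  have bl: "bounded_linear (to_wo :: real^'k \<Rightarrow> _)" "bounded_linear (from_wo :: _ \<Rightarrow> real^'k)"
    using linear_to_wo linear_from_wo linear_linear by blast+
  have E': "?E = from_wo -` E"
    by (auto simp: image_iff) (metis to_from_wo(1))
  have img': "?t ` ?E = to_wo ` (\<tau> ` E)" by (auto simp: image_iff)
  have vim: "F \<in> sets borel \<Longrightarrow> to_wo ` F \<in> sets borel" for F :: "(real^'k) set"
  proof -
    assume F: "F \<in> sets borel"
    have "to_wo ` F = from_wo -` F"
      by (auto simp: image_iff) (metis to_from_wo(1))
    then show ?thesis using measurable_sets[OF borel_measurable_linear[OF linear_from_wo] F] by simp
  qed
  have dets: "det (matrix (?D w)) = det (matrix (D (from_wo w)))" if "w \<in> ?E" for w
  proof -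
    have ax: "from_wo (axis j 1) = axis (un_wo j) (1::real)" for j
      by (auto simp: from_wo_def vec_eq_iff axis_def)
    have "matrix (?D w) = (\<chi> i j. matrix (D (from_wo w)) $ un_wo i $ un_wo j)"
      by (simp add: matrix_def ax to_wo_def)
    then show ?thesis using det_reindex[OF bij_un_wo] by metis
  qed
  have ind: "indicator ?E w = (indicator E (from_wo w) :: real)" for w
    unfolding E' by (auto simp: indicator_def)
  have g: "indicator ?E w * \<bar>det (matrix (?D w))\<bar> = indicator E (from_wo w) * \<bar>det (matrix (D (from_wo w)))\<bar>" for w
  proof (cases "w \<in> ?E")
    case True then show ?thesis by (simp only: ind dets)
  next
    case False then show ?thesis by (simp add: ind[symmetric])
  qed
  have "emeasure lborel (\<tau> ` E) = emeasure lborel (?t ` ?E)"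
    unfolding img' using emeasure_to_wo[OF img] by simp
  also have "\<dots> = (\<integral>\<^sup>+w. ennreal (indicator ?E w * \<bar>det (matrix (?D w))\<bar>) \<partial>lborel)"
  proof (rule emeasure_differentiable_image_wellorder)
    show "?E \<in> sets borel" "?t ` ?E \<in> sets borel" unfolding img' using vim E img by auto
    show "inj_on ?t ?E" using inj by (auto simp: inj_on_def) (metis to_from_wo(2))
    show "(?t has_derivative ?D w) (at w within ?E)" if "w \<in> ?E" for w
    proof (rule has_derivative_at_withinI)
      have "(\<tau> has_derivative D (from_wo w)) (at (from_wo w))" using der that by auto
      from has_derivative_compose[OF bounded_linear_imp_has_derivative[OF bl(2)] this]
      have "((\<lambda>x. \<tau> (from_wo x)) has_derivative (\<lambda>x. D (from_wo w) (from_wo x))) (at w)" .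
      from bounded_linear.has_derivative[OF bl(1) this]
      show "(?t has_derivative ?D w) (at w)" by (simp add: o_def)
    qed
    show "(\<lambda>w. indicator ?E w * \<bar>det (matrix (?D w))\<bar>) \<in> borel_measurable borel"
      unfolding g using measurable_compose[OF borel_measurable_linear[OF linear_from_wo] meas] .
  qed
  also have "\<dots> = (\<integral>\<^sup>+w. ennreal (indicator E (from_wo w) * \<bar>det (matrix (D (from_wo w)))\<bar>) \<partial>distr lborel borel to_wo)"
    unfolding g distr_to_wo ..
  also have "\<dots> = (\<integral>\<^sup>+w. ennreal (indicator E w * \<bar>det (matrix (D w))\<bar>) \<partial>lborel)"
    using meas measurable_compose[OF borel_measurable_linear[OF linear_from_wo] meas]
    by (subst nn_integral_distr) (auto simp: borel_measurable_linear linear_to_wo)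
  finally show ?thesis .
qed

text \<open>The image of \<open>lborel\<close> with density the Jacobian determinant agrees with \<open>lborel\<close> on sets, so
  nonnegative functions integrate alike.\<close>

lemma nn_integral_differentiable_image:
  fixes \<tau> :: "real^'k::finite \<Rightarrow> real^'k"
  assumes W: "open W" and E: "E \<in> sets borel" "E \<subseteq> W"
    and der: "\<And>w. w \<in> W \<Longrightarrow> (\<tau> has_derivative D w) (at w)"
    and inj: "inj_on \<tau> W" and img: "\<And>F. F \<in> sets borel \<Longrightarrow> F \<subseteq> W \<Longrightarrow> \<tau> ` F \<in> sets borel"
    and meas: "(\<lambda>w. indicator W w * \<bar>det (matrix (D w))\<bar>) \<in> borel_measurable borel"
    and h: "h \<in> borel_measurable borel"
  shows "(\<integral>\<^sup>+u. h u * indicator (\<tau> ` E) u \<partial>lborel)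
       = (\<integral>\<^sup>+w. ennreal \<bar>det (matrix (D w))\<bar> * h (\<tau> w) * indicator E w \<partial>lborel)"
proof -
  define t where "t w = (if w \<in> W then \<tau> w else 0)" for w
  have contt: "continuous_on W \<tau>"
    using der has_derivative_continuous continuous_at_imp_continuous_on by blast
  have t [measurable]: "t \<in> borel_measurable borel"
  proof -
    have "(\<lambda>w. if w \<in> W then \<tau> w else 0) \<in> borel_measurable borel"
      using W contt by (intro borel_measurable_continuous_on_if) auto
    then show ?thesis unfolding t_def .
  qed
  note [measurable] = meas E(1) h
  define d where "d w = ennreal (indicator E w * \<bar>det (matrix (D w))\<bar>)" for w
  have measE: "(\<lambda>w. indicator F w * \<bar>det (matrix (D w))\<bar>) \<in> borel_measurable borel"
    if "F \<in> sets borel" "F \<subseteq> W" for F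
  proof -
    have "(\<lambda>w. indicator F w * \<bar>det (matrix (D w))\<bar>) = (\<lambda>w. indicator F w * (indicator W w * \<bar>det (matrix (D w))\<bar>))"
      using that by (auto simp: indicator_def fun_eq_iff)
    then show ?thesis using meas that by simp
  qed
  have d [measurable]: "d \<in> borel_measurable borel"
    using measE[OF E] unfolding d_def by measurable
  have imgE [measurable]: "\<tau> ` E \<in> sets borel" using img E by blast
  have eq: "distr (density lborel d) borel t = density lborel (indicator (\<tau> ` E))"
  proof (rule measure_eqI)
    fix C assume "C \<in> sets (distr (density lborel d) borel t)"
    then have C [measurable]: "C \<in> sets borel" by simp
    let ?F = "t -` C \<inter> E"
    have F: "?F \<in> sets borel" "?F \<subseteq> W"
      using measurable_sets[OF t C] E by auto
    have img_eq: "\<tau> ` ?F = \<tau> ` E \<inter> C" using E by (auto simp: t_def)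
    have "emeasure (distr (density lborel d) borel t) C = (\<integral>\<^sup>+w. d w * indicator (t -` C) w \<partial>lborel)"
      using measurable_sets[OF t C] by (simp add: emeasure_distr emeasure_density)
    also have "\<dots> = (\<integral>\<^sup>+w. ennreal (indicator ?F w * \<bar>det (matrix (D w))\<bar>) \<partial>lborel)"
      by (intro nn_integral_cong) (auto simp: d_def indicator_def)
    also have "\<dots> = emeasure lborel (\<tau> ` ?F)"
      using F by (intro emeasure_differentiable_image[symmetric])
        (auto intro: der img measE inj_on_subset[OF inj])
    also have "\<dots> = emeasure (density lborel (indicator (\<tau> ` E))) C"
    proof -
      have "emeasure (density lborel (indicator (\<tau> ` E))) C = (\<integral>\<^sup>+u. indicator (\<tau> ` E) u * indicator C u \<partial>lborel)"
        by (subst emeasure_density) auto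
      also have "\<dots> = (\<integral>\<^sup>+u. indicator (\<tau> ` E \<inter> C) u \<partial>lborel)"
        by (simp only: indicator_inter_arith)
      also have "\<dots> = emeasure lborel (\<tau> ` E \<inter> C)"
        by (rule nn_integral_indicator) simp
      finally show ?thesis unfolding img_eq ..
    qed
    finally show "emeasure (distr (density lborel d) borel t) C = emeasure (density lborel (indicator (\<tau> ` E))) C" .
  qed simp
  have "(\<integral>\<^sup>+u. h u * indicator (\<tau> ` E) u \<partial>lborel) = (\<integral>\<^sup>+u. h u \<partial>density lborel (indicator (\<tau> ` E)))"
    by (subst nn_integral_density) (auto intro!: nn_integral_cong simp: mult.commute)
  also have "\<dots> = (\<integral>\<^sup>+w. d w * h (t w) \<partial>lborel)"
    unfolding eq[symmetric] by (subst nn_integral_distr) (auto simp: nn_integral_density)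
  also have "\<dots> = (\<integral>\<^sup>+w. ennreal \<bar>det (matrix (D w))\<bar> * h (\<tau> w) * indicator E w \<partial>lborel)"
    using E by (intro nn_integral_cong) (auto simp: d_def t_def indicator_def)
  finally show ?thesis .
qed

section \<open>Gram determinants\<close>

text \<open>The matrix of the pulled-back inner product; its determinant is the squared volume density.\<close>

definition gram :: "(real^'k::finite \<Rightarrow> 'a::euclidean_space) \<Rightarrow> real^'k^'k" where
  "gram L = (\<chi> i j. L (axis i 1) \<bullet> L (axis j 1))"

lemma volume_density_gram: "volume_density \<phi> u = sqrt (det (gram (frechet_derivative \<phi> (at u))))"
  by (simp add: volume_density_def gram_def)

lemma linear_axis_expansion:
  fixes L :: "real^'k::finite \<Rightarrow> 'a::real_vector"
  assumes "linear L"
  shows "L x = (\<Sum>a\<in>UNIV. (x $ a) *\<^sub>R L (axis a 1))"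
proof -
  have "L x = L (\<Sum>a\<in>UNIV. (x $ a) *\<^sub>R axis a 1)"
    using basis_expansion[of x] by (simp add: scalar_mult_eq_scaleR)
  also have "\<dots> = (\<Sum>a\<in>UNIV. (x $ a) *\<^sub>R L (axis a 1))"
    by (simp add: linear_sum[OF assms] linear_scale[OF assms])
  finally show ?thesis .
qed

lemma gram_compose:
  fixes L :: "real^'k::finite \<Rightarrow> 'a::euclidean_space" and A :: "real^'m::finite \<Rightarrow> real^'k"
  assumes "linear L"
  shows "gram (L \<circ> A) = transpose (matrix A) ** gram L ** matrix A"
proof -
  have "(L \<circ> A) (axis i 1) \<bullet> (L \<circ> A) (axis j 1) =
      (\<Sum>b\<in>UNIV. (\<Sum>a\<in>UNIV. A (axis i 1) $ a * (L (axis a 1) \<bullet> L (axis b 1))) * A (axis j 1) $ b)" for i j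
    unfolding o_def
    apply (subst linear_axis_expansion[OF assms, of "A (axis i 1)"])
    apply (subst linear_axis_expansion[OF assms, of "A (axis j 1)"])
    apply (simp add: inner_sum_left inner_sum_right sum_distrib_right mult_ac)
    done
  then show ?thesis
    by (simp add: gram_def matrix_def matrix_matrix_mult_def transpose_def vec_eq_iff)
qed

text \<open>This cancels the Jacobian of a change of charts, and makes the volume density well defined.\<close>

lemma det_gram_compose:
  fixes L :: "real^'k::finite \<Rightarrow> 'a::euclidean_space" and A :: "real^'k \<Rightarrow> real^'k"
  assumes "linear L"
  shows "det (gram (L \<circ> A)) = (det (matrix A))\<^sup>2 * det (gram L)"
  by (simp add: gram_compose[OF assms] det_mul det_transpose power2_eq_square)

lemma gram_isometry:
  assumes "\<And>x y. f (L x) \<bullet> f (L y) = L x \<bullet> L y"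
  shows "gram (\<lambda>x. f (L x)) = gram L"
  using assms by (simp add: gram_def)

lemma norm_preserving_inner:
  fixes f :: "'a::real_inner \<Rightarrow> 'b::real_inner"
  assumes "linear f" "subspace S" "\<And>x. x \<in> S \<Longrightarrow> norm (f x) = norm x" "x \<in> S" "y \<in> S"
  shows "f x \<bullet> f y = x \<bullet> y"
proof -
  have "norm (f x + f y) = norm (x + y)"
    using assms subspace_add[OF assms(2,4,5)] by (simp add: linear_add[OF assms(1), symmetric])
  then have "(f x + f y) \<bullet> (f x + f y) = (x + y) \<bullet> (x + y)"
    by (simp add: norm_eq_sqrt_inner)
  moreover have "f x \<bullet> f x = x \<bullet> x" "f y \<bullet> f y = y \<bullet> y"
    using assms(3)[OF assms(4)] assms(3)[OF assms(5)] by (simp_all add: norm_eq_sqrt_inner)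
  ultimately show ?thesis by (simp add: inner_add_left inner_add_right inner_commute)
qed

lemma det_gram_pos:
  fixes L :: "real^'k::finite \<Rightarrow> 'a::euclidean_space"
  assumes L: "linear L" "inj L"
  shows "det (gram L) > 0"
proof -
  have sub: "subspace (range L)" using L(1) by (simp add: linear_subspace_image)
  have "dim (range L) = dim (UNIV :: (real^'k) set)"
    using L by (intro dim_image_eq) auto
  then obtain f g where f: "linear f" "f ` range L = (UNIV :: (real^'k) set)"
      "\<And>x. x \<in> range L \<Longrightarrow> norm (f x) = norm x" "\<And>x. x \<in> range L \<Longrightarrow> g (f x) = x"
    using isometries_subspaces[OF sub subspace_UNIV] by metis
  have "gram (\<lambda>x. f (L x)) = gram L"
    by (intro gram_isometry norm_preserving_inner[OF f(1) sub f(3)]) auto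
  moreover have "det (gram ((\<lambda>x. x) \<circ> (\<lambda>x. f (L x)))) = (det (matrix (\<lambda>x. f (L x))))\<^sup>2 * det (gram (\<lambda>x::real^'k. x))"
    by (rule det_gram_compose) (rule linear_ident)
  moreover have "gram (\<lambda>x::real^'k. x) = mat 1"
    by (auto simp: gram_def mat_def vec_eq_iff inner_axis_axis)
  moreover have "inj (\<lambda>x. f (L x))"
    using f(4) L(2) by (intro injI) (metis injD rangeI)
  then have "det (matrix (\<lambda>x. f (L x))) \<noteq> 0"
    using det_nz_iff_inj[of "\<lambda>x. f (L x)"] linear_compose[OF L(1) f(1)] by (simp add: o_def)
  ultimately show ?thesis by (simp add: o_def)
qed

lemma continuous_on_det:
  fixes A :: "'x::topological_space \<Rightarrow> real^'k::finite^'k"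
  assumes "\<And>i j. continuous_on S (\<lambda>x. A x $ i $ j)"
  shows "continuous_on S (\<lambda>x. det (A x))"
  unfolding det_def by (intro continuous_intros assms)

lemma continuous_on_gram:
  fixes L :: "'x::topological_space \<Rightarrow> real^'k::finite \<Rightarrow> 'a::euclidean_space"
  assumes "\<And>v. continuous_on S (\<lambda>x. L x v)"
  shows "continuous_on S (\<lambda>x. det (gram (L x)))"
  by (rule continuous_on_det) (auto simp: gram_def intro!: continuous_intros assms)

lemma continuous_on_volume_density:
  assumes "smooth_on_open U \<phi>"
  shows "continuous_on U (volume_density \<phi>)"
  unfolding volume_density_gram
  by (intro continuous_intros continuous_on_gram smooth_on_open_continuous_on
      smooth_on_open_frechet_derivative assms)

lemma local_parametrization_open: "local_parametrization M U \<phi> \<Longrightarrow> open U"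
  by (simp add: local_parametrization_def smooth_on_open_def)

lemma local_parametrization_has_derivative:
  "local_parametrization M U \<phi> \<Longrightarrow> u \<in> U \<Longrightarrow> (\<phi> has_derivative frechet_derivative \<phi> (at u)) (at u)"
  unfolding local_parametrization_def using smooth_on_open_has_derivative by blast

lemma local_parametrization_linear:
  "local_parametrization M U \<phi> \<Longrightarrow> u \<in> U \<Longrightarrow> linear (frechet_derivative \<phi> (at u))"
  using local_parametrization_has_derivative has_derivative_linear by blast

lemma volume_density_pos:
  "local_parametrization M U \<phi> \<Longrightarrow> u \<in> U \<Longrightarrow> volume_density \<phi> u > 0"
  unfolding volume_density_gram real_sqrt_gt_0_iff
  by (intro det_gram_pos local_parametrization_linear) (auto simp: local_parametrization_def)

lemma continuous_on_preimage_borel: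
  fixes g :: "'a::euclidean_space \<Rightarrow> 'b::euclidean_space"
  assumes "continuous_on W g" "W \<in> sets borel" "F \<in> sets borel"
  shows "{u \<in> W. g u \<in> F} \<in> sets borel"
proof -
  have m: "g \<in> measurable (restrict_space borel W) borel"
    by (rule borel_measurable_continuous_on_restrict[OF assms(1)])
  have "g -` F \<inter> space (restrict_space borel W) \<in> sets (restrict_space borel W)"
    using measurable_sets[OF m assms(3)] .
  moreover have "g -` F \<inter> space (restrict_space borel W) = {u \<in> W. g u \<in> F}"
    by (auto simp: space_restrict_space)
  ultimately show ?thesis using assms(2) by (auto simp: sets_restrict_space)
qed

section \<open>Transition maps\<close>

text \<open>As \<open>f\<close> is the identity to first order at \<open>\<tau> w\<close>, the increments of \<open>\<tau>\<close> and of \<open>f \<circ> \<tau>\<close> agree to first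
  order; this is the part of the inverse function theorem that transition maps need.\<close>

lemma has_derivative_lift:
  fixes f :: "'b::euclidean_space \<Rightarrow> 'b" and \<tau> :: "'c::euclidean_space \<Rightarrow> 'b"
  assumes f: "(f has_derivative (\<lambda>x. x)) (at (\<tau> w))"
    and h: "((\<lambda>w. f (\<tau> w)) has_derivative h') (at w)" and c: "isCont \<tau> w"
  shows "(\<tau> has_derivative h') (at w)"
  unfolding has_derivative_at_alt
proof (intro conjI allI impI)
  show bl: "bounded_linear h'" using h by (rule has_derivative_bounded_linear)
  fix e :: real assume e: "e > 0"
  obtain B where B: "B > 0" "\<And>v. norm (h' v) \<le> norm v * B"
    using bounded_linear.pos_bounded[OF bl] by blast
  define e1 where "e1 = min (1/2) (e / (4 * (1 + B)))"
  define e2 where "e2 = min 1 (e / 2)"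
  have e12: "e1 > 0" "e2 > 0" "e1 \<le> 1/2" "e2 \<le> 1" "e2 \<le> e/2"
    using e B unfolding e1_def e2_def by (simp_all only: min.cobounded1 min.cobounded2) auto
  have "e1 \<le> e / (4 * (1 + B))" by (simp add: e1_def)
  then have e1': "e1 * (2 * (1 + B)) \<le> e / 2"
    using B by (simp add: field_simps)
  obtain d1 where d1: "d1 > 0"
    "\<And>u. norm (u - \<tau> w) < d1 \<Longrightarrow> norm (f u - f (\<tau> w) - (u - \<tau> w)) \<le> e1 * norm (u - \<tau> w)"
    using f e12 unfolding has_derivative_at_alt by meson
  obtain d2 where d2: "d2 > 0"
    "\<And>y. norm (y - w) < d2 \<Longrightarrow> norm (f (\<tau> y) - f (\<tau> w) - h' (y - w)) \<le> e2 * norm (y - w)"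
    using h e12 unfolding has_derivative_at_alt by meson
  obtain d3 where d3: "d3 > 0" "\<And>y. dist y w < d3 \<Longrightarrow> dist (\<tau> y) (\<tau> w) < d1"
    using c d1(1) unfolding continuous_at_eps_delta by meson
  show "\<exists>d>0. \<forall>y. norm (y - w) < d \<longrightarrow> norm (\<tau> y - \<tau> w - h' (y - w)) \<le> e * norm (y - w)"
  proof (intro exI[of _ "min d2 d3"] conjI allI impI)
    fix y assume y: "norm (y - w) < min d2 d3"
    let ?\<delta> = "norm (y - w)" and ?y = "norm (\<tau> y - \<tau> w)" and ?z = "norm (\<tau> y - \<tau> w - h' (y - w))"
    have 1: "norm (f (\<tau> y) - f (\<tau> w) - (\<tau> y - \<tau> w)) \<le> e1 * ?y"
      using d1(2)[of "\<tau> y"] d3(2)[of y] y by (simp add: dist_norm)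
    have 2: "norm (f (\<tau> y) - f (\<tau> w) - h' (y - w)) \<le> e2 * ?\<delta>"
      using d2(2)[of y] y by simp
    have z: "?z \<le> e1 * ?y + e2 * ?\<delta>"
    proof -
      have "\<tau> y - \<tau> w - h' (y - w)
          = (f (\<tau> y) - f (\<tau> w) - h' (y - w)) - (f (\<tau> y) - f (\<tau> w) - (\<tau> y - \<tau> w))"
        by (simp add: algebra_simps)
      then have "?z \<le> norm (f (\<tau> y) - f (\<tau> w) - h' (y - w)) + norm (f (\<tau> y) - f (\<tau> w) - (\<tau> y - \<tau> w))"
        by (simp only: norm_triangle_ineq4)
      with 1 2 show ?thesis by linarith
    qed
    have "?y \<le> ?z + norm (h' (y - w))"
      using norm_triangle_ineq[of "\<tau> y - \<tau> w - h' (y - w)" "h' (y - w)"] by simp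
    also have "\<dots> \<le> ?z + ?\<delta> * B" using B(2) by simp
    also have "\<dots> \<le> (1/2) * ?y + 1 * ?\<delta> + ?\<delta> * B"
    proof -
      have "e1 * ?y \<le> (1/2) * ?y" "e2 * ?\<delta> \<le> 1 * ?\<delta>"
        by (intro mult_right_mono; use e12 in simp)+
      with z show ?thesis by linarith
    qed
    finally have y2: "?y \<le> 2 * (1 + B) * ?\<delta>" by (simp add: algebra_simps)
    have "e1 * ?y \<le> e1 * (2 * (1 + B) * ?\<delta>)" using y2 e12 by (intro mult_left_mono) auto
    also have "\<dots> = (e1 * (2 * (1 + B))) * ?\<delta>" by simp
    also have "\<dots> \<le> (e/2) * ?\<delta>" using e1' by (intro mult_right_mono) auto
    finally have "e1 * ?y \<le> (e/2) * ?\<delta>" .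
    moreover have "e2 * ?\<delta> \<le> (e/2) * ?\<delta>" using e12 by (intro mult_right_mono) auto
    ultimately show "?z \<le> e * ?\<delta>" using z by (simp add: field_simps)
  qed (use d2 d3 in auto)
qed

lemma overlap_open:
  assumes "local_parametrization M U \<phi>" "local_parametrization M V \<psi>"
  shows "open {w \<in> V. \<psi> w \<in> \<phi> ` U}"
proof -
  obtain O' where O': "open O'" "\<phi> ` U = M \<inter> O'"
    using assms(1) unfolding local_parametrization_def openin_open by blast
  have "\<psi> ` V \<subseteq> M" using assms(2) unfolding local_parametrization_def
    using openin_imp_subset by blast
  then have "{w \<in> V. \<psi> w \<in> \<phi> ` U} = V \<inter> \<psi> -` O'" using O' by auto
  moreover have "continuous_on V \<psi>" "open V"
    using assms(2) smooth_on_open_continuous_on local_parametrization_open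
    unfolding local_parametrization_def by blast+
  ultimately show ?thesis using O'(1) by (simp add: continuous_open_preimage)
qed

text \<open>Composing \<open>\<phi>\<close> with a linear left inverse of its derivative gives a map of \<open>real^'k\<close> to itself with
  derivative the identity, to which \<open>has_derivative_lift\<close> applies.\<close>

lemma transition_map:
  fixes \<phi> \<psi> :: "real^'k::finite \<Rightarrow> 'a::euclidean_space"
  assumes P: "local_parametrization M U \<phi>" and Q: "local_parametrization M V \<psi>"
    and hom: "homeomorphism U (\<phi> ` U) \<phi> \<phi>i"
  defines "W \<equiv> {w \<in> V. \<psi> w \<in> \<phi> ` U}"
  assumes w: "w \<in> W"
  shows "\<exists>D. ((\<lambda>w. \<phi>i (\<psi> w)) has_derivative D) (at w) \<and>
    frechet_derivative \<psi> (at w) = frechet_derivative \<phi> (at (\<phi>i (\<psi> w))) \<circ> D"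
proof -
  let ?\<tau> = "\<lambda>w. \<phi>i (\<psi> w)"
  let ?L = "frechet_derivative \<phi> (at (?\<tau> w))"
  have "open W" unfolding W_def by (rule overlap_open[OF P Q])
  have tau: "?\<tau> y \<in> U" "\<phi> (?\<tau> y) = \<psi> y" if "y \<in> W" for y
    using hom that unfolding W_def homeomorphism_def by auto
  have "continuous_on W ?\<tau>"
  proof (rule continuous_on_compose2[of "\<phi> ` U" \<phi>i])
    show "continuous_on (\<phi> ` U) \<phi>i" using hom by (simp add: homeomorphism_def)
    show "continuous_on W \<psi>"
      using Q smooth_on_open_continuous_on continuous_on_subset unfolding local_parametrization_def W_def
      by (metis (no_types, lifting) mem_Collect_eq subsetI)
  qed (auto simp: W_def)
  then have cont: "isCont ?\<tau> w" using \<open>open W\<close> w continuous_on_eq_continuous_at by blast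
  have L: "(\<phi> has_derivative ?L) (at (?\<tau> w))" "linear ?L" "inj ?L"
    using local_parametrization_has_derivative[OF P] local_parametrization_linear[OF P] tau(1)[OF w] P
    by (auto simp: local_parametrization_def)
  obtain L' where L': "linear L'" "L' \<circ> ?L = id"
    using linear_injective_left_inverse[OF L(2,3)] by blast
  have bl: "bounded_linear L'" using L'(1) linear_linear by blast
  have psi: "(\<psi> has_derivative frechet_derivative \<psi> (at w)) (at w)"
    using local_parametrization_has_derivative[OF Q] w W_def by blast
  have "((\<lambda>w. L' (\<psi> w)) has_derivative (\<lambda>v. L' (frechet_derivative \<psi> (at w) v))) (at w)"
    by (rule bounded_linear.has_derivative[OF bl psi])
  then have h: "((\<lambda>w. L' (\<phi> (?\<tau> w))) has_derivative (\<lambda>v. L' (frechet_derivative \<psi> (at w) v))) (at w)"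
    by (rule has_derivative_transform_within_open[OF _ \<open>open W\<close> w]) (simp add: tau)
  have f: "((\<lambda>u. L' (\<phi> u)) has_derivative (\<lambda>x. x)) (at (?\<tau> w))"
  proof -
    have "(\<lambda>x. L' (?L x)) = (\<lambda>x. x)" using L'(2) by (auto simp: fun_eq_iff)
    with bounded_linear.has_derivative[OF bl L(1)] show ?thesis by simp
  qed
  define D where "D = (\<lambda>v. L' (frechet_derivative \<psi> (at w) v))"
  have D: "(?\<tau> has_derivative D) (at w)"
    unfolding D_def by (rule has_derivative_lift[OF f h cont])
  have "(\<phi> \<circ> ?\<tau> has_derivative ?L \<circ> D) (at w)"
    by (rule diff_chain_at[OF D L(1)])
  then have "(\<psi> has_derivative ?L \<circ> D) (at w)"
    by (rule has_derivative_transform_within_open[OF _ \<open>open W\<close> w]) (simp add: tau)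
  then have "frechet_derivative \<psi> (at w) = ?L \<circ> D"
    by (rule frechet_derivative_at[symmetric])
  with D show ?thesis by blast
qed

text \<open>Change of variables along the transition map, combined with the transformation rule of the Gram
  determinant.\<close>

lemma transition_nn_integral:
  fixes \<phi> \<psi> :: "real^'k::finite \<Rightarrow> 'a::euclidean_space"
  assumes P: "local_parametrization M U \<phi>" and Q: "local_parametrization M V \<psi>"
    and E: "E \<in> sets borel" "E \<subseteq> V" "\<psi> ` E \<subseteq> \<phi> ` U"
  shows "(\<integral>\<^sup>+u. ennreal (volume_density \<phi> u) * indicator {u \<in> U. \<phi> u \<in> \<psi> ` E} u \<partial>lborel)
       = (\<integral>\<^sup>+w. ennreal (volume_density \<psi> w) * indicator E w \<partial>lborel)"
proof -
  obtain \<phi>i where hom: "homeomorphism U (\<phi> ` U) \<phi> \<phi>i"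
    using P by (auto simp: local_parametrization_def)
  obtain \<psi>i where hom': "homeomorphism V (\<psi> ` V) \<psi> \<psi>i"
    using Q by (auto simp: local_parametrization_def)
  define \<tau> where "\<tau> w = \<phi>i (\<psi> w)" for w
  define W where "W = {w \<in> V. \<psi> w \<in> \<phi> ` U}"
  have W: "open W" unfolding W_def by (rule overlap_open[OF P Q])
  have tau: "\<tau> y \<in> U" "\<phi> (\<tau> y) = \<psi> y" if "y \<in> W" for y
    using hom that unfolding W_def \<tau>_def homeomorphism_def by auto
  have "\<exists>D. \<forall>w\<in>W. (\<tau> has_derivative D w) (at w) \<and>
    frechet_derivative \<psi> (at w) = frechet_derivative \<phi> (at (\<tau> w)) \<circ> D w"
    using transition_map[OF P Q hom] unfolding \<tau>_def W_def by (intro bchoice) blast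
  then obtain D where D: "\<And>w. w \<in> W \<Longrightarrow> (\<tau> has_derivative D w) (at w)"
    "\<And>w. w \<in> W \<Longrightarrow> frechet_derivative \<psi> (at w) = frechet_derivative \<phi> (at (\<tau> w)) \<circ> D w" by blast
  have dens: "volume_density \<psi> w = \<bar>det (matrix (D w))\<bar> * volume_density \<phi> (\<tau> w)" if "w \<in> W" for w
    unfolding volume_density_gram D(2)[OF that]
    by (simp add: det_gram_compose local_parametrization_linear[OF P tau(1)[OF that]] real_sqrt_mult)
  have pos: "volume_density \<phi> (\<tau> w) > 0" if "w \<in> W" for w
    using volume_density_pos[OF P] tau(1) that by blast
  have contt: "continuous_on W \<tau>"
    using D(1) has_derivative_continuous continuous_at_imp_continuous_on by blast
  have cont\<phi>: "continuous_on U (volume_density \<phi>)" "continuous_on V (volume_density \<psi>)"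
    using P Q continuous_on_volume_density unfolding local_parametrization_def by blast+
  have inj: "inj_on \<tau> W"
  proof (rule inj_onI)
    fix x y assume "x \<in> W" "y \<in> W" "\<tau> x = \<tau> y"
    then have "\<psi> x = \<psi> y" using tau(2) by metis
    then show "x = y" using hom' \<open>x \<in> W\<close> \<open>y \<in> W\<close> unfolding W_def homeomorphism_def by (metis (lifting) mem_Collect_eq)
  qed
  have EW: "E \<subseteq> W" using E by (auto simp: W_def)
  have "(\<integral>\<^sup>+u. (indicator U u * ennreal (volume_density \<phi> u)) * indicator (\<tau> ` E) u \<partial>lborel)
       = (\<integral>\<^sup>+w. ennreal \<bar>det (matrix (D w))\<bar> * (indicator U (\<tau> w) * ennreal (volume_density \<phi> (\<tau> w))) * indicator E w \<partial>lborel)"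
  proof (rule nn_integral_differentiable_image[OF W E(1) EW D(1) inj])
    fix F :: "(real^'k) set" assume F: "F \<in> sets borel" "F \<subseteq> W"
    let ?W' = "{u \<in> U. \<phi> u \<in> \<psi> ` V}"
    have "open ?W'" by (rule overlap_open[OF Q P])
    have "continuous_on ?W' (\<lambda>u. \<psi>i (\<phi> u))"
    proof (rule continuous_on_compose2[of "\<psi> ` V" \<psi>i])
      show "continuous_on (\<psi> ` V) \<psi>i" using hom' by (simp add: homeomorphism_def)
      show "continuous_on ?W' \<phi>"
        using P smooth_on_open_continuous_on continuous_on_subset unfolding local_parametrization_def
        by (metis (no_types, lifting) mem_Collect_eq subsetI)
    qed auto
    from continuous_on_preimage_borel[OF this _ F(1)]
    have "{u \<in> ?W'. \<psi>i (\<phi> u) \<in> F} \<in> sets borel" using \<open>open ?W'\<close> by auto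
    moreover have "\<tau> ` F = {u \<in> ?W'. \<psi>i (\<phi> u) \<in> F}"
    proof safe
      fix w assume "w \<in> F"
      then have "w \<in> W" using F by blast
      then have "w \<in> V" by (simp add: W_def)
      show "\<tau> w \<in> U" using tau(1) \<open>w \<in> W\<close> .
      show "\<phi> (\<tau> w) \<in> \<psi> ` V" using tau(2)[OF \<open>w \<in> W\<close>] \<open>w \<in> V\<close> by simp
      show "\<psi>i (\<phi> (\<tau> w)) \<in> F" using tau(2)[OF \<open>w \<in> W\<close>] \<open>w \<in> V\<close> hom' \<open>w \<in> F\<close> by (simp add: homeomorphism_def)
    next
      fix u v assume u: "u \<in> U" "\<phi> u = \<psi> v" "v \<in> V" "\<psi>i (\<phi> u) \<in> F"
      then have "v \<in> F" using hom' by (simp add: homeomorphism_def)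
      moreover have "\<tau> v = u" unfolding \<tau>_def using u hom by (metis homeomorphism_def)
      ultimately show "u \<in> \<tau> ` F" by blast
    qed
    ultimately show "\<tau> ` F \<in> sets borel" by simp
  next
    have "continuous_on W (\<lambda>w. volume_density \<psi> w / volume_density \<phi> (\<tau> w))"
      using pos tau by (intro continuous_on_divide continuous_on_subset[OF cont\<phi>(2)]
          continuous_on_compose2[OF cont\<phi>(1) contt]) (auto simp: W_def less_imp_neq[symmetric] dest: less_imp_neq)
    then have "(\<lambda>w. indicator W w *\<^sub>R (volume_density \<psi> w / volume_density \<phi> (\<tau> w))) \<in> borel_measurable borel"
      using W by (intro borel_measurable_continuous_on_indicator) auto
    moreover have "indicator W w *\<^sub>R (volume_density \<psi> w / volume_density \<phi> (\<tau> w)) = indicator W w * \<bar>det (matrix (D w))\<bar>" for w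
      using dens[of w] pos[of w] by (cases "w \<in> W") auto
    ultimately show "(\<lambda>w. indicator W w * \<bar>det (matrix (D w))\<bar>) \<in> borel_measurable borel" by simp
    have "(\<lambda>u. ennreal (indicator U u *\<^sub>R volume_density \<phi> u)) \<in> borel_measurable borel"
      using local_parametrization_open[OF P] cont\<phi>(1)
      by (intro measurable_compose[OF _ measurable_ennreal] borel_measurable_continuous_on_indicator) auto
    moreover have "ennreal (indicator U u *\<^sub>R volume_density \<phi> u) = indicator U u * ennreal (volume_density \<phi> u)" for u
      by (auto simp: indicator_def)
    ultimately show "(\<lambda>u. indicator U u * ennreal (volume_density \<phi> u)) \<in> borel_measurable borel" by simp
  qed
  moreover have "\<tau> ` E = {u \<in> U. \<phi> u \<in> \<psi> ` E}"
  proof safe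
    fix w assume "w \<in> E"
    then have "w \<in> W" using EW by blast
    show "\<tau> w \<in> U" "\<phi> (\<tau> w) \<in> \<psi> ` E" using tau[OF \<open>w \<in> W\<close>] \<open>w \<in> E\<close> by auto
  next
    fix u v assume "u \<in> U" "\<phi> u = \<psi> v" "v \<in> E"
    moreover then have "\<tau> v = u" unfolding \<tau>_def using hom by (metis homeomorphism_def)
    ultimately show "u \<in> \<tau> ` E" by blast
  qed
  moreover have "(\<integral>\<^sup>+u. (indicator U u * ennreal (volume_density \<phi> u)) * indicator {u \<in> U. \<phi> u \<in> \<psi> ` E} u \<partial>lborel)
      = (\<integral>\<^sup>+u. ennreal (volume_density \<phi> u) * indicator {u \<in> U. \<phi> u \<in> \<psi> ` E} u \<partial>lborel)"
    by (intro nn_integral_cong) (auto simp: indicator_def)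
  moreover have "(\<integral>\<^sup>+w. ennreal \<bar>det (matrix (D w))\<bar> * (indicator U (\<tau> w) * ennreal (volume_density \<phi> (\<tau> w))) * indicator E w \<partial>lborel)
      = (\<integral>\<^sup>+w. ennreal (volume_density \<psi> w) * indicator E w \<partial>lborel)"
    using EW tau by (intro nn_integral_cong) (auto simp: indicator_def dens subset_iff ennreal_mult' )
  ultimately show ?thesis by simp
qed

section \<open>Existence and uniqueness of the Riemannian volume\<close>

definition countable_atlas ::
    "'a::euclidean_space set \<Rightarrow> (nat \<Rightarrow> real^'k::finite \<Rightarrow> 'a) \<Rightarrow> (nat \<Rightarrow> (real^'k) set) \<Rightarrow> bool" where
  "countable_atlas M \<phi> U \<longleftrightarrow> (\<forall>i. local_parametrization M (U i) (\<phi> i)) \<and> M = (\<Union>i. \<phi> i ` U i)"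

text \<open>The part of chart \<open>i\<close> that earlier charts miss: the images of these pieces are disjoint and cover \<open>M\<close>.\<close>

definition chart_piece :: "(nat \<Rightarrow> real^'k::finite \<Rightarrow> 'a) \<Rightarrow> (nat \<Rightarrow> (real^'k) set) \<Rightarrow> nat \<Rightarrow> (real^'k) set" where
  "chart_piece \<phi> U i = {u \<in> U i. \<forall>j<i. \<phi> i u \<notin> \<phi> j ` U j}"

definition atlas_volume ::
    "(nat \<Rightarrow> real^'k::finite \<Rightarrow> 'a::euclidean_space) \<Rightarrow> (nat \<Rightarrow> (real^'k) set) \<Rightarrow> 'a set \<Rightarrow> ennreal" where
  "atlas_volume \<phi> U A = (\<Sum>i. \<integral>\<^sup>+u. ennreal (volume_density (\<phi> i) u) *
     indicator {u \<in> chart_piece \<phi> U i. \<phi> i u \<in> A} u \<partial>lborel)"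

text \<open>A subset of a Euclidean space is a Lindeloef space.\<close>

lemma countable_atlas_exists:
  assumes "embedded_submanifold TYPE('k::finite) M" "M \<noteq> {}"
  obtains \<phi> :: "nat \<Rightarrow> real^'k \<Rightarrow> 'a::euclidean_space" and U where "countable_atlas M \<phi> U"
proof -
  let ?P = "\<lambda>p. local_parametrization M (fst p) (snd p :: real^'k \<Rightarrow> 'a)"
  let ?F = "(\<lambda>p. snd p ` fst p) ` {p. ?P p}"
  have "openin (top_of_set M) S" if "S \<in> ?F" for S
    using that by (auto simp: local_parametrization_def)
  then obtain F' where F': "F' \<subseteq> ?F" "countable F'" "\<Union>F' = \<Union>?F"
    using Lindelof_openin[of ?F M] by blast
  have "\<Union>?F = M"
  proof
    show "\<Union>?F \<subseteq> M" using openin_imp_subset \<open>\<And>S. S \<in> ?F \<Longrightarrow> openin (top_of_set M) S\<close> by blast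
    show "M \<subseteq> \<Union>?F"
    proof
      fix x assume "x \<in> M"
      then obtain V and \<psi> :: "real^'k \<Rightarrow> 'a" where "local_parametrization M V \<psi>" "x \<in> \<psi> ` V"
        using assms(1) unfolding embedded_submanifold_def by blast
      then show "x \<in> \<Union>?F" by (intro UnionI[of "\<psi> ` V"] image_eqI[of _ _ "(V, \<psi>)"]) auto
    qed
  qed
  then have ne: "F' \<noteq> {}" using F' assms(2) by auto
  have "\<forall>i. \<exists>p. ?P p \<and> snd p ` fst p = from_nat_into F' i"
    using from_nat_into[OF ne] F'(1) by (metis (mono_tags, lifting) imageE mem_Collect_eq subsetD)
  then obtain p where p: "\<And>i. ?P (p i)" "\<And>i. snd (p i) ` fst (p i) = from_nat_into F' i"
    by metis
  have "M = (\<Union>i. snd (p i) ` fst (p i))"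
    using \<open>\<Union>?F = M\<close> F'(3) range_from_nat_into[OF ne F'(2)] p(2) by auto
  then have "countable_atlas M (\<lambda>i. snd (p i)) (\<lambda>i. fst (p i))"
    using p(1) by (simp add: countable_atlas_def)
  then show ?thesis by (rule that)
qed

lemma local_parametrization_continuous_on:
  "local_parametrization M U \<phi> \<Longrightarrow> E \<subseteq> U \<Longrightarrow> continuous_on E \<phi>"
  unfolding local_parametrization_def
  by (auto intro: continuous_on_subset[OF smooth_on_open_continuous_on])

lemma local_parametrization_density_continuous_on:
  "local_parametrization M U \<phi> \<Longrightarrow> E \<subseteq> U \<Longrightarrow> continuous_on E (volume_density \<phi>)"
  unfolding local_parametrization_def
  by (auto intro: continuous_on_subset[OF continuous_on_volume_density])

lemma local_parametrization_image_subset: "local_parametrization M U \<phi> \<Longrightarrow> \<phi> ` U \<subseteq> M"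
  unfolding local_parametrization_def by (auto dest: openin_imp_subset)

lemma image_chart_sets:
  assumes "local_parametrization M U \<phi>" "E \<in> sets borel" "E \<subseteq> U"
  shows "\<phi> ` E \<in> sets (restrict_space borel M)"
proof -
  obtain \<phi>i where hom: "homeomorphism U (\<phi> ` U) \<phi> \<phi>i"
    using assms(1) by (auto simp: local_parametrization_def)
  obtain O' where O': "open O'" "\<phi> ` U = M \<inter> O'"
    using assms(1) unfolding local_parametrization_def openin_open by blast
  have "\<phi>i \<in> measurable (restrict_space borel (\<phi> ` U)) borel"
    using hom by (intro borel_measurable_continuous_on_restrict) (auto simp: homeomorphism_def)
  from measurable_sets[OF this assms(2)]
  obtain B where B: "B \<in> sets borel" "\<phi>i -` E \<inter> (\<phi> ` U) = \<phi> ` U \<inter> B"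
    by (auto simp: sets_restrict_space space_restrict_space)
  have "\<phi> ` E = \<phi>i -` E \<inter> (\<phi> ` U)"
    using hom assms(3) by (auto simp: homeomorphism_def image_iff subset_iff)
  then have "\<phi> ` E = M \<inter> (O' \<inter> B)" using B O' by auto
  then show ?thesis using O' B by (auto simp: sets_restrict_space)
qed

lemma chart_preimage_borel:
  assumes "local_parametrization M U \<phi>" "E \<in> sets borel" "E \<subseteq> U" "A \<in> sets (restrict_space borel M)"
  shows "{u \<in> E. \<phi> u \<in> A} \<in> sets borel"
proof -
  obtain B where B: "B \<in> sets borel" "A = M \<inter> B" using assms(4) by (auto simp: sets_restrict_space)
  have "\<phi> ` U \<subseteq> M" by (rule local_parametrization_image_subset[OF assms(1)])
  then have "{u \<in> E. \<phi> u \<in> A} = {u \<in> E. \<phi> u \<in> B}" using B assms(3) by auto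
  moreover have "continuous_on E \<phi>"
    by (rule local_parametrization_continuous_on[OF assms(1,3)])
  ultimately show ?thesis using continuous_on_preimage_borel[of E \<phi> B] assms(2) B(1) by simp
qed

lemma chart_piece_borel:
  assumes "countable_atlas M \<phi> U"
  shows "chart_piece \<phi> U i \<in> sets borel" "chart_piece \<phi> U i \<subseteq> U i"
proof -
  have "chart_piece \<phi> U i = U i - (\<Union>j\<in>{..<i}. {u \<in> U i. \<phi> i u \<in> \<phi> j ` U j})"
    by (auto simp: chart_piece_def)
  moreover have "open (U i)" "open {u \<in> U i. \<phi> i u \<in> \<phi> j ` U j}" for j
    using assms local_parametrization_open overlap_open unfolding countable_atlas_def by blast+
  ultimately show "chart_piece \<phi> U i \<in> sets borel" by auto
qed (auto simp: chart_piece_def)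

lemma chart_piece_image_disjoint:
  assumes "u \<in> chart_piece \<phi> U i" "v \<in> chart_piece \<phi> U j" "\<phi> i u = \<phi> j v"
  shows "i = j"
proof (rule ccontr)
  assume "i \<noteq> j"
  then consider "i < j" | "j < i" by linarith
  moreover have "\<phi> i u \<in> \<phi> i ` U i" "\<phi> j v \<in> \<phi> j ` U j"
    using assms(1,2) by (simp_all add: chart_piece_def)
  ultimately show False
    using assms unfolding chart_piece_def by cases auto
qed

lemma chart_piece_cover:
  assumes "countable_atlas M \<phi> U" "x \<in> M"
  obtains i u where "u \<in> chart_piece \<phi> U i" "x = \<phi> i u"
proof -
  have ex: "\<exists>i. x \<in> \<phi> i ` U i" using assms by (auto simp: countable_atlas_def)
  define i where "i = (LEAST i. x \<in> \<phi> i ` U i)"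
  have "x \<in> \<phi> i ` U i" "\<And>j. j < i \<Longrightarrow> x \<notin> \<phi> j ` U j"
    unfolding i_def using LeastI_ex[OF ex] not_less_Least by blast+
  then obtain u where "u \<in> chart_piece \<phi> U i" "x = \<phi> i u" by (auto simp: chart_piece_def)
  then show ?thesis by (rule that)
qed

lemma volume_density_measurable:
  assumes "local_parametrization M U \<phi>" "E \<in> sets borel" "E \<subseteq> U"
  shows "(\<lambda>u. ennreal (volume_density \<phi> u) * indicator E u) \<in> borel_measurable borel"
proof -
  have "continuous_on E (volume_density \<phi>)"
    by (rule local_parametrization_density_continuous_on[OF assms(1,3)])
  then have "(\<lambda>u. ennreal (indicator E u *\<^sub>R volume_density \<phi> u)) \<in> borel_measurable borel"
    by (intro measurable_compose[OF _ measurable_ennreal] borel_measurable_continuous_on_indicator assms)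
  moreover have "ennreal (indicator E u *\<^sub>R volume_density \<phi> u) = ennreal (volume_density \<phi> u) * indicator E u" for u
    by (auto simp: indicator_def)
  ultimately show ?thesis by simp
qed

text \<open>Uniqueness: countable additivity over the disjoint pieces of an atlas determines the measure.\<close>

lemma riemannian_volume_atlas:
  assumes atlas: "countable_atlas M \<phi> U" and vol: "is_riemannian_volume TYPE('k) M \<mu>"
    and A: "A \<in> sets (restrict_space borel M)"
  shows "emeasure \<mu> A = atlas_volume (\<phi> :: nat \<Rightarrow> real^'k::finite \<Rightarrow> 'a::euclidean_space) U A"
proof -
  let ?E = "\<lambda>i. {u \<in> chart_piece \<phi> U i. \<phi> i u \<in> A}"
  have lp: "local_parametrization M (U i) (\<phi> i)" for i using atlas unfolding countable_atlas_def by blast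
  have sets: "sets \<mu> = sets (restrict_space borel M)" using vol by (simp add: is_riemannian_volume_def)
  have E: "?E i \<in> sets borel" "?E i \<subseteq> U i" for i
    using chart_preimage_borel[OF lp chart_piece_borel[OF atlas] A, of i] chart_piece_borel(2)[OF atlas, of i] by auto
  have "A \<subseteq> M" using sets.sets_into_space[OF A] by (simp add: space_restrict_space)
  have "A = (\<Union>i. \<phi> i ` ?E i)"
  proof
    show "A \<subseteq> (\<Union>i. \<phi> i ` ?E i)"
    proof
      fix x assume "x \<in> A"
      then obtain i u where "u \<in> chart_piece \<phi> U i" "x = \<phi> i u"
        using chart_piece_cover[OF atlas, of x] \<open>A \<subseteq> M\<close> by blast
      then show "x \<in> (\<Union>i. \<phi> i ` ?E i)" using \<open>x \<in> A\<close> by blast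
    qed
  qed auto
  then have "emeasure \<mu> A = emeasure \<mu> (\<Union>i. \<phi> i ` ?E i)" by simp
  also have "\<dots> = (\<Sum>i. emeasure \<mu> (\<phi> i ` ?E i))"
  proof (rule suminf_emeasure[symmetric])
    show "range (\<lambda>i. \<phi> i ` ?E i) \<subseteq> sets \<mu>"
      using image_chart_sets[OF lp E] sets by auto
    show "disjoint_family (\<lambda>i. \<phi> i ` ?E i)"
    unfolding disjoint_family_on_def
    proof (intro ballI impI equals0I)
      fix i j x assume "i \<noteq> j" "x \<in> \<phi> i ` ?E i \<inter> \<phi> j ` ?E j"
      then show False using chart_piece_image_disjoint[of _ \<phi> U i _ j] by auto
    qed
  qed
  also have "\<dots> = (\<Sum>i. \<integral>\<^sup>+u. ennreal (volume_density (\<phi> i) u) * indicator (?E i) u \<partial>lborel)"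
    using vol lp E unfolding is_riemannian_volume_def by (intro suminf_cong) blast
  finally show ?thesis by (simp add: atlas_volume_def)
qed

lemma atlas_volume_measure:
  assumes atlas: "countable_atlas M \<phi> U" and "M \<noteq> {}"
  obtains \<mu> where "sets \<mu> = sets (restrict_space borel M)"
    "\<And>A. A \<in> sets (restrict_space borel M) \<Longrightarrow>
        emeasure \<mu> A = atlas_volume (\<phi> :: nat \<Rightarrow> real^'k::finite \<Rightarrow> 'a::euclidean_space) U A"
proof -
  have lp: "local_parametrization M (U i) (\<phi> i)" for i using atlas unfolding countable_atlas_def by blast
  note cp = chart_piece_borel[OF atlas]
  obtain x0 where "x0 \<in> M" using \<open>M \<noteq> {}\<close> by blast
  define P where "P = (count_space UNIV :: nat measure) \<Otimes>\<^sub>M (lborel :: (real^'k) measure)"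
  define d where "d = (\<lambda>(i, u). ennreal (volume_density (\<phi> i) u) * indicator (chart_piece \<phi> U i) u)"
  define h where "h = (\<lambda>(i, u). if u \<in> chart_piece \<phi> U i then \<phi> i u else x0)"
  have img: "\<phi> i ` U i \<subseteq> M" for i
    by (rule local_parametrization_image_subset[OF lp])
  have d [measurable]: "d \<in> borel_measurable P"
    unfolding P_def d_def
  proof (intro measurable_pair_measure_countable1)
    fix i :: nat
    show "(\<lambda>y. case (i, y) of (i, u) \<Rightarrow> ennreal (volume_density (\<phi> i) u) * indicator (chart_piece \<phi> U i) u) \<in> borel_measurable lborel"
      using volume_density_measurable[OF lp cp, of i] by simp
  qed simp
  have h [measurable]: "h \<in> measurable P (restrict_space borel M)"
    unfolding P_def h_def
  proof (intro measurable_pair_measure_countable1)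
    fix i :: nat
    have "continuous_on (chart_piece \<phi> U i) (\<phi> i)"
      by (rule local_parametrization_continuous_on[OF lp cp(2)])
    then have "(\<lambda>u. if u \<in> chart_piece \<phi> U i then \<phi> i u else x0) \<in> borel_measurable borel"
      using cp(1)[of i] by (intro borel_measurable_continuous_on_if) auto
    then show "(\<lambda>y. case (i, y) of (i, u) \<Rightarrow> if u \<in> chart_piece \<phi> U i then \<phi> i u else x0) \<in> measurable lborel (restrict_space borel M)"
      using subset_trans[OF image_mono[OF cp(2)] img[of i]] \<open>x0 \<in> M\<close>
      by (intro measurable_restrict_space2) (auto simp: image_subset_iff)
  qed simp
  define \<mu> where "\<mu> = distr (density P d) (restrict_space borel M) h"
  show ?thesis
  proof (rule that[of \<mu>])
    show "sets \<mu> = sets (restrict_space borel M)" by (simp add: \<mu>_def)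
    fix A assume A: "A \<in> sets (restrict_space borel M)"
    have hA: "h -` A \<inter> space P \<in> sets P" using measurable_sets[OF h A] .
    have "emeasure \<mu> A = emeasure (density P d) (h -` A \<inter> space P)"
      unfolding \<mu>_def using A by (subst emeasure_distr) auto
    also have "\<dots> = (\<integral>\<^sup>+z. d z * indicator (h -` A \<inter> space P) z \<partial>P)"
      using hA by (subst emeasure_density) auto
    also have "\<dots> = (\<integral>\<^sup>+i. \<integral>\<^sup>+u. d (i, u) * indicator (h -` A \<inter> space P) (i, u) \<partial>lborel \<partial>count_space UNIV)"
      unfolding P_def using hA d
      by (intro lborel.nn_integral_fst[symmetric] borel_measurable_times_ennreal borel_measurable_indicator) (auto simp: P_def)
    also have "\<dots> = (\<integral>\<^sup>+i. \<integral>\<^sup>+u. ennreal (volume_density (\<phi> i) u) *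
        indicator {u \<in> chart_piece \<phi> U i. \<phi> i u \<in> A} u \<partial>lborel \<partial>count_space UNIV)"
      by (intro nn_integral_cong) (auto simp: d_def h_def P_def indicator_def space_pair_measure)
    also have "\<dots> = atlas_volume \<phi> U A"
      by (simp add: nn_integral_count_space_nat atlas_volume_def)
    finally show "emeasure \<mu> A = atlas_volume \<phi> U A" .
  qed
qed

text \<open>The measure built from one atlas has the right density in every other chart, by the invariance
  of the density under transition maps; this gives existence.\<close>

lemma atlas_volume_chart:
  assumes atlas: "countable_atlas M \<phi> U" and lpV: "local_parametrization M V (\<psi> :: real^'k \<Rightarrow> 'a)"
    and E: "E \<in> sets borel" "E \<subseteq> V"
  shows "atlas_volume (\<phi> :: nat \<Rightarrow> real^'k::finite \<Rightarrow> 'a::euclidean_space) U (\<psi> ` E)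
      = (\<integral>\<^sup>+w. ennreal (volume_density \<psi> w) * indicator E w \<partial>lborel)"
proof -
  have lp: "local_parametrization M (U i) (\<phi> i)" for i using atlas unfolding countable_atlas_def by blast
  let ?E = "\<lambda>i. {w \<in> E. \<psi> w \<in> \<phi> i ` chart_piece \<phi> U i}"
  have img: "\<phi> i ` chart_piece \<phi> U i \<in> sets (restrict_space borel M)" for i
    using image_chart_sets[OF lp chart_piece_borel[OF atlas]] .
  have Ei: "?E i \<in> sets borel" "?E i \<subseteq> V" for i
    using chart_preimage_borel[OF lpV E img] E by auto
  have inj\<phi>: "inj_on (\<phi> i) (U i)" for i
    using lp[of i] unfolding local_parametrization_def homeomorphism_def inj_on_def by metis
  have "{u \<in> chart_piece \<phi> U i. \<phi> i u \<in> \<psi> ` E} = {u \<in> U i. \<phi> i u \<in> \<psi> ` ?E i}" for i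
  proof safe
    fix u w assume "u \<in> chart_piece \<phi> U i" "\<phi> i u = \<psi> w" "w \<in> E"
    then show "\<phi> i u \<in> \<psi> ` ?E i" by (metis (mono_tags, lifting) imageI mem_Collect_eq)
    show "u \<in> U i" using \<open>u \<in> chart_piece \<phi> U i\<close> by (simp add: chart_piece_def)
  next
    fix u w v assume u: "u \<in> U i" "\<phi> i u = \<psi> w" "w \<in> E" "\<psi> w = \<phi> i v" "v \<in> chart_piece \<phi> U i"
    have "v \<in> U i" using u by (simp add: chart_piece_def)
    then have "u = v" using inj\<phi> u inj_onD by metis
    then show "u \<in> chart_piece \<phi> U i" using u by simp
    show "\<phi> i u \<in> \<psi> ` E" using u(2,3) by (rule image_eqI)
  qed
  then have "atlas_volume \<phi> U (\<psi> ` E) = (\<Sum>i. \<integral>\<^sup>+u. ennreal (volume_density (\<phi> i) u) *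
      indicator {u \<in> U i. \<phi> i u \<in> \<psi> ` ?E i} u \<partial>lborel)"
    by (simp add: atlas_volume_def)
  also have "\<dots> = (\<Sum>i. \<integral>\<^sup>+w. ennreal (volume_density \<psi> w) * indicator (?E i) w \<partial>lborel)"
    using chart_piece_borel(2)[OF atlas] by (intro suminf_cong transition_nn_integral[OF lp lpV Ei]) blast
  also have "\<dots> = (\<integral>\<^sup>+w. (\<Sum>i. ennreal (volume_density \<psi> w) * indicator (?E i) w) \<partial>lborel)"
    using volume_density_measurable[OF lpV Ei] by (intro nn_integral_suminf[symmetric]) auto
  also have "\<dots> = (\<integral>\<^sup>+w. ennreal (volume_density \<psi> w) * indicator E w \<partial>lborel)"
  proof (intro nn_integral_cong)
    fix w
    have "\<psi> ` V \<subseteq> M" by (rule local_parametrization_image_subset[OF lpV])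
    have "(\<Union>i. ?E i) = E"
    proof
      show "E \<subseteq> (\<Union>i. ?E i)"
      proof
        fix w assume "w \<in> E"
        then have "\<psi> w \<in> M" using E \<open>\<psi> ` V \<subseteq> M\<close> by auto
        then obtain i u where "u \<in> chart_piece \<phi> U i" "\<psi> w = \<phi> i u"
          using chart_piece_cover[OF atlas] by metis
        then show "w \<in> (\<Union>i. ?E i)" using \<open>w \<in> E\<close> by blast
      qed
    qed auto
    moreover have "disjoint_family ?E"
    unfolding disjoint_family_on_def
    proof (intro ballI impI equals0I)
      fix i j x assume "i \<noteq> j" "x \<in> ?E i \<inter> ?E j"
      then obtain u v where "u \<in> chart_piece \<phi> U i" "\<psi> x = \<phi> i u"
        "v \<in> chart_piece \<phi> U j" "\<psi> x = \<phi> j v" by blast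
      then show False using chart_piece_image_disjoint[of u \<phi> U i v j] \<open>i \<noteq> j\<close> by simp
    qed
    ultimately have "(\<Sum>i. indicator (?E i) w) = (indicator E w :: ennreal)"
      using suminf_indicator[of ?E w] by simp
    then show "(\<Sum>i. ennreal (volume_density \<psi> w) * indicator (?E i) w) = ennreal (volume_density \<psi> w) * indicator E w"
      by (simp only: ennreal_suminf_cmult)
  qed
  finally show ?thesis .
qed

proposition is_riemannian_volume_riemannian_volume:
  assumes "embedded_submanifold TYPE('k::finite) (M :: 'a::euclidean_space set)" "M \<noteq> {}"
  shows "is_riemannian_volume TYPE('k) M (riemannian_volume TYPE('k) M)"
    and "is_riemannian_volume TYPE('k) M \<mu> \<Longrightarrow> riemannian_volume TYPE('k) M = \<mu>"
proof -
  obtain \<phi> :: "nat \<Rightarrow> real^'k \<Rightarrow> 'a" and U where atlas: "countable_atlas M \<phi> U"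
    using countable_atlas_exists[OF assms] by blast
  obtain \<mu> where \<mu>: "sets \<mu> = sets (restrict_space borel M)"
    "\<And>A. A \<in> sets (restrict_space borel M) \<Longrightarrow> emeasure \<mu> A = atlas_volume \<phi> U A"
    using atlas_volume_measure[OF atlas assms(2)] by blast
  have ex: "is_riemannian_volume TYPE('k) M \<mu>"
    unfolding is_riemannian_volume_def
  proof (intro conjI allI impI ballI)
    fix V and \<psi> :: "real^'k \<Rightarrow> 'a" and E
    assume *: "local_parametrization M V \<psi>" "E \<in> sets borel" "E \<subseteq> V"
    show "emeasure \<mu> (\<psi> ` E) = (\<integral>\<^sup>+x\<in>E. ennreal (volume_density \<psi> x)\<partial>lborel)"
      using \<mu>(2)[OF image_chart_sets[OF *]] atlas_volume_chart[OF atlas *] by simp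
  qed (rule \<mu>(1))
  have un: "\<nu> = \<mu>" if "is_riemannian_volume TYPE('k) M \<nu>" for \<nu>
  proof (rule measure_eqI)
    show "sets \<nu> = sets \<mu>" using that ex by (simp add: is_riemannian_volume_def)
    fix A assume "A \<in> sets \<nu>"
    then have "A \<in> sets (restrict_space borel M)" using that by (simp add: is_riemannian_volume_def)
    then show "emeasure \<nu> A = emeasure \<mu> A"
      using riemannian_volume_atlas[OF atlas that] riemannian_volume_atlas[OF atlas ex] by simp
  qed
  have eq: "riemannian_volume TYPE('k) M = \<mu>"
    unfolding riemannian_volume_def using ex un by (rule the_equality)
  show "is_riemannian_volume TYPE('k) M (riemannian_volume TYPE('k) M)"
    unfolding eq by (rule ex)
  show "is_riemannian_volume TYPE('k) M \<nu> \<Longrightarrow> riemannian_volume TYPE('k) M = \<nu>" for \<nu>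
    unfolding eq using un by simp
qed

section \<open>Images, isometries and finiteness\<close>

lemma local_parametrization_restrict:
  assumes lp: "local_parametrization M U \<phi>" and V: "open V" "V \<subseteq> U"
  shows "local_parametrization M V \<phi>"
proof -
  obtain \<psi> where hom: "homeomorphism U (\<phi> ` U) \<phi> \<psi>" using lp by (auto simp: local_parametrization_def)
  have "openin (top_of_set U) V"
    using V by (simp add: openin_open_eq local_parametrization_open[OF lp])
  then have "openin (top_of_set (\<phi> ` U)) (\<phi> ` V)"
    by (rule homeomorphism_imp_open_map[OF hom])
  moreover have "openin (top_of_set M) (\<phi> ` U)" using lp by (simp add: local_parametrization_def)
  ultimately have "openin (top_of_set M) (\<phi> ` V)" by (rule openin_trans)
  moreover have "homeomorphism V (\<phi> ` V) \<phi> \<psi>"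
    by (rule homeomorphism_of_subsets[OF hom V(2)]) (use V in auto)
  ultimately show ?thesis
    using lp V smooth_on_open_subset unfolding local_parametrization_def by blast
qed

text \<open>If increments of \<open>f\<close> dominate those of \<open>g\<close> then so do their derivatives. Applied to \<open>f = F \<circ> \<phi>\<close>
  and \<open>g = \<phi>\<close> this makes \<open>F \<circ> \<phi>\<close> an immersion.\<close>

lemma derivative_kernel_subset:
  fixes f :: "'a::real_normed_vector \<Rightarrow> 'b::real_normed_vector" and g :: "'a \<Rightarrow> 'c::real_normed_vector"
  assumes f: "(f has_derivative f') (at u)" and g: "(g has_derivative g') (at u)"
    and U: "open U" "u \<in> U" and c: "c > 0"
    and lower: "\<And>y. y \<in> U \<Longrightarrow> c * norm (g y - g u) \<le> norm (f y - f u)"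
    and v: "f' v = 0"
  shows "g' v = 0"
proof (rule ccontr)
  assume nz: "g' v \<noteq> 0"
  have lin: "linear f'" "linear g'" using f g has_derivative_linear by blast+
  have v0: "v \<noteq> 0" using nz linear_0[OF lin(2)] by auto
  define e where "e = min (norm (g' v) / (2 * norm v)) (c * norm (g' v) / (4 * norm v))"
  have e: "e > 0" "e * norm v \<le> norm (g' v) / 2" "e * norm v \<le> c * norm (g' v) / 4"
    using nz v0 c by (auto simp: e_def min_def field_simps)
  obtain d1 where d1: "d1 > 0" "\<And>y. norm (y - u) < d1 \<Longrightarrow> norm (f y - f u - f' (y - u)) \<le> e * norm (y - u)"
    using f e(1) unfolding has_derivative_at_alt by meson
  obtain d2 where d2: "d2 > 0" "\<And>y. norm (y - u) < d2 \<Longrightarrow> norm (g y - g u - g' (y - u)) \<le> e * norm (y - u)"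
    using g e(1) unfolding has_derivative_at_alt by meson
  obtain d3 where d3: "d3 > 0" "ball u d3 \<subseteq> U" using U open_contains_ball by blast
  define h where "h = min d1 (min d2 d3) / (2 * norm v)"
  have h: "h > 0" "norm (h *\<^sub>R v) < min d1 (min d2 d3)"
    using d1(1) d2(1) d3(1) v0 by (auto simp: h_def field_simps)
  let ?y = "u + h *\<^sub>R v"
  have "?y \<in> U" using h d3 by (auto simp: dist_norm subset_iff)
  then have low: "c * norm (g ?y - g u) \<le> norm (f ?y - f u)" by (rule lower)
  have "norm (f ?y - f u) \<le> e * (h * norm v)"
    using d1(2)[of ?y] h v by (simp add: linear_scale[OF lin(1)])
  also have "\<dots> = h * (e * norm v)" by simp
  also have "\<dots> \<le> h * (c * norm (g' v) / 4)" using e(3) h by (intro mult_left_mono) auto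
  finally have 1: "norm (f ?y - f u) \<le> h * (c * norm (g' v) / 4)" .
  have "norm (g ?y - g u - h *\<^sub>R g' v) \<le> e * (h * norm v)"
    using d2(2)[of ?y] h by (simp add: linear_scale[OF lin(2)])
  also have "\<dots> = h * (e * norm v)" by simp
  also have "\<dots> \<le> h * (norm (g' v) / 2)" using e(2) h by (intro mult_left_mono) auto
  finally have "norm (g ?y - g u - h *\<^sub>R g' v) \<le> h * (norm (g' v) / 2)" .
  then have "norm (h *\<^sub>R g' v) - norm (g ?y - g u) \<le> h * (norm (g' v) / 2)"
    by (smt (verit) norm_minus_commute norm_triangle_ineq2)
  then have "norm (g ?y - g u) \<ge> h * norm (g' v) / 2" using h by (simp add: field_simps)
  then have "c * (h * norm (g' v) / 2) \<le> c * norm (g ?y - g u)" using c by (intro mult_left_mono) auto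
  with low 1 have "c * (h * norm (g' v) / 2) \<le> h * (c * norm (g' v) / 4)" by linarith
  moreover have "c * h * norm (g' v) > 0" using c h nz by simp
  ultimately show False by (simp add: field_simps)
qed

text \<open>The lower Lipschitz bound supplies injectivity, immersivity and continuity of the inverse at once.\<close>

lemma local_parametrization_image:
  fixes F :: "'a::euclidean_space \<Rightarrow> 'a" and \<phi> :: "real^'k::finite \<Rightarrow> 'a"
  assumes lp: "local_parametrization M U \<phi>" and F: "smooth_on_open UNIV F" and c: "c > 0"
    and lower: "\<And>x y. x \<in> M \<Longrightarrow> y \<in> M \<Longrightarrow> c * norm (x - y) \<le> norm (F x - F y)"
  shows "local_parametrization (F ` M) U (F \<circ> \<phi>)"
proof -
  have inj: "inj_on F M"
  proof (rule inj_onI)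
    fix x y assume "x \<in> M" "y \<in> M" "F x = F y"
    then show "x = y" using lower[of x y] c by (simp add: mult_le_0_iff)
  qed
  obtain \<psi> where hom: "homeomorphism U (\<phi> ` U) \<phi> \<psi>" using lp by (auto simp: local_parametrization_def)
  let ?G = "the_inv_into M F"
  have GF: "?G (F x) = x" if "x \<in> M" for x using the_inv_into_f_f[OF inj that] .
  have "(1/c)-lipschitz_on (F ` M) ?G"
  proof (rule lipschitz_onI)
    fix a b assume "a \<in> F ` M" "b \<in> F ` M"
    then show "dist (?G a) (?G b) \<le> 1 / c * dist a b"
      using lower c by (auto simp: GF dist_norm field_simps)
  qed (use c in auto)
  then have homF: "homeomorphism M (F ` M) F ?G"
    using continuous_on_subset[OF smooth_on_open_continuous_on[OF F], of M] GF
    by (auto simp: homeomorphism_def lipschitz_on_continuous_on image_image)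
  have img: "\<phi> ` U \<subseteq> M" by (rule local_parametrization_image_subset[OF lp])
  have "homeomorphism (\<phi> ` U) (F ` (\<phi> ` U)) F ?G"
    by (rule homeomorphism_of_subsets[OF homF img]) auto
  from homeomorphism_compose[OF hom this]
  have "homeomorphism U ((F \<circ> \<phi>) ` U) (F \<circ> \<phi>) (\<psi> \<circ> ?G)" by (simp add: image_comp)
  moreover have "openin (top_of_set (F ` M)) ((F \<circ> \<phi>) ` U)"
    using homeomorphism_imp_open_map[OF homF, of "\<phi> ` U"] lp by (simp add: local_parametrization_def image_comp)
  moreover have sm: "smooth_on_open U (F \<circ> \<phi>)"
    using smooth_on_open_compose[OF F, of U \<phi>] lp by (simp add: local_parametrization_def o_def)
  moreover have "inj (frechet_derivative (F \<circ> \<phi>) (at u))" if u: "u \<in> U" for u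
  proof -
    have d: "((F \<circ> \<phi>) has_derivative frechet_derivative (F \<circ> \<phi>) (at u)) (at u)"
      by (rule smooth_on_open_has_derivative[OF sm u])
    have inj\<phi>: "inj (frechet_derivative \<phi> (at u))" using lp u by (simp add: local_parametrization_def)
    have "v = 0" if "frechet_derivative (F \<circ> \<phi>) (at u) v = 0" for v
    proof -
      have "frechet_derivative \<phi> (at u) v = 0"
        using derivative_kernel_subset[OF d local_parametrization_has_derivative[OF lp u]
            local_parametrization_open[OF lp] u c _ that] lower img u by (auto simp: image_subset_iff)
      then show ?thesis
        using inj\<phi> linear_injective_0[OF local_parametrization_linear[OF lp u]] by blast
    qed
    then show ?thesis using linear_injective_0[OF has_derivative_linear[OF d]] by blast
  qed
  ultimately show ?thesis unfolding local_parametrization_def by blast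
qed

lemma embedded_submanifold_image:
  fixes F :: "'a::euclidean_space \<Rightarrow> 'a"
  assumes emb: "embedded_submanifold TYPE('k::finite) M" and F: "smooth_on_open UNIV F" and c: "c > 0"
    and lower: "\<And>x y. x \<in> M \<Longrightarrow> y \<in> M \<Longrightarrow> c * norm (x - y) \<le> norm (F x - F y)"
  shows "embedded_submanifold TYPE('k) (F ` M)"
  unfolding embedded_submanifold_def
proof
  fix z assume "z \<in> F ` M"
  then obtain x where x: "x \<in> M" "z = F x" by blast
  then obtain U and \<phi> :: "real^'k \<Rightarrow> 'a" where "local_parametrization M U \<phi>" "x \<in> \<phi> ` U"
    using emb unfolding embedded_submanifold_def by blast
  then have "local_parametrization (F ` M) U (F \<circ> \<phi>)" "z \<in> (F \<circ> \<phi>) ` U"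
    using local_parametrization_image[OF _ F c lower] x by auto
  then show "\<exists>U (\<phi> :: real^'k \<Rightarrow> 'a). local_parametrization (F ` M) U \<phi> \<and> z \<in> \<phi> ` U" by blast
qed

lemma riemannian_volume_chart:
  assumes "is_riemannian_volume TYPE('k::finite) M \<mu>"
    and "local_parametrization M U (\<phi> :: real^'k \<Rightarrow> 'a::euclidean_space)" "E \<in> sets borel" "E \<subseteq> U"
  shows "emeasure \<mu> (\<phi> ` E) = (\<integral>\<^sup>+u. ennreal (volume_density \<phi> u) * indicator E u \<partial>lborel)"
  using assms unfolding is_riemannian_volume_def by blast

lemma chart_volume_finite:
  assumes lp: "local_parametrization M U (\<phi> :: real^'k::finite \<Rightarrow> 'a::euclidean_space)" and r: "cball u r \<subseteq> U"
  shows "(\<integral>\<^sup>+w. ennreal (volume_density \<phi> w) * indicator (ball u r) w \<partial>lborel) < \<infinity>"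
proof -
  have "compact (volume_density \<phi> ` cball u r)"
    by (intro compact_continuous_image local_parametrization_density_continuous_on[OF lp r]) simp
  then obtain B where B: "\<And>w. w \<in> cball u r \<Longrightarrow> volume_density \<phi> w \<le> B"
    using compact_imp_bounded bounded_pos by (metis abs_le_D1 imageI real_norm_def)
  have "(\<integral>\<^sup>+w. ennreal (volume_density \<phi> w) * indicator (ball u r) w \<partial>lborel)
      \<le> (\<integral>\<^sup>+w. ennreal B * indicator (ball u r) w \<partial>lborel)"
    by (intro nn_integral_mono) (auto simp: indicator_def intro!: ennreal_leI B)
  also have "\<dots> = ennreal B * emeasure lborel (ball u r)" by (simp add: nn_integral_cmult_indicator)
  also have "\<dots> < \<infinity>" using emeasure_bounded_finite[of "ball u r"] by (simp add: ennreal_mult_less_top)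
  finally show ?thesis .
qed

lemma riemannian_volume_finite:
  assumes emb: "embedded_submanifold TYPE('k::finite) (M :: 'a::euclidean_space set)" and "compact M"
    and vol: "is_riemannian_volume TYPE('k) M \<mu>"
  shows "emeasure \<mu> M < \<infinity>"
proof -
  have sets: "sets \<mu> = sets (restrict_space borel M)" using vol by (simp add: is_riemannian_volume_def)
  have "\<exists>S. openin (top_of_set M) S \<and> x \<in> S \<and> S \<in> sets \<mu> \<and> emeasure \<mu> S < \<infinity>" if "x \<in> M" for x
  proof -
    obtain U and \<phi> :: "real^'k \<Rightarrow> 'a" where lp: "local_parametrization M U \<phi>" "x \<in> \<phi> ` U"
      using emb \<open>x \<in> M\<close> unfolding embedded_submanifold_def by blast
    then obtain u where u: "u \<in> U" "x = \<phi> u" by blast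
    obtain r where r: "r > 0" "cball u r \<subseteq> U"
      using local_parametrization_open[OF lp(1)] u(1) open_contains_cball by blast
    have sub: "ball u r \<subseteq> U" using r ball_subset_cball by blast
    have "openin (top_of_set M) (\<phi> ` ball u r)"
      using local_parametrization_restrict[OF lp(1) open_ball sub] unfolding local_parametrization_def by blast
    moreover have "emeasure \<mu> (\<phi> ` ball u r) < \<infinity>"
      using riemannian_volume_chart[OF vol lp(1) _ sub] chart_volume_finite[OF lp(1) r(2)] by simp
    moreover have "\<phi> ` ball u r \<in> sets \<mu>" using image_chart_sets[OF lp(1) _ sub] sets by simp
    moreover have "x \<in> \<phi> ` ball u r" using u r by simp
    ultimately show ?thesis by blast
  qed
  then have "\<exists>S. \<forall>x\<in>M. openin (top_of_set M) (S x) \<and> x \<in> S x \<and> S x \<in> sets \<mu> \<and> emeasure \<mu> (S x) < \<infinity>"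
    by (intro bchoice ballI)
  then obtain S where S: "\<And>x. x \<in> M \<Longrightarrow> openin (top_of_set M) (S x)" "\<And>x. x \<in> M \<Longrightarrow> x \<in> S x"
    "\<And>x. x \<in> M \<Longrightarrow> S x \<in> sets \<mu>" "\<And>x. x \<in> M \<Longrightarrow> emeasure \<mu> (S x) < \<infinity>" by blast
  have "\<forall>C. (\<forall>c\<in>C. openin (top_of_set M) c) \<and> M \<subseteq> \<Union>C \<longrightarrow> (\<exists>D\<subseteq>C. finite D \<and> M \<subseteq> \<Union>D)"
    using \<open>compact M\<close> unfolding compact_eq_openin_cover .
  from this[rule_format, of "S ` M"] S(1,2)
  obtain D where D: "D \<subseteq> S ` M" "finite D" "M \<subseteq> \<Union>D" by blast
  have "emeasure \<mu> M \<le> emeasure \<mu> (\<Union>c\<in>D. c)"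
    using D S(3) by (intro emeasure_mono) auto
  also have "\<dots> \<le> (\<Sum>c\<in>D. emeasure \<mu> c)"
    using D S(3) by (intro emeasure_subadditive_finite) auto
  also have "\<dots> < \<infinity>" using D S(4) by (auto simp: ennreal_sum_less_top)
  finally show ?thesis .
qed

lemma linear_imp_smooth_on_open:
  fixes f :: "'a::euclidean_space \<Rightarrow> 'b::euclidean_space"
  shows "linear f \<Longrightarrow> smooth_on_open UNIV f"
  using smooth_on_open_linear[OF _ smooth_on_open_ident[of UNIV], of f] by (simp add: linear_linear)

text \<open>An isometry carries charts to charts of equal Gram matrix, so the uniqueness of the volume
  applies to the image measure.\<close>

lemma riemannian_volume_isometry:
  fixes f :: "'a::euclidean_space \<Rightarrow> 'a"
  assumes emb: "embedded_submanifold TYPE('k::finite) M" "M \<noteq> {}"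
    and f: "orthogonal_transformation f" "f ` M = M"
  defines "\<mu> \<equiv> riemannian_volume TYPE('k) M"
  shows "distr \<mu> \<mu> f = \<mu>" "f \<in> measurable \<mu> \<mu>"
proof -
  have vol: "is_riemannian_volume TYPE('k) M \<mu>"
    unfolding \<mu>_def by (rule is_riemannian_volume_riemannian_volume[OF emb])
  have sets: "sets \<mu> = sets (restrict_space borel M)" using vol by (simp add: is_riemannian_volume_def)
  then have "space \<mu> = space (restrict_space borel M)" by (rule sets_eq_imp_space_eq)
  then have space: "space \<mu> = M" by (simp add: space_restrict_space)
  have lin: "linear f" using f(1) by (rule orthogonal_transformation_linear)
  have "f \<in> measurable (restrict_space borel M) (restrict_space borel M)"
    using f(2) borel_measurable_linear[OF lin]
    by (intro measurable_restrict_space2 measurable_restrict_space1) (auto simp: space_restrict_space)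
  then show meas: "f \<in> measurable \<mu> \<mu>" using measurable_cong_sets[OF sets sets] by simp
  have bij: "bij f" using f(1) by (rule orthogonal_transformation_bij)
  define g where "g = inv f"
  have g: "orthogonal_transformation g" unfolding g_def by (rule orthogonal_transformation_inv[OF f(1)])
  have gf: "g (f x) = x" "f (g x) = x" for x
    unfolding g_def using bij by (simp_all add: bij_is_inj bij_is_surj surj_f_inv_f)
  have "g ` (f ` M) = M" by (simp add: image_image gf)
  then have gM: "g ` M = M" by (simp only: f(2))
  have glin: "linear g" using g by (rule orthogonal_transformation_linear)
  have "is_riemannian_volume TYPE('k) M (distr \<mu> \<mu> f)"
    unfolding is_riemannian_volume_def
  proof (intro conjI allI impI ballI)
    fix V and \<psi> :: "real^'k \<Rightarrow> 'a" and E
    assume lp: "local_parametrization M V \<psi>" and E: "E \<in> sets borel" "E \<subseteq> V"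
    have lpg: "local_parametrization M V (g \<circ> \<psi>)"
      using local_parametrization_image[OF lp linear_imp_smooth_on_open[OF glin], of 1] gM
      by (simp add: linear_diff[OF glin, symmetric] orthogonal_transformation_norm[OF g])
    have "f -` (\<psi> ` E) \<inter> M = (g \<circ> \<psi>) ` E"
    proof -
      have "f -` (\<psi> ` E) = (g \<circ> \<psi>) ` E"
      proof (intro set_eqI iffI)
        fix x assume "x \<in> f -` (\<psi> ` E)"
        then obtain w where "w \<in> E" "f x = \<psi> w" by auto
        then show "x \<in> (g \<circ> \<psi>) ` E" using gf(1)[of x] by (intro image_eqI[of _ _ w]) auto
      qed (auto simp: gf)
      moreover have "(g \<circ> \<psi>) ` E \<subseteq> M"
        using local_parametrization_image_subset[OF lpg] E by blast
      ultimately show ?thesis by blast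
    qed
    then have "emeasure (distr \<mu> \<mu> f) (\<psi> ` E) = emeasure \<mu> ((g \<circ> \<psi>) ` E)"
      using image_chart_sets[OF lp E] meas by (subst emeasure_distr) (auto simp: sets space)
    also have "\<dots> = (\<integral>\<^sup>+u. ennreal (volume_density (g \<circ> \<psi>) u) * indicator E u \<partial>lborel)"
      by (rule riemannian_volume_chart[OF vol lpg E])
    also have "\<dots> = (\<integral>\<^sup>+u. ennreal (volume_density \<psi> u) * indicator E u \<partial>lborel)"
    proof (intro nn_integral_cong)
      fix u
      show "ennreal (volume_density (g \<circ> \<psi>) u) * indicator E u = ennreal (volume_density \<psi> u) * indicator E u"
      proof (cases "u \<in> E")
        case True
        then have "(\<psi> has_derivative frechet_derivative \<psi> (at u)) (at u)"
          using local_parametrization_has_derivative[OF lp] E by blast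
        then have "((\<lambda>x. g (\<psi> x)) has_derivative (\<lambda>v. g (frechet_derivative \<psi> (at u) v))) (at u)"
          using bounded_linear.has_derivative glin linear_linear by blast
        then have "frechet_derivative (g \<circ> \<psi>) (at u) = (\<lambda>v. g (frechet_derivative \<psi> (at u) v))"
          unfolding o_def by (rule frechet_derivative_at[symmetric])
        then show ?thesis
          using g gram_isometry[of g "frechet_derivative \<psi> (at u)"]
          by (simp add: volume_density_gram orthogonal_transformation_def)
      qed simp
    qed
    finally show "emeasure (distr \<mu> \<mu> f) (\<psi> ` E) = (\<integral>\<^sup>+x\<in>E. ennreal (volume_density \<psi> x)\<partial>lborel)" .
  qed (simp add: sets)
  then show "distr \<mu> \<mu> f = \<mu>"
    using is_riemannian_volume_riemannian_volume(2)[OF emb] \<mu>_def by metis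
qed

section \<open>The unit sphere\<close>

text \<open>An open hemisphere is a graph over a ball in the hyperplane orthogonal to \<open>p\<close>.\<close>

lemma sphere_graph_chart:
  fixes p :: "'a::euclidean_space"
  assumes dim: "DIM('a) = CARD('n::finite) + 1" and p: "norm p = 1"
  obtains J :: "real^'n \<Rightarrow> 'a" and \<phi>
  where "linear J" "\<And>u. norm (J u) = norm u" "range J = {x. p \<bullet> x = 0}"
    "\<phi> = (\<lambda>u. J u + sqrt (1 - u \<bullet> u) *\<^sub>R p)"
    "local_parametrization (sphere 0 1) (ball 0 1) \<phi>"
    "\<phi> ` ball 0 1 = {x \<in> sphere 0 1. p \<bullet> x > 0}"
proof -
  have "p \<noteq> 0" using p by auto
  then have "dim (UNIV :: (real^'n) set) = dim {x. p \<bullet> x = 0}"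
    using dim_hyperplane[of p] dim by simp
  then obtain J g where J: "linear J" "linear g" "J ` (UNIV :: (real^'n) set) = {x. p \<bullet> x = 0}"
      "\<And>x. norm (J x) = norm x" "\<And>x. x \<in> {x. p \<bullet> x = 0} \<Longrightarrow> norm (g x) = norm x"
      "\<And>x. g (J x) = x" "\<And>x. x \<in> {x. p \<bullet> x = 0} \<Longrightarrow> J (g x) = x"
    by (rule isometries_subspaces[OF subspace_UNIV subspace_hyperplane[of p]]) auto
  have Jp: "p \<bullet> J u = 0" "J u \<bullet> p = 0" for u using J(3) by (auto simp: inner_commute)
  have JJ: "J u \<bullet> J u = u \<bullet> u" for u using J(4) by (metis dot_square_norm)
  have pp: "p \<bullet> p = 1" using p by (simp add: dot_square_norm)
  define \<phi> where "\<phi> u = J u + sqrt (1 - u \<bullet> u) *\<^sub>R p" for u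
  define \<psi> where "\<psi> x = g (x - (p \<bullet> x) *\<^sub>R p)" for x
  have ball: "0 < 1 - u \<bullet> u" if "u \<in> ball 0 1" for u :: "real^'n"
    using that power_strict_mono[of "norm u" 1 2] by (simp add: dot_square_norm)
  have "linear (\<lambda>x. g (x - (p \<bullet> x) *\<^sub>R p))"
    by (intro linearI) (auto simp: inner_add_right scaleR_add_left algebra_simps
        linear_add[OF J(2)] linear_diff[OF J(2)] linear_scale[OF J(2)])
  then have psi_lin: "linear \<psi>" by (simp add: \<psi>_def[abs_def])
  have p\<phi>: "p \<bullet> \<phi> u = sqrt (1 - u \<bullet> u)" for u
    by (simp add: \<phi>_def inner_add_right Jp pp)
  have \<psi>\<phi>: "\<psi> (\<phi> u) = u" for u
    unfolding \<psi>_def p\<phi> by (simp add: \<phi>_def J(6))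
  have \<phi>\<psi>: "\<phi> (\<psi> x) = x" "\<psi> x \<in> ball 0 1" if x: "x \<in> sphere 0 1" "p \<bullet> x > 0" for x
  proof -
    let ?y = "x - (p \<bullet> x) *\<^sub>R p"
    have xx: "x \<bullet> x = 1" using x by (simp add: dot_square_norm)
    have y: "?y \<in> {x. p \<bullet> x = 0}" by (simp add: inner_diff_right pp)
    have "norm (\<psi> x) = norm ?y" unfolding \<psi>_def by (rule J(5)[OF y])
    then have "\<psi> x \<bullet> \<psi> x = ?y \<bullet> ?y" by (simp add: dot_square_norm)
    also have "\<dots> = 1 - (p \<bullet> x)\<^sup>2"
      by (simp add: inner_diff_left inner_diff_right xx pp inner_commute power2_eq_square)
    finally have 1: "\<psi> x \<bullet> \<psi> x = 1 - (p \<bullet> x)\<^sup>2" .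
    then show "\<phi> (\<psi> x) = x"
      using x(2) J(7)[OF y] by (simp add: \<phi>_def \<psi>_def)
    have "(norm (\<psi> x))\<^sup>2 < 1" using 1 x(2) by (simp add: dot_square_norm)
    then show "\<psi> x \<in> ball 0 1" using power_less_imp_less_base[of "norm (\<psi> x)" 2 1] by simp
  qed
  have \<phi>S: "\<phi> u \<in> sphere 0 1" "p \<bullet> \<phi> u > 0" if "u \<in> ball 0 1" for u
  proof -
    have "\<phi> u \<bullet> \<phi> u = 1"
      using ball[OF that] by (simp add: \<phi>_def inner_add_left inner_add_right Jp JJ pp)
    then show "\<phi> u \<in> sphere 0 1" by (simp add: norm_eq_1)
    show "p \<bullet> \<phi> u > 0" using ball[OF that] by (simp add: p\<phi>)
  qed
  have img: "\<phi> ` ball 0 1 = {x \<in> sphere 0 1. p \<bullet> x > 0}"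
  proof (intro equalityI subsetI)
    fix x assume "x \<in> {x \<in> sphere 0 1. p \<bullet> x > 0}"
    then have "x = \<phi> (\<psi> x)" "\<psi> x \<in> ball 0 1" using \<phi>\<psi>[of x] by auto
    then show "x \<in> \<phi> ` ball 0 1" by (rule image_eqI)
  qed (use \<phi>S in auto)
  have smooth: "smooth_on_open (ball 0 1) \<phi>"
  proof -
    have J': "smooth_on_open (ball 0 1) J"
      using linear_imp_smooth_on_open[OF J(1)] smooth_on_open_subset by blast
    have "smooth_on_open (ball 0 1) (\<lambda>u::real^'n. 1 - u \<bullet> u)"
      by (intro smooth_on_open_diff smooth_on_open_const smooth_on_open_inner smooth_on_open_ident) auto
    then have "smooth_on_open (ball 0 1) (\<lambda>u::real^'n. sqrt (1 - u \<bullet> u))"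
      by (intro smooth_on_open_compose[OF smooth_on_open_sqrt]) (use ball in auto)
    then have "smooth_on_open (ball 0 1) (\<lambda>u. J u + sqrt (1 - u \<bullet> u) *\<^sub>R p)"
      by (intro smooth_on_open_add J' smooth_on_open_scaleR smooth_on_open_const) auto
    then show ?thesis by (simp add: \<phi>_def[abs_def])
  qed
  have "inj (frechet_derivative \<phi> (at u))" if u: "u \<in> ball 0 1" for u
  proof -
    have "((\<lambda>u. \<psi> (\<phi> u)) has_derivative (\<lambda>v. \<psi> (frechet_derivative \<phi> (at u) v))) (at u)"
      using bounded_linear.has_derivative[OF _ smooth_on_open_has_derivative[OF smooth u]] psi_lin linear_linear by blast
    then have "(\<lambda>v. \<psi> (frechet_derivative \<phi> (at u) v)) = (\<lambda>v. v)"
      unfolding \<psi>\<phi> using has_derivative_unique has_derivative_ident by blast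
    then show ?thesis by (intro injI) metis
  qed
  moreover have "homeomorphism (ball 0 1) (\<phi> ` ball 0 1) \<phi> \<psi>"
    unfolding homeomorphism_def
    using \<psi>\<phi> smooth_on_open_continuous_on[OF smooth] continuous_on_linear_compose[OF psi_lin]
    by (auto simp: image_image)
  moreover have "openin (top_of_set (sphere 0 1)) (\<phi> ` ball 0 1)"
  proof -
    have "\<phi> ` ball 0 1 = sphere 0 1 \<inter> {x. p \<bullet> x > 0}" unfolding img by blast
    then show ?thesis using open_halfspace_gt[of 0 p] by (metis openin_open_Int)
  qed
  ultimately have "local_parametrization (sphere 0 1) (ball 0 1) \<phi>"
    using smooth unfolding local_parametrization_def by blast
  then show ?thesis
    using that[of J \<phi>] J img \<phi>_def by blast
qed

lemma embedded_submanifold_sphere: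
  assumes dim: "DIM('a::euclidean_space) = CARD('n::finite) + 1"
  shows "embedded_submanifold TYPE('n) (sphere (0::'a) 1)"
  unfolding embedded_submanifold_def
proof
  fix p :: 'a assume "p \<in> sphere 0 1"
  then have "norm p = 1" by simp
  then obtain \<phi> :: "real^'n \<Rightarrow> 'a" where "local_parametrization (sphere 0 1) (ball 0 1) \<phi>"
    "\<phi> ` ball 0 1 = {x \<in> sphere 0 1. p \<bullet> x > 0}"
    by (rule sphere_graph_chart[OF dim]) (rule that)
  then show "\<exists>U (\<phi> :: real^'n \<Rightarrow> 'a). local_parametrization (sphere 0 1) U \<phi> \<and> p \<in> \<phi> ` U"
    using \<open>norm p = 1\<close> by (intro exI[of _ "ball 0 1"] exI[of _ \<phi>]) (auto simp: dot_square_norm)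
qed

text \<open>In a hemisphere chart centred on the great sphere the set is the graph over a linear hyperplane,
  which is Lebesgue null; finitely many such charts cover it.\<close>

lemma great_sphere_null:
  fixes a :: "'a::euclidean_space"
  assumes dim: "DIM('a) = CARD('n::finite) + 1" and a: "a \<noteq> 0"
    and vol: "is_riemannian_volume TYPE('n) (sphere (0::'a) 1) \<mu>"
  shows "emeasure \<mu> {x \<in> sphere 0 1. a \<bullet> x = 0} = 0"
proof -
  let ?S = "{x \<in> sphere 0 1. a \<bullet> x = 0}"
  have sets: "sets \<mu> = sets (restrict_space borel (sphere (0::'a) 1))" using vol by (simp add: is_riemannian_volume_def)
  have cs: "?S = sphere 0 1 \<inter> {x. a \<bullet> x = 0}" by blast
  have "compact ?S" unfolding cs by (intro compact_Int_closed closed_hyperplane) simp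
  have "\<exists>N\<in>sets \<mu>. emeasure \<mu> N = 0 \<and> {x \<in> ?S. p \<bullet> x > 0} \<subseteq> N" if p: "p \<in> ?S" for p
  proof -
    have np: "norm p = 1" using p by simp
    obtain J :: "real^'n \<Rightarrow> 'a" and \<phi> where J: "linear J" "\<And>u. norm (J u) = norm u" "range J = {x. p \<bullet> x = 0}"
      and \<phi>: "\<phi> = (\<lambda>u. J u + sqrt (1 - u \<bullet> u) *\<^sub>R p)" 
      and lp: "local_parametrization (sphere 0 1) (ball 0 1) \<phi>"
      and img: "\<phi> ` ball 0 1 = {x \<in> sphere 0 1. p \<bullet> x > 0}"
      by (rule sphere_graph_chart[OF dim np]) (rule that)
    have "a \<in> range J" unfolding J(3) using p by (simp add: inner_commute)
    then obtain b where b: "a = J b" by blast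
    have "b \<noteq> 0" using a b linear_0[OF J(1)] by auto
    have inn: "a \<bullet> \<phi> u = b \<bullet> u" for u
    proof -
      have "a \<bullet> \<phi> u = J b \<bullet> J u" unfolding \<phi> using p b by (simp add: inner_add_right)
      then show ?thesis using norm_preserving_inner[OF J(1) subspace_UNIV J(2), of b u] by simp
    qed
    define E where "E = {u. b \<bullet> u = 0} \<inter> ball 0 1"
    have E: "E \<in> sets borel" "E \<subseteq> ball 0 1"
      by (auto simp: E_def intro!: borel_closed closed_hyperplane)
    have "negligible E" unfolding E_def
      using negligible_hyperplane[of b 0] \<open>b \<noteq> 0\<close> by (auto intro: negligible_Int)
    then have null: "E \<in> null_sets lborel"
      using E(1) by (simp add: negligible_iff_null_sets null_sets_def)
    have "emeasure \<mu> (\<phi> ` E) = (\<integral>\<^sup>+u. ennreal (volume_density \<phi> u) * indicator E u \<partial>lborel)"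
      by (rule riemannian_volume_chart[OF vol lp E])
    also have "\<dots> = 0" by (rule nn_integral_null_set[OF null])
    finally have "emeasure \<mu> (\<phi> ` E) = 0" .
    moreover have "{x \<in> ?S. p \<bullet> x > 0} \<subseteq> \<phi> ` E"
    proof
      fix x assume x: "x \<in> {x \<in> ?S. p \<bullet> x > 0}"
      then have "x \<in> \<phi> ` ball 0 1" unfolding img by simp
      then obtain u where "u \<in> ball 0 1" "x = \<phi> u" by blast
      then show "x \<in> \<phi> ` E" using x inn by (auto simp: E_def)
    qed
    moreover have "\<phi> ` E \<in> sets \<mu>" using image_chart_sets[OF lp E] sets by simp
    ultimately show ?thesis by blast
  qed
  then have "\<exists>N. \<forall>p\<in>?S. N p \<in> sets \<mu> \<and> emeasure \<mu> (N p) = 0 \<and> {x \<in> ?S. p \<bullet> x > 0} \<subseteq> N p"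
    by (intro bchoice ballI) blast
  then obtain N where N: "\<And>p. p \<in> ?S \<Longrightarrow> N p \<in> sets \<mu>" "\<And>p. p \<in> ?S \<Longrightarrow> emeasure \<mu> (N p) = 0"
    "\<And>p. p \<in> ?S \<Longrightarrow> {x \<in> ?S. p \<bullet> x > 0} \<subseteq> N p" by blast
  have cov: "?S \<subseteq> (\<Union>p\<in>?S. {x. p \<bullet> x > 0})"
    by (auto simp: dot_square_norm)
  obtain D where D: "D \<subseteq> ?S" "finite D" "?S \<subseteq> (\<Union>p\<in>D. {x. p \<bullet> x > 0})"
    by (rule compactE_image[OF \<open>compact ?S\<close> open_halfspace_gt cov]) (rule that)
  have "?S \<subseteq> (\<Union>p\<in>D. N p)"
  proof
    fix x assume x: "x \<in> ?S"
    then obtain p where "p \<in> D" "p \<bullet> x > 0" using D(3) by blast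
    then show "x \<in> (\<Union>p\<in>D. N p)" using N(3)[of p] D(1) x by blast
  qed
  then have "emeasure \<mu> ?S \<le> emeasure \<mu> (\<Union>p\<in>D. N p)"
    using D N(1) by (intro emeasure_mono sets.finite_UN) auto
  also have "\<dots> \<le> (\<Sum>p\<in>D. emeasure \<mu> (N p))"
    using D N(1) by (intro emeasure_subadditive_finite) auto
  also have "\<dots> = 0" using D N(2) by (intro sum.neutral) auto
  finally show ?thesis by simp
qed

section \<open>Derivative of the determinant\<close>

lemma det_has_real_derivative:
  fixes M :: "real \<Rightarrow> real^'k::finite^'k"
  assumes "\<And>i j. ((\<lambda>s. M s $ i $ j) has_real_derivative M' $ i $ j) (at s)"
  shows "((\<lambda>s. det (M s)) has_real_derivative
           (\<Sum>l\<in>UNIV. det (\<chi> i. if i = l then M' $ l else M s $ i))) (at s)"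
proof -
  have "((\<lambda>s. det (M s)) has_real_derivative
      (\<Sum>p | p permutes (UNIV::'k set). of_int (sign p) * (\<Sum>l\<in>UNIV. M' $ l $ p l * (\<Prod>i\<in>UNIV - {l}. M s $ i $ p i)))) (at s)"
    unfolding det_def
    by (intro DERIV_sum DERIV_cmult has_field_derivative_prod assms)
  also have "(\<Sum>p | p permutes (UNIV::'k set). of_int (sign p) * (\<Sum>l\<in>UNIV. M' $ l $ p l * (\<Prod>i\<in>UNIV - {l}. M s $ i $ p i)))
     = (\<Sum>l\<in>UNIV. det (\<chi> i. if i = l then M' $ l else M s $ i))"
  proof -
    have "(\<Prod>i\<in>UNIV. (\<chi> i. if i = l then M' $ l else M s $ i) $ i $ p i) =
        M' $ l $ p l * (\<Prod>i\<in>UNIV - {l}. M s $ i $ p i)" for l and p :: "'k \<Rightarrow> 'k"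
      by (subst prod.remove[of _ l]) (auto intro!: prod.cong)
    then show ?thesis
      unfolding det_def by (simp only: sum_distrib_left) (subst sum.swap, simp)
  qed
  finally show ?thesis .
qed

lemma det_row_cramer:
  fixes G :: "real^'k::finite^'k"
  assumes "transpose G = G"
  shows "det (\<chi> i. if i = a then G *v z else G $ i) = z $ a * det G"
proof -
  have "(\<chi> i. if i = a then G *v z else G $ i) = transpose (\<chi> i j. if j = a then (G *v z) $ i else G $ i $ j)"
    using assms by (auto simp: transpose_def vec_eq_iff)
  then have "det (\<chi> i. if i = a then G *v z else G $ i) = det (\<chi> i j. if j = a then (G *v z) $ i else G $ i $ j)"
    by (simp only: det_transpose)
  then show ?thesis by (simp only: cramer_lemma)
qed

text \<open>The derivative of the Gram determinant in the direction of the symmetric matrix \<open>h c\<^sup>T + c h\<^sup>T\<close>: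
  by Cramer's rule both summands contribute \<open>h\<^sup>T adj(G) c\<close>.\<close>

lemma det_symmetric_update:
  fixes G :: "real^'k::finite^'k"
  assumes sym: "transpose G = G" and nz: "det G \<noteq> 0"
  shows "(\<Sum>l\<in>UNIV. det (\<chi> i. if i = l then h $ l *s c + c $ l *s h else G $ i))
    = 2 * (\<Sum>l\<in>UNIV. h $ l * det (\<chi> i. if i = l then c else G $ i))"
proof -
  obtain B where B: "G ** B = mat 1" using nz invertible_det_nz invertible_def by blast
  define z w where "z = B *v c" and "w = B *v h"
  have z: "G *v z = c" and w: "G *v w = h"
    by (simp_all add: z_def w_def matrix_vector_mul_assoc B)
  have dc: "det (\<chi> i. if i = l then c else G $ i) = z $ l * det G"
   and dh: "det (\<chi> i. if i = l then h else G $ i) = w $ l * det G" for l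
    by (rule det_row_cramer[OF sym, of l z, unfolded z] det_row_cramer[OF sym, of l w, unfolded w])+
  have "det (\<chi> i. if i = l then h $ l *s c + c $ l *s h else G $ i)
      = h $ l * (z $ l * det G) + c $ l * (w $ l * det G)" for l
    using det_row_add[of l "\<lambda>_. h $ l *s c" "\<lambda>_. c $ l *s h" "\<lambda>i. G $ i"]
      det_row_mul[of l "h $ l" "\<lambda>_. c" "\<lambda>i. G $ i"] det_row_mul[of l "c $ l" "\<lambda>_. h" "\<lambda>i. G $ i"]
    by (simp add: dc dh)
  then have "(\<Sum>l\<in>UNIV. det (\<chi> i. if i = l then h $ l *s c + c $ l *s h else G $ i))
      = det G * (h \<bullet> z) + det G * (c \<bullet> w)"
    by (simp add: inner_vec_def sum.distrib sum_distrib_left mult_ac)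
  also have "c \<bullet> w = h \<bullet> z"
    using dot_lmul_matrix[of z G w] transpose_matrix_vector[of G z] sym z w by (simp add: inner_commute)
  finally show ?thesis
    by (simp add: dc inner_vec_def sum_distrib_left mult_ac)
qed

lemma smooth_on_open_prod:
  fixes f :: "'i \<Rightarrow> 'a::euclidean_space \<Rightarrow> real"
  assumes "open S" "\<And>i. i \<in> I \<Longrightarrow> smooth_on_open S (f i)"
  shows "smooth_on_open S (\<lambda>x. \<Prod>i\<in>I. f i x)"
proof (cases "finite I")
  case True
  then show ?thesis using assms(2)
  proof (induction I rule: finite_induct)
    case (insert i I)
    have 1: "smooth_on_open S (f i)" by (rule insert.prems) simp
    have 2: "smooth_on_open S (\<lambda>x. \<Prod>j\<in>I. f j x)" by (rule insert.IH) (rule insert.prems, simp)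
    show ?case unfolding prod.insert[OF insert.hyps] by (rule smooth_on_open_mult[OF 1 2])
  qed (simp add: smooth_on_open_const assms(1))
qed (simp add: smooth_on_open_const assms(1))

lemma smooth_on_open_sum:
  assumes "open S" "\<And>i. i \<in> I \<Longrightarrow> smooth_on_open S (f i)"
  shows "smooth_on_open S (\<lambda>x. \<Sum>i\<in>I. f i x)"
  unfolding smooth_on_open_def
proof (intro conjI allI)
  show "times_differentiable_on m (\<lambda>x. \<Sum>i\<in>I. f i x) S" for m
    by (rule times_differentiable_on_sum[OF assms(1)]) (use assms(2) smooth_on_open_def in blast)
qed (rule assms(1))

lemma smooth_on_open_det:
  fixes A :: "'a::euclidean_space \<Rightarrow> real^'k::finite^'k"
  assumes "open S" "\<And>i j. smooth_on_open S (\<lambda>x. A x $ i $ j)"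
  shows "smooth_on_open S (\<lambda>x. det (A x))"
  unfolding det_def
  by (rule smooth_on_open_sum[OF assms(1)])
    (rule smooth_on_open_mult[OF smooth_on_open_const[OF assms(1)] smooth_on_open_prod[OF assms(1) assms(2)]])

lemma smooth_on_open_powr: "smooth_on_open {0<..} (\<lambda>y::real. y powr a)"
proof -
  have "smooth_on_open {0<..} ((\<lambda>j y. (\<Prod>i<j. (a - real i)) * y powr (a - real j)) 0)"
  proof (rule smooth_on_open_derivative_chain)
    fix j :: nat and y :: real assume "y \<in> {0<..}"
    then have "((\<lambda>y. (\<Prod>i<j. (a - real i)) * y powr (a - real j)) has_real_derivative
        (\<Prod>i<j. (a - real i)) * ((a - real j) * y powr (a - real j - 1))) (at y)"
      by (intro DERIV_cmult has_real_derivative_powr) simp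
    moreover have "a - real j - 1 = a - real (Suc j)" by simp
    ultimately show "((\<lambda>y. (\<Prod>i<j. (a - real i)) * y powr (a - real j)) has_real_derivative
        (\<Prod>i<Suc j. (a - real i)) * y powr (a - real (Suc j))) (at y)"
      unfolding prod.lessThan_Suc mult.assoc by (rule back_subst[where P = "\<lambda>r. (_ has_real_derivative _ * (_ * y powr r)) (at y)"])
  qed (rule open_greaterThan)
  then show ?thesis by (simp only: lessThan_0 prod.empty of_nat_0 diff_zero mult_1_left)
qed

section \<open>Integrals of derivatives\<close>

text \<open>Translation invariance of \<open>lborel\<close> makes the integral of every difference quotient vanish.\<close>

lemma integral_directional_derivative:
  fixes f :: "'a::euclidean_space \<Rightarrow> real"
  assumes der: "\<And>x. (f has_derivative f' x) (at x)" and cont: "continuous_on UNIV (\<lambda>x. f' x v)"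
    and C: "bounded C" "\<And>x. x \<notin> C \<Longrightarrow> f x = 0"
  shows "(LINT x|lborel. f' x v) = 0" "integrable lborel (\<lambda>x. f' x v)"
proof -
  obtain R0 where "C \<subseteq> ball 0 R0" using bounded_subset_ballD[OF C(1), of 0] by auto
  then have R0: "C \<subseteq> cball 0 R0" using ball_subset_cball[of 0 R0] by (rule subset_trans)
  define R where "R = R0 + norm v + 1"
  have supp: "f x = 0" if "x \<notin> cball 0 R0" for x using C(2) R0 that by blast
  have f': "f' x v = 0" if "x \<notin> cball 0 R0" for x
  proof -
    have "((\<lambda>x. 0) has_derivative (\<lambda>x. 0)) (at x)" by (rule has_derivative_const)
    then have "(f has_derivative (\<lambda>x. 0)) (at x)"
      by (rule has_derivative_transform_within_open[of _ _ _ _ "- cball 0 R0"]) (use that supp in auto)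
    then have "f' x = (\<lambda>x. 0)" using der has_derivative_unique by blast
    then show ?thesis by simp
  qed
  have "compact ((\<lambda>x. f' x v) ` cball 0 R0)"
    by (intro compact_continuous_image continuous_on_subset[OF cont]) auto
  from compact_imp_bounded[OF this] obtain B where "B > 0" "\<And>x. x \<in> cball 0 R0 \<Longrightarrow> norm (f' x v) \<le> B"
    unfolding bounded_pos by auto
  then have B: "norm (f' x v) \<le> B" for x using f' by (cases "x \<in> cball 0 R0") auto
  have lin: "linear (f' x)" for x using der has_derivative_linear by blast
  have contf: "continuous_on UNIV f"
    using der has_derivative_continuous continuous_at_imp_continuous_on by blast
  have mv: "norm (f (x + h *\<^sub>R v) - f x) \<le> B * h" if "h \<ge> 0" for x h
  proof -
    have "norm (f (x + h *\<^sub>R v) - f (x + 0 *\<^sub>R v)) \<le> B * norm (h - 0)"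
    proof (rule differentiable_bound[of "{0..h}" "\<lambda>t. f (x + t *\<^sub>R v)" "\<lambda>t d. d * f' (x + t *\<^sub>R v) v" B h 0])
      fix t assume "t \<in> {0..h}"
      have g: "((\<lambda>t. x + t *\<^sub>R v) has_derivative (\<lambda>d. d *\<^sub>R v)) (at t within {0..h})"
        by (auto intro!: derivative_eq_intros)
      show "((\<lambda>t. f (x + t *\<^sub>R v)) has_derivative (\<lambda>d. d * f' (x + t *\<^sub>R v) v)) (at t within {0..h})"
        using has_derivative_compose[OF g der] by (simp add: linear_scale[OF lin])
      show "onorm (\<lambda>d. d * f' (x + t *\<^sub>R v) v) \<le> B"
      proof (rule onorm_le)
        fix d
        have "norm (d * f' (x + t *\<^sub>R v) v) = norm (f' (x + t *\<^sub>R v) v) * norm d"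
          by (simp add: abs_mult)
        also have "\<dots> \<le> B * norm d" by (rule mult_right_mono[OF B]) simp
        finally show "norm (d * f' (x + t *\<^sub>R v) v) \<le> B * norm d" .
      qed
    qed (use that in auto)
    then show ?thesis using that by simp
  qed
  define q where "q n x = real (Suc n) * (f (x + (1 / real (Suc n)) *\<^sub>R v) - f x)" for n x
  have lim: "(\<lambda>n. q n x) \<longlonglongrightarrow> f' x v" for x
  proof -
    have g: "((\<lambda>t. x + t *\<^sub>R v) has_derivative (\<lambda>d. d *\<^sub>R v)) (at 0)"
      by (auto intro!: derivative_eq_intros)
    have "((\<lambda>t. f (x + t *\<^sub>R v)) has_derivative (\<lambda>d. f' x v * d)) (at 0)"
      using has_derivative_compose[OF g, of f "f' x"] der[of x] by (simp add: linear_scale[OF lin] mult.commute)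
    then have "((\<lambda>t. f (x + t *\<^sub>R v)) has_real_derivative f' x v) (at 0)"
      by (simp add: has_field_derivative_def)
    then have *: "((\<lambda>h. (f (x + h *\<^sub>R v) - f x) / h) \<longlongrightarrow> f' x v) (at 0)"
      by (simp add: has_field_derivative_iff)
    have "filterlim (\<lambda>n. 1 / real (Suc n)) (at 0) sequentially"
      using LIMSEQ_inverse_real_of_nat by (auto simp: filterlim_at inverse_eq_divide)
    from filterlim_compose[OF * this] show ?thesis by (simp add: q_def mult.commute)
  qed
  have bint: "integrable lborel (\<lambda>x. indicator (cball 0 R) x *\<^sub>R g x)" if "continuous_on UNIV g" for g :: "'a \<Rightarrow> real"
    using that by (intro borel_integrable_compact continuous_on_subset[OF that]) auto
  have ind: "indicator (cball 0 R) x *\<^sub>R g x = g x" if "\<And>x. x \<notin> cball 0 R \<Longrightarrow> g x = 0" for g :: "'a \<Rightarrow> real" and x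
    using that by (auto simp: indicator_def)
  have R0R: "R0 \<le> R" by (simp add: R_def)
  have "(\<lambda>x. indicator (cball 0 R) x *\<^sub>R f x) = f"
    by (rule ext, rule ind) (use supp R0R in auto)
  with bint[OF contf] have intf: "integrable lborel f" by (simp only:)
  have "(\<lambda>x. indicator (cball 0 R) x *\<^sub>R f' x v) = (\<lambda>x. f' x v)"
    by (rule ext, rule ind) (use f' R0R in auto)
  with bint[OF cont] show int: "integrable lborel (\<lambda>x. f' x v)" by (simp only:)
  have tr: "integrable lborel (\<lambda>x. f (x + c))" "(LINT x|lborel. f (x + c)) = (LINT x|lborel. f x)" for c
  proof -
    have [measurable]: "f \<in> borel_measurable borel" using contf by (rule borel_measurable_continuous_onI)
    have "integrable (distr lborel borel ((+) c)) f" unfolding lborel_distr_plus by (rule intf)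
    then show "integrable lborel (\<lambda>x. f (x + c))" by (simp add: integrable_distr_eq add.commute)
    have "(LINT x|distr lborel borel ((+) c). f x) = (LINT x|lborel. f (c + x))"
      by (rule integral_distr) auto
    then show "(LINT x|lborel. f (x + c)) = (LINT x|lborel. f x)"
      unfolding lborel_distr_plus by (simp add: add.commute)
  qed
  have q0: "(LINT x|lborel. q n x) = 0" "integrable lborel (q n)" for n
    unfolding q_def using tr intf by (auto simp: Bochner_Integration.integral_diff)
  have "(\<lambda>n. LINT x|lborel. q n x) \<longlonglongrightarrow> (LINT x|lborel. f' x v)"
  proof (rule integral_dominated_convergence[where w = "\<lambda>x. indicator (cball 0 R) x *\<^sub>R B"])
    show "(\<lambda>x. f' x v) \<in> borel_measurable lborel" using int by auto
    show "q n \<in> borel_measurable lborel" for n using q0(2)[of n] by auto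
    show "integrable lborel (\<lambda>x. indicator (cball (0::'a) R) x *\<^sub>R B)" by (rule bint) simp
    show "AE x in lborel. (\<lambda>n. q n x) \<longlonglongrightarrow> f' x v" using lim by simp
    show "AE x in lborel. norm (q n x) \<le> indicator (cball 0 R) x *\<^sub>R B" for n
    proof (rule AE_I2)
      fix x :: 'a
      have h: "0 \<le> 1 / real (Suc n)" "1 / real (Suc n) \<le> 1" by auto
      show "norm (q n x) \<le> indicator (cball 0 R) x *\<^sub>R B"
      proof (cases "x \<in> cball 0 R")
        case True
        have "norm (q n x) = real (Suc n) * norm (f (x + (1 / real (Suc n)) *\<^sub>R v) - f x)"
          by (simp add: q_def abs_mult)
        also have "\<dots> \<le> real (Suc n) * (B * (1 / real (Suc n)))" by (intro mult_left_mono mv) auto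
        finally show ?thesis using True by simp
      next
        case False
        have "norm ((1 / real (Suc n)) *\<^sub>R v) \<le> norm v"
          unfolding norm_scaleR using mult_left_le_one_le[OF norm_ge_zero[of v] h] by simp
        then have "norm (x + (1 / real (Suc n)) *\<^sub>R v) > R0"
          using False norm_diff_ineq[of x "(1 / real (Suc n)) *\<^sub>R v"] by (simp add: R_def)
        moreover have "norm x > R0" using False R0R by simp
        ultimately have "q n x = 0" unfolding q_def using supp by simp
        then show ?thesis using False by simp
      qed
    qed
  qed
  then show "(LINT x|lborel. f' x v) = 0"
    unfolding q0(1) using LIMSEQ_unique[OF tendsto_const] by metis
qed

section \<open>Rotations in a plane\<close>

text \<open>The generator of the rotations \<open>plane_rot a b\<close>, for orthonormal \<open>a\<close> and \<open>b\<close>.\<close>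

definition plane_gen :: "'a::real_inner \<Rightarrow> 'a \<Rightarrow> 'a \<Rightarrow> 'a" where
  "plane_gen a b x = (a \<bullet> x) *\<^sub>R b - (b \<bullet> x) *\<^sub>R a"

definition plane_rot :: "'a::real_inner \<Rightarrow> 'a \<Rightarrow> real \<Rightarrow> 'a \<Rightarrow> 'a" where
  "plane_rot a b t x = x + (cos t - 1) *\<^sub>R ((a \<bullet> x) *\<^sub>R a + (b \<bullet> x) *\<^sub>R b) + sin t *\<^sub>R plane_gen a b x"

context
  fixes a b :: "'a::euclidean_space"
  assumes ab: "norm a = 1" "norm b = 1" "a \<bullet> b = 0"
begin

lemma plane_inner: "a \<bullet> a = 1" "b \<bullet> b = 1" "b \<bullet> a = 0" "a \<bullet> b = 0"
  using ab by (simp_all add: dot_square_norm inner_commute)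

lemma linear_plane_gen: "linear (plane_gen a b)"
  by (rule linearI) (simp_all add: plane_gen_def inner_add_right algebra_simps)

lemma linear_plane_rot: "linear (plane_rot a b t)"
  by (rule linearI) (simp_all add: plane_rot_def plane_gen_def inner_add_right algebra_simps)

lemma plane_gen_skew: "plane_gen a b x \<bullet> y = - (x \<bullet> plane_gen a b y)"
  by (simp add: plane_gen_def inner_diff_left inner_diff_right inner_commute)

lemma plane_rot_0: "plane_rot a b 0 x = x"
  by (simp add: plane_rot_def)

lemma plane_rot_inner: "plane_rot a b t x \<bullet> plane_rot a b t y = x \<bullet> y"
proof -
  define c s where "c = cos t" and "s = sin t"
  have cs: "s * s = 1 - c * c" using sin_squared_eq[of t] by (simp add: c_def s_def power2_eq_square)
  have "plane_rot a b t x \<bullet> plane_rot a b t y = x \<bullet> y +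
     (2 * (c - 1) + (c - 1) * (c - 1) + s * s) * ((a \<bullet> x) * (a \<bullet> y) + (b \<bullet> x) * (b \<bullet> y))"
    unfolding plane_rot_def plane_gen_def c_def[symmetric] s_def[symmetric]
    by (simp add: inner_add_left inner_add_right inner_diff_left inner_diff_right plane_inner
        inner_commute[of x a] inner_commute[of x b] algebra_simps)
  also have "2 * (c - 1) + (c - 1) * (c - 1) + s * s = 0" unfolding cs by (simp add: algebra_simps)
  finally show ?thesis by simp
qed

lemma orthogonal_plane_rot: "orthogonal_transformation (plane_rot a b t)"
  by (simp add: orthogonal_transformation_def linear_plane_rot plane_rot_inner)

lemma norm_plane_rot: "norm (plane_rot a b t x) = norm x"
  by (simp add: norm_eq_sqrt_inner plane_rot_inner)

lemma norm_plane_gen: "norm (plane_gen a b x) \<le> norm x"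
proof -
  have gg: "(norm (plane_gen a b x))\<^sup>2 = (a \<bullet> x)\<^sup>2 + (b \<bullet> x)\<^sup>2"
    unfolding power2_norm_eq_inner unfolding plane_gen_def power2_eq_square
    by (simp add: inner_diff_left inner_diff_right plane_inner)
  let ?y = "x - (a \<bullet> x) *\<^sub>R a - (b \<bullet> x) *\<^sub>R b"
  have "0 \<le> ?y \<bullet> ?y" by simp
  also have "?y \<bullet> ?y = (norm x)\<^sup>2 - ((a \<bullet> x)\<^sup>2 + (b \<bullet> x)\<^sup>2)"
    unfolding power2_norm_eq_inner unfolding power2_eq_square
    by (simp add: inner_diff_left inner_diff_right plane_inner
        inner_commute[of x a] inner_commute[of x b] algebra_simps)
  finally show ?thesis using gg by (metis diff_ge_0_iff_ge norm_ge_zero power2_le_imp_le)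
qed

lemma plane_rot_has_derivative:
  "((\<lambda>t. plane_rot a b t x) has_vector_derivative plane_rot a b t (plane_gen a b x)) (at t)"
proof -
  have "plane_rot a b t (plane_gen a b x) =
      (- sin t) *\<^sub>R ((a \<bullet> x) *\<^sub>R a + (b \<bullet> x) *\<^sub>R b) + cos t *\<^sub>R plane_gen a b x"
    by (simp add: plane_rot_def plane_gen_def inner_diff_right plane_inner algebra_simps)
  moreover have "((\<lambda>t. plane_rot a b t x) has_vector_derivative
      (- sin t) *\<^sub>R ((a \<bullet> x) *\<^sub>R a + (b \<bullet> x) *\<^sub>R b) + cos t *\<^sub>R plane_gen a b x) (at t)"
    unfolding plane_rot_def has_vector_derivative_def
    by (auto intro!: derivative_eq_intros simp: algebra_simps)
  ultimately show ?thesis by simp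
qed

lemma plane_rot_diff: "norm (plane_rot a b s x - plane_rot a b t x) \<le> \<bar>s - t\<bar> * norm x"
proof -
  have "norm (plane_rot a b s x - plane_rot a b t x) \<le> norm x * norm (s - t)"
  proof (rule differentiable_bound[of UNIV _ "\<lambda>t d. d *\<^sub>R plane_rot a b t (plane_gen a b x)"])
    fix t :: real
    show "((\<lambda>t. plane_rot a b t x) has_derivative (\<lambda>d. d *\<^sub>R plane_rot a b t (plane_gen a b x))) (at t within UNIV)"
      using plane_rot_has_derivative[of x t] by (simp add: has_vector_derivative_def)
    show "onorm (\<lambda>d. d *\<^sub>R plane_rot a b t (plane_gen a b x)) \<le> norm x"
    proof (rule onorm_le)
      fix d
      have "norm (d *\<^sub>R plane_rot a b t (plane_gen a b x)) = norm (plane_gen a b x) * norm d"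
        by (simp add: norm_plane_rot)
      also have "\<dots> \<le> norm x * norm d" by (rule mult_right_mono[OF norm_plane_gen]) simp
      finally show "norm (d *\<^sub>R plane_rot a b t (plane_gen a b x)) \<le> norm x * norm d" .
    qed
  qed auto
  then show ?thesis by (simp add: mult.commute)
qed

end

section \<open>First variation\<close>

lemma smooth_real_lipschitz:
  fixes f :: "real \<Rightarrow> real"
  assumes "smooth_on_open UNIV f"
  obtains L where "L > 0" "\<And>x y. x \<in> {a..b} \<Longrightarrow> y \<in> {a..b} \<Longrightarrow> \<bar>f x - f y\<bar> \<le> L * \<bar>x - y\<bar>"
proof -
  let ?D = "\<lambda>x. frechet_derivative f (at x)"
  have der: "(f has_derivative ?D x) (at x)" for x
    by (rule smooth_on_open_has_derivative[OF assms]) simp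
  have "continuous_on UNIV (\<lambda>x. ?D x 1)"
    by (rule smooth_on_open_continuous_on[OF smooth_on_open_frechet_derivative[OF assms]])
  then have "compact ((\<lambda>x. ?D x 1) ` {a..b})"
    by (intro compact_continuous_image) (auto intro: continuous_on_subset)
  from compact_imp_bounded[OF this] obtain L where L: "L > 0" "\<And>x. x \<in> {a..b} \<Longrightarrow> \<bar>?D x 1\<bar> \<le> L"
    unfolding bounded_pos by auto
  have on: "onorm (?D x) \<le> L" if "x \<in> {a..b}" for x
  proof (rule onorm_le)
    fix d :: real
    have "?D x (d *\<^sub>R 1) = d *\<^sub>R ?D x 1"
      by (rule linear_scale[OF has_derivative_linear[OF der]])
    then have "norm (?D x d) = \<bar>?D x 1\<bar> * norm d" by (simp add: abs_mult)
    also have "\<dots> \<le> L * norm d" by (rule mult_right_mono[OF L(2)[OF that]]) simp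
    finally show "norm (?D x d) \<le> L * norm d" .
  qed
  show ?thesis
  proof (rule that[OF L(1)])
    fix x y assume "x \<in> {a..b}" "y \<in> {a..b}"
    then have "norm (f x - f y) \<le> L * norm (x - y)"
      by (intro differentiable_bound[of "{a..b}" f ?D L x y]) (auto intro: has_derivative_at_withinI der on)
    then show "\<bar>f x - f y\<bar> \<le> L * \<bar>x - y\<bar>" by simp
  qed
qed

lemma has_derivative_line:
  assumes "(f has_derivative f') (at (x::'a::real_normed_vector))"
  shows "((\<lambda>t. f (x + t *\<^sub>R v)) has_vector_derivative f' v) (at 0)"
proof -
  have g: "((\<lambda>t. x + t *\<^sub>R v) has_derivative (\<lambda>d. d *\<^sub>R v)) (at 0)"
    by (auto intro!: derivative_eq_intros)
  have "((\<lambda>t. f (x + t *\<^sub>R v)) has_derivative (\<lambda>d. f' (d *\<^sub>R v))) (at 0)"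
    using has_derivative_compose[OF g, of f f'] assms by simp
  then show ?thesis
    by (simp add: has_vector_derivative_def linear_scale[OF has_derivative_linear[OF assms]])
qed

lemma sqrt_diff_bound:
  assumes "a \<ge> 0" "b > 0"
  shows "\<bar>sqrt a - sqrt b\<bar> \<le> \<bar>a - b\<bar> / sqrt b"
proof -
  have "(sqrt a - sqrt b) * (sqrt a + sqrt b) = a - b"
    using assms by (simp add: algebra_simps)
  then have "\<bar>a - b\<bar> = \<bar>sqrt a - sqrt b\<bar> * (sqrt a + sqrt b)"
    using assms by (metis abs_mult abs_of_nonneg add_nonneg_nonneg less_imp_le real_sqrt_ge_zero)
  also have "\<dots> \<ge> \<bar>sqrt a - sqrt b\<bar> * sqrt b"
    using assms by (intro mult_left_mono) auto
  finally show ?thesis using assms by (simp add: field_simps)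
qed

text \<open>A chart of \<open>X\<close> that is infinitesimally isometric at its centre, and a unit vector \<open>\<nu>\<close> normal to
  \<open>X\<close> and tangent to the sphere there, in whose direction the mean curvature is to be tested.

  \<open>A\<close> is the Killing field of the rotation in the plane of \<open>\<phi> 0\<close> and \<open>\<nu>\<close>, with value \<open>\<nu>\<close> at \<open>\<phi> 0\<close>, and \<open>F \<tau> s\<close>
  rotates by the angle \<open>s \<eta> \<tau> x\<close>. By Cramer's rule \<open>w i\<close> is the \<open>i\<close>-th coordinate of the tangential
  part of \<open>A\<close> times the volume density, so that the sum of the \<open>Dw i\<close> is the divergence of this part,
  times the density; \<open>h\<close> is the differential of the cut-off function.\<close>

locale critical_chart =
  fixes X :: "'a::euclidean_space set" and U :: "(real^'k::finite) set" and \<phi> :: "real^'k \<Rightarrow> 'a" and \<nu> :: 'a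
  assumes emb: "embedded_submanifold TYPE('k) X" and compact: "compact X" and sph: "X \<subseteq> sphere 0 1"
    and critical: "volume_critical TYPE('k) (sphere 0 1) X"
    and lp: "local_parametrization X U \<phi>" and U0: "0 \<in> U"
    and orth: "gram (frechet_derivative \<phi> (at 0)) = mat 1"
    and \<nu>: "norm \<nu> = 1" "\<nu> \<bullet> \<phi> 0 = 0" "\<And>v. \<nu> \<bullet> frechet_derivative \<phi> (at 0) v = 0"
begin

abbreviation D\<phi> :: "real^'k \<Rightarrow> real^'k \<Rightarrow> 'a" where "D\<phi> u \<equiv> frechet_derivative \<phi> (at u)"
definition A :: "'a \<Rightarrow> 'a" where "A = plane_gen (\<phi> 0) \<nu>"
definition c :: "real^'k \<Rightarrow> real^'k" where "c u = (\<chi> i. D\<phi> u (axis i 1) \<bullet> A (\<phi> u))"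
definition w :: "'k \<Rightarrow> real^'k \<Rightarrow> real" where
  "w i u = det (\<chi> l. if l = i then c u else gram (D\<phi> u) $ l) * det (gram (D\<phi> u)) powr (-1/2)"
definition \<eta> :: "real \<Rightarrow> 'a \<Rightarrow> real" where "\<eta> \<tau> x = flat_bump (\<phi> 0 \<bullet> x - \<tau>)"
definition h :: "real \<Rightarrow> real^'k \<Rightarrow> real^'k \<Rightarrow> real" where
  "h \<tau> u = frechet_derivative (\<lambda>u. \<eta> \<tau> (\<phi> u)) (at u)"
definition Dw :: "'k \<Rightarrow> real^'k \<Rightarrow> real" where "Dw i u = frechet_derivative (w i) (at u) (axis i 1)"
definition F :: "real \<Rightarrow> real \<Rightarrow> 'a \<Rightarrow> 'a" where "F \<tau> s x = plane_rot (\<phi> 0) \<nu> (s * \<eta> \<tau> x) x"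

lemma X0: "\<phi> 0 \<in> X" using local_parametrization_image_subset[OF lp] U0 by blast

lemma n0: "norm (\<phi> 0) = 1" "norm \<nu> = 1" "\<phi> 0 \<bullet> \<nu> = 0"
proof -
  have "\<phi> 0 \<in> sphere 0 1" using X0 sph by (rule subsetD[rotated])
  then show "norm (\<phi> 0) = 1" by simp
  show "norm \<nu> = 1" by (rule \<nu>(1))
  show "\<phi> 0 \<bullet> \<nu> = 0" using \<nu>(2) by (rule inner_commute[THEN trans])
qed

lemma openU: "open U" by (rule local_parametrization_open[OF lp])

lemma smooth\<phi>: "smooth_on_open U \<phi>" using lp by (simp add: local_parametrization_def)

lemma linA: "linear A" unfolding A_def by (rule linear_plane_gen[OF n0])

lemma smoothA: "smooth_on_open U (\<lambda>u. A (\<phi> u))"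
  by (rule smooth_on_open_linear[OF _ smooth\<phi>]) (use linA linear_linear in blast)

lemma smooth_c: "smooth_on_open U (\<lambda>u. c u $ i)"
  unfolding c_def vec_lambda_beta
  by (rule smooth_on_open_inner[OF smooth_on_open_frechet_derivative[OF smooth\<phi>] smoothA])

lemma smooth_gram: "smooth_on_open U (\<lambda>u. gram (D\<phi> u) $ i $ j)"
  unfolding gram_def vec_lambda_beta
  by (rule smooth_on_open_inner[OF smooth_on_open_frechet_derivative[OF smooth\<phi>]
        smooth_on_open_frechet_derivative[OF smooth\<phi>]])

lemma J_pos: "u \<in> U \<Longrightarrow> det (gram (D\<phi> u)) > 0"
  using det_gram_pos[OF local_parametrization_linear[OF lp]] lp by (simp add: local_parametrization_def)

lemma smooth_J: "smooth_on_open U (\<lambda>u. det (gram (D\<phi> u)))"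
  by (rule smooth_on_open_det[OF openU smooth_gram])

lemma smooth_row: "smooth_on_open U (\<lambda>u. (\<chi> l. if l = i then c u else gram (D\<phi> u) $ l) $ m $ j)"
  by (cases "m = i") (simp_all add: smooth_c smooth_gram)

lemma smooth_w: "smooth_on_open U (w i)"
proof -
  have "smooth_on_open U (\<lambda>u. det (gram (D\<phi> u)) powr (-1/2))"
    by (rule smooth_on_open_compose[OF smooth_on_open_powr smooth_J]) (use J_pos in auto)
  from smooth_on_open_mult[OF smooth_on_open_det[OF openU smooth_row[of i]] this]
  have "smooth_on_open U (\<lambda>u. w i u)" unfolding w_def .
  then show ?thesis .
qed

lemma smooth_\<eta>: "smooth_on_open UNIV (\<eta> \<tau>)"
proof -
  have "smooth_on_open UNIV (\<lambda>x. flat_bump (\<phi> 0 \<bullet> x - \<tau>))"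
    by (intro smooth_on_open_compose[OF smooth_on_open_flat_bump] smooth_on_open_diff
        smooth_on_open_inner smooth_on_open_const smooth_on_open_ident) auto
  then show ?thesis by (simp add: \<eta>_def[abs_def])
qed

lemma smooth_\<eta>\<phi>: "smooth_on_open U (\<lambda>u. \<eta> \<tau> (\<phi> u))"
  by (rule smooth_on_open_compose[OF smooth_\<eta> smooth\<phi>]) simp

lemma h_der: "u \<in> U \<Longrightarrow> ((\<lambda>u. \<eta> \<tau> (\<phi> u)) has_derivative h \<tau> u) (at u)"
  unfolding h_def by (rule smooth_on_open_has_derivative[OF smooth_\<eta>\<phi>])

lemma h_cont: "continuous_on U (\<lambda>u. h \<tau> u v)"
  unfolding h_def
  by (rule smooth_on_open_continuous_on[OF smooth_on_open_frechet_derivative[OF smooth_\<eta>\<phi>]])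

lemma Dw_cont: "continuous_on U (Dw i)"
  using smooth_on_open_continuous_on[OF smooth_on_open_frechet_derivative[OF smooth_w, of i "axis i 1"]]
  by (simp add: Dw_def[abs_def])

lemma divergence_integral:
  assumes R: "0 < r" "r < R" "cball 0 R \<subseteq> U" and supp: "\<And>u. u \<in> U \<Longrightarrow> r \<le> norm u \<Longrightarrow> \<eta> \<tau> (\<phi> u) = 0"
  shows "(LINT u|lborel. indicator (ball 0 R) u *
            (h \<tau> u (axis i 1) * w i u + \<eta> \<tau> (\<phi> u) * Dw i u)) = 0"
    and "integrable lborel (\<lambda>u. indicator (ball 0 R) u *
            (h \<tau> u (axis i 1) * w i u + \<eta> \<tau> (\<phi> u) * Dw i u))"
proof -
  let ?e = "\<lambda>u. \<eta> \<tau> (\<phi> u)" and ?w' = "\<lambda>u. frechet_derivative (w i) (at u)"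
  define f where "f u = (if u \<in> U then ?e u * w i u else 0)" for u
  define f' where "f' u = (if u \<in> U then (\<lambda>v. ?e u * ?w' u v + h \<tau> u v * w i u) else (\<lambda>_. 0))" for u
  have rR: "cball 0 r \<subseteq> U" using R by auto
  have out: "f u = 0" if "u \<notin> cball 0 r" for u using that supp by (auto simp: f_def)
  have der_out: "(f has_derivative (\<lambda>_. 0)) (at u)" if "u \<notin> cball 0 r" for u
    by (rule has_derivative_transform_within_open[OF has_derivative_const[of 0], of "- cball 0 r"])
      (use that out in auto)
  have der: "(f has_derivative f' u) (at u)" for u
  proof (cases "u \<in> U")
    case True
    have "((\<lambda>u. ?e u * w i u) has_derivative (\<lambda>v. ?e u * ?w' u v + h \<tau> u v * w i u)) (at u)"
      by (rule has_derivative_mult[OF h_der[OF True] smooth_on_open_has_derivative[OF smooth_w True]])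
    then have "(f has_derivative (\<lambda>v. ?e u * ?w' u v + h \<tau> u v * w i u)) (at u)"
      by (rule has_derivative_transform_within_open[OF _ openU True]) (simp add: f_def)
    then show ?thesis using True by (simp add: f'_def)
  next
    case False
    then have "u \<notin> cball 0 r" using rR by blast
    then show ?thesis using der_out False by (simp add: f'_def)
  qed
  have f'_out: "f' u v = 0" if "u \<notin> cball 0 r" for u v
    using has_derivative_unique[OF der der_out[OF that]] by simp
  have "continuous_on (U \<union> - cball 0 r) (\<lambda>u. f' u (axis i 1))"
  proof (rule continuous_on_open_Un[OF openU])
    have "continuous_on U (\<lambda>u. ?e u * Dw i u + h \<tau> u (axis i 1) * w i u)"
      by (intro continuous_intros Dw_cont h_cont smooth_on_open_continuous_on[OF smooth_w]
          smooth_on_open_continuous_on[OF smooth_\<eta>\<phi>])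
    then show "continuous_on U (\<lambda>u. f' u (axis i 1))"
      by (rule continuous_on_cong[THEN iffD1, rotated -1]) (auto simp: f'_def Dw_def)
    show "continuous_on (- cball 0 r) (\<lambda>u. f' u (axis i 1))"
      by (rule continuous_on_cong[THEN iffD1, rotated -1, OF continuous_on_const[of _ 0]]) (auto simp: f'_out)
  qed auto
  moreover have "U \<union> - cball 0 r = UNIV" using rR by blast
  ultimately have cont: "continuous_on UNIV (\<lambda>u. f' u (axis i 1))" by simp
  have eq: "(\<lambda>u. indicator (ball 0 R) u * (h \<tau> u (axis i 1) * w i u + \<eta> \<tau> (\<phi> u) * Dw i u))
      = (\<lambda>u. f' u (axis i 1))"
  proof
    fix u
    show "indicator (ball 0 R) u * (h \<tau> u (axis i 1) * w i u + \<eta> \<tau> (\<phi> u) * Dw i u) = f' u (axis i 1)"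
    proof (cases "u \<in> ball 0 R")
      case True
      then have "u \<in> U" using R(3) ball_subset_cball by blast
      then show ?thesis using True by (simp add: f'_def Dw_def)
    next
      case False
      then have "u \<notin> cball 0 r" using R by auto
      then show ?thesis using False f'_out by simp
    qed
  qed
  have "bounded (cball (0::real^'k) r)" by (rule bounded_cball)
  from integral_directional_derivative[OF der cont this out]
  show "(LINT u|lborel. indicator (ball 0 R) u *
            (h \<tau> u (axis i 1) * w i u + \<eta> \<tau> (\<phi> u) * Dw i u)) = 0"
    and "integrable lborel (\<lambda>u. indicator (ball 0 R) u *
            (h \<tau> u (axis i 1) * w i u + \<eta> \<tau> (\<phi> u) * Dw i u))"
    unfolding eq by auto
qed

lemma smooth_F: "smooth_on_open UNIV (\<lambda>p. F \<tau> (fst p) (snd p))"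
proof -
  have fst: "smooth_on_open UNIV (\<lambda>p::real \<times> 'a. fst p)"
    by (rule smooth_on_open_linear[OF bounded_linear_fst smooth_on_open_ident]) simp
  have snd: "smooth_on_open UNIV (\<lambda>p::real \<times> 'a. snd p)"
    by (rule smooth_on_open_linear[OF bounded_linear_snd smooth_on_open_ident]) simp
  have sig: "smooth_on_open UNIV (\<lambda>p::real \<times> 'a. fst p * \<eta> \<tau> (snd p))"
    by (rule smooth_on_open_mult[OF fst smooth_on_open_compose[OF smooth_\<eta> snd]]) simp
  have cos: "smooth_on_open UNIV (\<lambda>p::real \<times> 'a. cos (fst p * \<eta> \<tau> (snd p)) - 1)"
    by (intro smooth_on_open_diff smooth_on_open_const smooth_on_open_compose[OF smooth_on_open_cos sig]) auto
  have sin: "smooth_on_open UNIV (\<lambda>p::real \<times> 'a. sin (fst p * \<eta> \<tau> (snd p)))"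
    by (rule smooth_on_open_compose[OF smooth_on_open_sin sig]) simp
  have lin1: "linear (\<lambda>x. (\<phi> 0 \<bullet> x) *\<^sub>R \<phi> 0 + (\<nu> \<bullet> x) *\<^sub>R \<nu>)"
    by (rule linearI) (simp_all add: inner_add_right algebra_simps)
  then have l1: "smooth_on_open UNIV (\<lambda>p::real \<times> 'a. (\<phi> 0 \<bullet> snd p) *\<^sub>R \<phi> 0 + (\<nu> \<bullet> snd p) *\<^sub>R \<nu>)"
    using smooth_on_open_linear[OF _ snd] linear_linear by blast
  have l2: "smooth_on_open UNIV (\<lambda>p::real \<times> 'a. plane_gen (\<phi> 0) \<nu> (snd p))"
    using smooth_on_open_linear[OF _ snd] linear_plane_gen[OF n0] linear_linear by blast
  show ?thesis
    unfolding F_def plane_rot_def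
    by (rule smooth_on_open_add[OF smooth_on_open_add[OF snd smooth_on_open_scaleR[OF cos l1]]
          smooth_on_open_scaleR[OF sin l2]])
qed

lemma smooth_Fs: "smooth_on_open UNIV (F \<tau> s)"
proof -
  have "smooth_on_open UNIV (\<lambda>x::'a. (s, 0) + (0, x))"
    by (intro smooth_on_open_add smooth_on_open_const smooth_on_open_linear[OF bounded_linear_Pair]
        smooth_on_open_ident bounded_linear_zero bounded_linear_ident) auto
  then have "smooth_on_open UNIV (\<lambda>x::'a. (s, x))" by simp
  from smooth_on_open_compose[OF smooth_F this] show ?thesis by simp
qed

lemma variation: "smooth_variation (sphere 0 1) X 1 (F \<tau>)"
  unfolding smooth_variation_def smooth_map_on_def
proof (intro conjI ballI)
  fix p assume "p \<in> {-1<..<1::real} \<times> X"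
  show "\<exists>W g. p \<in> W \<and> smooth_on_open W g \<and> (\<forall>y\<in>W \<inter> {-1<..<1} \<times> X. g y = (case y of (s, x) \<Rightarrow> F \<tau> s x))"
    by (rule exI[of _ UNIV], rule exI[of _ "\<lambda>p. F \<tau> (fst p) (snd p)"]) (auto simp: smooth_F)
next
  fix s x assume "x \<in> X"
  then show "F \<tau> s x \<in> sphere 0 1" using sph norm_plane_rot[OF n0] by (auto simp: F_def)
qed (auto simp: F_def plane_rot_0[OF n0])

text \<open>A rotation is an isometry, so only the variation of its angle can shrink distances, by a factor
  controlled by \<open>s\<close> times a Lipschitz constant of \<open>\<eta>\<close>.\<close>

lemma F_lower:
  obtains \<delta> where "\<delta> > 0" "\<delta> \<le> 1" "\<And>s x y. \<bar>s\<bar> \<le> \<delta> \<Longrightarrow> x \<in> X \<Longrightarrow> y \<in> X \<Longrightarrow> (1/2) * norm (x - y) \<le> norm (F \<tau> s x - F \<tau> s y)"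
proof -
  obtain L where L: "L > 0" "\<And>a b. a \<in> {-1-\<tau>..1-\<tau>} \<Longrightarrow> b \<in> {-1-\<tau>..1-\<tau>} \<Longrightarrow> \<bar>flat_bump a - flat_bump b\<bar> \<le> L * \<bar>a - b\<bar>"
    using smooth_real_lipschitz[OF smooth_on_open_flat_bump] by blast
  have inn: "\<phi> 0 \<bullet> x - \<tau> \<in> {-1-\<tau>..1-\<tau>}" if "x \<in> X" for x
    using Cauchy_Schwarz_ineq2[of "\<phi> 0" x] n0 sph that by auto
  have eta: "\<bar>\<eta> \<tau> x - \<eta> \<tau> y\<bar> \<le> L * norm (x - y)" if "x \<in> X" "y \<in> X" for x y
  proof -
    have "\<bar>\<eta> \<tau> x - \<eta> \<tau> y\<bar> \<le> L * \<bar>\<phi> 0 \<bullet> (x - y)\<bar>"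
      using L(2)[OF inn[OF that(1)] inn[OF that(2)]] by (simp add: \<eta>_def inner_diff_right)
    also have "\<bar>\<phi> 0 \<bullet> (x - y)\<bar> \<le> norm (x - y)"
      using Cauchy_Schwarz_ineq2[of "\<phi> 0" "x - y"] n0 by simp
    finally show ?thesis using L(1) by simp
  qed
  define \<delta> where "\<delta> = min 1 (1 / (2 * L))"
  have \<delta>: "\<delta> > 0" "\<delta> \<le> 1" "\<delta> * L \<le> 1/2" using L(1) by (auto simp: \<delta>_def min_def field_simps)
  show ?thesis
  proof (rule that[OF \<delta>(1,2)])
    fix s x y assume s: "\<bar>s\<bar> \<le> \<delta>" and xy: "x \<in> X" "y \<in> X"
    let ?R = "\<lambda>t z. plane_rot (\<phi> 0) \<nu> t z"
    have "norm (x - y) = norm (?R (s * \<eta> \<tau> x) (x - y))" by (simp add: norm_plane_rot[OF n0])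
    also have "\<dots> = norm (?R (s * \<eta> \<tau> x) x - ?R (s * \<eta> \<tau> x) y)"
      by (simp only: linear_diff[OF linear_plane_rot[OF n0]])
    also have "\<dots> \<le> norm (F \<tau> s x - F \<tau> s y) + norm (?R (s * \<eta> \<tau> x) y - ?R (s * \<eta> \<tau> y) y)"
      unfolding F_def dist_norm[symmetric] by (rule dist_triangle2)
    also have "norm (?R (s * \<eta> \<tau> x) y - ?R (s * \<eta> \<tau> y) y) \<le> (1/2) * norm (x - y)"
    proof -
      have "norm (?R (s * \<eta> \<tau> x) y - ?R (s * \<eta> \<tau> y) y) \<le> \<bar>s * \<eta> \<tau> x - s * \<eta> \<tau> y\<bar> * norm y"
        by (rule plane_rot_diff[OF n0])
      also have "\<dots> = \<bar>s\<bar> * \<bar>\<eta> \<tau> x - \<eta> \<tau> y\<bar>"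
        using sph xy by (auto simp: abs_mult[symmetric] right_diff_distrib)
      also have "\<dots> \<le> \<delta> * (L * norm (x - y))"
        by (intro mult_mono s eta xy) (use \<delta> in auto)
      also have "\<dots> = (\<delta> * L) * norm (x - y)" by simp
      also have "\<dots> \<le> (1/2) * norm (x - y)" by (rule mult_right_mono[OF \<delta>(3)]) simp
      finally show ?thesis .
    qed
    finally show "(1/2) * norm (x - y) \<le> norm (F \<tau> s x - F \<tau> s y)" by simp
  qed
qed

text \<open>The derivative of \<open>F \<tau> s \<circ> \<phi>\<close> is a rotation applied to \<open>D\<phi> u + s h A(\<phi> u)\<close>. The rotation does not affect
  the Gram matrix, which is therefore a quadratic polynomial in \<open>s\<close>.\<close>

lemma gram_F\<phi>:
  assumes u: "u \<in> U"
  shows "gram (frechet_derivative (F \<tau> s \<circ> \<phi>) (at u)) =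
    (\<chi> i j. gram (D\<phi> u) $ i $ j + s * (h \<tau> u (axis j 1) * c u $ i + h \<tau> u (axis i 1) * c u $ j)
       + s\<^sup>2 * (h \<tau> u (axis i 1) * h \<tau> u (axis j 1) * (A (\<phi> u) \<bullet> A (\<phi> u))))"
proof -
  let ?R = "plane_rot (\<phi> 0) \<nu>" and ?t = "s * \<eta> \<tau> (\<phi> u)"
  have lin: "linear (\<lambda>x. (\<phi> 0 \<bullet> x) *\<^sub>R \<phi> 0 + (\<nu> \<bullet> x) *\<^sub>R \<nu>)"
    by (rule linearI) (simp_all add: inner_add_right algebra_simps)
  let ?P = "\<lambda>x. (\<phi> 0 \<bullet> x) *\<^sub>R \<phi> 0 + (\<nu> \<bullet> x) *\<^sub>R \<nu>"
  have d\<phi>: "(\<phi> has_derivative D\<phi> u) (at u)" by (rule local_parametrization_has_derivative[OF lp u])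
  have dP: "((\<lambda>u. ?P (\<phi> u)) has_derivative (\<lambda>v. ?P (D\<phi> u v))) (at u)"
    using bounded_linear.has_derivative[OF _ d\<phi>] lin linear_linear by blast
  have dA: "((\<lambda>u. A (\<phi> u)) has_derivative (\<lambda>v. A (D\<phi> u v))) (at u)"
    using bounded_linear.has_derivative[OF _ d\<phi>] linA linear_linear by blast
  have dt: "((\<lambda>u. s * \<eta> \<tau> (\<phi> u)) has_derivative (\<lambda>v. s * h \<tau> u v)) (at u)"
    by (rule has_derivative_mult_right[OF h_der[OF u]])
  have dc: "((\<lambda>u. cos (s * \<eta> \<tau> (\<phi> u)) - 1) has_derivative (\<lambda>v. (s * h \<tau> u v) * (- sin ?t))) (at u)"
    by (rule has_derivative_eq_rhs, rule has_derivative_diff[OF has_derivative_cos[OF dt] has_derivative_const])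
      (auto simp: fun_eq_iff)
  have ds: "((\<lambda>u. sin (s * \<eta> \<tau> (\<phi> u))) has_derivative (\<lambda>v. (s * h \<tau> u v) * cos ?t)) (at u)"
    by (rule has_derivative_eq_rhs, rule has_derivative_sin[OF dt]) (auto simp: fun_eq_iff)
  have "((\<lambda>u. \<phi> u + (cos (s * \<eta> \<tau> (\<phi> u)) - 1) *\<^sub>R ?P (\<phi> u) + sin (s * \<eta> \<tau> (\<phi> u)) *\<^sub>R A (\<phi> u)) has_derivative
     (\<lambda>v. D\<phi> u v + ((cos ?t - 1) *\<^sub>R ?P (D\<phi> u v) + ((s * h \<tau> u v) * (- sin ?t)) *\<^sub>R ?P (\<phi> u)) +
        (sin ?t *\<^sub>R A (D\<phi> u v) + ((s * h \<tau> u v) * cos ?t) *\<^sub>R A (\<phi> u)))) (at u)"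
    by (intro has_derivative_add has_derivative_scaleR d\<phi> dc dP ds dA)
  moreover have "(\<lambda>u. \<phi> u + (cos (s * \<eta> \<tau> (\<phi> u)) - 1) *\<^sub>R ?P (\<phi> u) + sin (s * \<eta> \<tau> (\<phi> u)) *\<^sub>R A (\<phi> u)) = F \<tau> s \<circ> \<phi>"
    by (auto simp: F_def plane_rot_def A_def)
  moreover have "(\<lambda>v. D\<phi> u v + ((cos ?t - 1) *\<^sub>R ?P (D\<phi> u v) + ((s * h \<tau> u v) * (- sin ?t)) *\<^sub>R ?P (\<phi> u)) +
        (sin ?t *\<^sub>R A (D\<phi> u v) + ((s * h \<tau> u v) * cos ?t) *\<^sub>R A (\<phi> u)))
      = (\<lambda>v. ?R ?t (D\<phi> u v + (s * h \<tau> u v) *\<^sub>R A (\<phi> u)))"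
  proof
    fix v
    have RA: "?R ?t (A (\<phi> u)) = (- sin ?t) *\<^sub>R ?P (\<phi> u) + cos ?t *\<^sub>R A (\<phi> u)"
      unfolding A_def plane_rot_def plane_gen_def
      by (simp add: inner_diff_right plane_inner[OF n0] algebra_simps)
    show "D\<phi> u v + ((cos ?t - 1) *\<^sub>R ?P (D\<phi> u v) + ((s * h \<tau> u v) * (- sin ?t)) *\<^sub>R ?P (\<phi> u)) +
        (sin ?t *\<^sub>R A (D\<phi> u v) + ((s * h \<tau> u v) * cos ?t) *\<^sub>R A (\<phi> u))
      = ?R ?t (D\<phi> u v + (s * h \<tau> u v) *\<^sub>R A (\<phi> u))"
      unfolding linear_add[OF linear_plane_rot[OF n0]] linear_scale[OF linear_plane_rot[OF n0]] RA
      by (simp add: plane_rot_def A_def algebra_simps)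
  qed
  ultimately have "((F \<tau> s \<circ> \<phi>) has_derivative (\<lambda>v. ?R ?t (D\<phi> u v + (s * h \<tau> u v) *\<^sub>R A (\<phi> u)))) (at u)"
    by simp
  then have "frechet_derivative (F \<tau> s \<circ> \<phi>) (at u) = (\<lambda>v. ?R ?t (D\<phi> u v + (s * h \<tau> u v) *\<^sub>R A (\<phi> u)))"
    by (rule frechet_derivative_at[symmetric])
  then have "gram (frechet_derivative (F \<tau> s \<circ> \<phi>) (at u)) = gram (\<lambda>v. D\<phi> u v + (s * h \<tau> u v) *\<^sub>R A (\<phi> u))"
    using gram_isometry[of "?R ?t" "\<lambda>v. D\<phi> u v + (s * h \<tau> u v) *\<^sub>R A (\<phi> u)"] plane_rot_inner[OF n0] by simp
  then show ?thesis
    by (simp add: gram_def c_def vec_eq_iff inner_add_left inner_add_right inner_commute[of "A (\<phi> u)" "D\<phi> u _"]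
        power2_eq_square algebra_simps)
qed

definition vol :: "real \<Rightarrow> real \<Rightarrow> ennreal" where
  "vol \<tau> s = emeasure (riemannian_volume TYPE('k) (F \<tau> s ` X)) (F \<tau> s ` X)"

text \<open>Where the cut-off vanishes the map is the identity, so only the volume inside the chart
  depends on \<open>s\<close>.\<close>

lemma vol_split:
  assumes R: "cball 0 R \<subseteq> U"
    and suppX: "\<And>x. x \<in> X \<Longrightarrow> x \<notin> \<phi> ` ball 0 R \<Longrightarrow> \<phi> 0 \<bullet> x < \<tau>"
    and \<delta>: "\<delta> > 0" "\<And>s x y. \<bar>s\<bar> \<le> \<delta> \<Longrightarrow> x \<in> X \<Longrightarrow> y \<in> X \<Longrightarrow> (1/2) * norm (x - y) \<le> norm (F \<tau> s x - F \<tau> s y)"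
  obtains C where "C < \<infinity>" "\<And>s. \<bar>s\<bar> \<le> \<delta> \<Longrightarrow> vol \<tau> s =
      (\<integral>\<^sup>+u. ennreal (volume_density (F \<tau> s \<circ> \<phi>) u) * indicator (ball 0 R) u \<partial>lborel) + C"
proof -
  have ne: "X \<noteq> {}" using X0 by blast
  obtain \<psi>' :: "nat \<Rightarrow> real^'k \<Rightarrow> 'a" and V' where atl': "countable_atlas X \<psi>' V'"
    by (rule countable_atlas_exists[OF emb ne]) (rule that)
  define \<psi> where "\<psi> i = (case i of 0 \<Rightarrow> \<phi> | Suc j \<Rightarrow> \<psi>' j)" for i
  define V where "V i = (case i of 0 \<Rightarrow> ball 0 R | Suc j \<Rightarrow> V' j)" for i
  have sub: "ball 0 R \<subseteq> U" using R ball_subset_cball by (rule subset_trans[rotated])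
  have lp\<psi>: "local_parametrization X (V i) (\<psi> i)" for i
    using local_parametrization_restrict[OF lp open_ball sub] atl'
    unfolding \<psi>_def V_def countable_atlas_def by (cases i) auto
  have XU: "X = (\<Union>i. \<psi> i ` V i)"
  proof
    show "(\<Union>i. \<psi> i ` V i) \<subseteq> X" using local_parametrization_image_subset[OF lp\<psi>] by blast
    have "X \<subseteq> (\<Union>j. \<psi>' j ` V' j)" using atl' unfolding countable_atlas_def by blast
    also have "\<dots> = (\<Union>j. \<psi> (Suc j) ` V (Suc j))" by (simp add: \<psi>_def V_def)
    also have "\<dots> \<subseteq> (\<Union>i. \<psi> i ` V i)" by blast
    finally show "X \<subseteq> (\<Union>i. \<psi> i ` V i)" .
  qed
  define C where "C = (\<Sum>j. \<integral>\<^sup>+u. ennreal (volume_density (\<psi> (Suc j)) u) * indicator (chart_piece \<psi> V (Suc j)) u \<partial>lborel)"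
  have main: "vol \<tau> s = (\<integral>\<^sup>+u. ennreal (volume_density (F \<tau> s \<circ> \<phi>) u) * indicator (ball 0 R) u \<partial>lborel) + C"
    "vol \<tau> s < \<infinity>" if s: "\<bar>s\<bar> \<le> \<delta>" for s
  proof -
    let ?M = "F \<tau> s ` X"
    have half: "(1/2::real) > 0" by simp
    have low: "\<And>x y. x \<in> X \<Longrightarrow> y \<in> X \<Longrightarrow> (1/2) * norm (x - y) \<le> norm (F \<tau> s x - F \<tau> s y)"
      by (rule \<delta>(2)[OF s])
    have lps: "local_parametrization ?M (V i) (F \<tau> s \<circ> \<psi> i)" for i
      by (rule local_parametrization_image[OF lp\<psi> smooth_Fs half low])
    have atl: "countable_atlas ?M (\<lambda>i. F \<tau> s \<circ> \<psi> i) V"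
      unfolding countable_atlas_def
    proof (intro conjI allI)
      have "F \<tau> s ` X = F \<tau> s ` (\<Union>i. \<psi> i ` V i)" using XU by simp
      also have "\<dots> = (\<Union>i. (F \<tau> s \<circ> \<psi> i) ` V i)" by (simp only: image_UN image_comp)
      finally show "F \<tau> s ` X = (\<Union>i. (F \<tau> s \<circ> \<psi> i) ` V i)" .
    qed (rule lps)
    have embs: "embedded_submanifold TYPE('k) ?M"
      by (rule embedded_submanifold_image[OF emb smooth_Fs half low])
    have nes: "?M \<noteq> {}" using ne by simp
    have rv: "is_riemannian_volume TYPE('k) ?M (riemannian_volume TYPE('k) ?M)"
      by (rule is_riemannian_volume_riemannian_volume(1)[OF embs nes])
    have inj: "x = y" if "x \<in> X" "y \<in> X" "F \<tau> s x = F \<tau> s y" for x y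
      using low[OF that(1,2)] that(3) by simp
    have piece: "chart_piece (\<lambda>i. F \<tau> s \<circ> \<psi> i) V i = chart_piece \<psi> V i" for i
    proof -
      have "(F \<tau> s \<circ> \<psi> i) u \<notin> (F \<tau> s \<circ> \<psi> j) ` V j \<longleftrightarrow> \<psi> i u \<notin> \<psi> j ` V j" if "u \<in> V i" for u j
      proof -
        have "\<psi> i u \<in> X" using local_parametrization_image_subset[OF lp\<psi>] that by blast
        moreover have "\<psi> j v \<in> X" if "v \<in> V j" for v using local_parametrization_image_subset[OF lp\<psi>] that by blast
        ultimately show ?thesis using inj by (auto simp: image_iff)
      qed
      then show ?thesis unfolding chart_piece_def by auto
    qed
    have top: "?M \<in> sets (restrict_space borel ?M)"
      using sets.top[of "restrict_space borel ?M"] by (simp add: space_restrict_space)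
    have "vol \<tau> s = atlas_volume (\<lambda>i. F \<tau> s \<circ> \<psi> i) V ?M"
      unfolding vol_def by (rule riemannian_volume_atlas[OF atl rv top])
    also have "\<dots> = (\<Sum>i. \<integral>\<^sup>+u. ennreal (volume_density (F \<tau> s \<circ> \<psi> i) u) * indicator (chart_piece \<psi> V i) u \<partial>lborel)"
    proof -
      have "{u \<in> chart_piece \<psi> V i. (F \<tau> s \<circ> \<psi> i) u \<in> ?M} = chart_piece \<psi> V i" for i
        using local_parametrization_image_subset[OF lp\<psi>, of i] by (auto simp: chart_piece_def)
      then show ?thesis unfolding atlas_volume_def piece by simp
    qed
    also have "\<dots> = C + (\<integral>\<^sup>+u. ennreal (volume_density (F \<tau> s \<circ> \<psi> 0) u) * indicator (chart_piece \<psi> V 0) u \<partial>lborel)"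
    proof -
      have eq: "(\<integral>\<^sup>+u. ennreal (volume_density (F \<tau> s \<circ> \<psi> (Suc j)) u) * indicator (chart_piece \<psi> V (Suc j)) u \<partial>lborel)
          = (\<integral>\<^sup>+u. ennreal (volume_density (\<psi> (Suc j)) u) * indicator (chart_piece \<psi> V (Suc j)) u \<partial>lborel)" for j
      proof (rule nn_integral_cong)
        fix u
        let ?j = "Suc j"
        show "ennreal (volume_density (F \<tau> s \<circ> \<psi> ?j) u) * indicator (chart_piece \<psi> V ?j) u
          = ennreal (volume_density (\<psi> ?j) u) * indicator (chart_piece \<psi> V ?j) u"
        proof (cases "u \<in> chart_piece \<psi> V ?j")
          case True
          then have u: "u \<in> V ?j" "\<psi> ?j u \<notin> \<psi> 0 ` V 0" by (auto simp: chart_piece_def)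
          let ?W = "{v \<in> V ?j. \<phi> 0 \<bullet> \<psi> ?j v < \<tau>}"
          have oV: "open (V ?j)" by (rule local_parametrization_open[OF lp\<psi>])
          have "continuous_on (V ?j) (\<lambda>v. \<phi> 0 \<bullet> \<psi> ?j v)"
            by (intro continuous_intros local_parametrization_continuous_on[OF lp\<psi>]) simp
          then have "open (V ?j \<inter> (\<lambda>v. \<phi> 0 \<bullet> \<psi> ?j v) -` {..<\<tau>})"
            by (rule continuous_open_preimage) (use oV in auto)
          moreover have "V ?j \<inter> (\<lambda>v. \<phi> 0 \<bullet> \<psi> ?j v) -` {..<\<tau>} = ?W" by auto
          ultimately have oW: "open ?W" by simp
          have "\<psi> ?j u \<in> X" using local_parametrization_image_subset[OF lp\<psi>] u(1) by blast
          then have uW: "u \<in> ?W" using suppX[of "\<psi> ?j u"] u by (simp add: \<psi>_def V_def)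
          have "frechet_derivative (\<psi> ?j) (at u) = frechet_derivative (F \<tau> s \<circ> \<psi> ?j) (at u)"
          proof (rule frechet_derivative_transform_within_open[OF _ oW uW])
            show "\<psi> ?j differentiable at u"
              by (rule differentiableI[OF local_parametrization_has_derivative[OF lp\<psi> u(1)]])
            show "\<psi> ?j v = (F \<tau> s \<circ> \<psi> ?j) v" if "v \<in> ?W" for v
              using that by (simp add: F_def \<eta>_def flat_bump_def plane_rot_0[OF n0])
          qed
          then show ?thesis by (simp add: volume_density_gram)
        qed simp
      qed
      let ?f = "\<lambda>i. \<integral>\<^sup>+u. ennreal (volume_density (F \<tau> s \<circ> \<psi> i) u) * indicator (chart_piece \<psi> V i) u \<partial>lborel"
      have "(\<lambda>j. ?f (Suc j)) sums C"
        unfolding eq C_def by (rule summable_sums) (rule summableI)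
      then have "?f sums (C + ?f 0)" by (rule sums_Suc)
      then show ?thesis by (rule sums_unique[symmetric])
    qed
    also have "chart_piece \<psi> V 0 = ball 0 R" by (auto simp: chart_piece_def V_def)
    finally show "vol \<tau> s = (\<integral>\<^sup>+u. ennreal (volume_density (F \<tau> s \<circ> \<phi>) u) * indicator (ball 0 R) u \<partial>lborel) + C"
      by (simp add: \<psi>_def add.commute o_def)
    have "compact ?M"
      by (rule compact_continuous_image[OF continuous_on_subset[OF smooth_on_open_continuous_on[OF smooth_Fs]] compact]) simp
    then show "vol \<tau> s < \<infinity>" unfolding vol_def by (rule riemannian_volume_finite[OF embs _ rv])
  qed
  have "C \<le> vol \<tau> 0" using main(1)[of 0] \<delta>(1) by simp
  then have "C < \<infinity>" using main(2)[of 0] \<delta>(1) by (simp add: le_less_trans)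
  then show ?thesis using main(1) by (rule that)
qed

text \<open>The Gram matrix of \<open>F \<tau> s \<circ> \<phi>\<close>; \<open>M'\<close> is its derivative in \<open>s\<close>, and \<open>P'\<close> that of its determinant.\<close>

definition M :: "real \<Rightarrow> real \<Rightarrow> real^'k \<Rightarrow> real^'k^'k" where
  "M \<tau> s u = (\<chi> i j. gram (D\<phi> u) $ i $ j + s * (h \<tau> u (axis j 1) * c u $ i + h \<tau> u (axis i 1) * c u $ j)
       + s\<^sup>2 * (h \<tau> u (axis i 1) * h \<tau> u (axis j 1) * (A (\<phi> u) \<bullet> A (\<phi> u))))"
definition M' :: "real \<Rightarrow> real \<Rightarrow> real^'k \<Rightarrow> real^'k^'k" where
  "M' \<tau> s u = (\<chi> i j. (h \<tau> u (axis j 1) * c u $ i + h \<tau> u (axis i 1) * c u $ j)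
       + 2 * s * (h \<tau> u (axis i 1) * h \<tau> u (axis j 1) * (A (\<phi> u) \<bullet> A (\<phi> u))))"
definition P' :: "real \<Rightarrow> real \<Rightarrow> real^'k \<Rightarrow> real" where
  "P' \<tau> s u = (\<Sum>l\<in>UNIV. det (\<chi> i. if i = l then M' \<tau> s u $ l else M \<tau> s u $ i))"

lemma density_M: "u \<in> U \<Longrightarrow> volume_density (F \<tau> s \<circ> \<phi>) u = sqrt (det (M \<tau> s u))"
  by (simp only: volume_density_gram gram_F\<phi> M_def)

lemma M_der: "((\<lambda>s. det (M \<tau> s u)) has_real_derivative P' \<tau> s u) (at s)"
  unfolding P'_def
  by (rule det_has_real_derivative)
    (auto simp: M_def M'_def intro!: derivative_eq_intros simp: algebra_simps)

lemma M_0: "M \<tau> 0 u = gram (D\<phi> u)"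
  by (simp add: M_def vec_eq_iff)

lemma transpose_gram: "transpose (gram L) = gram L"
  by (simp add: transpose_def gram_def inner_commute vec_eq_iff)

lemma P'_0: "u \<in> U \<Longrightarrow> P' \<tau> 0 u = 2 * (\<Sum>i\<in>UNIV. h \<tau> u (axis i 1) * det (\<chi> l. if l = i then c u else gram (D\<phi> u) $ l))"
proof -
  assume u: "u \<in> U"
  define hv where "hv = (\<chi> i. h \<tau> u (axis i 1))"
  have "M' \<tau> 0 u $ l = hv $ l *s c u + c u $ l *s hv" for l
    by (simp add: M'_def hv_def vec_eq_iff algebra_simps)
  then have "P' \<tau> 0 u = (\<Sum>l\<in>UNIV. det (\<chi> i. if i = l then hv $ l *s c u + c u $ l *s hv else gram (D\<phi> u) $ i))"
    by (simp add: P'_def M_0 cong: if_cong)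
  also have "\<dots> = 2 * (\<Sum>l\<in>UNIV. hv $ l * det (\<chi> i. if i = l then c u else gram (D\<phi> u) $ i))"
    by (rule det_symmetric_update[OF transpose_gram]) (use J_pos[OF u] in simp)
  finally show ?thesis by (simp add: hv_def)
qed

lemma cont_entries:
  "continuous_on (UNIV \<times> U) (\<lambda>p. M \<tau> (fst p) (snd p) $ i $ j)"
  "continuous_on (UNIV \<times> U) (\<lambda>p. M' \<tau> (fst p) (snd p) $ i $ j)"
proof -
  have sn: "continuous_on (UNIV \<times> U) (\<lambda>p::real \<times> (real^'k). f (snd p))" if "continuous_on U f" for f :: "real^'k \<Rightarrow> real"
    by (rule continuous_on_compose2[OF that continuous_on_snd[OF continuous_on_id]]) auto
  note cs = sn[OF h_cont] sn[OF smooth_on_open_continuous_on[OF smooth_c]]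
    sn[OF smooth_on_open_continuous_on[OF smooth_gram]]
    sn[OF smooth_on_open_continuous_on[OF smooth_on_open_inner[OF smoothA smoothA]]]
  show "continuous_on (UNIV \<times> U) (\<lambda>p. M \<tau> (fst p) (snd p) $ i $ j)"
    unfolding M_def vec_lambda_beta by (intro continuous_intros cs)
  show "continuous_on (UNIV \<times> U) (\<lambda>p. M' \<tau> (fst p) (snd p) $ i $ j)"
    unfolding M'_def vec_lambda_beta by (intro continuous_intros cs)
qed

lemma P'_cont: "continuous_on (UNIV \<times> U) (\<lambda>p. P' \<tau> (fst p) (snd p))"
  unfolding P'_def
proof (intro continuous_on_sum continuous_on_det)
  fix l i j :: 'k
  show "continuous_on (UNIV \<times> U) (\<lambda>p. (\<chi> i. if i = l then M' \<tau> (fst p) (snd p) $ l else M \<tau> (fst p) (snd p) $ i) $ i $ j)"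
    by (cases "i = l") (simp_all add: cont_entries)
qed

text \<open>Domination for differentiating the volume under the integral sign.\<close>

lemma density_estimate:
  assumes R: "cball 0 R \<subseteq> U"
  obtains B where "B > 0" "\<And>s u. \<bar>s\<bar> \<le> 1 \<Longrightarrow> u \<in> cball 0 R \<Longrightarrow> det (M \<tau> s u) > 0 \<Longrightarrow>
     \<bar>sqrt (det (M \<tau> s u)) - sqrt (det (M \<tau> 0 u))\<bar> \<le> B * \<bar>s\<bar>"
proof -
  have "compact ((\<lambda>p. P' \<tau> (fst p) (snd p)) ` ({-1..1} \<times> cball 0 R))"
    by (intro compact_continuous_image continuous_on_subset[OF P'_cont] compact_Times) (use R in auto)
  from compact_imp_bounded[OF this] obtain K where K: "K > 0"
    "\<And>s u. s \<in> {-1..1} \<Longrightarrow> u \<in> cball 0 R \<Longrightarrow> \<bar>P' \<tau> s u\<bar> \<le> K"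
    unfolding bounded_pos by (auto simp: image_iff)
  have "compact ((\<lambda>u. det (gram (D\<phi> u))) ` cball 0 R)"
    by (intro compact_continuous_image continuous_on_subset[OF smooth_on_open_continuous_on[OF smooth_J]]) (use R in auto)
  moreover have "0 \<notin> (\<lambda>u. det (gram (D\<phi> u))) ` cball 0 R"
    using J_pos R by (auto simp: image_iff subset_iff) (metis less_irrefl mem_cball_0)
  ultimately obtain m where m: "m > 0" "\<forall>x\<in>(\<lambda>u. det (gram (D\<phi> u))) ` cball 0 R. m \<le> dist 0 x"
    using separate_point_closed[OF compact_imp_closed] by blast
  have m2: "m \<le> \<bar>det (gram (D\<phi> u))\<bar>" if "u \<in> cball 0 R" for u
    using m(2)[rule_format, OF imageI[OF that]] by (simp add: dist_norm)
  show ?thesis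
  proof (rule that[of "K / sqrt m"])
    show "K / sqrt m > 0" using K m by simp
    fix s u assume s: "\<bar>s\<bar> \<le> 1" and u: "u \<in> cball 0 R" and pos: "det (M \<tau> s u) > 0"
    have uU: "u \<in> U" using u R by blast
    have J: "det (M \<tau> 0 u) > 0" "m \<le> det (M \<tau> 0 u)" using J_pos[OF uU] m2[OF u] by (simp_all add: M_0)
    have "norm (det (M \<tau> s u) - det (M \<tau> 0 u)) \<le> K * norm (s - 0)"
    proof (rule field_differentiable_bound[of "{-1..1}" "\<lambda>s. det (M \<tau> s u)" "\<lambda>s. P' \<tau> s u"])
      show "((\<lambda>s. det (M \<tau> s u)) has_field_derivative P' \<tau> t u) (at t within {-1..1})" for t
        by (rule has_field_derivative_at_within[OF M_der])
      show "norm (P' \<tau> t u) \<le> K" if "t \<in> {-1..1}" for t using K(2)[OF that u] by simp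
    qed (use s in \<open>auto simp: abs_le_iff\<close>)
    then have 1: "\<bar>det (M \<tau> s u) - det (M \<tau> 0 u)\<bar> \<le> K * \<bar>s\<bar>" by simp
    have "\<bar>sqrt (det (M \<tau> s u)) - sqrt (det (M \<tau> 0 u))\<bar> \<le> \<bar>det (M \<tau> s u) - det (M \<tau> 0 u)\<bar> / sqrt (det (M \<tau> 0 u))"
      by (rule sqrt_diff_bound) (use pos J in auto)
    also have "\<dots> \<le> (K * \<bar>s\<bar>) / sqrt m"
      by (intro frac_le 1) (use J m K in auto)
    finally show "\<bar>sqrt (det (M \<tau> s u)) - sqrt (det (M \<tau> 0 u))\<bar> \<le> K / sqrt m * \<bar>s\<bar>" by simp
  qed
qed

lemma density_derivative:
  assumes u: "u \<in> U"
  shows "((\<lambda>s. sqrt (det (M \<tau> s u))) has_real_derivative (\<Sum>i\<in>UNIV. h \<tau> u (axis i 1) * w i u)) (at 0)"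
proof -
  let ?J = "det (gram (D\<phi> u))"
  have J: "?J > 0" by (rule J_pos[OF u])
  have "((\<lambda>s. sqrt (det (M \<tau> s u))) has_real_derivative inverse (sqrt (det (M \<tau> 0 u))) / 2 * P' \<tau> 0 u) (at 0)"
    by (rule DERIV_chain2[OF DERIV_real_sqrt M_der]) (use J in \<open>simp add: M_0\<close>)
  moreover have "?J powr (-1/2) = inverse (sqrt ?J)"
    using J by (simp add: powr_minus powr_half_sqrt)
  then have "w i u = det (\<chi> l. if l = i then c u else gram (D\<phi> u) $ l) * inverse (sqrt ?J)" for i
    by (simp only: w_def)
  then have "inverse (sqrt (det (M \<tau> 0 u))) / 2 * P' \<tau> 0 u = (\<Sum>i\<in>UNIV. h \<tau> u (axis i 1) * w i u)"
    unfolding P'_0[OF u] M_0 by (simp add: sum_distrib_left mult_ac)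
  ultimately show ?thesis by simp
qed

text \<open>Differentiation of the volume under the integral at \<open>s = 0\<close>.\<close>

lemma first_variation:
  assumes R: "0 < R" "cball 0 R \<subseteq> U"
    and suppX: "\<And>x. x \<in> X \<Longrightarrow> x \<notin> \<phi> ` ball 0 R \<Longrightarrow> \<phi> 0 \<bullet> x < \<tau>"
  shows "(LINT u|lborel. indicator (ball 0 R) u * (\<Sum>i\<in>UNIV. h \<tau> u (axis i 1) * w i u)) = 0"
proof -
  obtain \<delta> where \<delta>: "\<delta> > 0" "\<delta> \<le> 1" "\<And>s x y. \<bar>s\<bar> \<le> \<delta> \<Longrightarrow> x \<in> X \<Longrightarrow> y \<in> X \<Longrightarrow> (1/2) * norm (x - y) \<le> norm (F \<tau> s x - F \<tau> s y)"
    by (rule F_lower) (rule that)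
  obtain C where C: "C < \<infinity>" "\<And>s. \<bar>s\<bar> \<le> \<delta> \<Longrightarrow> vol \<tau> s =
      (\<integral>\<^sup>+u. ennreal (volume_density (F \<tau> s \<circ> \<phi>) u) * indicator (ball 0 R) u \<partial>lborel) + C"
    by (rule vol_split[OF R(2) suppX \<delta>(1,3)]; (assumption | rule that; assumption))
  obtain B where B: "B > 0" "\<And>s u. \<bar>s\<bar> \<le> 1 \<Longrightarrow> u \<in> cball 0 R \<Longrightarrow> det (M \<tau> s u) > 0 \<Longrightarrow>
     \<bar>sqrt (det (M \<tau> s u)) - sqrt (det (M \<tau> 0 u))\<bar> \<le> B * \<bar>s\<bar>"
    by (rule density_estimate[OF R(2)]) (rule that)
  have sub: "ball 0 R \<subseteq> U" using R(2) ball_subset_cball by (rule subset_trans[rotated])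
  have half: "(1/2::real) > 0" by simp
  define g where "g s u = indicator (ball 0 R) u * sqrt (det (M \<tau> s u))" for s u
  have lps: "local_parametrization (F \<tau> s ` X) U (F \<tau> s \<circ> \<phi>)" if "\<bar>s\<bar> \<le> \<delta>" for s
    by (rule local_parametrization_image[OF lp smooth_Fs half \<delta>(3)[OF that]])
  have pos: "det (M \<tau> s u) > 0" if "\<bar>s\<bar> \<le> \<delta>" "u \<in> U" for s u
    using volume_density_pos[OF lps[OF that(1)] that(2)] density_M[OF that(2)] by simp
  have g_nn: "ennreal (g s u) = ennreal (volume_density (F \<tau> s \<circ> \<phi>) u) * indicator (ball 0 R) u" for s u
    using density_M[of u] sub by (auto simp: g_def indicator_def)
  have g_nonneg: "g s u \<ge> 0" if "\<bar>s\<bar> \<le> \<delta>" for s u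
    using pos[OF that, of u] sub by (auto simp: g_def indicator_def less_imp_le)
  have g_meas: "g s \<in> borel_measurable borel" for s
  proof -
    have "continuous_on U (\<lambda>u. det (M \<tau> s u))"
    proof (rule continuous_on_det)
      fix i j
      have "continuous_on U (\<lambda>u. (s, u))" by (intro continuous_intros)
      from continuous_on_compose2[OF cont_entries(1)[of \<tau> i j] this]
      show "continuous_on U (\<lambda>u. M \<tau> s u $ i $ j)" by auto
    qed
    then have "continuous_on (ball 0 R) (\<lambda>u. sqrt (det (M \<tau> s u)))"
      using sub by (intro continuous_on_real_sqrt) (rule continuous_on_subset)
    from borel_measurable_continuous_on_indicator[OF _ this]
    have "(\<lambda>u. indicator (ball 0 R) u *\<^sub>R sqrt (det (M \<tau> s u))) \<in> borel_measurable borel" by simp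
    then show ?thesis by (simp add: g_def[abs_def])
  qed
  have fin: "(\<integral>\<^sup>+u. ennreal (g s u) \<partial>lborel) < \<infinity>" if "\<bar>s\<bar> \<le> \<delta>" for s
    unfolding g_nn by (rule chart_volume_finite[OF lps[OF that] R(2)])
  have g_int: "integrable lborel (g s)" if "\<bar>s\<bar> \<le> \<delta>" for s
    using g_meas fin[OF that] g_nonneg[OF that] by (intro integrableI_nonneg) auto
  have V: "measure (riemannian_volume TYPE('k) (F \<tau> s ` X)) (F \<tau> s ` X) = (LINT u|lborel. g s u) + enn2real C"
    if s: "\<bar>s\<bar> \<le> \<delta>" for s
  proof -
    have "(LINT u|lborel. g s u) = enn2real (\<integral>\<^sup>+u. ennreal (g s u) \<partial>lborel)"
      using g_meas g_nonneg[OF s] by (intro integral_eq_nn_integral) auto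
    moreover have "measure (riemannian_volume TYPE('k) (F \<tau> s ` X)) (F \<tau> s ` X) = enn2real (vol \<tau> s)"
      by (simp only: measure_def vol_def)
    moreover have "vol \<tau> s = (\<integral>\<^sup>+u. ennreal (g s u) \<partial>lborel) + C"
      unfolding g_nn by (rule C(2)[OF s])
    ultimately show ?thesis using fin[OF s] C(1) by (simp add: enn2real_plus)
  qed
  let ?V = "\<lambda>s. measure (riemannian_volume TYPE('k) (F \<tau> s ` X)) (F \<tau> s ` X)"
  have "(?V has_real_derivative 0) (at 0)"
    using critical variation unfolding volume_critical_def by blast
  then have limV: "((\<lambda>s. (?V s - ?V 0) / s) \<longlongrightarrow> 0) (at 0)"
    by (simp add: has_field_derivative_iff)
  define sn where "sn n = \<delta> / real (Suc n)" for n
  have sn: "0 < sn n" "\<bar>sn n\<bar> \<le> \<delta>" "\<bar>sn n\<bar> \<le> 1" for n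
    using \<delta>(1,2) by (auto simp: sn_def field_simps intro: order_trans[OF \<delta>(2)])
  have "sn \<longlonglongrightarrow> 0"
    using tendsto_mult_right_zero[OF LIMSEQ_inverse_real_of_nat, of \<delta>] by (simp add: sn_def[abs_def] divide_inverse)
  then have sn0: "filterlim sn (at 0) sequentially"
    using sn(1) by (auto simp: filterlim_at less_imp_neq[symmetric] eventually_sequentially dest: less_imp_neq)
  define q where "q n u = (g (sn n) u - g 0 u) / sn n" for n u
  define q0 where "q0 u = indicator (ball 0 R) u * (\<Sum>i\<in>UNIV. h \<tau> u (axis i 1) * w i u)" for u
  have z: "\<bar>0::real\<bar> \<le> \<delta>" using \<delta>(1) by simp
  have q_eq: "(LINT u|lborel. q n u) = (?V (sn n) - ?V 0) / sn n" for n
    unfolding q_def V[OF sn(2)] V[OF z] using g_int[OF sn(2), of n] g_int[OF z] by simp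
  then have lim1: "(\<lambda>n. LINT u|lborel. q n u) \<longlonglongrightarrow> 0"
    using filterlim_compose[OF limV sn0] by simp
  have "(\<lambda>n. LINT u|lborel. q n u) \<longlonglongrightarrow> (LINT u|lborel. q0 u)"
  proof (rule integral_dominated_convergence[where w = "\<lambda>u. indicator (cball 0 R) u *\<^sub>R B"])
    show "integrable lborel (\<lambda>u. indicator (cball (0::real^'k) R) u *\<^sub>R B)"
      by (rule borel_integrable_compact) auto
    show "q n \<in> borel_measurable lborel" for n
      unfolding q_def using g_meas by measurable
    have lim: "(\<lambda>n. q n u) \<longlonglongrightarrow> q0 u" for u
    proof (cases "u \<in> ball 0 R")
      case True
      then have "((\<lambda>s. (sqrt (det (M \<tau> s u)) - sqrt (det (M \<tau> 0 u))) / s) \<longlongrightarrow> (\<Sum>i\<in>UNIV. h \<tau> u (axis i 1) * w i u)) (at 0)"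
        using density_derivative[of u \<tau>] sub by (auto simp: has_field_derivative_iff)
      from filterlim_compose[OF this sn0] show ?thesis
        using True by (simp add: q_def q0_def g_def)
    next
      case False
      then show ?thesis by (simp add: q_def q0_def g_def)
    qed
    then show "AE u in lborel. (\<lambda>n. q n u) \<longlonglongrightarrow> q0 u" by simp
    show "q0 \<in> borel_measurable lborel"
      by (rule borel_measurable_LIMSEQ_real[OF lim]) (use g_meas in \<open>simp add: q_def[abs_def]\<close>)
    show "AE u in lborel. norm (q n u) \<le> indicator (cball 0 R) u *\<^sub>R B" for n
    proof (rule AE_I2)
      fix u :: "real^'k"
      show "norm (q n u) \<le> indicator (cball 0 R) u *\<^sub>R B"
      proof (cases "u \<in> ball 0 R")
        case True
        then have u: "u \<in> cball 0 R" "u \<in> U" using sub by auto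
        have "\<bar>sqrt (det (M \<tau> (sn n) u)) - sqrt (det (M \<tau> 0 u))\<bar> \<le> B * \<bar>sn n\<bar>"
          by (rule B(2)[OF sn(3) u(1) pos[OF sn(2) u(2)]])
        then show ?thesis using True u(1) sn(1)[of n] by (simp add: q_def g_def field_simps)
      next
        case False
        then show ?thesis using B(1) by (simp add: q_def g_def indicator_def)
      qed
    qed
  qed
  then have "(LINT u|lborel. q0 u) = 0" using lim1 by (rule LIMSEQ_unique)
  then show ?thesis by (simp add: q0_def[abs_def])
qed

text \<open>The first variation and the divergence theorem leave \<open>\<integral> \<eta> (\<Sum>i. Dw i) = 0\<close> for cut-off functions \<open>\<eta>\<close> supported
  arbitrarily close to \<open>\<phi> 0\<close>; a divergence of constant sign near \<open>0\<close> contradicts this.\<close>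

lemma divergence_zero: "(\<Sum>i\<in>UNIV. Dw i 0) = 0"
proof (rule ccontr)
  assume nz: "(\<Sum>i\<in>UNIV. Dw i 0) \<noteq> 0"
  define d where "d u = sgn (\<Sum>i\<in>UNIV. Dw i 0) * (\<Sum>i\<in>UNIV. Dw i u)" for u
  have d0: "d 0 > 0" using nz unfolding d_def by (simp add: sgn_if)
  have dcont: "continuous_on U d" unfolding d_def by (intro continuous_intros Dw_cont)
  then have "open (U \<inter> d -` {0<..})" by (rule continuous_open_preimage[OF _ openU]) simp
  moreover have "0 \<in> U \<inter> d -` {0<..}" using U0 d0 by simp
  ultimately obtain R where R: "R > 0" "cball 0 R \<subseteq> U \<inter> d -` {0<..}"
    using open_contains_cball by blast
  then have RU: "cball 0 R \<subseteq> U" and dpos: "\<And>u. u \<in> cball 0 R \<Longrightarrow> d u > 0" by auto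
  \<comment> \<open>The cut-off is supported in the image of the smaller ball, so that it vanishes near the boundary of the larger one.\<close>
  define r where "r = R / 2"
  have r: "0 < r" "r < R" using R(1) by (auto simp: r_def)
  have rU: "ball 0 r \<subseteq> U" using RU r by (auto simp: subset_iff)
  have "openin (top_of_set X) (\<phi> ` ball 0 r)"
    using local_parametrization_restrict[OF lp open_ball rU] by (simp add: local_parametrization_def)
  moreover have "\<phi> 0 \<in> \<phi> ` ball 0 r" using r(1) by simp
  ultimately obtain e where e: "e > 0" "ball (\<phi> 0) e \<inter> X \<subseteq> \<phi> ` ball 0 r"
    unfolding openin_contains_ball by blast
  \<comment> \<open>For unit vectors \<open>\<phi> 0 \<bullet> x > \<tau>\<close> means that \<open>x\<close> has distance less than \<open>e\<close> from \<open>\<phi> 0\<close>.\<close>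
  define \<tau> where "\<tau> = 1 - e\<^sup>2 / 2"
  have near: "x \<in> \<phi> ` ball 0 r" if "x \<in> X" "\<phi> 0 \<bullet> x > \<tau>" for x
  proof -
    have "x \<bullet> x = 1" "\<phi> 0 \<bullet> \<phi> 0 = 1" using that(1) sph n0(1) by (auto simp: dot_square_norm)
    then have "(norm (\<phi> 0 - x))\<^sup>2 = 2 - 2 * (\<phi> 0 \<bullet> x)"
      unfolding power2_norm_eq_inner by (simp add: inner_diff_left inner_diff_right inner_commute[of x "\<phi> 0"])
    also have "\<dots> < e\<^sup>2" using that(2) by (simp add: \<tau>_def)
    finally have "norm (\<phi> 0 - x) < e" using e(1) by (simp add: power2_less_imp_less)
    then show ?thesis using e(2) that(1) by (auto simp: dist_norm)
  qed
  have inj: "inj_on \<phi> U" using lp unfolding local_parametrization_def homeomorphism_def inj_on_def by metis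
  have suppU: "\<eta> \<tau> (\<phi> u) = 0" if "u \<in> U" "r \<le> norm u" for u
  proof -
    have "\<phi> u \<notin> \<phi> ` ball 0 r"
    proof
      assume "\<phi> u \<in> \<phi> ` ball 0 r"
      then obtain v where v: "v \<in> ball 0 r" "\<phi> u = \<phi> v" by blast
      then have "u = v" using inj_onD[OF inj v(2) that(1)] rU by blast
      then show False using v that(2) by simp
    qed
    moreover have "\<phi> u \<in> X" using local_parametrization_image_subset[OF lp] that(1) by blast
    ultimately have "\<not> \<phi> 0 \<bullet> \<phi> u > \<tau>" using near by blast
    then show ?thesis by (simp add: \<eta>_def flat_bump_def)
  qed
  define \<tau>' where "\<tau>' = \<tau> + e\<^sup>2 / 4"
  have suppX: "\<phi> 0 \<bullet> x < \<tau>'" if "x \<in> X" "x \<notin> \<phi> ` ball 0 R" for x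
  proof -
    have "\<phi> ` ball 0 r \<subseteq> \<phi> ` ball 0 R" using r by (intro image_mono) auto
    then have "\<not> \<phi> 0 \<bullet> x > \<tau>" using near[OF that(1)] that(2) by blast
    then show ?thesis using zero_less_power[OF e(1), of 2] unfolding \<tau>'_def by linarith
  qed
  have suppU': "\<eta> \<tau>' (\<phi> u) = 0" if "u \<in> U" "r \<le> norm u" for u
  proof -
    have "flat_bump (\<phi> 0 \<bullet> \<phi> u - \<tau>) = 0" using suppU[OF that] by (simp add: \<eta>_def)
    then have "\<phi> 0 \<bullet> \<phi> u \<le> \<tau>" by (simp add: flat_bump_def split: if_splits)
    then have "\<phi> 0 \<bullet> \<phi> u - \<tau>' \<le> 0" using zero_less_power[OF e(1), of 2] unfolding \<tau>'_def by linarith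
    then show ?thesis by (simp add: \<eta>_def flat_bump_def)
  qed
  let ?\<eta> = "\<lambda>u. \<eta> \<tau>' (\<phi> u)"
  let ?I = "\<lambda>u. indicator (ball 0 R) u :: real"
  note di = divergence_integral[OF r RU suppU']
  have "(LINT u|lborel. (\<Sum>i\<in>UNIV. ?I u * (h \<tau>' u (axis i 1) * w i u + ?\<eta> u * Dw i u))) = 0"
    using di by (subst Bochner_Integration.integral_sum) auto
  moreover have "(\<Sum>i\<in>UNIV. ?I u * (h \<tau>' u (axis i 1) * w i u + ?\<eta> u * Dw i u))
     = ?I u * (\<Sum>i\<in>UNIV. h \<tau>' u (axis i 1) * w i u) + ?I u * (?\<eta> u * (\<Sum>i\<in>UNIV. Dw i u))" for u
    by (simp add: sum_distrib_left sum.distrib algebra_simps)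
  moreover have bint: "integrable lborel (\<lambda>u. ?I u * f u)" if "continuous_on U f" for f
  proof -
    have "integrable lborel (\<lambda>u. indicator (ball 0 R) u *\<^sub>R (indicator (cball 0 R) u *\<^sub>R f u))"
      by (rule integrable_mult_indicator[OF _ borel_integrable_compact[OF compact_cball continuous_on_subset[OF that RU]]]) simp
    moreover have "indicator (ball 0 R) u *\<^sub>R (indicator (cball 0 R) u *\<^sub>R f u) = ?I u * f u" for u
      by (auto simp: indicator_def)
    ultimately show ?thesis by (simp only:)
  qed
  have c1: "continuous_on U (\<lambda>u. \<Sum>i\<in>UNIV. h \<tau>' u (axis i 1) * w i u)"
    by (intro continuous_intros h_cont smooth_on_open_continuous_on[OF smooth_w])
  have c2: "continuous_on U (\<lambda>u. ?\<eta> u * (\<Sum>i\<in>UNIV. Dw i u))"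
    by (intro continuous_intros Dw_cont smooth_on_open_continuous_on[OF smooth_\<eta>\<phi>])
  ultimately have "(LINT u|lborel. ?I u * (\<Sum>i\<in>UNIV. h \<tau>' u (axis i 1) * w i u)) +
      (LINT u|lborel. ?I u * (?\<eta> u * (\<Sum>i\<in>UNIV. Dw i u))) = 0"
    using Bochner_Integration.integral_add[OF bint[OF c1] bint[OF c2]] by simp
  then have "(LINT u|lborel. ?I u * (?\<eta> u * (\<Sum>i\<in>UNIV. Dw i u))) = 0"
    using first_variation[OF R(1) RU suppX] by simp
  then have "sgn (\<Sum>i\<in>UNIV. Dw i 0) * (LINT u|lborel. ?I u * (?\<eta> u * (\<Sum>i\<in>UNIV. Dw i u))) = 0" by simp
  then have int0: "(LINT u|lborel. ?I u * (?\<eta> u * d u)) = 0"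
    unfolding d_def by (subst (asm) integral_mult_right_zero[symmetric]) (simp add: mult_ac)
  have nonneg: "0 \<le> ?I u * (?\<eta> u * d u)" for u
    using dpos[of u] by (auto simp: indicator_def \<eta>_def flat_bump_def)
  have c3: "continuous_on U (\<lambda>u. ?\<eta> u * d u)"
    by (intro continuous_intros dcont smooth_on_open_continuous_on[OF smooth_\<eta>\<phi>])
  have AE: "AE u in lborel. ?I u * (?\<eta> u * d u) = 0"
    using integral_nonneg_eq_0_iff_AE[OF bint[OF c3]] nonneg int0 by simp
  let ?O = "ball 0 R \<inter> (U \<inter> (\<lambda>u. ?\<eta> u * d u) -` {0<..})"
  have "open ?O" by (intro open_Int open_ball continuous_open_preimage[OF c3 openU]) simp
  moreover have "0 \<in> ?O"
  proof -
    have "\<phi> 0 \<bullet> \<phi> 0 - \<tau>' > 0" using n0(1) e(1) by (simp add: dot_square_norm \<tau>_def \<tau>'_def)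
    then have "?\<eta> 0 > 0" by (simp add: \<eta>_def flat_bump_def)
    then show ?thesis using R(1) U0 d0 by simp
  qed
  ultimately have "\<not> negligible ?O" using open_not_negligible by blast
  moreover have "negligible ?O"
  proof -
    obtain N where N: "{u \<in> space lborel. \<not> ?I u * (?\<eta> u * d u) = 0} \<subseteq> N" "emeasure lborel N = 0" "N \<in> sets lborel"
      by (rule AE_E[OF AE]) (rule that)
    then have "N \<in> null_sets lborel" by (simp add: null_sets_def)
    then have "negligible N" by (simp add: negligible_iff_null_sets null_sets_completionI)
    then show ?thesis by (rule negligible_subset) (use N(1) in \<open>auto simp: indicator_def subset_iff\<close>)
  qed
  ultimately show False by blast
qed

text \<open>At \<open>0\<close> the Gram matrix is the identity and \<open>c\<close> vanishes, so the derivatives of the Gram matrix drop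
  out of \<open>Dw\<close>; the terms \<open>D\<phi> e \<bullet> A (D\<phi> e)\<close> vanish because \<open>A\<close> is skew.\<close>

lemma mean_curvature_zero:
  "(\<Sum>i\<in>UNIV. frechet_derivative (\<lambda>u. D\<phi> u (axis i 1)) (at 0) (axis i 1) \<bullet> \<nu>) = 0"
proof -
  have c0: "c 0 = 0"
  proof -
    have "A (\<phi> 0) = \<nu>"
      by (simp add: A_def plane_gen_def plane_inner[OF n0])
    then show ?thesis using \<nu>(3) by (simp add: c_def vec_eq_iff inner_commute)
  qed
  have "Dw i 0 = frechet_derivative (\<lambda>u. D\<phi> u (axis i 1)) (at 0) (axis i 1) \<bullet> \<nu>" for i
  proof -
    let ?e = "axis i 1 :: real^'k"
    let ?dd = "frechet_derivative (\<lambda>u. D\<phi> u ?e) (at 0) ?e"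
    define Mi where "Mi t = (\<chi> l. if l = i then c (t *\<^sub>R ?e) else gram (D\<phi> (t *\<^sub>R ?e)) $ l)" for t
    have line: "((\<lambda>t. f (t *\<^sub>R ?e)) has_real_derivative frechet_derivative f (at 0) ?e) (at 0)"
      if "smooth_on_open U f" for f :: "real^'k \<Rightarrow> real"
      using has_derivative_line[OF smooth_on_open_has_derivative[OF that U0], of ?e]
      by (simp add: has_real_derivative_iff_has_vector_derivative)
    define Md where "Md = (\<chi> l j. frechet_derivative (\<lambda>u. (\<chi> l. if l = i then c u else gram (D\<phi> u) $ l) $ l $ j) (at 0) ?e)"
    have Mi_der: "((\<lambda>t. Mi t $ l $ j) has_real_derivative Md $ l $ j) (at 0)" for l j
      using line[OF smooth_row[of i l j]] by (simp only: Mi_def Md_def vec_lambda_beta)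
    have Mi0: "Mi 0 $ i = 0" by (simp add: Mi_def c0)
    have Mi0': "Mi 0 $ l = mat 1 $ l" if "l \<noteq> i" for l using that orth by (simp add: Mi_def)
    have "((\<lambda>t. det (Mi t)) has_real_derivative (\<Sum>l\<in>UNIV. det (\<chi> m. if m = l then Md $ l else Mi 0 $ m))) (at 0)"
      by (rule det_has_real_derivative[OF Mi_der])
    also have "(\<Sum>l\<in>UNIV. det (\<chi> m. if m = l then Md $ l else Mi 0 $ m)) = Md $ i $ i"
    proof -
      have "det (\<chi> m. if m = l then Md $ l else Mi 0 $ m) = 0" if "l \<noteq> i" for l
        by (rule det_zero_row(1)[of i]) (use that Mi0 in \<open>simp add: row_def vec_eq_iff\<close>)
      then have "(\<Sum>l\<in>UNIV. det (\<chi> m. if m = l then Md $ l else Mi 0 $ m)) = det (\<chi> m. if m = i then Md $ i else Mi 0 $ m)"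
        by (subst sum.remove[of _ i]) auto
      also have "(\<chi> m. if m = i then Md $ i else Mi 0 $ m) = (\<chi> m. if m = i then mat 1 *v (Md $ i) else mat 1 $ m)"
        using Mi0' by (auto simp: vec_eq_iff)
      also have "det \<dots> = (Md $ i) $ i * det (mat 1 :: real^'k^'k)"
        by (rule det_row_cramer) (simp add: transpose_mat)
      finally show ?thesis by simp
    qed
    finally have dMi: "((\<lambda>t. det (Mi t)) has_real_derivative Md $ i $ i) (at 0)" .
    have dJ: "((\<lambda>t. det (gram (D\<phi> (t *\<^sub>R ?e))) powr (-1/2)) has_real_derivative
        frechet_derivative (\<lambda>u. det (gram (D\<phi> u)) powr (-1/2)) (at 0) ?e) (at 0)"
      by (rule line, rule smooth_on_open_compose[OF smooth_on_open_powr smooth_J]) (use J_pos in auto)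
    have "det (Mi 0) = 0" by (rule det_zero_row(1)[of i]) (use Mi0 in \<open>simp add: row_def vec_eq_iff\<close>)
    then have "((\<lambda>t. det (Mi t) * det (gram (D\<phi> (t *\<^sub>R ?e))) powr (-1/2)) has_real_derivative Md $ i $ i) (at 0)"
      using DERIV_mult[OF dMi dJ] orth by simp
    moreover have "((\<lambda>t. w i (t *\<^sub>R ?e)) has_real_derivative Dw i 0) (at 0)"
      unfolding Dw_def by (rule line[OF smooth_w])
    moreover have "(\<lambda>t. w i (t *\<^sub>R ?e)) = (\<lambda>t. det (Mi t) * det (gram (D\<phi> (t *\<^sub>R ?e))) powr (-1/2))"
      by (simp add: w_def Mi_def)
    ultimately have 1: "Dw i 0 = Md $ i $ i" using DERIV_unique by metis
    have "((\<lambda>u. c u $ i) has_derivative (\<lambda>v. D\<phi> 0 ?e \<bullet> A (D\<phi> 0 v) + frechet_derivative (\<lambda>u. D\<phi> u ?e) (at 0) v \<bullet> A (\<phi> 0))) (at 0)"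
    proof -
      have dA: "((\<lambda>u. A (\<phi> u)) has_derivative (\<lambda>v. A (D\<phi> 0 v))) (at 0)"
        using bounded_linear.has_derivative[OF _ local_parametrization_has_derivative[OF lp U0]] linA linear_linear by blast
      have dD: "((\<lambda>u. D\<phi> u ?e) has_derivative frechet_derivative (\<lambda>u. D\<phi> u ?e) (at 0)) (at 0)"
        by (rule smooth_on_open_has_derivative[OF smooth_on_open_frechet_derivative[OF smooth\<phi>] U0])
      show ?thesis unfolding c_def vec_lambda_beta by (rule has_derivative_inner[OF dD dA])
    qed
    from frechet_derivative_at[OF this]
    have "Md $ i $ i = D\<phi> 0 ?e \<bullet> A (D\<phi> 0 ?e) + ?dd \<bullet> A (\<phi> 0)"
      by (simp add: Md_def fun_eq_iff)
    moreover have "D\<phi> 0 ?e \<bullet> A (D\<phi> 0 ?e) = 0"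
      using plane_gen_skew[OF n0, of "D\<phi> 0 ?e" "D\<phi> 0 ?e"] by (simp add: A_def inner_commute)
    moreover have "A (\<phi> 0) = \<nu>"
      by (simp add: A_def plane_gen_def plane_inner[OF n0])
    ultimately show ?thesis using 1 by simp
  qed
  then show ?thesis using divergence_zero by simp
qed

end

text \<open>A linear change of the parameters orthonormalizes the derivative at one point.\<close>

lemma normal_chart:
  fixes X :: "'a::euclidean_space set"
  assumes emb: "embedded_submanifold TYPE('k::finite) X" and x: "x \<in> X"
  obtains U and \<phi> :: "real^'k \<Rightarrow> 'a" where "local_parametrization X U \<phi>" "0 \<in> U" "\<phi> 0 = x"
    "gram (frechet_derivative \<phi> (at 0)) = mat 1"
proof -
  obtain V and \<psi> :: "real^'k \<Rightarrow> 'a" where lp: "local_parametrization X V \<psi>" "x \<in> \<psi> ` V"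
    using emb x unfolding embedded_submanifold_def by blast
  then obtain v0 where v0: "v0 \<in> V" "x = \<psi> v0" by blast
  let ?L = "frechet_derivative \<psi> (at v0)"
  have L: "linear ?L" "inj ?L"
    using local_parametrization_linear[OF lp(1) v0(1)] lp(1) v0(1) by (auto simp: local_parametrization_def)
  have sub: "subspace (range ?L)" using L(1) by (simp add: linear_subspace_image)
  have "dim (UNIV :: (real^'k) set) = dim (range ?L)"
    using dim_image_eq[of ?L UNIV] L by simp
  then obtain J where J: "linear J" "J ` (UNIV :: (real^'k) set) = range ?L" "\<And>u. norm (J u) = norm u"
    by (rule isometries_subspaces[OF subspace_UNIV sub]) (rule that, assumption, assumption, simp)
  obtain L' where L': "linear L'" "L' \<circ> ?L = id"
    using linear_injective_left_inverse[OF L] by blast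
  define E where "E u = L' (J u)" for u
  have E: "linear E" unfolding E_def[abs_def] using linear_compose[OF J(1) L'(1)] by (simp add: o_def)
  have LE: "?L (E u) = J u" for u
  proof -
    have "J u \<in> range ?L" using J(2) by blast
    then obtain z where "J u = ?L z" by blast
    then show ?thesis using L'(2) by (simp add: E_def fun_eq_iff)
  qed
  have injE: "inj E"
  proof -
    have "u = 0" if "E u = 0" for u
      using LE[of u] J(3)[of u] that linear_0[OF L(1)] by simp
    then show ?thesis using linear_injective_0[OF E] by blast
  qed
  then have surjE: "surj E" by (rule linear_inj_imp_surj[OF E])
  obtain E' where E': "linear E'" "E' \<circ> E = id" "E \<circ> E' = id"
    using linear_injective_left_inverse[OF E injE] linear_inverse_left[OF E] by metis
  have EE: "E (E' y) = y" "E' (E y) = y" for y using E'(2,3) by (simp_all add: fun_eq_iff)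
  let ?T = "\<lambda>u. v0 + E u"
  define U where "U = ?T -` V"
  define \<phi> where "\<phi> u = \<psi> (v0 + E u)" for u
  have TU: "?T ` U = V"
  proof
    show "V \<subseteq> ?T ` U"
    proof
      fix v assume "v \<in> V"
      then show "v \<in> ?T ` U" by (intro image_eqI[of _ _ "E' (v - v0)"]) (auto simp: U_def EE)
    qed
  qed (auto simp: U_def)
  have smT: "smooth_on_open UNIV ?T"
    by (rule smooth_on_open_add[OF smooth_on_open_const linear_imp_smooth_on_open[OF E]]) simp
  have oV: "open V" by (rule local_parametrization_open[OF lp(1)])
  have "open (UNIV \<inter> U)" unfolding U_def
    by (rule continuous_open_preimage[OF smooth_on_open_continuous_on[OF smT] open_UNIV oV])
  then have oU: "open U" by simp
  have sm\<psi>: "smooth_on_open V \<psi>" using lp(1) by (simp add: local_parametrization_def)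
  have sm: "smooth_on_open U \<phi>"
    unfolding \<phi>_def[abs_def]
    by (rule smooth_on_open_compose[OF sm\<psi> smooth_on_open_subset[OF smT oU]]) (auto simp: U_def)
  have der: "frechet_derivative \<phi> (at u) = (\<lambda>w. frechet_derivative \<psi> (at (v0 + E u)) (E w))" if "u \<in> U" for u
  proof -
    have dT: "(?T has_derivative E) (at u)"
      using bounded_linear_imp_has_derivative[of E] E linear_linear by (auto intro!: derivative_eq_intros)
    have "v0 + E u \<in> V" using that by (simp add: U_def)
    from has_derivative_compose[OF dT local_parametrization_has_derivative[OF lp(1) this]]
    have "(\<phi> has_derivative (\<lambda>w. frechet_derivative \<psi> (at (v0 + E u)) (E w))) (at u)"
      by (simp add: \<phi>_def[abs_def])
    then show ?thesis by (rule frechet_derivative_at[symmetric])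
  qed
  have img: "\<phi> ` U = \<psi> ` V" unfolding TU[symmetric] by (auto simp: \<phi>_def)
  obtain \<psi>i where hom: "homeomorphism V (\<psi> ` V) \<psi> \<psi>i" using lp(1) by (auto simp: local_parametrization_def)
  have homT: "homeomorphism U V ?T (\<lambda>v. E' (v - v0))"
    unfolding homeomorphism_def
  proof (intro conjI ballI)
    show "continuous_on V (\<lambda>v. E' (v - v0))"
      by (rule continuous_on_compose2[OF continuous_on_linear_compose[OF E'(1), of UNIV]]) (auto intro!: continuous_intros)
    show "continuous_on U ?T" using smooth_on_open_continuous_on[OF smT] continuous_on_subset by blast
    show "(\<lambda>v. E' (v - v0)) ` V = U"
      unfolding TU[symmetric] by (auto simp: EE image_image)
  qed (auto simp: EE TU)
  have "homeomorphism U (\<phi> ` U) \<phi> ((\<lambda>v. E' (v - v0)) \<circ> \<psi>i)"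
    using homeomorphism_compose[OF homT hom] unfolding img by (simp add: \<phi>_def[abs_def] o_def)
  moreover have "openin (top_of_set X) (\<phi> ` U)" unfolding img using lp(1) by (simp add: local_parametrization_def)
  moreover have "inj (frechet_derivative \<phi> (at u))" if "u \<in> U" for u
  proof -
    have "v0 + E u \<in> V" using that by (simp add: U_def)
    then have "inj (frechet_derivative \<psi> (at (v0 + E u)))" using lp(1) by (simp add: local_parametrization_def)
    then show ?thesis unfolding der[OF that] using injE by (simp add: inj_def)
  qed
  ultimately have lp\<phi>: "local_parametrization X U \<phi>"
    using sm unfolding local_parametrization_def by blast
  have U0: "0 \<in> U" using v0(1) linear_0[OF E] by (simp add: U_def)
  have "frechet_derivative \<phi> (at 0) = J"
    unfolding der[OF U0] using linear_0[OF E] LE by (simp add: fun_eq_iff)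
  moreover have "gram J = mat 1"
    using norm_preserving_inner[OF J(1) subspace_UNIV J(3)] by (auto simp: gram_def mat_def vec_eq_iff inner_axis_axis)
  ultimately show ?thesis
    using lp\<phi> U0 v0(2) linear_0[OF E] by (intro that[of U \<phi>]) (auto simp: \<phi>_def)
qed

text \<open>Split \<open>p\<close> into a multiple of \<open>\<phi> 0\<close> and a vector \<open>q\<close> normal to \<open>X\<close> in the sphere. Against \<open>q\<close> the trace is the mean curvature,
  which vanishes; against \<open>\<phi> 0\<close> each term is \<open>-1\<close>, from differentiating \<open>\<phi> \<bullet> \<phi> = 1\<close> twice.\<close>

lemma critical_trace:
  fixes X :: "'a::euclidean_space set" and \<phi> :: "real^'k::finite \<Rightarrow> 'a"
  assumes emb: "embedded_submanifold TYPE('k) X" and X: "compact X" "X \<subseteq> sphere 0 1"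
    and critical: "volume_critical TYPE('k) (sphere 0 1) X"
    and lp: "local_parametrization X U \<phi>" and U0: "0 \<in> U"
    and orth: "gram (frechet_derivative \<phi> (at 0)) = mat 1"
    and p: "\<And>v. p \<bullet> frechet_derivative \<phi> (at 0) v = 0"
  shows "(\<Sum>i\<in>UNIV. frechet_derivative (\<lambda>u. frechet_derivative \<phi> (at u) (axis i 1)) (at 0) (axis i 1) \<bullet> p)
      = - real CARD('k) * (\<phi> 0 \<bullet> p)"
proof -
  let ?D = "\<lambda>u. frechet_derivative \<phi> (at u)"
  let ?dd = "\<lambda>i. frechet_derivative (\<lambda>u. ?D u (axis i 1)) (at 0) (axis i 1)"
  have oU: "open U" by (rule local_parametrization_open[OF lp])
  have sm: "smooth_on_open U \<phi>" using lp by (simp add: local_parametrization_def)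
  have unit: "\<phi> u \<bullet> \<phi> u = 1" if "u \<in> U" for u
  proof -
    have "\<phi> u \<in> sphere 0 1" using local_parametrization_image_subset[OF lp] X(2) that by blast
    then show ?thesis by (simp add: dot_square_norm)
  qed
  have d: "(\<phi> has_derivative ?D u) (at u)" if "u \<in> U" for u
    by (rule local_parametrization_has_derivative[OF lp that])
  have ortho: "\<phi> u \<bullet> ?D u v = 0" if "u \<in> U" for u v
  proof -
    have "((\<lambda>u. \<phi> u \<bullet> \<phi> u) has_derivative (\<lambda>v. \<phi> u \<bullet> ?D u v + ?D u v \<bullet> \<phi> u)) (at u)"
      by (rule has_derivative_inner[OF d[OF that] d[OF that]])
    then have "((\<lambda>u. 1) has_derivative (\<lambda>v. \<phi> u \<bullet> ?D u v + ?D u v \<bullet> \<phi> u)) (at u)"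
      by (rule has_derivative_transform_within_open[OF _ oU that]) (simp add: unit)
    from has_derivative_unique[OF this has_derivative_const]
    have "\<phi> u \<bullet> ?D u v + ?D u v \<bullet> \<phi> u = 0" by (simp add: fun_eq_iff)
    then show ?thesis by (simp add: inner_commute)
  qed
  have self: "?dd i \<bullet> \<phi> 0 = - 1" for i
  proof -
    let ?e = "axis i 1 :: real^'k"
    have dD: "((\<lambda>u. ?D u ?e) has_derivative frechet_derivative (\<lambda>u. ?D u ?e) (at 0)) (at 0)"
      by (rule smooth_on_open_has_derivative[OF smooth_on_open_frechet_derivative[OF sm] U0])
    have "((\<lambda>u. \<phi> u \<bullet> ?D u ?e) has_derivative (\<lambda>v. \<phi> 0 \<bullet> frechet_derivative (\<lambda>u. ?D u ?e) (at 0) v + ?D 0 v \<bullet> ?D 0 ?e)) (at 0)"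
      by (rule has_derivative_inner[OF d[OF U0] dD])
    then have "((\<lambda>u. 0) has_derivative (\<lambda>v. \<phi> 0 \<bullet> frechet_derivative (\<lambda>u. ?D u ?e) (at 0) v + ?D 0 v \<bullet> ?D 0 ?e)) (at 0)"
      by (rule has_derivative_transform_within_open[OF _ oU U0]) (simp add: ortho)
    from has_derivative_unique[OF this has_derivative_const]
    have "\<phi> 0 \<bullet> ?dd i + ?D 0 ?e \<bullet> ?D 0 ?e = 0" by (simp add: fun_eq_iff)
    moreover have "?D 0 ?e \<bullet> ?D 0 ?e = gram (?D 0) $ i $ i" by (simp add: gram_def)
    ultimately show ?thesis unfolding orth by (simp add: mat_def inner_commute)
  qed
  define n where "n = p - (\<phi> 0 \<bullet> p) *\<^sub>R \<phi> 0"
  have p_eq: "p = n + (\<phi> 0 \<bullet> p) *\<^sub>R \<phi> 0" by (simp add: n_def)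
  have n0: "n \<bullet> \<phi> 0 = 0" using unit[OF U0] by (simp add: n_def inner_diff_left inner_commute[of p "\<phi> 0"])
  have nD: "n \<bullet> ?D 0 v = 0" for v using ortho[OF U0] p by (simp add: n_def inner_diff_left)
  have "(\<Sum>i\<in>UNIV. ?dd i \<bullet> n) = 0"
  proof (cases "n = 0")
    case False
    let ?\<nu> = "(1 / norm n) *\<^sub>R n"
    interpret critical_chart X U \<phi> ?\<nu>
      by unfold_locales (use assms n0 nD False in auto)
    have "(\<Sum>i\<in>UNIV. ?dd i \<bullet> ?\<nu>) = 0" by (rule mean_curvature_zero)
    then have "(1 / norm n) * (\<Sum>i\<in>UNIV. ?dd i \<bullet> n) = 0" by (simp add: sum_distrib_left)
    then show ?thesis using False by simp
  qed simp
  moreover have "?dd i \<bullet> p = ?dd i \<bullet> n - (\<phi> 0 \<bullet> p)" for i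
    by (subst p_eq) (simp add: inner_add_right self)
  ultimately show ?thesis by (simp add: sum_subtractf)
qed

section \<open>The Jacobi operator on polynomials\<close>

text \<open>The Laplacian of the unit \<open>n\<close>-sphere on functions of the squared length \<open>v\<close> of the projection to
  a linear subspace of dimension \<open>k + 1\<close>. It is a Jacobi operator: its polynomial eigenfunctions are Jacobi polynomials in \<open>1 - 2 v\<close>.\<close>

definition jacobi_op :: "real \<Rightarrow> real \<Rightarrow> real poly \<Rightarrow> real \<Rightarrow> real" where
  "jacobi_op k n \<Theta> v = 4 * v * (1 - v) * poly (pderiv (pderiv \<Theta>)) v
      + (2 * (k + 1) - 2 * (n + 1) * v) * poly (pderiv \<Theta>) v"

lemma jacobi_op_add: "jacobi_op k n (p + q) v = jacobi_op k n p v + jacobi_op k n q v"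
  by (simp add: jacobi_op_def pderiv_add algebra_simps)

lemma jacobi_op_smult: "jacobi_op k n (smult a p) v = a * jacobi_op k n p v"
  by (simp add: jacobi_op_def pderiv_smult algebra_simps)

lemma jacobi_op_monom:
  "jacobi_op k n (monom 1 (Suc m)) v = real (Suc m) * ((4 * real m + 2 * (k + 1)) * v ^ m - (4 * real m + 2 * (n + 1)) * v ^ Suc m)"
proof (cases m)
  case 0
  then show ?thesis by (simp add: jacobi_op_def pderiv_monom poly_monom)
next
  case (Suc l)
  then show ?thesis by (simp add: jacobi_op_def pderiv_monom poly_monom algebra_simps)
qed

text \<open>On monomials the operator is triangular, with non-zero diagonal entries except at the constants.\<close>

lemma jacobi_op_surj_monom:
  assumes "n \<ge> 0"
  shows "\<exists>\<Theta> c. \<forall>v. v ^ m = jacobi_op k n \<Theta> v + c"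
proof (induction m)
  case 0
  have "\<forall>v. v ^ 0 = jacobi_op k n 0 v + 1" by (simp add: jacobi_op_def)
  then show ?case by blast
next
  case (Suc m)
  then obtain \<Theta> c where IH: "\<And>v. v ^ m = jacobi_op k n \<Theta> v + c" by blast
  define a where "a = 4 * real m + 2 * (n + 1)"
  define b where "b = 4 * real m + 2 * (k + 1)"
  have a: "a > 0" using assms by (simp add: a_def)
  define M where "M = real (Suc m)"
  have M: "M > 0" by (simp add: M_def)
  define \<Theta>' where "\<Theta>' = smult (b / a) \<Theta> + smult (- 1 / (a * M)) (monom 1 (Suc m))"
  have "v ^ Suc m = jacobi_op k n \<Theta>' v + b / a * c" for v
  proof -
    have "jacobi_op k n \<Theta>' v + b / a * c = b / a * (jacobi_op k n \<Theta> v + c) - 1 / a * (b * v ^ m - a * v ^ Suc m)"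
    proof -
      define Y where "Y = b * v ^ m - a * v ^ Suc m"
      have "- 1 / (a * M) * (M * Y) = - (1 / a * Y)" using a M by simp
      then show ?thesis
        unfolding \<Theta>'_def jacobi_op_add jacobi_op_smult jacobi_op_monom
          a_def[symmetric] b_def[symmetric] M_def[symmetric] Y_def[symmetric]
        by (simp add: distrib_left)
    qed
    also have "\<dots> = v ^ Suc m" unfolding IH[symmetric] using a by (simp add: field_simps)
    finally show ?thesis by simp
  qed
  then show ?case by blast
qed

lemma jacobi_op_surj:
  assumes "n \<ge> 0"
  obtains \<Theta> c where "\<And>v. poly g v = jacobi_op k n \<Theta> v + c"
proof -
  have "\<exists>\<Theta> c. \<forall>v. (\<Sum>i\<le>d. coeff g i * v ^ i) = jacobi_op k n \<Theta> v + c" for d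
  proof (induction d)
    case 0
    have "\<forall>v. (\<Sum>i\<le>0. coeff g i * v ^ i) = jacobi_op k n 0 v + coeff g 0" by (simp add: jacobi_op_def)
    then show ?case by blast
  next
    case (Suc d)
    then obtain \<Theta> c where 1: "\<And>v. (\<Sum>i\<le>d. coeff g i * v ^ i) = jacobi_op k n \<Theta> v + c" by blast
    obtain \<Theta>' c' where 2: "\<And>v. v ^ Suc d = jacobi_op k n \<Theta>' v + c'"
      using jacobi_op_surj_monom[OF assms, where m = "Suc d" and k = k] by blast
    have "\<forall>v. (\<Sum>i\<le>Suc d. coeff g i * v ^ i) = jacobi_op k n (\<Theta> + smult (coeff g (Suc d)) \<Theta>') v + (c + coeff g (Suc d) * c')"
      using 1 2 by (simp add: jacobi_op_add jacobi_op_smult algebra_simps del: power_Suc)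
    then show ?case by blast
  qed
  then show ?thesis using that unfolding poly_altdef by blast
qed

lemma interior_min_second_derivative:
  fixes y :: "real poly"
  assumes v: "0 < v" "v < 1" and min: "\<And>x. 0 \<le> x \<Longrightarrow> x \<le> 1 \<Longrightarrow> poly y v \<le> poly y x"
  shows "poly (pderiv y) v = 0" "poly (pderiv (pderiv y)) v \<ge> 0"
proof -
  show z: "poly (pderiv y) v = 0"
  proof (rule DERIV_local_min[OF poly_DERIV, of "min v (1 - v)"])
    show "0 < min v (1 - v)" using v by simp
    show "\<forall>x. \<bar>v - x\<bar> < min v (1 - v) \<longrightarrow> poly y v \<le> poly y x" by (auto intro!: min)
  qed
  show "poly (pderiv (pderiv y)) v \<ge> 0"
  proof (rule ccontr)
    assume "\<not> poly (pderiv (pderiv y)) v \<ge> 0"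
    then have "poly (pderiv (pderiv y)) v < 0" by simp
    from DERIV_neg_dec_right[OF poly_DERIV this]
    obtain d where d: "d > 0" "\<And>h. 0 < h \<Longrightarrow> h < d \<Longrightarrow> poly (pderiv y) (v + h) < poly (pderiv y) v" by blast
    define e where "e = min (d / 2) ((1 - v) / 2)"
    have e: "0 < e" "e < d" "v + e < 1" using d(1) v by (auto simp: e_def min_def field_simps)
    have "poly y (v + e) < poly y v"
    proof (rule DERIV_neg_imp_decreasing_open[of v "v + e" "poly y"])
      show "v < v + e" using e by simp
      show "\<exists>y'. (poly y has_real_derivative y') (at x) \<and> y' < 0" if "v < x" "x < v + e" for x
        using d(2)[of "x - v"] that e z by (intro exI[of _ "poly (pderiv y) x"]) auto
    qed (intro continuous_intros)
    then show False using min[of "v + e"] e v by simp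
  qed
qed

lemma endpoint_derivative:
  fixes y :: "real poly"
  assumes min: "\<And>x. 0 \<le> x \<Longrightarrow> x \<le> 1 \<Longrightarrow> poly y v \<le> poly y x"
  shows "v = 0 \<Longrightarrow> poly (pderiv y) v \<ge> 0" "v = 1 \<Longrightarrow> poly (pderiv y) v \<le> 0"
proof -
  show "poly (pderiv y) v \<ge> 0" if "v = 0"
  proof (rule ccontr)
    assume "\<not> poly (pderiv y) v \<ge> 0"
    then have "poly (pderiv y) v < 0" by simp
    from DERIV_neg_dec_right[OF poly_DERIV this]
    obtain d where d: "d > 0" "\<And>h. 0 < h \<Longrightarrow> h < d \<Longrightarrow> poly y (v + h) < poly y v" by blast
    then show False using min[of "v + min (d/2) 1"] that by (auto simp: not_le[symmetric])
  qed
  show "poly (pderiv y) v \<le> 0" if "v = 1"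
  proof (rule ccontr)
    assume "\<not> poly (pderiv y) v \<le> 0"
    then have "poly (pderiv y) v > 0" by simp
    from DERIV_pos_inc_left[OF poly_DERIV this]
    obtain d where d: "d > 0" "\<And>h. 0 < h \<Longrightarrow> h < d \<Longrightarrow> poly y (v - h) < poly y v" by blast
    then show False using min[of "v - min (d/2) 1"] that by (auto simp: not_le[symmetric])
  qed
qed

text \<open>A minimum principle for \<open>y = \<Theta>'\<close>. Differentiating the equation gives an elliptic operator with
  zeroth order term \<open>- 2 (n + 1) y\<close> applied to \<open>y\<close>, with value \<open>g' \<le> 0\<close>; so \<open>y\<close> cannot have a negative minimum.
  At the endpoints the second order term degenerates and the first order term points inwards.\<close>

lemma jacobi_op_monotone:
  assumes kn: "0 \<le> k" "k \<le> n" and g: "\<And>v. poly g v = jacobi_op k n \<Theta> v + c"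
    and dec: "\<And>v. 0 \<le> v \<Longrightarrow> v \<le> 1 \<Longrightarrow> poly (pderiv g) v \<le> 0"
    and v: "0 \<le> v" "v \<le> 1"
  shows "poly (pderiv \<Theta>) v \<ge> 0"
proof -
  define y where "y = pderiv \<Theta>"
  define G where "G = [:0, 4, -4:] * pderiv y + [:2 * (k + 1), - 2 * (n + 1):] * y + [:c:]"
  have "poly g = poly G"
    by (rule ext) (simp add: g jacobi_op_def G_def y_def algebra_simps)
  then have "g = G" by (simp add: poly_eq_poly_eq_iff)
  then have dg: "poly (pderiv g) x = 4 * x * (1 - x) * poly (pderiv (pderiv y)) x + 4 * (1 - 2 * x) * poly (pderiv y) x
      + (2 * (k + 1) - 2 * (n + 1) * x) * poly (pderiv y) x - 2 * (n + 1) * poly y x" for x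
    by (simp add: G_def pderiv_add pderiv_mult pderiv_pCons pderiv_smult pderiv_minus algebra_simps)
  have "\<exists>x\<in>{0..1}. \<forall>z\<in>{0..1}. poly y x \<le> poly y z"
    by (rule continuous_attains_inf) (auto intro!: continuous_intros)
  then obtain x where x: "0 \<le> x" "x \<le> 1" and min: "\<And>z. 0 \<le> z \<Longrightarrow> z \<le> 1 \<Longrightarrow> poly y x \<le> poly y z" by auto
  have "poly y x \<ge> 0"
  proof -
    consider "x = 0" | "x = 1" | "0 < x" "x < 1" using x by linarith
    then have "2 * (n + 1) * poly y x \<ge> 0"
    proof cases
      case 1
      have "poly (pderiv y) x \<ge> 0" using endpoint_derivative(1)[OF min 1] .
      then have "(4 + 2 * (k + 1)) * poly (pderiv y) x \<ge> 0" using kn by simp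
      then show ?thesis using dec[of x] x dg[of x] 1 by (simp add: algebra_simps)
    next
      case 2
      have "poly (pderiv y) x \<le> 0" using endpoint_derivative(2)[OF min 2] .
      then have "(4 + 2 * (n - k)) * poly (pderiv y) x \<le> 0" using kn by (simp add: mult_nonneg_nonpos)
      then show ?thesis using dec[of x] x dg[of x] 2 by (simp add: algebra_simps)
    next
      case 3
      have d: "poly (pderiv y) x = 0" "poly (pderiv (pderiv y)) x \<ge> 0"
        using interior_min_second_derivative[OF 3 min] by auto
      then have "4 * x * (1 - x) * poly (pderiv (pderiv y)) x \<ge> 0" using 3 by simp
      moreover have "poly (pderiv g) x = 4 * x * (1 - x) * poly (pderiv (pderiv y)) x - 2 * (n + 1) * poly y x"
        by (simp add: dg d(1))
      ultimately show ?thesis using dec[OF x] by linarith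
    qed
    then show ?thesis using kn by (simp add: zero_le_mult_iff)
  qed
  then show ?thesis using min[OF v] by (simp add: y_def)
qed

lemma poly_bounded_unit:
  fixes p :: "real poly"
  obtains B where "B > 0" "\<And>x. 0 \<le> x \<Longrightarrow> x \<le> 1 \<Longrightarrow> \<bar>poly p x\<bar> \<le> B"
proof -
  have "compact (poly p ` {0..1})" by (intro compact_continuous_image continuous_intros) simp
  from compact_imp_bounded[OF this] show ?thesis using that unfolding bounded_pos by auto
qed

lemma poly_taylor_bound:
  fixes p :: "real poly"
  obtains K where "K > 0" "\<And>x y. 0 \<le> x \<Longrightarrow> x \<le> 1 \<Longrightarrow> 0 \<le> y \<Longrightarrow> y \<le> 1 \<Longrightarrow>
    \<bar>poly p y - poly p x - poly (pderiv p) x * (y - x)\<bar> \<le> K * (y - x)\<^sup>2"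
proof -
  obtain K where K: "K > 0" "\<And>x. 0 \<le> x \<Longrightarrow> x \<le> 1 \<Longrightarrow> \<bar>poly (pderiv (pderiv p)) x\<bar> \<le> K"
    by (rule poly_bounded_unit) (rule that)
  show ?thesis
  proof (rule that[OF K(1)])
    fix x y :: real assume x: "0 \<le> x" "x \<le> 1" and y: "0 \<le> y" "y \<le> 1"
    let ?S = "closed_segment x y"
    have seg: "0 \<le> t" "t \<le> 1" "\<bar>t - x\<bar> \<le> \<bar>y - x\<bar>" if "t \<in> ?S" for t
      using that x y by (auto simp: closed_segment_eq_real_ivl split: if_splits)
    have 1: "norm (poly (pderiv p) t - poly (pderiv p) x) \<le> K * \<bar>y - x\<bar>" if t: "t \<in> ?S" for t
    proof -
      have "norm (poly (pderiv p) t - poly (pderiv p) x) \<le> K * norm (t - x)"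
        by (rule field_differentiable_bound[of ?S "poly (pderiv p)" "poly (pderiv (pderiv p))"])
          (use t K(2) seg in \<open>auto intro: DERIV_subset[OF poly_DERIV]\<close>)
      also have "\<dots> \<le> K * \<bar>y - x\<bar>" using seg(3)[OF t] K(1) by simp
      finally show ?thesis .
    qed
    let ?h = "\<lambda>t. poly p t - poly (pderiv p) x * t"
    have "norm (?h y - ?h x) \<le> (K * \<bar>y - x\<bar>) * norm (y - x)"
    proof (rule field_differentiable_bound[of ?S ?h "\<lambda>t. poly (pderiv p) t - poly (pderiv p) x"])
      show "(?h has_field_derivative poly (pderiv p) t - poly (pderiv p) x) (at t within ?S)" for t
        by (auto intro!: derivative_eq_intros intro: DERIV_subset[OF poly_DERIV])
    qed (use 1 in auto)
    moreover have "?h y - ?h x = poly p y - poly p x - poly (pderiv p) x * (y - x)"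
      by (simp add: algebra_simps)
    moreover have "(K * \<bar>y - x\<bar>) * norm (y - x) = K * (y - x)\<^sup>2"
      by (simp add: power2_eq_square mult.assoc)
    ultimately show "\<bar>poly p y - poly p x - poly (pderiv p) x * (y - x)\<bar> \<le> K * (y - x)\<^sup>2"
      by (simp only: real_norm_def)
  qed
qed

text \<open>For \<open>w\<close> between \<open>y\<close> and \<open>z\<close> take \<open>(1 - v^m)^N\<close> with \<open>N\<close> close to \<open>w\<close> to the power \<open>-m\<close>: then \<open>N v^m\<close> tends to \<open>0\<close> for
  \<open>v < w\<close> and to infinity for \<open>v > w\<close> as \<open>m\<close> grows. All these polynomials decrease on the unit interval.\<close>

lemma power_step_polynomial:
  fixes y z \<delta> :: real
  assumes yz: "0 \<le> y" "y < z" "z \<le> 1" and \<delta>: "\<delta> > 0"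
  obtains g :: "real poly" where
    "\<And>v. 0 \<le> v \<Longrightarrow> v \<le> 1 \<Longrightarrow> poly (pderiv g) v \<le> 0"
    "\<And>v. 0 \<le> v \<Longrightarrow> v \<le> 1 \<Longrightarrow> 0 \<le> poly g v \<and> poly g v \<le> 1"
    "\<And>v. 0 \<le> v \<Longrightarrow> v \<le> y \<Longrightarrow> 1 - \<delta> \<le> poly g v"
    "\<And>v. z \<le> v \<Longrightarrow> v \<le> 1 \<Longrightarrow> poly g v \<le> \<delta>"
proof -
  define w where "w = (y + z) / 2"
  have w: "0 < w" "y < w" "w < z" "w \<le> 1" using yz by (auto simp: w_def)
  have l1: "(\<lambda>m. (y / w) ^ m) \<longlonglongrightarrow> 0" using w yz by (intro LIMSEQ_power_zero) simp
  have l2: "(\<lambda>m. (w / z) ^ m) \<longlonglongrightarrow> 0" using w yz by (intro LIMSEQ_power_zero) simp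
  have "eventually (\<lambda>m. (y / w) ^ m < \<delta> / 2 \<and> (w / z) ^ m < \<delta> \<and> m \<ge> 1) sequentially"
    by (intro eventually_conj order_tendstoD(2)[OF l1] order_tendstoD(2)[OF l2] eventually_ge_at_top) (use \<delta> in auto)
  then obtain m where m: "(y / w) ^ m < \<delta> / 2" "(w / z) ^ m < \<delta>" "m \<ge> 1"
    by (auto simp: eventually_sequentially)
  define N where "N = nat \<lceil>(1 / w) ^ m\<rceil>"
  have w1: "(1 / w) ^ m \<ge> 1" using w by (intro one_le_power) simp
  have N: "real N \<ge> (1 / w) ^ m" "real N \<le> 2 * (1 / w) ^ m"
    unfolding N_def using w1 by linarith+
  define g :: "real poly" where "g = (1 - monom 1 m) ^ N"
  have pg: "poly g v = (1 - v ^ m) ^ N" for v by (simp add: g_def poly_monom)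
  show ?thesis
  proof (rule that[of g])
    fix v :: real
    { assume v: "0 \<le> v" "v \<le> 1"
      then have vm: "0 \<le> v ^ m" "v ^ m \<le> 1" by (auto intro: power_le_one)
      show "poly (pderiv g) v \<le> 0"
      proof (cases N)
        case 0 then show ?thesis by (simp add: g_def)
      next
        case (Suc N')
        have "poly (pderiv g) v = - (real N * (1 - v ^ m) ^ N' * (real m * v ^ (m - 1)))"
          by (simp add: g_def Suc pderiv_power_Suc pderiv_diff pderiv_monom poly_monom pderiv_1 del: power_Suc)
        also have "\<dots> \<le> 0" using vm v by simp
        finally show ?thesis .
      qed
      show "0 \<le> poly g v \<and> poly g v \<le> 1"
        unfolding pg using vm by (auto intro: power_le_one)
    }
    { assume v: "0 \<le> v" "v \<le> y"
      have "1 - \<delta> \<le> 1 + real N * (- (v ^ m))"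
      proof -
        have "real N * v ^ m \<le> (2 * (1 / w) ^ m) * y ^ m"
          using N v w yz by (intro mult_mono power_mono) auto
        also have "\<dots> = 2 * (y / w) ^ m" by (simp add: power_divide)
        also have "\<dots> \<le> \<delta>" using m(1) by simp
        finally show ?thesis by simp
      qed
      also have "\<dots> \<le> (1 + (- (v ^ m))) ^ N"
        using v yz by (intro Bernoulli_inequality) (auto intro: power_le_one)
      finally show "1 - \<delta> \<le> poly g v" unfolding pg by simp
    }
    { assume v: "z \<le> v" "v \<le> 1"
      then have v0: "0 \<le> v" using w yz by simp
      have vm: "0 \<le> v ^ m" "v ^ m \<le> 1" using v v0 by (auto intro: power_le_one)
      have "(1 - v ^ m) ^ N \<le> exp (- (v ^ m)) ^ N"
        using exp_ge_add_one_self[of "- (v ^ m)"] vm by (intro power_mono) auto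
      also have "\<dots> = exp (- (real N * v ^ m))" by (simp add: exp_of_nat_mult[symmetric])
      also have "\<dots> \<le> exp (- ((z / w) ^ m))"
      proof -
        have "(z / w) ^ m = (1 / w) ^ m * z ^ m" by (simp add: power_divide)
        also have "\<dots> \<le> real N * v ^ m" using N v w yz by (intro mult_mono power_mono) auto
        finally show ?thesis by simp
      qed
      also have "\<dots> \<le> (w / z) ^ m"
      proof -
        have pos: "(z / w) ^ m > 0" using w yz by simp
        have "exp (- ((z / w) ^ m)) = inverse (exp ((z / w) ^ m))" by (rule exp_minus)
        also have "\<dots> \<le> inverse ((z / w) ^ m)"
        proof (rule le_imp_inverse_le)
          show "(z / w) ^ m \<le> exp ((z / w) ^ m)" using exp_ge_add_one_self[of "(z / w) ^ m"] by linarith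
        qed (rule pos)
        also have "\<dots> = (w / z) ^ m" by (simp add: power_divide)
        finally show ?thesis .
      qed
      finally show "poly g v \<le> \<delta>" unfolding pg using m(2) by simp
    }
  qed
qed

section \<open>Sums over coordinate planes\<close>

text \<open>Ordered pairs, so that each rotation occurs together with its inverse and first order terms in
  the angle cancel in sums over \<open>planes\<close>. The second order term of such a sum is the
  Laplacian of the sphere: the rotation fields satisfy the identities of this section.\<close>

definition planes :: "('a::euclidean_space \<times> 'a) set" where
  "planes = {(i, j). i \<in> Basis \<and> j \<in> Basis \<and> i \<noteq> j}"

lemma finite_planes: "finite (planes :: ('a::euclidean_space \<times> 'a) set)"
  by (rule finite_subset[of _ "Basis \<times> Basis"]) (auto simp: planes_def)

lemma planes_orthonormal:
  assumes "(i, j) \<in> planes" shows "norm i = 1" "norm j = 1" "i \<bullet> j = 0"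
  using assms by (auto simp: planes_def inner_not_same_Basis)

lemma sum_planes:
  fixes f :: "'a::euclidean_space \<Rightarrow> 'a \<Rightarrow> real"
  assumes "\<And>i. i \<in> Basis \<Longrightarrow> f i i = 0"
  shows "(\<Sum>(i, j)\<in>planes. f i j) = (\<Sum>i\<in>Basis. \<Sum>j\<in>Basis. f i j)"
proof -
  have "(\<Sum>(i, j)\<in>planes. f i j) = (\<Sum>(i, j)\<in>Basis \<times> Basis. f i j)"
    by (rule sum.mono_neutral_left) (auto simp: planes_def assms)
  then show ?thesis by (simp add: sum.cartesian_product)
qed

lemma inner_Basis_sum: "(\<Sum>i\<in>Basis. (i \<bullet> x) * (i \<bullet> y)) = x \<bullet> (y::'a::euclidean_space)"
  by (simp add: euclidean_inner[of x y] inner_commute)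

lemma planes_gen_sum: "(\<Sum>(i, j)\<in>planes. plane_gen i j p \<bullet> x) = (0::real)" for p x :: "'a::euclidean_space"
proof -
  have "(\<Sum>(i, j)\<in>planes. plane_gen i j p \<bullet> x) = (\<Sum>i\<in>Basis. \<Sum>j\<in>Basis. plane_gen i j p \<bullet> x)"
    by (rule sum_planes) (simp add: plane_gen_def)
  also have "\<dots> = (\<Sum>i\<in>Basis. \<Sum>j\<in>Basis. (i \<bullet> p) * (j \<bullet> x)) - (\<Sum>i\<in>Basis. \<Sum>j\<in>Basis. (j \<bullet> p) * (i \<bullet> x))"
    by (simp add: plane_gen_def inner_diff_left sum_subtractf)
  also have "(\<Sum>i\<in>Basis. \<Sum>j\<in>Basis. (j \<bullet> p) * (i \<bullet> x)) = (\<Sum>i\<in>Basis. \<Sum>j\<in>Basis. (i \<bullet> p) * (j \<bullet> x))"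
    by (rule sum.swap)
  finally show ?thesis by simp
qed

lemma planes_gen_product:
  "(\<Sum>(i, j)\<in>planes. (plane_gen i j p \<bullet> x) * (plane_gen i j p \<bullet> y)) = 2 * ((p \<bullet> p) * (x \<bullet> y) - (p \<bullet> x) * (p \<bullet> y))"
  for p x y :: "'a::euclidean_space"
proof -
  have "(\<Sum>(i, j)\<in>planes. (plane_gen i j p \<bullet> x) * (plane_gen i j p \<bullet> y))
      = (\<Sum>i\<in>Basis. \<Sum>j\<in>Basis. (plane_gen i j p \<bullet> x) * (plane_gen i j p \<bullet> y))"
    by (rule sum_planes) (simp add: plane_gen_def)
  also have "\<dots> = (\<Sum>i\<in>Basis. \<Sum>j\<in>Basis. ((i \<bullet> p) * (i \<bullet> p)) * ((j \<bullet> x) * (j \<bullet> y)))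
     + (\<Sum>i\<in>Basis. \<Sum>j\<in>Basis. ((i \<bullet> x) * (i \<bullet> y)) * ((j \<bullet> p) * (j \<bullet> p)))
     - (\<Sum>i\<in>Basis. \<Sum>j\<in>Basis. ((i \<bullet> p) * (i \<bullet> y)) * ((j \<bullet> p) * (j \<bullet> x)))
     - (\<Sum>i\<in>Basis. \<Sum>j\<in>Basis. ((i \<bullet> p) * (i \<bullet> x)) * ((j \<bullet> p) * (j \<bullet> y)))"
    by (simp add: plane_gen_def inner_diff_left sum_subtractf[symmetric] sum.distrib[symmetric] algebra_simps)
  also have "\<dots> = 2 * ((p \<bullet> p) * (x \<bullet> y) - (p \<bullet> x) * (p \<bullet> y))"
    by (simp only: sum_product[symmetric] inner_Basis_sum) (simp add: algebra_simps)
  finally show ?thesis .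
qed

lemma planes_projection_sum:
  "(\<Sum>(i, j)\<in>planes. (i \<bullet> p) * (i \<bullet> x) + (j \<bullet> p) * (j \<bullet> x)) = 2 * (real DIM('a) - 1) * (p \<bullet> x)"
  for p x :: "'a::euclidean_space"
proof -
  have "(\<Sum>(i, j)\<in>planes. (i \<bullet> p) * (i \<bullet> x) + (j \<bullet> p) * (j \<bullet> x))
     = (\<Sum>(i, j)\<in>planes. (\<lambda>i j. (i \<bullet> p) * (i \<bullet> x) + (j \<bullet> p) * (j \<bullet> x) - (if i = j then 2 * ((i \<bullet> p) * (i \<bullet> x)) else 0)) i j)"
    by (rule sum.cong) (auto simp: planes_def)
  also have "\<dots> = (\<Sum>i\<in>Basis. \<Sum>j\<in>Basis. (i \<bullet> p) * (i \<bullet> x) + (j \<bullet> p) * (j \<bullet> x) - (if i = j then 2 * ((i \<bullet> p) * (i \<bullet> x)) else 0))"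
    by (rule sum_planes) simp
  also have "\<dots> = real DIM('a) * (p \<bullet> x) + real DIM('a) * (p \<bullet> x) - 2 * (p \<bullet> x)"
    by (simp add: sum.distrib sum_subtractf inner_Basis_sum sum_distrib_left[symmetric])
  finally show ?thesis by (simp add: algebra_simps)
qed

lemma planes_rot_sum:
  "(\<Sum>(i, j)\<in>planes. (plane_rot i j s p - p) \<bullet> x) = (cos s - 1) * (2 * (real DIM('a) - 1) * (p \<bullet> x))"
  for p x :: "'a::euclidean_space"
proof -
  have "(\<Sum>(i, j)\<in>planes. (plane_rot i j s p - p) \<bullet> x) =
     (cos s - 1) * (\<Sum>(i, j)\<in>planes. (i \<bullet> p) * (i \<bullet> x) + (j \<bullet> p) * (j \<bullet> x)) + sin s * (\<Sum>(i, j)\<in>planes. plane_gen i j p \<bullet> x)"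
  proof -
    have "(\<Sum>(i, j)\<in>planes. (plane_rot i j s p - p) \<bullet> x) =
      (\<Sum>(i, j)\<in>planes. (cos s - 1) * ((i \<bullet> p) * (i \<bullet> x) + (j \<bullet> p) * (j \<bullet> x)) + sin s * (plane_gen i j p \<bullet> x))"
      by (rule sum.cong) (auto simp: plane_rot_def inner_add_left)
    then show ?thesis by (simp only: case_prod_unfold distrib_left sum.distrib sum_distrib_left)
  qed
  then show ?thesis by (simp add: planes_gen_sum planes_projection_sum)
qed

lemma planes_gen_gen_sum:
  "(\<Sum>(i, j)\<in>planes. plane_gen i j (plane_gen i j p) \<bullet> x) = - 2 * (real DIM('a) - 1) * (p \<bullet> x)"
  for p x :: "'a::euclidean_space"
proof -
  have "(\<Sum>(i, j)\<in>planes. plane_gen i j (plane_gen i j p) \<bullet> x) = (\<Sum>(i, j)\<in>planes. - ((i \<bullet> p) * (i \<bullet> x) + (j \<bullet> p) * (j \<bullet> x)))"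
  proof (rule sum.cong, simp, clarify)
    fix i j :: 'a assume ij: "(i, j) \<in> planes"
    show "plane_gen i j (plane_gen i j p) \<bullet> x = - ((i \<bullet> p) * (i \<bullet> x) + (j \<bullet> p) * (j \<bullet> x))"
      using plane_inner[OF planes_orthonormal[OF ij]]
      by (simp add: plane_gen_def inner_diff_left inner_diff_right)
  qed
  also have "\<dots> = - (\<Sum>(i, j)\<in>planes. (i \<bullet> p) * (i \<bullet> x) + (j \<bullet> p) * (j \<bullet> x))"
    by (subst sum_negf[symmetric]) (simp only: case_prod_unfold)
  finally show ?thesis by (simp only: planes_projection_sum)
qed

text \<open>The second order Taylor formula, assuming the second derivative at a single point only.\<close>

lemma second_order_limit:
  fixes f :: "real \<Rightarrow> real"
  assumes "eventually (\<lambda>s. (f has_real_derivative f' s) (at s)) (nhds 0)"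
    and "(f' has_real_derivative f'') (at 0)"
  shows "((\<lambda>s. (f s - f 0 - s * f' 0) / s\<^sup>2) \<longlongrightarrow> f'' / 2) (at 0)"
proof (rule lhopital[where f' = "\<lambda>s. f' s - f' 0" and g' = "\<lambda>s. 2 * s"])
  have ev: "eventually (\<lambda>s. (f has_real_derivative f' s) (at s)) (at 0)"
    using assms(1) by (simp add: eventually_at_filter eventually_mono)
  have "(f has_real_derivative f' 0) (at 0)" using assms(1) by (rule eventually_nhds_x_imp_x)
  then have "isCont f 0" by (rule DERIV_isCont)
  then have "(f \<longlongrightarrow> f 0) (at 0)" by (simp add: isCont_def)
  then have "((\<lambda>s. f s - f 0 - s * f' 0) \<longlongrightarrow> f 0 - f 0 - 0 * f' 0) (at 0)"
    by (rule tendsto_diff[OF tendsto_diff[OF _ tendsto_const] tendsto_mult[OF tendsto_ident_at tendsto_const]])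
  then show "((\<lambda>s. f s - f 0 - s * f' 0) \<longlongrightarrow> 0) (at 0)" by simp
  have "((\<lambda>s::real. s\<^sup>2) \<longlongrightarrow> 0\<^sup>2) (at 0)" by (intro tendsto_intros)
  then show "((\<lambda>s::real. s\<^sup>2) \<longlongrightarrow> 0) (at 0)" by simp
  show "eventually (\<lambda>s::real. s\<^sup>2 \<noteq> 0) (at 0)" "eventually (\<lambda>s::real. 2 * s \<noteq> 0) (at 0)"
    by (auto simp: eventually_at_filter)
  show "eventually (\<lambda>s. ((\<lambda>s. f s - f 0 - s * f' 0) has_real_derivative f' s - f' 0) (at s)) (at 0)"
    using ev by eventually_elim (auto intro!: derivative_eq_intros)
  show "eventually (\<lambda>s::real. ((\<lambda>s. s\<^sup>2) has_real_derivative 2 * s) (at s)) (at 0)"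
    by (rule always_eventually) (auto intro!: derivative_eq_intros)
  have "((\<lambda>s. (f' s - f' 0) / s / 2) \<longlongrightarrow> f'' / 2) (at 0)"
    using assms(2) by (intro tendsto_divide) (auto simp: has_field_derivative_iff)
  then show "((\<lambda>s. (f' s - f' 0) / (2 * s)) \<longlongrightarrow> f'' / 2) (at 0)" by (simp add: mult.commute)
qed

section \<open>Averaging over rotations\<close>

text \<open>The properties of the volume of the sphere that the comparison uses.\<close>

locale sphere_measure =
  fixes \<mu> :: "'a::euclidean_space measure"
  assumes sets: "sets \<mu> = sets (restrict_space borel (sphere 0 1))"
    and finite: "emeasure \<mu> (sphere 0 1) < \<infinity>"
    and rot: "\<And>i j s. (i, j) \<in> planes \<Longrightarrow> distr \<mu> \<mu> (plane_rot i j s) = \<mu>"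
    and rot_measurable: "\<And>i j s. (i, j) \<in> planes \<Longrightarrow> plane_rot i j s \<in> measurable \<mu> \<mu>"
    and hyperplane_null: "\<And>a. a \<noteq> 0 \<Longrightarrow> emeasure \<mu> {x \<in> sphere 0 1. a \<bullet> x = 0} = 0"
begin

lemma space: "space \<mu> = sphere 0 1"
  using sets_eq_imp_space_eq[OF sets] by (simp add: space_restrict_space)

sublocale finite_measure \<mu>
  by (rule finite_measureI) (use finite space in auto)

lemma continuous_measurable:
  fixes f :: "'a \<Rightarrow> real"
  assumes "continuous_on (sphere 0 1) f"
  shows "f \<in> borel_measurable \<mu>"
  using borel_measurable_continuous_on_restrict[OF assms] measurable_cong_sets[OF sets refl] by blast

definition rot_diff :: "('a \<Rightarrow> real) \<Rightarrow> real \<Rightarrow> 'a \<Rightarrow> real" where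
  "rot_diff u s p = (\<Sum>(i, j)\<in>planes. u (plane_rot i j s p) - u p)"

lemma integral_rot_diff:
  assumes u: "u \<in> borel_measurable \<mu>" and B: "\<And>p. p \<in> sphere 0 1 \<Longrightarrow> \<bar>u p\<bar> \<le> B"
  shows "integrable \<mu> (rot_diff u s)" "(LINT p|\<mu>. rot_diff u s p) = 0"
proof -
  have iu: "integrable \<mu> u"
    by (rule integrable_const_bound[where B = B]) (use u B space in \<open>auto intro!: AE_I2\<close>)
  have 1: "integrable \<mu> (\<lambda>p. u (plane_rot i j s p))" "(LINT p|\<mu>. u (plane_rot i j s p)) = (LINT p|\<mu>. u p)"
    if "(i, j) \<in> planes" for i j
  proof -
    have "integrable (distr \<mu> \<mu> (plane_rot i j s)) u" unfolding rot[OF that] by (rule iu)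
    then show "integrable \<mu> (\<lambda>p. u (plane_rot i j s p))"
      by (subst (asm) integrable_distr_eq[OF rot_measurable[OF that] u])
    have "(LINT p|distr \<mu> \<mu> (plane_rot i j s). u p) = (LINT p|\<mu>. u (plane_rot i j s p))"
      by (rule integral_distr[OF rot_measurable[OF that] u])
    then show "(LINT p|\<mu>. u (plane_rot i j s p)) = (LINT p|\<mu>. u p)" unfolding rot[OF that] by simp
  qed
  have 2: "integrable \<mu> (\<lambda>p. u (plane_rot (fst q) (snd q) s p) - u p)"
    "(LINT p|\<mu>. u (plane_rot (fst q) (snd q) s p) - u p) = 0" if "q \<in> planes" for q
    using 1[of "fst q" "snd q"] iu that by auto
  show "integrable \<mu> (rot_diff u s)"
    unfolding rot_diff_def[abs_def] case_prod_unfold using 2(1) by (rule Bochner_Integration.integrable_sum)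
  show "(LINT p|\<mu>. rot_diff u s p) = 0"
    unfolding rot_diff_def case_prod_unfold using 2 by (subst Bochner_Integration.integral_sum) auto
qed

text \<open>Rotation invariance makes the integral of every \<open>rot_diff u s\<close> vanish. Truncation by \<open>f\<close> from above
  makes the quotients bounded, so dominated convergence applies, and keeps the integrals nonpositive.\<close>

lemma rotation_inequality:
  assumes u: "u \<in> borel_measurable \<mu>" and B: "\<And>p. p \<in> sphere 0 1 \<Longrightarrow> \<bar>u p\<bar> \<le> B"
    and f: "f \<in> borel_measurable \<mu>" and B': "\<And>p. p \<in> sphere 0 1 \<Longrightarrow> \<bar>f p\<bar> \<le> B'"
    and low: "\<And>s p. 0 < s \<Longrightarrow> p \<in> sphere 0 1 \<Longrightarrow> - C \<le> rot_diff u s p / s\<^sup>2"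
    and lim: "AE p in \<mu>. \<exists>e. (e \<longlongrightarrow> f p) (at 0) \<and> eventually (\<lambda>s. e s \<le> rot_diff u s p / s\<^sup>2) (at 0)"
  shows "(LINT p|\<mu>. f p) \<le> 0"
proof -
  define sn where "sn n = 1 / real (Suc n)" for n
  have sn: "sn n > 0" for n by (simp add: sn_def)
  have sn0: "filterlim sn (at 0) sequentially"
    using LIMSEQ_inverse_real_of_nat by (auto simp: filterlim_at sn_def[abs_def] inverse_eq_divide)
  define h where "h n p = min (rot_diff u (sn n) p / (sn n)\<^sup>2) (f p)" for n p
  define M where "M = max \<bar>C\<bar> \<bar>B'\<bar>"
  have meas: "h n \<in> borel_measurable \<mu>" for n
    unfolding h_def using integral_rot_diff(1)[OF u B] f by measurable
  have bound: "norm (h n p) \<le> M" if p: "p \<in> sphere 0 1" for n p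
    using low[OF sn[of n] p] B'[OF p] unfolding h_def M_def real_norm_def by (auto simp: min_def max_def abs_le_iff)
  have conv: "AE p in \<mu>. (\<lambda>n. h n p) \<longlonglongrightarrow> f p"
    using lim
  proof eventually_elim
    fix p assume "\<exists>e. (e \<longlongrightarrow> f p) (at 0) \<and> eventually (\<lambda>s. e s \<le> rot_diff u s p / s\<^sup>2) (at 0)"
    then obtain e where e: "(e \<longlongrightarrow> f p) (at 0)" "eventually (\<lambda>s. e s \<le> rot_diff u s p / s\<^sup>2) (at 0)" by blast
    have "(\<lambda>n. e (sn n)) \<longlonglongrightarrow> f p" by (rule filterlim_compose[OF e(1) sn0])
    then have l: "(\<lambda>n. min (e (sn n)) (f p)) \<longlonglongrightarrow> min (f p) (f p)" by (rule tendsto_min[OF _ tendsto_const])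
    show "(\<lambda>n. h n p) \<longlonglongrightarrow> f p"
    proof (rule tendsto_sandwich[OF _ _ l[simplified] tendsto_const])
      show "eventually (\<lambda>n. min (e (sn n)) (f p) \<le> h n p) sequentially"
        using eventually_compose_filterlim[OF e(2) sn0] by eventually_elim (auto simp: h_def min_def)
      show "eventually (\<lambda>n. h n p \<le> f p) sequentially" by (simp add: h_def)
    qed
  qed
  have lims: "(\<lambda>n. LINT p|\<mu>. h n p) \<longlonglongrightarrow> (LINT p|\<mu>. f p)"
    by (rule integral_dominated_convergence[where w = "\<lambda>_. M"])
      (use meas f bound conv space in \<open>auto intro!: AE_I2\<close>)
  have "(LINT p|\<mu>. h n p) \<le> 0" for n
  proof -
    have ih: "integrable \<mu> (h n)"
      by (rule integrable_const_bound[where B = M]) (use meas bound space in \<open>auto intro!: AE_I2\<close>)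
    have "(LINT p|\<mu>. h n p) \<le> (LINT p|\<mu>. rot_diff u (sn n) p / (sn n)\<^sup>2)"
      by (rule integral_mono[OF ih]) (use integral_rot_diff(1)[OF u B] in \<open>auto simp: h_def\<close>)
    also have "\<dots> = 0" using integral_rot_diff(2)[OF u B, of "sn n"] by simp
    finally show ?thesis .
  qed
  then show ?thesis by (intro LIMSEQ_le_const2[OF lims]) auto
qed

end

lemma plane_rot_near:
  assumes "(i, j) \<in> planes" "norm p = 1"
  shows "norm (plane_rot i j s p - p) \<le> \<bar>s\<bar>"
  using plane_rot_diff[OF planes_orthonormal[OF assms(1)], of s p 0] plane_rot_0[OF planes_orthonormal[OF assms(1)]] assms(2)
  by simp

lemma cos_minus_one_bound: "\<bar>cos s - 1\<bar> \<le> s\<^sup>2" for s :: real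
proof -
  have "cos s - 1 = - 2 * (sin (s / 2))\<^sup>2" using cos_double_sin[of "s / 2"] by simp
  moreover have "(sin (s / 2))\<^sup>2 \<le> (s / 2)\<^sup>2"
    using abs_sin_x_le_abs_x[of "s / 2"] by (simp only: abs_le_square_iff)
  then have "4 * (sin (s / 2))\<^sup>2 \<le> s\<^sup>2" by (simp add: power_divide)
  moreover have "0 \<le> (sin (s / 2))\<^sup>2" by simp
  ultimately show ?thesis by linarith
qed

section \<open>Orthogonal projection to a subspace\<close>

text \<open>The squared length \<open>v\<close> of the orthogonal projection \<open>P\<close> to the span of \<open>Y\<close>.\<close>

locale orthonormal_set =
  fixes Y :: "'a::euclidean_space set"
  assumes finY: "finite Y" and nY: "\<And>t. t \<in> Y \<Longrightarrow> norm t = 1"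
    and oY: "\<And>t t'. t \<in> Y \<Longrightarrow> t' \<in> Y \<Longrightarrow> t \<noteq> t' \<Longrightarrow> t \<bullet> t' = 0"
begin

definition v :: "'a \<Rightarrow> real" where "v q = (\<Sum>t\<in>Y. (t \<bullet> q)\<^sup>2)"
definition P :: "'a \<Rightarrow> 'a" where "P q = (\<Sum>t\<in>Y. (t \<bullet> q) *\<^sub>R t)"

lemma inner_P: "t \<in> Y \<Longrightarrow> t \<bullet> P q = t \<bullet> q"
proof -
  assume t: "t \<in> Y"
  have "t \<bullet> P q = (\<Sum>t'\<in>Y. (t' \<bullet> q) * (t \<bullet> t'))" by (simp add: P_def inner_sum_right)
  also have "\<dots> = (\<Sum>t'\<in>Y. if t' = t then t \<bullet> q else 0)"
  proof (rule sum.cong[OF refl])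
    fix t' assume "t' \<in> Y"
    then show "(t' \<bullet> q) * (t \<bullet> t') = (if t' = t then t \<bullet> q else 0)"
      using oY[OF t, of t'] nY[OF t] by (auto simp: dot_square_norm)
  qed
  also have "\<dots> = t \<bullet> q" using t finY by simp
  finally show ?thesis .
qed

lemma P_inner: "P q \<bullet> x = (\<Sum>t\<in>Y. (t \<bullet> q) * (t \<bullet> x))"
  by (simp add: P_def inner_sum_left)

lemma P_q: "P q \<bullet> q = v q" and P_P: "P q \<bullet> P q = v q"
  by (simp_all add: P_inner inner_P v_def power2_eq_square)

lemma v_bounds: "norm q = 1 \<Longrightarrow> 0 \<le> v q \<and> v q \<le> 1"
proof -
  assume q: "norm q = 1"
  have "0 \<le> (q - P q) \<bullet> (q - P q)" by simp
  also have "\<dots> = 1 - v q"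
  proof -
    have "q \<bullet> q = 1" using q by (simp add: dot_square_norm)
    then show ?thesis
      unfolding inner_diff_left inner_diff_right P_P inner_commute[of q "P q"] P_q by simp
  qed
  finally show ?thesis by (simp add: v_def sum_nonneg)
qed

lemma v_continuous: "continuous_on S v"
  unfolding v_def by (intro continuous_intros)

text \<open>The squared projection length is a quadratic polynomial, so the Laplacian of \<open>\<Theta>(v)\<close> is computed by the chain
  rule from the first and second derivatives of \<open>v\<close> along the rotations.\<close>

lemma v_second_order:
  fixes \<Theta> :: "real poly" and k :: real
  assumes p: "norm p = 1" and card: "real (card Y) = k + 1"
  defines "n \<equiv> real DIM('a) - 1"
  shows "((\<lambda>s. (\<Sum>(i, j)\<in>planes. poly \<Theta> (v (plane_rot i j s p)) - poly \<Theta> (v p)) / s\<^sup>2) \<longlongrightarrow> jacobi_op k n \<Theta> (v p)) (at 0)"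
proof -
  let ?R = "\<lambda>q s. plane_rot (fst q) (snd q) s" and ?A = "\<lambda>q. plane_gen (fst q) (snd q)"
  define w where "w q s = v (?R q s p)" for q s
  define w1 where "w1 q s = (\<Sum>t\<in>Y. 2 * (t \<bullet> ?R q s p) * (t \<bullet> ?R q s (?A q p)))" for q s
  define w2 where "w2 q = (\<Sum>t\<in>Y. 2 * (t \<bullet> ?A q p) * (t \<bullet> ?A q p) + 2 * (t \<bullet> p) * (t \<bullet> ?A q (?A q p)))" for q
  have on: "norm (fst q) = 1" "norm (snd q) = 1" "fst q \<bullet> snd q = 0" if "q \<in> planes" for q :: "'a \<times> 'a"
    using planes_orthonormal[of "fst q" "snd q"] that by auto
  have dR: "((\<lambda>s. t \<bullet> ?R q s x) has_real_derivative t \<bullet> ?R q s (?A q x)) (at s)" if "q \<in> planes" for q :: "'a \<times> 'a" and s :: real and t x :: 'a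
  proof -
    have "((\<lambda>s. ?R q s x) has_vector_derivative ?R q s (?A q x)) (at s)" by (rule plane_rot_has_derivative[OF on[OF that]])
    from bounded_linear.has_vector_derivative[OF bounded_linear_inner_right this, of t]
    show ?thesis by (simp add: has_real_derivative_iff_has_vector_derivative)
  qed
  have dw: "(w q has_real_derivative w1 q s) (at s)" if "q \<in> planes" for q s
    unfolding w_def[abs_def] w1_def v_def
  proof (rule DERIV_sum)
    fix t assume "t \<in> Y"
    show "((\<lambda>s. (t \<bullet> ?R q s p)\<^sup>2) has_real_derivative 2 * (t \<bullet> ?R q s p) * (t \<bullet> ?R q s (?A q p))) (at s)"
    proof -
      have "((\<lambda>s. t \<bullet> ?R q s p) has_real_derivative t \<bullet> ?R q s (?A q p)) (at s)" by (rule dR[OF that])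
      from DERIV_power[OF this, of 2] show ?thesis by (simp add: mult_ac)
    qed
  qed
  have R0: "?R q 0 x = x" if "q \<in> planes" for q :: "'a \<times> 'a" and x :: 'a by (rule plane_rot_0[OF on[OF that]])
  have dw1: "(w1 q has_real_derivative w2 q) (at 0)" if "q \<in> planes" for q
  proof -
    have "(w1 q has_real_derivative (\<Sum>t\<in>Y. 2 * (t \<bullet> ?R q 0 (?A q p)) * (t \<bullet> ?R q 0 (?A q p)) + 2 * (t \<bullet> ?R q 0 p) * (t \<bullet> ?R q 0 (?A q (?A q p))))) (at 0)"
      unfolding w1_def[abs_def]
      by (rule DERIV_sum) (rule derivative_eq_intros dR[OF that] refl | simp)+
    then show ?thesis unfolding w2_def R0[OF that] .
  qed
  let ?p1 = "poly (pderiv \<Theta>)" and ?p2 = "poly (pderiv (pderiv \<Theta>))"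
  define f where "f s = (\<Sum>q\<in>planes. poly \<Theta> (w q s))" for s
  define f1 where "f1 s = (\<Sum>q\<in>planes. ?p1 (w q s) * w1 q s)" for s
  define f2 where "f2 = (\<Sum>q\<in>planes. ?p2 (w q 0) * w1 q 0 * w1 q 0 + ?p1 (w q 0) * w2 q)"
  have df: "(f has_real_derivative f1 s) (at s)" for s
    unfolding f_def[abs_def] f1_def
    by (rule DERIV_sum) (rule DERIV_chain2[OF poly_DERIV dw])
  have df1: "(f1 has_real_derivative f2) (at 0)"
    unfolding f1_def[abs_def] f2_def
  proof (rule DERIV_sum)
    fix q :: "'a \<times> 'a" assume q: "q \<in> planes"
    have "((\<lambda>s. ?p1 (w q s)) has_real_derivative ?p2 (w q 0) * w1 q 0) (at 0)"
      by (rule DERIV_chain2[OF poly_DERIV dw[OF q]])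
    from DERIV_mult[OF this dw1[OF q]]
    show "((\<lambda>s. ?p1 (w q s) * w1 q s) has_real_derivative ?p2 (w q 0) * w1 q 0 * w1 q 0 + ?p1 (w q 0) * w2 q) (at 0)"
      by (simp add: mult_ac add.commute)
  qed
  have w0: "w q 0 = v p" if "q \<in> planes" for q using R0[OF that] by (simp add: w_def)
  have w10: "w1 q 0 = 2 * (?A q p \<bullet> P p)" if "q \<in> planes" for q
    unfolding w1_def R0[OF that] inner_commute[of "?A q p"] P_inner sum_distrib_left by (simp add: mult_ac)
  have s1: "(\<Sum>q\<in>planes. w1 q 0) = 0"
  proof -
    have "(\<Sum>q\<in>planes. w1 q 0) = (\<Sum>q\<in>planes. 2 * (?A q p \<bullet> P p))" by (rule sum.cong) (auto simp: w10)
    also have "\<dots> = 2 * (\<Sum>(i, j)\<in>planes. plane_gen i j p \<bullet> P p)" by (simp add: sum_distrib_left case_prod_unfold)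
    finally show ?thesis by (simp add: planes_gen_sum)
  qed
  have pp: "p \<bullet> p = 1" using p by (simp add: dot_square_norm)
  have s2: "(\<Sum>q\<in>planes. w1 q 0 * w1 q 0) = 8 * v p * (1 - v p)"
  proof -
    have "(\<Sum>q\<in>planes. w1 q 0 * w1 q 0) = (\<Sum>q\<in>planes. 4 * ((?A q p \<bullet> P p) * (?A q p \<bullet> P p)))"
      by (rule sum.cong) (auto simp: w10)
    also have "\<dots> = 4 * (\<Sum>(i, j)\<in>planes. (plane_gen i j p \<bullet> P p) * (plane_gen i j p \<bullet> P p))"
      by (simp add: sum_distrib_left case_prod_unfold)
    also have "\<dots> = 4 * (2 * (v p - v p * v p))"
      unfolding planes_gen_product pp P_P inner_commute[of p "P p"] P_q by simp
    finally show ?thesis by (simp add: algebra_simps)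
  qed
  have s3: "(\<Sum>q\<in>planes. w2 q) = 4 * (k + 1) - 4 * (n + 1) * v p"
  proof -
    have "(\<Sum>q\<in>planes. w2 q) = (\<Sum>t\<in>Y. \<Sum>q\<in>planes. 2 * ((?A q p \<bullet> t) * (?A q p \<bullet> t)) + 2 * (t \<bullet> p) * (?A q (?A q p) \<bullet> t))"
      unfolding w2_def by (subst sum.swap) (simp add: inner_commute mult.assoc)
    also have "\<dots> = (\<Sum>t\<in>Y. 4 - 4 * (n + 1) * (t \<bullet> p)\<^sup>2)"
    proof (rule sum.cong[OF refl])
      fix t assume t: "t \<in> Y"
      have "(\<Sum>q\<in>planes. 2 * ((?A q p \<bullet> t) * (?A q p \<bullet> t)) + 2 * (t \<bullet> p) * (?A q (?A q p) \<bullet> t))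
        = 2 * (\<Sum>(i, j)\<in>planes. (plane_gen i j p \<bullet> t) * (plane_gen i j p \<bullet> t))
          + 2 * (t \<bullet> p) * (\<Sum>(i, j)\<in>planes. plane_gen i j (plane_gen i j p) \<bullet> t)"
        by (simp only: sum.distrib sum_distrib_left case_prod_unfold)
      also have "\<dots> = 4 - 4 * (n + 1) * (t \<bullet> p)\<^sup>2"
        unfolding planes_gen_product planes_gen_gen_sum pp inner_commute[of p t] n_def
        using nY[OF t] by (simp add: dot_square_norm power2_eq_square algebra_simps)
      finally show "(\<Sum>q\<in>planes. 2 * ((?A q p \<bullet> t) * (?A q p \<bullet> t)) + 2 * (t \<bullet> p) * (?A q (?A q p) \<bullet> t))
        = 4 - 4 * (n + 1) * (t \<bullet> p)\<^sup>2" .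
    qed
    also have "\<dots> = 4 * real (card Y) - 4 * (n + 1) * v p"
      by (simp add: sum_subtractf v_def sum_distrib_left)
    finally show ?thesis by (simp add: card)
  qed
  have f10: "f1 0 = 0"
  proof -
    have "f1 0 = (\<Sum>q\<in>planes. ?p1 (v p) * w1 q 0)" unfolding f1_def by (rule sum.cong) (auto simp: w0)
    then show ?thesis by (simp add: sum_distrib_left[symmetric] s1)
  qed
  have f2: "f2 / 2 = jacobi_op k n \<Theta> (v p)"
  proof -
    have "f2 = (\<Sum>q\<in>planes. ?p2 (v p) * (w1 q 0 * w1 q 0) + ?p1 (v p) * w2 q)"
      unfolding f2_def by (rule sum.cong) (auto simp: w0)
    also have "\<dots> = ?p2 (v p) * (8 * v p * (1 - v p)) + ?p1 (v p) * (4 * (k + 1) - 4 * (n + 1) * v p)"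
      by (simp only: sum.distrib sum_distrib_left[symmetric] s2 s3)
    finally show ?thesis by (simp add: jacobi_op_def algebra_simps)
  qed
  have "((\<lambda>s. (f s - f 0 - s * f1 0) / s\<^sup>2) \<longlongrightarrow> f2 / 2) (at 0)"
    by (rule second_order_limit[OF always_eventually df1]) (simp add: df)
  moreover have "f s - f 0 - s * f1 0 = (\<Sum>(i, j)\<in>planes. poly \<Theta> (v (plane_rot i j s p)) - poly \<Theta> (v p))" for s
  proof -
    have "f 0 = (\<Sum>q\<in>(planes :: ('a \<times> 'a) set). poly \<Theta> (v p))" unfolding f_def by (rule sum.cong) (auto simp: w0)
    then show ?thesis by (simp add: f10 f_def w_def sum_subtractf case_prod_unfold)
  qed
  ultimately show ?thesis unfolding f2 by simp
qed

lemma v_difference_bound: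
  fixes \<Theta> :: "real poly"
  obtains C where "\<And>s p. norm p = 1 \<Longrightarrow>
    \<bar>\<Sum>(i, j)\<in>planes. poly \<Theta> (v (plane_rot i j s p)) - poly \<Theta> (v p)\<bar> \<le> C * s\<^sup>2"
proof -
  obtain K where K: "K > 0" "\<And>x y. 0 \<le> x \<Longrightarrow> x \<le> 1 \<Longrightarrow> 0 \<le> y \<Longrightarrow> y \<le> 1 \<Longrightarrow>
    \<bar>poly \<Theta> y - poly \<Theta> x - poly (pderiv \<Theta>) x * (y - x)\<bar> \<le> K * (y - x)\<^sup>2"
    by (rule poly_taylor_bound) (rule that)
  obtain B where B: "B > 0" "\<And>x. 0 \<le> x \<Longrightarrow> x \<le> 1 \<Longrightarrow> \<bar>poly (pderiv \<Theta>) x\<bar> \<le> B"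
    by (rule poly_bounded_unit) (rule that)
  define c where "c = real (card Y)"
  define q where "q = real (card (planes :: ('a \<times> 'a) set))"
  define d where "d = real DIM('a)"
  have pos: "c \<ge> 0" "q \<ge> 0" "d \<ge> 1" using DIM_positive[where 'a = 'a] by (auto simp: c_def q_def d_def)
  show ?thesis
  proof (rule that)
    fix s :: real and p :: 'a assume p: "norm p = 1"
    let ?w = "\<lambda>r. v (plane_rot (fst r) (snd r) s p)"
    have nR: "norm (plane_rot (fst r) (snd r) s p) = 1" if "r \<in> planes" for r
      using norm_plane_rot[OF planes_orthonormal[of "fst r" "snd r"]] p that by simp
    have small: "\<bar>t \<bullet> (plane_rot (fst r) (snd r) s p - p)\<bar> \<le> \<bar>s\<bar>" if "r \<in> planes" "t \<in> Y" for r t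
      using Cauchy_Schwarz_ineq2[of t "plane_rot (fst r) (snd r) s p - p"] nY[OF that(2)]
        plane_rot_near[of "fst r" "snd r" p s] p that(1) by simp
    have dec: "?w r - v p = 2 * (\<Sum>t\<in>Y. (t \<bullet> p) * (t \<bullet> (plane_rot (fst r) (snd r) s p - p)))
        + (\<Sum>t\<in>Y. (t \<bullet> (plane_rot (fst r) (snd r) s p - p))\<^sup>2)" for r
      unfolding v_def sum_distrib_left sum_subtractf[symmetric] sum.distrib[symmetric]
      by (rule sum.cong) (auto simp: inner_diff_right power2_eq_square algebra_simps)
    have tp: "\<bar>t \<bullet> p\<bar> \<le> 1" if "t \<in> Y" for t using Cauchy_Schwarz_ineq2[of t p] nY[OF that] p by simp
    have sq: "(\<Sum>t\<in>Y. (t \<bullet> (plane_rot (fst r) (snd r) s p - p))\<^sup>2) \<le> c * s\<^sup>2" if "r \<in> planes" for r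
    proof -
      have "(t \<bullet> (plane_rot (fst r) (snd r) s p - p))\<^sup>2 \<le> s\<^sup>2" if "t \<in> Y" for t
        using small[OF \<open>r \<in> planes\<close> that] by (simp only: abs_le_square_iff)
      then have "(\<Sum>t\<in>Y. (t \<bullet> (plane_rot (fst r) (snd r) s p - p))\<^sup>2) \<le> (\<Sum>t\<in>Y. s\<^sup>2)" by (rule sum_mono)
      then show ?thesis by (simp add: c_def)
    qed
    have sq0: "0 \<le> (\<Sum>t\<in>Y. (t \<bullet> (plane_rot (fst r) (snd r) s p - p))\<^sup>2)" for r by (simp add: sum_nonneg)
    have lip: "(?w r - v p)\<^sup>2 \<le> 4 * c\<^sup>2 * s\<^sup>2" if r: "r \<in> planes" for r
    proof -
      have "\<bar>?w r - v p\<bar> \<le> (\<Sum>t\<in>Y. 2 * \<bar>s\<bar>)"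
        unfolding v_def sum_subtractf[symmetric]
      proof (rule order_trans[OF sum_abs sum_mono])
        fix t assume t: "t \<in> Y"
        let ?x = "t \<bullet> plane_rot (fst r) (snd r) s p"
        have e: "?x\<^sup>2 - (t \<bullet> p)\<^sup>2 = (?x - t \<bullet> p) * (?x + t \<bullet> p)" by (simp add: power2_eq_square algebra_simps)
        have a: "\<bar>?x - t \<bullet> p\<bar> \<le> \<bar>s\<bar>" using small[OF r t] by (simp add: inner_diff_right)
        have "\<bar>?x\<bar> \<le> 1" using Cauchy_Schwarz_ineq2[of t "plane_rot (fst r) (snd r) s p"] nY[OF t] nR[OF r] by simp
        then have b: "\<bar>?x + t \<bullet> p\<bar> \<le> 2" using tp[OF t] by linarith
        have "\<bar>?x\<^sup>2 - (t \<bullet> p)\<^sup>2\<bar> \<le> \<bar>s\<bar> * 2" unfolding e abs_mult by (rule mult_mono[OF a b]) simp_all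
        then show "\<bar>?x\<^sup>2 - (t \<bullet> p)\<^sup>2\<bar> \<le> 2 * \<bar>s\<bar>" by simp
      qed
      then have "\<bar>?w r - v p\<bar> \<le> 2 * c * \<bar>s\<bar>" by (simp add: c_def)
      then have "\<bar>?w r - v p\<bar>\<^sup>2 \<le> (2 * c * \<bar>s\<bar>)\<^sup>2" by (rule power_mono) simp
      then show ?thesis by (simp add: power_mult_distrib)
    qed
    have v01: "0 \<le> v p" "v p \<le> 1" using v_bounds[OF p] by auto
    have each: "\<bar>poly \<Theta> (?w r) - poly \<Theta> (v p) - poly (pderiv \<Theta>) (v p) * (?w r - v p)\<bar> \<le> K * (4 * c\<^sup>2 * s\<^sup>2)" if "r \<in> planes" for r
    proof -
      have "\<bar>poly \<Theta> (?w r) - poly \<Theta> (v p) - poly (pderiv \<Theta>) (v p) * (?w r - v p)\<bar> \<le> K * (?w r - v p)\<^sup>2"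
        using v_bounds[OF nR[OF that]] v01 by (intro K(2)) auto
      also have "\<dots> \<le> K * (4 * c\<^sup>2 * s\<^sup>2)" using lip[OF that] K(1) by (intro mult_left_mono) auto
      finally show ?thesis .
    qed
    have lin: "\<bar>\<Sum>r\<in>planes. ?w r - v p\<bar> \<le> (4 * d + q * c) * s\<^sup>2"
    proof -
      have "(\<Sum>r\<in>planes. ?w r - v p) = 2 * (\<Sum>t\<in>Y. (t \<bullet> p) * (\<Sum>r\<in>planes. t \<bullet> (plane_rot (fst r) (snd r) s p - p)))
          + (\<Sum>r\<in>planes. \<Sum>t\<in>Y. (t \<bullet> (plane_rot (fst r) (snd r) s p - p))\<^sup>2)"
        unfolding dec sum.distrib sum_distrib_left[symmetric] by (subst sum.swap) (simp add: sum_distrib_left)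
      also have "(\<Sum>t\<in>Y. (t \<bullet> p) * (\<Sum>r\<in>planes. t \<bullet> (plane_rot (fst r) (snd r) s p - p))) = (cos s - 1) * (2 * (d - 1)) * v p"
      proof -
        have "(\<Sum>r\<in>planes. t \<bullet> (plane_rot (fst r) (snd r) s p - p)) = (cos s - 1) * (2 * (d - 1) * (t \<bullet> p))" for t
          using planes_rot_sum[of s p t] by (simp add: case_prod_unfold inner_commute d_def)
        then show ?thesis by (simp add: v_def sum_distrib_left power2_eq_square mult_ac)
      qed
      finally have eq: "(\<Sum>r\<in>planes. ?w r - v p) = 2 * ((cos s - 1) * (2 * (d - 1)) * v p)
          + (\<Sum>r\<in>planes. \<Sum>t\<in>Y. (t \<bullet> (plane_rot (fst r) (snd r) s p - p))\<^sup>2)" .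
      have "\<bar>2 * ((cos s - 1) * (2 * (d - 1)) * v p)\<bar> = \<bar>cos s - 1\<bar> * (4 * (d - 1) * v p)"
        using pos v01 by (simp add: abs_mult)
      also have "\<dots> \<le> s\<^sup>2 * (4 * d * 1)"
        using pos v01 cos_minus_one_bound[of s] by (intro mult_mono) auto
      finally have 1: "\<bar>2 * ((cos s - 1) * (2 * (d - 1)) * v p)\<bar> \<le> 4 * d * s\<^sup>2"
        by (simp only: mult_1_right mult.commute[of "s\<^sup>2"])
      have "(\<Sum>r\<in>planes. \<Sum>t\<in>Y. (t \<bullet> (plane_rot (fst r) (snd r) s p - p))\<^sup>2) \<le> (\<Sum>r\<in>(planes::('a\<times>'a) set). c * s\<^sup>2)"
        by (rule sum_mono) (rule sq)
      then have 2: "(\<Sum>r\<in>planes. \<Sum>t\<in>Y. (t \<bullet> (plane_rot (fst r) (snd r) s p - p))\<^sup>2) \<le> q * c * s\<^sup>2"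
        by (simp add: q_def)
      have 3: "0 \<le> (\<Sum>r\<in>planes. \<Sum>t\<in>Y. (t \<bullet> (plane_rot (fst r) (snd r) s p - p))\<^sup>2)" by (intro sum_nonneg) simp
      show ?thesis unfolding eq distrib_right using 1 2 3 by linarith
    qed
    have "(\<Sum>(i, j)\<in>planes. poly \<Theta> (v (plane_rot i j s p)) - poly \<Theta> (v p))
      = (\<Sum>r\<in>planes. poly \<Theta> (?w r) - poly \<Theta> (v p) - poly (pderiv \<Theta>) (v p) * (?w r - v p)) + poly (pderiv \<Theta>) (v p) * (\<Sum>r\<in>planes. ?w r - v p)"
      by (simp only: case_prod_unfold sum_distrib_left sum.distrib[symmetric]) (simp add: algebra_simps)
    moreover have "\<bar>\<Sum>r\<in>planes. poly \<Theta> (?w r) - poly \<Theta> (v p) - poly (pderiv \<Theta>) (v p) * (?w r - v p)\<bar> \<le> (\<Sum>r\<in>(planes::('a\<times>'a) set). K * (4 * c\<^sup>2 * s\<^sup>2))"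
      by (rule order_trans[OF sum_abs sum_mono]) (rule each)
    moreover have "(\<Sum>r\<in>(planes::('a\<times>'a) set). K * (4 * c\<^sup>2 * s\<^sup>2)) = q * K * 4 * c\<^sup>2 * s\<^sup>2" by (simp add: q_def)
    moreover have "\<bar>poly (pderiv \<Theta>) (v p) * (\<Sum>r\<in>planes. ?w r - v p)\<bar> \<le> B * ((4 * d + q * c) * s\<^sup>2)"
      unfolding abs_mult by (intro mult_mono lin B(2) v01) (use B in auto)
    moreover have "(q * K * 4 * c\<^sup>2 + B * (4 * d + q * c)) * s\<^sup>2 = q * K * 4 * c\<^sup>2 * s\<^sup>2 + B * ((4 * d + q * c) * s\<^sup>2)"
      by (simp add: algebra_simps)
    ultimately show "\<bar>\<Sum>(i, j)\<in>planes. poly \<Theta> (v (plane_rot i j s p)) - poly \<Theta> (v p)\<bar>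
        \<le> (q * K * 4 * c\<^sup>2 + B * (4 * d + q * c)) * s\<^sup>2"
      by linarith
  qed
qed

end

text \<open>Both \<open>\<Theta>\<close> and \<open>- \<Theta>\<close> satisfy the hypotheses of the rotation inequality.\<close>

lemma (in sphere_measure) projection_integral:
  assumes Y: "orthonormal_set Y" and card: "real (card Y) = k + 1"
  shows "(LINT p|\<mu>. jacobi_op k (real DIM('a) - 1) \<Theta> (orthonormal_set.v Y p)) = 0"
proof -
  interpret Y: orthonormal_set Y by (rule Y)
  let ?L = "\<lambda>p. jacobi_op k (real DIM('a) - 1) \<Theta> (Y.v p)"
  obtain C where C: "\<And>s p. norm p = 1 \<Longrightarrow> \<bar>\<Sum>(i, j)\<in>planes. poly \<Theta> (Y.v (plane_rot i j s p)) - poly \<Theta> (Y.v p)\<bar> \<le> C * s\<^sup>2"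
    by (rule Y.v_difference_bound) (rule that)
  have one: "(LINT p|\<mu>. a * ?L p) \<le> 0" if a: "\<bar>a\<bar> = 1" for a
  proof -
    let ?u = "\<lambda>p. a * poly \<Theta> (Y.v p)"
    have cu: "continuous_on (sphere 0 1) ?u" by (intro continuous_intros Y.v_continuous)
    have cf: "continuous_on (sphere 0 1) (\<lambda>p. a * ?L p)" unfolding jacobi_op_def by (intro continuous_intros Y.v_continuous)
    have bd: "\<exists>B. \<forall>p\<in>sphere 0 1. \<bar>g p\<bar> \<le> B" if "continuous_on (sphere 0 1) g" for g :: "'a \<Rightarrow> real"
      using compact_imp_bounded[OF compact_continuous_image[OF that compact_sphere]] unfolding bounded_iff by auto
    obtain B where B: "\<And>p. p \<in> sphere 0 1 \<Longrightarrow> \<bar>?u p\<bar> \<le> B" using bd[OF cu] by blast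
    obtain B' where B': "\<And>p. p \<in> sphere 0 1 \<Longrightarrow> \<bar>a * ?L p\<bar> \<le> B'" using bd[OF cf] by blast
    have eq: "rot_diff ?u s p = a * (\<Sum>(i, j)\<in>planes. poly \<Theta> (Y.v (plane_rot i j s p)) - poly \<Theta> (Y.v p))" for s p
      by (simp add: rot_diff_def sum_distrib_left case_prod_unfold right_diff_distrib)
    show ?thesis
    proof (rule rotation_inequality[OF continuous_measurable[OF cu] B continuous_measurable[OF cf] B'])
      fix s :: real and p :: 'a assume "0 < s" "p \<in> sphere 0 1"
      then have "\<bar>rot_diff ?u s p\<bar> \<le> C * s\<^sup>2" using C[of p s] a by (simp add: eq abs_mult)
      then have "- (C * s\<^sup>2) \<le> rot_diff ?u s p" by linarith
      then show "- C \<le> rot_diff ?u s p / s\<^sup>2" using \<open>0 < s\<close> by (simp add: pos_le_divide_eq)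
    next
      show "AE p in \<mu>. \<exists>e. (e \<longlongrightarrow> a * ?L p) (at 0) \<and> eventually (\<lambda>s. e s \<le> rot_diff ?u s p / s\<^sup>2) (at 0)"
      proof (rule AE_I2)
        fix p assume "p \<in> space \<mu>"
        then have "norm p = 1" using space by simp
        from tendsto_mult[OF tendsto_const Y.v_second_order[OF this card]]
        have "((\<lambda>s. rot_diff ?u s p / s\<^sup>2) \<longlongrightarrow> a * ?L p) (at 0)" by (simp add: eq)
        then show "\<exists>e. (e \<longlongrightarrow> a * ?L p) (at 0) \<and> eventually (\<lambda>s. e s \<le> rot_diff ?u s p / s\<^sup>2) (at 0)"
          by (intro exI[of _ "\<lambda>s. rot_diff ?u s p / s\<^sup>2"]) simp
      qed
    qed
  qed
  show ?thesis using one[of 1] one[of "- 1"] by simp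
qed

section \<open>The distance function of a critical submanifold\<close>

locale critical_sphere = sphere_measure \<mu> for \<mu> :: "'a::euclidean_space measure" +
  fixes X :: "'a set" and K :: "'k::finite itself"
  assumes emb: "embedded_submanifold TYPE('k) X" and compact: "compact X" and sph: "X \<subseteq> sphere 0 1"
    and nonempty: "X \<noteq> {}" and critical: "volume_critical TYPE('k) (sphere 0 1) X"
    and dim_le: "real CARD('k) \<le> real DIM('a) - 1"
begin

definition m :: "'a \<Rightarrow> real" where "m p = (SUP x\<in>X. x \<bullet> p)"

lemma attained: obtains x where "x \<in> X" "x \<bullet> p = m p" "\<And>y. y \<in> X \<Longrightarrow> y \<bullet> p \<le> m p"
proof -
  have "\<exists>x\<in>X. \<forall>y\<in>X. y \<bullet> p \<le> x \<bullet> p"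
    by (rule continuous_attains_sup[OF compact nonempty]) (intro continuous_intros)
  then obtain x where x: "x \<in> X" "\<And>y. y \<in> X \<Longrightarrow> y \<bullet> p \<le> x \<bullet> p" by blast
  have "m p = x \<bullet> p" unfolding m_def
    by (rule cSup_eq_maximum) (use x in auto)
  then show ?thesis using that x by simp
qed

lemma m_ge: "x \<in> X \<Longrightarrow> x \<bullet> p \<le> m p"
  by (rule attained[of p]) simp

lemma norm_X: "x \<in> X \<Longrightarrow> norm x = 1" using sph by auto

lemma m_le: "m p \<le> norm p"
proof (rule attained[of p])
  fix x assume "x \<in> X" "x \<bullet> p = m p"
  then show ?thesis using norm_cauchy_schwarz[of x p] norm_X by simp
qed

lemma m_continuous: "continuous_on S m"
proof -
  have le: "m p \<le> m q + norm (p - q)" for p q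
  proof (rule attained[of p])
    fix x assume x: "x \<in> X" "x \<bullet> p = m p"
    have "x \<bullet> p = x \<bullet> q + x \<bullet> (p - q)" by (simp add: inner_diff_right)
    also have "\<dots> \<le> m q + norm (p - q)"
      using m_ge[OF x(1), of q] norm_cauchy_schwarz[of x "p - q"] norm_X[OF x(1)] by simp
    finally show ?thesis using x by simp
  qed
  have "1-lipschitz_on S m"
  proof (rule lipschitz_onI)
    fix p q show "dist (m p) (m q) \<le> 1 * dist p q"
      using le[of p q] le[of q p] by (simp add: dist_norm norm_minus_commute abs_le_iff)
  qed simp
  then show ?thesis by (rule lipschitz_on_continuous_on)
qed

text \<open>At a maximizer of \<open>x \<bullet> p\<close> the first derivative vanishes, that is \<open>p\<close> is normal to \<open>X\<close>, so the trace
  formula for critical submanifolds applies.\<close>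

lemma maximizer_chart:
  obtains U and \<phi> :: "real^'k \<Rightarrow> 'a" where "local_parametrization X U \<phi>" "0 \<in> U" "\<phi> 0 \<bullet> p = m p"
    "gram (frechet_derivative \<phi> (at 0)) = mat 1" "\<And>v. p \<bullet> frechet_derivative \<phi> (at 0) v = 0"
    "(\<Sum>i\<in>UNIV. frechet_derivative (\<lambda>u. frechet_derivative \<phi> (at u) (axis i 1)) (at 0) (axis i 1) \<bullet> p)
      = - real CARD('k) * m p"
proof -
  obtain x where x: "x \<in> X" "x \<bullet> p = m p" "\<And>y. y \<in> X \<Longrightarrow> y \<bullet> p \<le> m p" by (rule attained[of p]) (rule that)
  obtain U and \<phi> :: "real^'k \<Rightarrow> 'a" where lp: "local_parametrization X U \<phi>" "0 \<in> U" "\<phi> 0 = x"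
    "gram (frechet_derivative \<phi> (at 0)) = mat 1"
    by (rule normal_chart[OF emb x(1)]) (rule that)
  let ?D = "frechet_derivative \<phi> (at 0)"
  have "((\<lambda>u. p \<bullet> \<phi> u) has_derivative (\<lambda>v. p \<bullet> ?D v)) (at 0)"
    by (rule has_derivative_inner_right[OF local_parametrization_has_derivative[OF lp(1,2)]])
  moreover have "p \<bullet> \<phi> u \<le> p \<bullet> \<phi> 0" if "u \<in> U" for u
  proof -
    have "\<phi> u \<in> X" using local_parametrization_image_subset[OF lp(1)] that by blast
    then show ?thesis using x by (simp add: lp(3) inner_commute[of p])
  qed
  ultimately have "(\<lambda>v. p \<bullet> ?D v) = (\<lambda>v. 0)"
    using differential_zero_maxmin[OF lp(2) local_parametrization_open[OF lp(1)]] by blast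
  then have D0: "p \<bullet> ?D v = 0" for v by (simp add: fun_eq_iff)
  show ?thesis
    using that[OF lp(1,2) _ lp(4) D0] critical_trace[OF emb compact sph critical lp(1,2,4) D0] x(2) lp(3) by simp
qed

lemma second_derivatives:
  fixes \<phi> :: "real^'k \<Rightarrow> 'a" and \<xi> :: "real^'k" and x :: 'a
  assumes lp: "local_parametrization X U \<phi>" and U0: "0 \<in> U" and ij: "(i, j) \<in> planes"
  defines "D \<equiv> \<lambda>u. frechet_derivative \<phi> (at u)"
  shows "eventually (\<lambda>s. ((\<lambda>s. \<phi> (s *\<^sub>R \<xi>) \<bullet> plane_rot i j s p) has_real_derivative
      D (s *\<^sub>R \<xi>) \<xi> \<bullet> plane_rot i j s p + \<phi> (s *\<^sub>R \<xi>) \<bullet> plane_rot i j s (plane_gen i j p)) (at s) \<and> s *\<^sub>R \<xi> \<in> U) (nhds 0)"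
    and "((\<lambda>s. D (s *\<^sub>R \<xi>) \<xi> \<bullet> plane_rot i j s p + \<phi> (s *\<^sub>R \<xi>) \<bullet> plane_rot i j s (plane_gen i j p)) has_real_derivative
      frechet_derivative (\<lambda>u. D u \<xi>) (at 0) \<xi> \<bullet> p + 2 * (D 0 \<xi> \<bullet> plane_gen i j p) + \<phi> 0 \<bullet> plane_gen i j (plane_gen i j p)) (at 0)"
proof -
  let ?R = "plane_rot i j" and ?A = "plane_gen i j"
  note on = planes_orthonormal[OF ij]
  have sm: "smooth_on_open U \<phi>" using lp by (simp add: local_parametrization_def)
  have oU: "open U" by (rule local_parametrization_open[OF lp])
  have dR: "((\<lambda>s. ?R s x) has_vector_derivative ?R s (?A x)) (at s)" for s x by (rule plane_rot_has_derivative[OF on])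
  have line: "((\<lambda>t. f (t *\<^sub>R \<xi>)) has_vector_derivative f' \<xi>) (at s)"
    if "(f has_derivative f') (at (s *\<^sub>R \<xi>))" for f :: "real^'k \<Rightarrow> 'a" and f' s
  proof -
    have g: "((\<lambda>t. t *\<^sub>R \<xi>) has_derivative (\<lambda>d. d *\<^sub>R \<xi>)) (at s)" by (auto intro!: derivative_eq_intros)
    from has_derivative_compose[OF g that]
    show ?thesis by (simp add: has_vector_derivative_def linear_scale[OF has_derivative_linear[OF that]])
  qed
  have prod: "((\<lambda>s. f s \<bullet> g s) has_real_derivative f' \<bullet> g s + f s \<bullet> g') (at s)"
    if "(f has_vector_derivative f') (at s)" "(g has_vector_derivative g') (at s)" for f g :: "real \<Rightarrow> 'a" and f' g' s
    using bounded_bilinear.has_vector_derivative[OF bounded_bilinear_inner that]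
    by (simp add: has_real_derivative_iff_has_vector_derivative add.commute)
  have "continuous_on UNIV (\<lambda>s::real. s *\<^sub>R \<xi>)" by (intro continuous_intros)
  from continuous_open_preimage[OF this open_UNIV oU]
  have "open ((\<lambda>s::real. s *\<^sub>R \<xi>) -` U)" by simp
  moreover have "0 \<in> (\<lambda>s::real. s *\<^sub>R \<xi>) -` U" using U0 by simp
  ultimately have "eventually (\<lambda>s::real. s \<in> (\<lambda>s. s *\<^sub>R \<xi>) -` U) (nhds 0)" by (rule eventually_nhds_in_open)
  then show "eventually (\<lambda>s. ((\<lambda>s. \<phi> (s *\<^sub>R \<xi>) \<bullet> ?R s p) has_real_derivative
      D (s *\<^sub>R \<xi>) \<xi> \<bullet> ?R s p + \<phi> (s *\<^sub>R \<xi>) \<bullet> ?R s (?A p)) (at s) \<and> s *\<^sub>R \<xi> \<in> U) (nhds 0)"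
  proof eventually_elim
    case (elim s)
    then have sU: "s *\<^sub>R \<xi> \<in> U" by simp
    have "(\<phi> has_derivative D (s *\<^sub>R \<xi>)) (at (s *\<^sub>R \<xi>))"
      unfolding D_def by (rule local_parametrization_has_derivative[OF lp sU])
    from prod[OF line[OF this] dR] sU show ?case by blast
  qed
  have d0: "(\<phi> has_derivative D 0) (at (0 *\<^sub>R \<xi>))"
    unfolding D_def using local_parametrization_has_derivative[OF lp U0] by simp
  have d1: "((\<lambda>u. D u \<xi>) has_derivative frechet_derivative (\<lambda>u. D u \<xi>) (at 0)) (at (0 *\<^sub>R \<xi>))"
    unfolding D_def using smooth_on_open_has_derivative[OF smooth_on_open_frechet_derivative[OF sm] U0] by simp
  have R0: "?R 0 x = x" for x by (rule plane_rot_0[OF on])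
  from DERIV_add[OF prod[OF line[OF d1] dR[of p 0]] prod[OF line[OF d0] dR[of "?A p" 0]]]
  show "((\<lambda>s. D (s *\<^sub>R \<xi>) \<xi> \<bullet> ?R s p + \<phi> (s *\<^sub>R \<xi>) \<bullet> ?R s (?A p)) has_real_derivative
      frechet_derivative (\<lambda>u. D u \<xi>) (at 0) \<xi> \<bullet> p + 2 * (D 0 \<xi> \<bullet> ?A p) + \<phi> 0 \<bullet> ?A (?A p)) (at 0)"
    by (simp add: R0 algebra_simps)
qed

text \<open>The Hessian of \<open>x \<bullet> p\<close> on \<open>X\<close> at a maximum has trace at most \<open>0\<close>, and this trace is \<open>- k (m p)\<close>. In
  particular \<open>X\<close> lies in no open hemisphere.\<close>

lemma m_nonneg: "m p \<ge> 0"
proof -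
  obtain U and \<phi> :: "real^'k \<Rightarrow> 'a" where lp: "local_parametrization X U \<phi>" "0 \<in> U" "\<phi> 0 \<bullet> p = m p"
    "gram (frechet_derivative \<phi> (at 0)) = mat 1" "\<And>v. p \<bullet> frechet_derivative \<phi> (at 0) v = 0"
    "(\<Sum>i\<in>UNIV. frechet_derivative (\<lambda>u. frechet_derivative \<phi> (at u) (axis i 1)) (at 0) (axis i 1) \<bullet> p)
      = - real CARD('k) * m p"
    by (rule maximizer_chart[of p]) (rule that)
  let ?D = "\<lambda>u. frechet_derivative \<phi> (at u)"
  have "frechet_derivative (\<lambda>u. ?D u \<xi>) (at 0) \<xi> \<bullet> p \<le> 0" for \<xi>
  proof -
    let ?dd = "frechet_derivative (\<lambda>u. ?D u \<xi>) (at 0) \<xi>"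
    have sm: "smooth_on_open U \<phi>" using lp(1) by (simp add: local_parametrization_def)
    have oU: "open U" by (rule local_parametrization_open[OF lp(1)])
    have line: "((\<lambda>t. f (t *\<^sub>R \<xi>) \<bullet> p) has_real_derivative f' \<xi> \<bullet> p) (at s)"
      if "(f has_derivative f') (at (s *\<^sub>R \<xi>))" for f :: "real^'k \<Rightarrow> 'a" and f' s
    proof -
      have g: "((\<lambda>t. t *\<^sub>R \<xi>) has_derivative (\<lambda>d. d *\<^sub>R \<xi>)) (at s)" by (auto intro!: derivative_eq_intros)
      from has_derivative_inner_left[OF has_derivative_compose[OF g that], of p]
      show ?thesis
        by (rule has_derivative_imp_has_field_derivative)
          (simp add: linear_scale[OF has_derivative_linear[OF that]])
    qed
    have "continuous_on UNIV (\<lambda>s::real. s *\<^sub>R \<xi>)" by (intro continuous_intros)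
    from continuous_open_preimage[OF this open_UNIV oU]
    have "open ((\<lambda>s::real. s *\<^sub>R \<xi>) -` U)" by simp
    moreover have "0 \<in> (\<lambda>s::real. s *\<^sub>R \<xi>) -` U" using lp(2) by simp
    ultimately have ev: "eventually (\<lambda>s::real. s \<in> (\<lambda>s. s *\<^sub>R \<xi>) -` U) (nhds 0)" by (rule eventually_nhds_in_open)
    have e1: "eventually (\<lambda>s. ((\<lambda>s. \<phi> (s *\<^sub>R \<xi>) \<bullet> p) has_real_derivative ?D (s *\<^sub>R \<xi>) \<xi> \<bullet> p) (at s)) (nhds 0)"
      using ev
    proof eventually_elim
      case (elim s)
      then have "s *\<^sub>R \<xi> \<in> U" by simp
      then have "(\<phi> has_derivative ?D (s *\<^sub>R \<xi>)) (at (s *\<^sub>R \<xi>))"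
        by (rule local_parametrization_has_derivative[OF lp(1)])
      then show ?case by (rule line)
    qed
    have e2: "((\<lambda>s. ?D (s *\<^sub>R \<xi>) \<xi> \<bullet> p) has_real_derivative ?dd \<bullet> p) (at 0)"
      by (rule line) (use smooth_on_open_has_derivative[OF smooth_on_open_frechet_derivative[OF sm] lp(2)] in simp)
    have evn: "eventually (\<lambda>s. (\<phi> (s *\<^sub>R \<xi>) \<bullet> p - \<phi> (0 *\<^sub>R \<xi>) \<bullet> p - s * (?D (0 *\<^sub>R \<xi>) \<xi> \<bullet> p)) / s\<^sup>2 \<le> 0) (nhds 0)"
      using ev
    proof eventually_elim
      case (elim s)
      then have "\<phi> (s *\<^sub>R \<xi>) \<in> X" using local_parametrization_image_subset[OF lp(1)] by auto
      then have "\<phi> (s *\<^sub>R \<xi>) \<bullet> p \<le> \<phi> 0 \<bullet> p" using m_ge lp(3) by simp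
      moreover have "?D 0 \<xi> \<bullet> p = 0" using lp(5)[of \<xi>] by (simp add: inner_commute)
      ultimately show ?case by (simp add: divide_nonpos_nonneg)
    qed
    have "((\<lambda>s. (\<phi> (s *\<^sub>R \<xi>) \<bullet> p - \<phi> (0 *\<^sub>R \<xi>) \<bullet> p - s * (?D (0 *\<^sub>R \<xi>) \<xi> \<bullet> p)) / s\<^sup>2) \<longlongrightarrow> ?dd \<bullet> p / 2) (at 0)"
      by (rule second_order_limit[OF e1 e2])
    moreover have "eventually (\<lambda>s. (\<phi> (s *\<^sub>R \<xi>) \<bullet> p - \<phi> (0 *\<^sub>R \<xi>) \<bullet> p - s * (?D (0 *\<^sub>R \<xi>) \<xi> \<bullet> p)) / s\<^sup>2 \<le> 0) (at 0)"
      using evn by (simp add: eventually_at_filter eventually_mono)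
    ultimately have "?dd \<bullet> p / 2 \<le> 0" by (rule tendsto_upperbound) simp
    then show ?thesis by simp
  qed
  then have "(\<Sum>i\<in>(UNIV :: 'k set). frechet_derivative (\<lambda>u. ?D u (axis i 1)) (at 0) (axis i 1) \<bullet> p) \<le> 0"
    by (intro sum_nonpos) auto
  then have "0 \<le> real CARD('k) * m p" unfolding lp(6) by simp
  then show ?thesis by (simp add: zero_le_mult_iff)
qed

text \<open>The barrier is \<open>\<phi> (s \<xi>) \<bullet> R p \<le> m (R p)\<close>, where \<open>R\<close> rotates by the angle \<open>s\<close>: while \<open>p\<close> rotates, the
  maximizer is replaced by a point moving in \<open>X\<close> with velocity \<open>\<xi>\<close>. For the \<open>\<xi>\<close> chosen below the
  sum over the rotations involves the Hessian of \<open>x \<bullet> p\<close> on \<open>X\<close> only through its trace.\<close>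

lemma barrier:
  fixes \<Theta> :: "real poly"
  assumes p: "norm p = 1" and mp: "m p > 0"
    and mono: "\<And>v. 0 \<le> v \<Longrightarrow> v \<le> 1 \<Longrightarrow> poly (pderiv \<Theta>) v \<ge> 0"
    and up: "\<And>a b. 0 \<le> a \<Longrightarrow> a \<le> b \<Longrightarrow> b \<le> 1 \<Longrightarrow> poly \<Theta> a \<le> poly \<Theta> b"
  shows "\<exists>e. (e \<longlongrightarrow> jacobi_op (real CARD('k)) (real DIM('a) - 1) \<Theta> ((m p)\<^sup>2)) (at 0) \<and>
     eventually (\<lambda>s. e s \<le> rot_diff (\<lambda>q. poly \<Theta> ((m q)\<^sup>2)) s p / s\<^sup>2) (at 0)"
proof -
  define c where "c = m p"
  define n where "n = real DIM('a) - 1"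
  define k where "k = real CARD('k)"
  obtain U and \<phi> :: "real^'k \<Rightarrow> 'a" where lp: "local_parametrization X U \<phi>" "0 \<in> U" "\<phi> 0 \<bullet> p = c"
    "gram (frechet_derivative \<phi> (at 0)) = mat 1" "\<And>v. p \<bullet> frechet_derivative \<phi> (at 0) v = 0"
    and tr: "(\<Sum>i\<in>UNIV. frechet_derivative (\<lambda>u. frechet_derivative \<phi> (at u) (axis i 1)) (at 0) (axis i 1) \<bullet> p) = - k * c"
    by (rule maximizer_chart[of p, folded c_def k_def]) (rule that)
  have c0: "c > 0" using mp by (simp add: c_def)
  have pp: "p \<bullet> p = 1" using p by (simp add: dot_square_norm)
  have xx: "\<phi> 0 \<bullet> \<phi> 0 = 1"
  proof -
    have "\<phi> 0 \<in> X" using local_parametrization_image_subset[OF lp(1)] lp(2) by blast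
    then show ?thesis using norm_X by (simp add: dot_square_norm)
  qed
  define D where "D u = frechet_derivative \<phi> (at u)" for u
  define d where "d a = D 0 (axis a 1)" for a :: 'k
  let ?A = "\<lambda>q. plane_gen (fst q) (snd q)" and ?R = "\<lambda>q s. plane_rot (fst q) (snd q) s"
  \<comment> \<open>If \<open>X\<close> is a great subsphere, then \<open>\<xi> q\<close> is the velocity of the actual maximizer \<open>P p / norm (P p)\<close>.\<close>
  define \<xi> where "\<xi> q = (\<chi> a. (?A q p \<bullet> d a) / c)" for q
  have sm: "smooth_on_open U \<phi>" using lp(1) by (simp add: local_parametrization_def)
  have dd: "d a \<bullet> d b = (if a = b then 1 else 0)" for a b
  proof -
    have "d a \<bullet> d b = gram (frechet_derivative \<phi> (at 0)) $ a $ b" by (simp add: gram_def d_def D_def)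
    then show ?thesis unfolding lp(4) by (simp add: mat_def)
  qed
  have pd: "p \<bullet> d a = 0" for a using lp(5) by (simp add: d_def D_def)
  have linD: "linear (D u)" if "u \<in> U" for u unfolding D_def by (rule local_parametrization_linear[OF lp(1) that])
  have D\<xi>: "D 0 y = (\<Sum>a\<in>UNIV. (y $ a) *\<^sub>R d a)" for y
    unfolding d_def by (rule linear_axis_expansion[OF linD[OF lp(2)]])
  define H where "H a b = frechet_derivative (\<lambda>u. D u (axis a 1)) (at 0) (axis b 1) \<bullet> p" for a b :: 'k
  have DD: "frechet_derivative (\<lambda>u. D u y) (at 0) y \<bullet> p = (\<Sum>a\<in>UNIV. \<Sum>b\<in>UNIV. y $ a * y $ b * H a b)" for y
  proof -
    let ?h = "\<lambda>a. frechet_derivative (\<lambda>u. D u (axis a 1)) (at 0)"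
    have h: "((\<lambda>u. D u (axis a 1)) has_derivative ?h a) (at 0)" for a
      unfolding D_def by (rule smooth_on_open_has_derivative[OF smooth_on_open_frechet_derivative[OF sm] lp(2)])
    have "((\<lambda>u. \<Sum>a\<in>UNIV. (y $ a) *\<^sub>R D u (axis a 1)) has_derivative (\<lambda>v. \<Sum>a\<in>UNIV. (y $ a) *\<^sub>R ?h a v)) (at 0)"
      by (intro has_derivative_sum has_derivative_scaleR_right h)
    then have "((\<lambda>u. D u y) has_derivative (\<lambda>v. \<Sum>a\<in>UNIV. (y $ a) *\<^sub>R ?h a v)) (at 0)"
      by (rule has_derivative_transform_within_open[OF _ local_parametrization_open[OF lp(1)] lp(2)])
        (rule linear_axis_expansion[OF linD, symmetric])
    then have "frechet_derivative (\<lambda>u. D u y) (at 0) = (\<lambda>v. \<Sum>a\<in>UNIV. (y $ a) *\<^sub>R ?h a v)"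
      by (rule frechet_derivative_at[symmetric])
    from fun_cong[OF this, of y]
    have "frechet_derivative (\<lambda>u. D u y) (at 0) y = (\<Sum>a\<in>UNIV. (y $ a) *\<^sub>R ?h a y)" .
    also have "\<dots> = (\<Sum>a\<in>UNIV. (y $ a) *\<^sub>R (\<Sum>b\<in>UNIV. (y $ b) *\<^sub>R ?h a (axis b 1)))"
      by (rule sum.cong[OF refl], rule arg_cong[where f = "\<lambda>z. _ *\<^sub>R z"], rule linear_axis_expansion[OF has_derivative_linear[OF h]])
    finally show ?thesis by (simp add: inner_sum_left sum_distrib_left H_def mult.assoc)
  qed
  have \<xi>\<xi>: "(\<Sum>q\<in>planes. \<xi> q $ a * \<xi> q $ b) = (if a = b then 2 / c\<^sup>2 else 0)" for a b
  proof -
    have "(\<Sum>q\<in>planes. \<xi> q $ a * \<xi> q $ b) = (\<Sum>q\<in>planes. 1 / c\<^sup>2 * ((?A q p \<bullet> d a) * (?A q p \<bullet> d b)))"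
      by (simp add: \<xi>_def power2_eq_square)
    also have "\<dots> = 1 / c\<^sup>2 * (\<Sum>(i, j)\<in>planes. (plane_gen i j p \<bullet> d a) * (plane_gen i j p \<bullet> d b))"
      by (simp only: sum_distrib_left case_prod_unfold)
    finally show ?thesis unfolding planes_gen_product pp pd dd by simp
  qed
  define r where "r q s = \<phi> (s *\<^sub>R \<xi> q) \<bullet> ?R q s p" for q s
  define r1 where "r1 q s = D (s *\<^sub>R \<xi> q) (\<xi> q) \<bullet> ?R q s p + \<phi> (s *\<^sub>R \<xi> q) \<bullet> ?R q s (?A q p)" for q s
  define r2 where "r2 q = frechet_derivative (\<lambda>u. D u (\<xi> q)) (at 0) (\<xi> q) \<bullet> p + 2 * (D 0 (\<xi> q) \<bullet> ?A q p) + \<phi> 0 \<bullet> ?A q (?A q p)" for q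
  have on: "norm (fst q) = 1" "norm (snd q) = 1" "fst q \<bullet> snd q = 0" if "q \<in> planes" for q :: "'a \<times> 'a"
    using planes_orthonormal[of "fst q" "snd q"] that by auto
  have R0: "?R q 0 y = y" if "q \<in> planes" for q :: "'a \<times> 'a" and y :: 'a by (rule plane_rot_0[OF on[OF that]])
  have ev: "eventually (\<lambda>s. (r q has_real_derivative r1 q s) (at s) \<and> s *\<^sub>R \<xi> q \<in> U) (nhds 0)"
    and dr1: "(r1 q has_real_derivative r2 q) (at 0)" if "q \<in> planes" for q
    using second_derivatives[OF lp(1,2), of "fst q" "snd q" "\<xi> q" p] that
    unfolding r_def[abs_def] r1_def[abs_def] r2_def D_def by auto
  have r0: "r q 0 = c" if "q \<in> planes" for q using R0[OF that] lp(3) by (simp add: r_def)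
  have r10: "r1 q 0 = ?A q p \<bullet> \<phi> 0" if "q \<in> planes" for q
    using R0[OF that] lp(5)[of "\<xi> q"] by (simp add: r1_def D_def inner_commute)
  have s1: "(\<Sum>q\<in>planes. r1 q 0) = 0"
  proof -
    have "(\<Sum>q\<in>planes. r1 q 0) = (\<Sum>(i, j)\<in>planes. plane_gen i j p \<bullet> \<phi> 0)"
      by (rule sum.cong) (auto simp: r10)
    then show ?thesis by (simp add: planes_gen_sum)
  qed
  have s2: "(\<Sum>q\<in>planes. r1 q 0 * r1 q 0) = 2 * (1 - c\<^sup>2)"
  proof -
    have "(\<Sum>q\<in>planes. r1 q 0 * r1 q 0) = (\<Sum>(i, j)\<in>planes. (plane_gen i j p \<bullet> \<phi> 0) * (plane_gen i j p \<bullet> \<phi> 0))"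
      by (rule sum.cong) (auto simp: r10)
    then show ?thesis unfolding planes_gen_product pp xx inner_commute[of p "\<phi> 0"] lp(3) by (simp add: power2_eq_square)
  qed
  have s3: "(\<Sum>q\<in>planes. r2 q) = 2 * (k / c - n * c)"
  proof -
    have a: "(\<Sum>q\<in>planes. frechet_derivative (\<lambda>u. D u (\<xi> q)) (at 0) (\<xi> q) \<bullet> p) = - 2 * k / c"
    proof -
      have "(\<Sum>q\<in>planes. frechet_derivative (\<lambda>u. D u (\<xi> q)) (at 0) (\<xi> q) \<bullet> p)
          = (\<Sum>a\<in>UNIV. \<Sum>b\<in>UNIV. (\<Sum>q\<in>planes. \<xi> q $ a * \<xi> q $ b) * H a b)"
        unfolding DD sum_distrib_right by (subst sum.swap) (subst (2) sum.swap, rule refl)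
      also have "\<dots> = (\<Sum>a\<in>UNIV. 2 / c\<^sup>2 * H a a)"
        unfolding \<xi>\<xi> by (simp add: if_distrib[of "\<lambda>x. x * _"] cong: if_cong)
      also have "\<dots> = 2 / c\<^sup>2 * (- k * c)"
        unfolding sum_distrib_left[symmetric] H_def D_def tr ..
      finally show ?thesis using c0 by (simp add: power2_eq_square field_simps)
    qed
    have b: "(\<Sum>q\<in>planes. D 0 (\<xi> q) \<bullet> ?A q p) = 2 * k / c"
    proof -
      have "(\<Sum>q\<in>planes. D 0 (\<xi> q) \<bullet> ?A q p) = (\<Sum>q\<in>planes. \<Sum>a\<in>UNIV. c * (\<xi> q $ a * \<xi> q $ a))"
        unfolding D\<xi> inner_sum_left using c0 by (simp add: \<xi>_def inner_commute)
      also have "\<dots> = c * (\<Sum>a\<in>UNIV. \<Sum>q\<in>planes. \<xi> q $ a * \<xi> q $ a)"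
        by (subst sum.swap) (simp only: sum_distrib_left)
      also have "\<dots> = c * (k * (2 / c\<^sup>2))" by (simp add: \<xi>\<xi> k_def)
      finally show ?thesis using c0 by (simp add: power2_eq_square field_simps)
    qed
    have c': "(\<Sum>q\<in>planes. \<phi> 0 \<bullet> ?A q (?A q p)) = - 2 * n * c"
    proof -
      have "(\<Sum>q\<in>planes. \<phi> 0 \<bullet> ?A q (?A q p)) = (\<Sum>(i, j)\<in>planes. plane_gen i j (plane_gen i j p) \<bullet> \<phi> 0)"
        by (simp add: case_prod_unfold inner_commute)
      then show ?thesis unfolding planes_gen_gen_sum inner_commute[of p "\<phi> 0"] lp(3) n_def by simp
    qed
    have "(\<Sum>q\<in>planes. r2 q) = - 2 * k / c + 2 * (2 * k / c) + - 2 * n * c"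
      unfolding r2_def sum.distrib a c' sum_distrib_left[symmetric] b ..
    then show ?thesis using c0 by (simp add: field_simps)
  qed
  define P where "P = pcompose \<Theta> [:0, 0, 1:]"
  have P: "poly P y = poly \<Theta> (y\<^sup>2)" for y by (simp add: P_def poly_pcompose power2_eq_square)
  have P1: "poly (pderiv P) y = 2 * y * poly (pderiv \<Theta>) (y\<^sup>2)" for y
    by (simp add: P_def pderiv_pcompose poly_pcompose power2_eq_square pderiv_pCons)
  have P2: "poly (pderiv (pderiv P)) y = 2 * poly (pderiv \<Theta>) (y\<^sup>2) + 4 * y\<^sup>2 * poly (pderiv (pderiv \<Theta>)) (y\<^sup>2)" for y
    by (simp add: P_def pderiv_pcompose pderiv_mult pderiv_smult poly_pcompose power2_eq_square pderiv_pCons algebra_simps)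
  define f where "f s = (\<Sum>q\<in>planes. poly P (r q s))" for s
  define f1 where "f1 s = (\<Sum>q\<in>planes. poly (pderiv P) (r q s) * r1 q s)" for s
  define f2 where "f2 = (\<Sum>q\<in>planes. poly (pderiv (pderiv P)) c * (r1 q 0 * r1 q 0) + poly (pderiv P) c * r2 q)"
  have evall: "eventually (\<lambda>s. \<forall>q\<in>planes. (r q has_real_derivative r1 q s) (at s) \<and> s *\<^sub>R \<xi> q \<in> U) (nhds 0)"
    by (rule eventually_ball_finite[OF finite_planes]) (use ev in blast)
  have df: "eventually (\<lambda>s. (f has_real_derivative f1 s) (at s)) (nhds 0)"
    using evall
  proof eventually_elim
    case (elim s)
    show ?case unfolding f_def[abs_def] f1_def
      by (rule DERIV_sum) (rule DERIV_chain2[OF poly_DERIV], use elim in blast)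
  qed
  have dr0: "(r q has_real_derivative r1 q 0) (at 0)" if "q \<in> planes" for q
    using eventually_nhds_x_imp_x[OF ev[OF that]] by blast
  have df1: "(f1 has_real_derivative f2) (at 0)"
    unfolding f1_def[abs_def] f2_def
  proof (rule DERIV_sum)
    fix q :: "'a \<times> 'a" assume q: "q \<in> planes"
    have "((\<lambda>s. poly (pderiv P) (r q s)) has_real_derivative poly (pderiv (pderiv P)) (r q 0) * r1 q 0) (at 0)"
      by (rule DERIV_chain2[OF poly_DERIV dr0[OF q]])
    from DERIV_mult[OF this dr1[OF q]]
    show "((\<lambda>s. poly (pderiv P) (r q s) * r1 q s) has_real_derivative
        poly (pderiv (pderiv P)) c * (r1 q 0 * r1 q 0) + poly (pderiv P) c * r2 q) (at 0)"
      by (simp add: r0[OF q] mult_ac add.commute)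
  qed
  have f10: "f1 0 = 0"
  proof -
    have "f1 0 = (\<Sum>q\<in>planes. poly (pderiv P) c * r1 q 0)" unfolding f1_def by (rule sum.cong) (auto simp: r0)
    then show ?thesis by (simp add: sum_distrib_left[symmetric] s1)
  qed
  have f2: "f2 / 2 = jacobi_op k n \<Theta> (c\<^sup>2)"
  proof -
    let ?A = "poly (pderiv \<Theta>) (c\<^sup>2)" and ?B = "poly (pderiv (pderiv \<Theta>)) (c\<^sup>2)"
    have h: "2 * c * A * (2 * (k / c - n * c)) = 4 * A * (k - n * c\<^sup>2)" for A
      using c0 by (simp add: power2_eq_square right_diff_distrib)
    have "f2 = poly (pderiv (pderiv P)) c * (2 * (1 - c\<^sup>2)) + poly (pderiv P) c * (2 * (k / c - n * c))"
      unfolding f2_def sum.distrib sum_distrib_left[symmetric] s2 s3 ..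
    then have "f2 = (2 * ?A + 4 * c\<^sup>2 * ?B) * (2 * (1 - c\<^sup>2)) + 4 * ?A * (k - n * c\<^sup>2)"
      unfolding P1 P2 using h[of ?A] by simp
    then show ?thesis unfolding jacobi_op_def by (simp add: algebra_simps)
  qed
  have lim: "((\<lambda>s. (f s - f 0 - s * f1 0) / s\<^sup>2) \<longlongrightarrow> jacobi_op k n \<Theta> (c\<^sup>2)) (at 0)"
    using second_order_limit[OF df df1] unfolding f2 .
  have evpos: "eventually (\<lambda>s. \<forall>q\<in>planes. r q s > 0) (nhds 0)"
  proof -
    have "eventually (\<lambda>s. r q s > 0) (nhds 0)" if q: "q \<in> planes" for q
    proof -
      have "isCont (r q) 0" by (rule DERIV_isCont[OF dr0[OF q]])
      then have "(r q \<longlongrightarrow> r q 0) (nhds 0)" by (simp add: isCont_def tendsto_nhds_iff)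
      then show ?thesis by (rule order_tendstoD(1)) (simp add: r0[OF q] c0)
    qed
    then show ?thesis by (intro eventually_ball_finite[OF finite_planes]) blast
  qed
  have "eventually (\<lambda>s. (f s - f 0 - s * f1 0) / s\<^sup>2 \<le> rot_diff (\<lambda>q. poly \<Theta> ((m q)\<^sup>2)) s p / s\<^sup>2) (nhds 0)"
    using evall evpos
  proof eventually_elim
    case (elim s)
    have "poly P (r q s) \<le> poly \<Theta> ((m (?R q s p))\<^sup>2)" if q: "q \<in> planes" for q
    proof -
      have "\<phi> (s *\<^sub>R \<xi> q) \<in> X" using local_parametrization_image_subset[OF lp(1)] elim(1) q by blast
      then have 1: "r q s \<le> m (?R q s p)" unfolding r_def by (rule m_ge)
      have 2: "m (?R q s p) \<le> 1" using m_le[of "?R q s p"] norm_plane_rot[OF on[OF q]] p by simp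
      have 3: "0 \<le> r q s" using elim(2) q by (simp add: less_imp_le)
      have "(r q s)\<^sup>2 \<le> (m (?R q s p))\<^sup>2" "(m (?R q s p))\<^sup>2 \<le> 1"
        using 1 2 3 by (auto intro: power_mono power_le_one)
      then show ?thesis unfolding P by (intro up) auto
    qed
    then have "f s \<le> (\<Sum>q\<in>planes. poly \<Theta> ((m (?R q s p))\<^sup>2))" unfolding f_def by (rule sum_mono)
    moreover have "f 0 = (\<Sum>q\<in>(planes :: ('a \<times> 'a) set). poly \<Theta> ((m p)\<^sup>2))"
      unfolding f_def by (rule sum.cong) (auto simp: r0 P c_def)
    ultimately have "f s - f 0 \<le> rot_diff (\<lambda>q. poly \<Theta> ((m q)\<^sup>2)) s p"
      unfolding rot_diff_def by (simp add: sum_subtractf case_prod_unfold)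
    then show ?case by (simp add: f10 divide_right_mono)
  qed
  then have "eventually (\<lambda>s. (f s - f 0 - s * f1 0) / s\<^sup>2 \<le> rot_diff (\<lambda>q. poly \<Theta> ((m q)\<^sup>2)) s p / s\<^sup>2) (at 0)"
    by (simp add: eventually_at_filter eventually_mono)
  with lim show ?thesis unfolding c_def k_def n_def by blast
qed

end

lemma (in sphere_measure) continuous_integrable:
  fixes f :: "'a \<Rightarrow> real"
  assumes "continuous_on (sphere 0 1) f"
  shows "integrable \<mu> f"
proof -
  have "compact (f ` sphere 0 1)" by (rule compact_continuous_image[OF assms]) simp
  from compact_imp_bounded[OF this] obtain B where "\<forall>y\<in>f ` sphere 0 1. norm y \<le> B"
    unfolding bounded_iff by blast
  then have "\<And>x. x \<in> sphere 0 1 \<Longrightarrow> \<bar>f x\<bar> \<le> B" by simp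
  then show ?thesis
    by (intro integrable_const_bound[where B = B] continuous_measurable[OF assms] AE_I2) (use space in auto)
qed

lemma jacobi_op_poly:
  "jacobi_op k n \<Theta> v = poly ([:0, 4, -4:] * pderiv (pderiv \<Theta>) + [:2 * (k + 1), - 2 * (n + 1):] * pderiv \<Theta>) v"
  by (simp add: jacobi_op_def algebra_simps)

context critical_sphere
begin

text \<open>If the points with \<open>m p = 0\<close> spanned the space, the sum \<open>q\<close> of a basis of such points would satisfy \<open>m q < 0\<close>. So
  they lie in a great sphere, which is null.\<close>

lemma m_positive: "AE p in \<mu>. m p > 0"
proof -
  let ?Z = "{p \<in> sphere 0 1. m p = 0}"
  have "span ?Z \<noteq> UNIV"
  proof
    assume Z: "span ?Z = UNIV"
    obtain B where B: "B \<subseteq> ?Z" "independent B" "?Z \<subseteq> span B" by (rule maximal_independent_subset)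
    have fB: "finite B" by (rule independent_imp_finite[OF B(2)])
    have "span ?Z \<subseteq> span B" by (rule span_minimal[OF B(3) subspace_span])
    then have sB: "span B = UNIV" using Z by blast
    obtain x where x: "x \<in> X" "x \<bullet> sum (\<lambda>b. b) B = m (sum (\<lambda>b. b) B)" by (rule attained[of "sum (\<lambda>b. b) B"]) (rule that)
    have le: "x \<bullet> b \<le> 0" if "b \<in> B" for b
    proof -
      have "m b = 0" using B(1) that by blast
      then show ?thesis using m_ge[OF x(1), of b] by simp
    qed
    have "(\<Sum>b\<in>B. x \<bullet> b) \<ge> 0" using m_nonneg x(2) by (simp add: inner_sum_right)
    moreover have "(\<Sum>b\<in>B. x \<bullet> b) \<le> 0" by (rule sum_nonpos) (rule le)
    ultimately have "(\<Sum>b\<in>B. - (x \<bullet> b)) = 0" by (simp only: sum_negf)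
    moreover have "(\<Sum>b\<in>B. - (x \<bullet> b)) = 0 \<longleftrightarrow> (\<forall>b\<in>B. - (x \<bullet> b) = 0)"
      by (rule sum_nonneg_eq_0_iff[OF fB]) (use le in simp)
    ultimately have z: "x \<bullet> b = 0" if "b \<in> B" for b using that by simp
    have "x \<in> span B" using sB by simp
    moreover have "span B \<subseteq> {y. x \<bullet> y = 0}"
      by (rule span_minimal) (use z in \<open>auto intro: subspace_hyperplane\<close>)
    ultimately have "x \<bullet> x = 0" by blast
    then show False using norm_X[OF x(1)] by simp
  qed
  from span_not_univ_subset_hyperplane[OF this] obtain a where a: "a \<noteq> 0" "span ?Z \<subseteq> {x. a \<bullet> x = 0}" by blast
  let ?N = "{x \<in> sphere 0 1. a \<bullet> x = 0}"
  have "(\<lambda>x. a \<bullet> x) \<in> borel_measurable \<mu>" by (rule continuous_measurable) (intro continuous_intros)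
  then have "{x \<in> space \<mu>. a \<bullet> x = 0} \<in> sets \<mu>" by measurable
  then have N: "?N \<in> sets \<mu>" by (simp add: space)
  have "{x \<in> space \<mu>. \<not> m x > 0} \<subseteq> ?N"
  proof
    fix x assume "x \<in> {x \<in> space \<mu>. \<not> m x > 0}"
    then have "x \<in> ?Z" "x \<in> sphere 0 1" using m_nonneg[of x] by (auto simp: space)
    then show "x \<in> ?N" using a(2) span_base[of x ?Z] by blast
  qed
  from AE_I[OF this hyperplane_null[OF a(1)] N] show ?thesis .
qed

text \<open>Keeping the maximizer \<open>x\<close> of \<open>p\<close> fixed gives a worse barrier, but one with a bound uniform in \<open>p\<close>: the first
  order terms sum to a multiple of \<open>cos s - 1\<close>.\<close>

lemma uniform_lower_bound:
  fixes \<Theta> :: "real poly"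
  assumes mono: "\<And>v. 0 \<le> v \<Longrightarrow> v \<le> 1 \<Longrightarrow> poly (pderiv \<Theta>) v \<ge> 0"
    and up: "\<And>a b. 0 \<le> a \<Longrightarrow> a \<le> b \<Longrightarrow> b \<le> 1 \<Longrightarrow> poly \<Theta> a \<le> poly \<Theta> b"
  obtains C where "\<And>s p. 0 < s \<Longrightarrow> p \<in> sphere 0 1 \<Longrightarrow> - C \<le> rot_diff (\<lambda>q. poly \<Theta> ((m q)\<^sup>2)) s p / s\<^sup>2"
proof -
  define P where "P = pcompose \<Theta> [:0, 0, 1:]"
  have P: "poly P y = poly \<Theta> (y\<^sup>2)" for y by (simp add: P_def poly_pcompose power2_eq_square)
  have P1: "poly (pderiv P) y = 2 * y * poly (pderiv \<Theta>) (y\<^sup>2)" for y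
    by (simp add: P_def pderiv_pcompose poly_pcompose power2_eq_square pderiv_pCons)
  obtain L where L: "L > 0" "\<And>x y. 0 \<le> x \<Longrightarrow> x \<le> 1 \<Longrightarrow> 0 \<le> y \<Longrightarrow> y \<le> 1 \<Longrightarrow>
      \<bar>poly P y - poly P x - poly (pderiv P) x * (y - x)\<bar> \<le> L * (y - x)\<^sup>2"
    by (rule poly_taylor_bound[of P]) (rule that)
  obtain B where B: "B > 0" "\<And>x. 0 \<le> x \<Longrightarrow> x \<le> 1 \<Longrightarrow> \<bar>poly (pderiv P) x\<bar> \<le> B"
    by (rule poly_bounded_unit[of "pderiv P"]) (rule that)
  define N where "N = real (card (planes :: ('a \<times> 'a) set))"
  define d where "d = 2 * (real DIM('a) - 1)"
  have d0: "d \<ge> 0" using dim_le by (simp add: d_def)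
  show ?thesis
  proof (rule that[of "N * L + B * d"])
    fix s :: real and p :: 'a assume s: "0 < s" and p: "p \<in> sphere 0 1"
    then have np: "norm p = 1" by simp
    define c where "c = m p"
    have c: "0 \<le> c" "c \<le> 1" using m_nonneg[of p] m_le[of p] np by (auto simp: c_def)
    obtain x where x: "x \<in> X" "x \<bullet> p = c" using attained[of p] unfolding c_def by blast
    let ?R = "\<lambda>q. plane_rot (fst q) (snd q) s p" and ?D = "poly (pderiv P) c"
    have D0: "?D \<ge> 0"
      unfolding P1 using c mono[of "c\<^sup>2"] by (simp add: power_le_one)
    have q: "poly \<Theta> ((m (?R q))\<^sup>2) - poly \<Theta> (c\<^sup>2) \<ge> ?D * (x \<bullet> ?R q - c) - L * s\<^sup>2" if q: "q \<in> planes" for q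
    proof -
      have q': "(fst q, snd q) \<in> planes" using q by simp
      define r where "r = x \<bullet> ?R q"
      have nR: "norm (?R q) = 1" using norm_plane_rot[OF planes_orthonormal[OF q']] np by simp
      have rm: "r \<le> m (?R q)" "m (?R q) \<le> 1" unfolding r_def using m_ge[OF x(1)] m_le[of "?R q"] nR by auto
      have "r - c = x \<bullet> (?R q - p)" using x(2) by (simp add: r_def inner_diff_right)
      then have "\<bar>r - c\<bar> \<le> norm (?R q - p)" using Cauchy_Schwarz_ineq2[of x "?R q - p"] norm_X[OF x(1)] by simp
      then have "\<bar>r - c\<bar> \<le> \<bar>s\<bar>" using plane_rot_near[OF q' np, of s] by linarith
      then have rs: "(r - c)\<^sup>2 \<le> s\<^sup>2" by (simp only: abs_le_square_iff)
      have m1: "(m (?R q))\<^sup>2 \<le> 1" using rm(2) m_nonneg by (simp add: power_le_one)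
      show ?thesis
      proof (cases "r \<ge> 0")
        case True
        have "r\<^sup>2 \<le> (m (?R q))\<^sup>2" using True rm by (simp add: power_mono)
        then have 1: "poly P r \<le> poly \<Theta> ((m (?R q))\<^sup>2)" unfolding P using m1 by (intro up) auto
        have 2: "\<bar>poly P r - poly P c - ?D * (r - c)\<bar> \<le> L * (r - c)\<^sup>2" using c True rm by (intro L(2)) auto
        have "L * (r - c)\<^sup>2 \<le> L * s\<^sup>2" using rs L(1) by simp
        then show ?thesis using 1 2 unfolding P[symmetric] r_def[symmetric] by linarith
      next
        \<comment> \<open>For \<open>r < 0\<close> the bound \<open>m \<ge> r\<close> says nothing about \<open>m\<^sup>2\<close>; but then \<open>c\<close> is at most \<open>\<bar>s\<bar>\<close>, and \<open>m \<ge> 0\<close> suffices.\<close>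
        case False
        have 1: "poly P 0 \<le> poly \<Theta> ((m (?R q))\<^sup>2)" unfolding P using m1 by (intro up) auto
        have 2: "\<bar>poly P 0 - poly P c - ?D * (0 - c)\<bar> \<le> L * (0 - c)\<^sup>2" using c by (intro L(2)) auto
        have "\<bar>0 - c\<bar> \<le> \<bar>r - c\<bar>" using False c by simp
        then have "(0 - c)\<^sup>2 \<le> (r - c)\<^sup>2" by (simp only: abs_le_square_iff)
        then have 3: "L * (0 - c)\<^sup>2 \<le> L * s\<^sup>2" using rs L(1) by (intro mult_left_mono) auto
        have 4: "?D * (r - c) \<le> ?D * (0 - c)" using False D0 by (intro mult_left_mono) auto
        show ?thesis using 1 2 3 4 unfolding P[symmetric] r_def[symmetric] by linarith
      qed
    qed
    have "(\<Sum>q\<in>planes. ?D * (x \<bullet> ?R q - c) - L * s\<^sup>2) \<le> rot_diff (\<lambda>q. poly \<Theta> ((m q)\<^sup>2)) s p"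
      unfolding rot_diff_def case_prod_unfold c_def[symmetric] by (rule sum_mono) (rule q)
    moreover have "(\<Sum>q\<in>planes. ?D * (x \<bullet> ?R q - c) - L * s\<^sup>2) = ?D * (\<Sum>q\<in>planes. x \<bullet> ?R q - c) - N * L * s\<^sup>2"
      by (simp add: sum_subtractf[of "\<lambda>q. ?D * (x \<bullet> ?R q - c)"] sum_distrib_left[symmetric] N_def)
    moreover have "(\<Sum>q\<in>planes. x \<bullet> ?R q - c) = (cos s - 1) * (d * c)"
    proof -
      have "(\<Sum>q\<in>planes. x \<bullet> ?R q - c) = (\<Sum>(i, j)\<in>planes. (plane_rot i j s p - p) \<bullet> x)"
        unfolding case_prod_unfold x(2)[symmetric] by (simp add: inner_diff_left inner_diff_right inner_commute)
      then show ?thesis unfolding planes_rot_sum d_def using x(2) by (simp add: inner_commute)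
    qed
    moreover have "\<bar>?D * ((cos s - 1) * (d * c))\<bar> \<le> B * (s\<^sup>2 * (d * 1))"
      unfolding abs_mult using B c d0 cos_minus_one_bound[of s] by (intro mult_mono) auto
    ultimately have "- ((N * L + B * d) * s\<^sup>2) \<le> rot_diff (\<lambda>q. poly \<Theta> ((m q)\<^sup>2)) s p"
      by (simp add: algebra_simps abs_le_iff)
    then show "- (N * L + B * d) \<le> rot_diff (\<lambda>q. poly \<Theta> ((m q)\<^sup>2)) s p / s\<^sup>2"
      unfolding pos_le_divide_eq[OF zero_less_power[OF s]] minus_mult_left[symmetric] .
  qed
qed

lemma m_square_bounds: "p \<in> sphere 0 1 \<Longrightarrow> 0 \<le> (m p)\<^sup>2 \<and> (m p)\<^sup>2 \<le> 1"
  using m_le[of p] m_nonneg[of p] by (simp add: power_le_one)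

lemma poly_m_continuous: "continuous_on S (\<lambda>p. poly g ((m p)\<^sup>2))"
  by (rule continuous_on_poly[OF continuous_on_power[OF m_continuous]])

lemma jacobi_integral_nonpos:
  fixes \<Theta> :: "real poly"
  assumes mono: "\<And>v. 0 \<le> v \<Longrightarrow> v \<le> 1 \<Longrightarrow> poly (pderiv \<Theta>) v \<ge> 0"
  shows "(LINT p|\<mu>. jacobi_op (real CARD('k)) (real DIM('a) - 1) \<Theta> ((m p)\<^sup>2)) \<le> 0"
proof -
  have up: "poly \<Theta> a \<le> poly \<Theta> b" if "0 \<le> a" "a \<le> b" "b \<le> 1" for a b
  proof (rule DERIV_nonneg_imp_nondecreasing[OF that(2)])
    fix x assume "a \<le> x" "x \<le> b"
    then show "\<exists>y. (poly \<Theta> has_real_derivative y) (at x) \<and> 0 \<le> y"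
      using that by (intro exI[of _ "poly (pderiv \<Theta>) x"] conjI poly_DERIV mono) linarith+
  qed
  obtain C where C: "\<And>s p. 0 < s \<Longrightarrow> p \<in> sphere 0 1 \<Longrightarrow> - C \<le> rot_diff (\<lambda>q. poly \<Theta> ((m q)\<^sup>2)) s p / s\<^sup>2"
    by (rule uniform_lower_bound[of \<Theta>], erule (1) mono, erule (2) up, rule that)
  let ?J = "[:0, 4, -4:] * pderiv (pderiv \<Theta>) + [:2 * (real CARD('k) + 1), - 2 * (real DIM('a) - 1 + 1):] * pderiv \<Theta>"
  obtain B where B: "B > 0" "\<And>x. 0 \<le> x \<Longrightarrow> x \<le> 1 \<Longrightarrow> \<bar>poly \<Theta> x\<bar> \<le> B"
    by (rule poly_bounded_unit[of \<Theta>]) (rule that)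
  obtain B' where B': "B' > 0" "\<And>x. 0 \<le> x \<Longrightarrow> x \<le> 1 \<Longrightarrow> \<bar>poly ?J x\<bar> \<le> B'"
    by (rule poly_bounded_unit[of ?J]) (rule that)
  show ?thesis
    unfolding jacobi_op_poly
  proof (rule rotation_inequality[where u = "\<lambda>p. poly \<Theta> ((m p)\<^sup>2)" and B = B and B' = B' and C = C])
    show "AE p in \<mu>. \<exists>e. (e \<longlongrightarrow> poly ?J ((m p)\<^sup>2)) (at 0) \<and>
        eventually (\<lambda>s. e s \<le> rot_diff (\<lambda>p. poly \<Theta> ((m p)\<^sup>2)) s p / s\<^sup>2) (at 0)"
      using m_positive AE_space
    proof eventually_elim
      case (elim p)
      then have "norm p = 1" by (simp add: space)
      from barrier[OF this elim(1) mono up] show ?case unfolding jacobi_op_poly .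
    qed
    show "(\<lambda>p. poly \<Theta> ((m p)\<^sup>2)) \<in> borel_measurable \<mu>" "(\<lambda>p. poly ?J ((m p)\<^sup>2)) \<in> borel_measurable \<mu>"
      by (rule continuous_measurable[OF poly_m_continuous])+
    show "\<bar>poly \<Theta> ((m p)\<^sup>2)\<bar> \<le> B" "\<bar>poly ?J ((m p)\<^sup>2)\<bar> \<le> B'" if "p \<in> sphere 0 1" for p
      using B(2) B'(2) m_square_bounds[OF that] by blast+
  qed (rule C)
qed

text \<open>Write \<open>g\<close> as \<open>L \<Theta>\<close> plus a constant; the constant contributes equally to both sides.\<close>

lemma decreasing_integral_le:
  fixes g :: "real poly"
  assumes dec: "\<And>v. 0 \<le> v \<Longrightarrow> v \<le> 1 \<Longrightarrow> poly (pderiv g) v \<le> 0"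
    and Y: "orthonormal_set Y" and card: "card Y = CARD('k) + 1"
  shows "(LINT p|\<mu>. poly g ((m p)\<^sup>2)) \<le> (LINT p|\<mu>. poly g (orthonormal_set.v Y p))"
proof -
  interpret Y: orthonormal_set Y by (rule Y)
  let ?k = "real CARD('k)" and ?n = "real DIM('a) - 1"
  have "?n \<ge> 0" using dim_le by simp
  then obtain \<Theta> c where \<Theta>: "\<And>v. poly g v = jacobi_op ?k ?n \<Theta> v + c"
    by (rule jacobi_op_surj) (rule that)
  have mono: "poly (pderiv \<Theta>) v \<ge> 0" if "0 \<le> v" "v \<le> 1" for v
    by (rule jacobi_op_monotone[OF _ dim_le \<Theta> dec that]) simp
  have int: "integrable \<mu> (\<lambda>p. jacobi_op ?k ?n \<Theta> ((m p)\<^sup>2))" "integrable \<mu> (\<lambda>p. jacobi_op ?k ?n \<Theta> (Y.v p))"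
    unfolding jacobi_op_poly by (rule continuous_integrable[OF poly_m_continuous], rule continuous_integrable[OF continuous_on_poly[OF Y.v_continuous]])
  have "(LINT p|\<mu>. jacobi_op ?k ?n \<Theta> ((m p)\<^sup>2)) \<le> (LINT p|\<mu>. jacobi_op ?k ?n \<Theta> (Y.v p))"
    using jacobi_integral_nonpos[OF mono] projection_integral[OF Y, of ?k \<Theta>] card by simp
  then show ?thesis unfolding \<Theta> using int by simp
qed

text \<open>Decreasing polynomials that are nearly \<open>1\<close> up to \<open>y\<close> and nearly \<open>0\<close> from \<open>z\<close> on.\<close>

lemma measure_sublevel_closed_le:
  assumes Y: "orthonormal_set Y" and card: "card Y = CARD('k) + 1" and yz: "0 \<le> y" "y < z" "z \<le> 1"
  shows "measure \<mu> {p \<in> space \<mu>. (m p)\<^sup>2 \<le> y} \<le> measure \<mu> {p \<in> space \<mu>. orthonormal_set.v Y p < z}"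
proof -
  interpret Y: orthonormal_set Y by (rule Y)
  let ?A = "{p \<in> space \<mu>. (m p)\<^sup>2 \<le> y}" and ?B = "{p \<in> space \<mu>. Y.v p < z}"
  let ?a = "measure \<mu> ?A" and ?b = "measure \<mu> ?B" and ?S = "measure \<mu> (space \<mu>)"
  have mm: "(\<lambda>p. (m p)\<^sup>2) \<in> borel_measurable \<mu>" "Y.v \<in> borel_measurable \<mu>"
    by (rule continuous_measurable[OF continuous_on_power[OF m_continuous]], rule continuous_measurable[OF Y.v_continuous])
  have A: "?A \<in> sets \<mu>" and B: "?B \<in> sets \<mu>" using mm by measurable
  have vb: "0 \<le> Y.v p \<and> Y.v p \<le> 1" if "p \<in> space \<mu>" for p
    using Y.v_bounds[of p] that by (simp add: space)
  have key: "?a \<le> ?b + \<delta> * (?a + ?S)" if \<delta>: "\<delta> > 0" for \<delta>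
  proof -
    obtain g where g: "\<And>v. 0 \<le> v \<Longrightarrow> v \<le> 1 \<Longrightarrow> poly (pderiv g) v \<le> 0"
      "\<And>v. 0 \<le> v \<Longrightarrow> v \<le> 1 \<Longrightarrow> 0 \<le> poly g v \<and> poly g v \<le> 1"
      "\<And>v. 0 \<le> v \<Longrightarrow> v \<le> y \<Longrightarrow> 1 - \<delta> \<le> poly g v"
      "\<And>v. z \<le> v \<Longrightarrow> v \<le> 1 \<Longrightarrow> poly g v \<le> \<delta>"
      by (rule power_step_polynomial[OF yz \<delta>]) (rule that)
    have ig: "integrable \<mu> (\<lambda>p. poly g ((m p)\<^sup>2))" "integrable \<mu> (\<lambda>p. poly g (Y.v p))"
      by (rule continuous_integrable[OF poly_m_continuous], rule continuous_integrable[OF continuous_on_poly[OF Y.v_continuous]])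
    have iA: "integrable \<mu> (\<lambda>p. (1 - \<delta>) * indicator ?A p)" and iB: "integrable \<mu> (\<lambda>p. indicator ?B p + \<delta>)"
      using A B by (auto intro!: integrable_real_indicator simp: emeasure_eq_measure)
    have "(1 - \<delta>) * ?a = (LINT p|\<mu>. (1 - \<delta>) * indicator ?A p)" using A by simp
    also have "\<dots> \<le> (LINT p|\<mu>. poly g ((m p)\<^sup>2))"
    proof (rule integral_mono[OF iA ig(1)])
      fix p assume "p \<in> space \<mu>"
      then have "0 \<le> (m p)\<^sup>2" "(m p)\<^sup>2 \<le> 1" using m_square_bounds by (auto simp: space)
      then show "(1 - \<delta>) * indicator ?A p \<le> poly g ((m p)\<^sup>2)"
        using g(2)[of "(m p)\<^sup>2"] g(3)[of "(m p)\<^sup>2"] by (auto simp: indicator_def)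
    qed
    also have "\<dots> \<le> (LINT p|\<mu>. poly g (Y.v p))" by (rule decreasing_integral_le[OF g(1) Y card])
    also have "\<dots> \<le> (LINT p|\<mu>. indicator ?B p + \<delta>)"
    proof (rule integral_mono[OF ig(2) iB])
      fix p assume p: "p \<in> space \<mu>"
      show "poly g (Y.v p) \<le> indicator ?B p + \<delta>"
      proof (cases "Y.v p < z")
        case True
        then show ?thesis using vb[OF p] g(2)[of "Y.v p"] \<delta> p by (simp add: indicator_def)
      next
        case False
        then show ?thesis using vb[OF p] g(4)[of "Y.v p"] by (simp add: indicator_def)
      qed
    qed
    also have "\<dots> = ?b + \<delta> * ?S" using B by (subst Bochner_Integration.integral_add) (auto simp: emeasure_eq_measure)
    finally show ?thesis by (simp add: algebra_simps)
  qed
  have "((\<lambda>\<delta>. ?b + \<delta> * (?a + ?S)) \<longlongrightarrow> ?b + 0 * (?a + ?S)) (at_right 0)" by (intro tendsto_intros)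
  from tendsto_lowerbound[OF this, of ?a] key show ?thesis
    by (simp add: eventually_at_filter)
qed

lemma measure_sublevel_le:
  assumes Y: "orthonormal_set Y" and card: "card Y = CARD('k) + 1" and z: "0 < z" "z \<le> 1"
  shows "measure \<mu> {p \<in> space \<mu>. (m p)\<^sup>2 < z} \<le> measure \<mu> {p \<in> space \<mu>. orthonormal_set.v Y p < z}"
proof -
  let ?A = "\<lambda>i. {p \<in> space \<mu>. (m p)\<^sup>2 \<le> z - z / real (Suc i)}"
  have mm: "(\<lambda>p. (m p)\<^sup>2) \<in> borel_measurable \<mu>"
    by (rule continuous_measurable[OF continuous_on_power[OF m_continuous]])
  have sets: "range ?A \<subseteq> sets \<mu>" using mm by auto
  have inc: "incseq ?A"
  proof (rule incseq_SucI)
    fix i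
    have "z / real (Suc (Suc i)) \<le> z / real (Suc i)" using z by (intro divide_left_mono) auto
    then show "?A i \<subseteq> ?A (Suc i)" by (auto simp del: of_nat_Suc)
  qed
  have "(\<Union>i. ?A i) = {p \<in> space \<mu>. (m p)\<^sup>2 < z}"
  proof (intro equalityI subsetI)
    fix p assume "p \<in> (\<Union>i. ?A i)"
    then obtain i where "p \<in> space \<mu>" "(m p)\<^sup>2 \<le> z - z / real (Suc i)" by blast
    moreover have "z / real (Suc i) > 0" using z by simp
    ultimately show "p \<in> {p \<in> space \<mu>. (m p)\<^sup>2 < z}" by simp
  next
    fix p assume p: "p \<in> {p \<in> space \<mu>. (m p)\<^sup>2 < z}"
    then have "(z - (m p)\<^sup>2) / z > 0" using z by simp
    then obtain i where i: "inverse (real (Suc i)) < (z - (m p)\<^sup>2) / z" using reals_Archimedean by blast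
    have "z * ((z - (m p)\<^sup>2) / z) = z - (m p)\<^sup>2" using z by simp
    then have "z / real (Suc i) < z - (m p)\<^sup>2"
      using mult_strict_left_mono[OF i z(1)] unfolding divide_inverse[of z "real (Suc i)"] by linarith
    then have "p \<in> ?A i" using p by (simp del: of_nat_Suc)
    then show "p \<in> (\<Union>i. ?A i)" by blast
  qed
  with finite_Lim_measure_incseq[OF sets inc]
  have "(\<lambda>i. measure \<mu> (?A i)) \<longlonglongrightarrow> measure \<mu> {p \<in> space \<mu>. (m p)\<^sup>2 < z}" by simp
  moreover have "measure \<mu> (?A i) \<le> measure \<mu> {p \<in> space \<mu>. orthonormal_set.v Y p < z}" for i
    by (rule measure_sublevel_closed_le[OF Y card]) (use z in \<open>auto simp: field_simps\<close>)
  ultimately show ?thesis by (intro LIMSEQ_le_const2) auto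
qed

lemma measure_superlevel_ge:
  assumes Y: "orthonormal_set Y" and card: "card Y = CARD('k) + 1" and z: "0 < z" "z \<le> 1"
  shows "emeasure \<mu> {p \<in> space \<mu>. z \<le> orthonormal_set.v Y p} \<le> emeasure \<mu> {p \<in> space \<mu>. z \<le> (m p)\<^sup>2}"
proof -
  interpret Y: orthonormal_set Y by (rule Y)
  have compl: "measure \<mu> {p \<in> space \<mu>. z \<le> f p} = measure \<mu> (space \<mu>) - measure \<mu> {p \<in> space \<mu>. f p < z}"
    if "f \<in> borel_measurable \<mu>" for f :: "'a \<Rightarrow> real"
  proof -
    have "{p \<in> space \<mu>. f p < z} \<in> sets \<mu>" using that by measurable
    moreover have "{p \<in> space \<mu>. z \<le> f p} = space \<mu> - {p \<in> space \<mu>. f p < z}" by auto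
    ultimately show ?thesis by (simp add: finite_measure_compl)
  qed
  have mm: "(\<lambda>p. (m p)\<^sup>2) \<in> borel_measurable \<mu>" "Y.v \<in> borel_measurable \<mu>"
    by (rule continuous_measurable[OF continuous_on_power[OF m_continuous]], rule continuous_measurable[OF Y.v_continuous])
  show ?thesis
    using measure_sublevel_le[OF assms] unfolding emeasure_eq_measure compl[OF mm(1)] compl[OF mm(2)]
    by (simp add: ennreal_leI)
qed

end

section \<open>Geodesic distance on the sphere\<close>

text \<open>The angle to \<open>\<gamma> 0\<close> changes at most at the speed of the curve, since \<open>\<gamma>' s\<close> is orthogonal to
  \<open>\<gamma> s\<close>. As \<open>arccos\<close> is not differentiable at \<open>-1\<close> and \<open>1\<close>, its argument is first divided by \<open>1 + \<epsilon>\<close>.\<close>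

lemma arccos_le_curve_length:
  fixes \<gamma> :: "real \<Rightarrow> 'a::euclidean_space"
  assumes C1: "\<gamma> C1_differentiable_on {0..1}" and sph: "\<gamma> ` {0..1} \<subseteq> sphere 0 1"
  shows "arccos (\<gamma> 0 \<bullet> \<gamma> 1) \<le> curve_length \<gamma>"
proof -
  define p where "p = \<gamma> 0"
  obtain D where D: "\<And>s. s \<in> {0..1} \<Longrightarrow> (\<gamma> has_vector_derivative D s) (at s)" and cD: "continuous_on {0..1} D"
    using C1 unfolding C1_differentiable_on_def by blast
  have n: "norm (\<gamma> s) = 1" if s: "s \<in> {0..1}" for s
  proof -
    have "\<gamma> s \<in> sphere 0 1" using sph imageI[OF s, of \<gamma>] by blast
    then show ?thesis by simp
  qed
  have p: "norm p = 1" unfolding p_def by (rule n) simp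
  have len: "((\<lambda>s. norm (D s)) has_integral curve_length \<gamma>) {0..1}"
  proof -
    have "integral {0..1} (\<lambda>s. norm (D s)) = curve_length \<gamma>"
      unfolding curve_length_def by (rule integral_cong) (simp add: vector_derivative_at[OF D])
    moreover have "(\<lambda>s. norm (D s)) integrable_on {0..1}"
      by (intro integrable_continuous_interval continuous_on_norm cD)
    ultimately show ?thesis using integrable_integral by metis
  qed
  have perp: "\<gamma> s \<bullet> D s = 0" if s: "s \<in> {0..1}" for s
  proof -
    have 1: "((\<lambda>r. \<gamma> r \<bullet> \<gamma> r) has_vector_derivative (\<gamma> s \<bullet> D s + D s \<bullet> \<gamma> s)) (at s within {0..1})"
      by (rule bounded_bilinear.has_vector_derivative[OF bounded_bilinear_inner]) (use D[OF s] has_vector_derivative_at_within in blast)+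
    have 2: "((\<lambda>r. \<gamma> r \<bullet> \<gamma> r) has_vector_derivative 0) (at s within {0..1})"
    proof (rule has_vector_derivative_transform[OF s])
      show "\<gamma> r \<bullet> \<gamma> r = 1" if "r \<in> {0..1}" for r using n[OF that] by (simp add: dot_square_norm)
    qed simp
    have "\<gamma> s \<bullet> D s + D s \<bullet> \<gamma> s = 0"
      by (rule vector_derivative_unique_within_closed_interval[of 0 1 s, OF _ _ 1[folded box_real(2)] 2[folded box_real(2)]]) (use s in auto)
    then show ?thesis by (simp add: inner_commute)
  qed
  have step: "arccos ((\<gamma> 1 \<bullet> p) / (1 + \<epsilon>)) - arccos (1 / (1 + \<epsilon>)) \<le> curve_length \<gamma>" if \<epsilon>: "\<epsilon> > 0" for \<epsilon>
  proof -
    let ?f = "\<lambda>s. (\<gamma> s \<bullet> p) / (1 + \<epsilon>)"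
    let ?h' = "\<lambda>s. inverse (- sqrt (1 - (?f s)\<^sup>2)) * ((D s \<bullet> p) / (1 + \<epsilon>))"
    have f1: "\<bar>?f s\<bar> < 1" if s: "s \<in> {0..1}" for s
    proof -
      have "\<bar>\<gamma> s \<bullet> p\<bar> \<le> 1" using Cauchy_Schwarz_ineq2[of "\<gamma> s" p] n[OF s] p by simp
      then show ?thesis using \<epsilon> by (simp add: abs_divide)
    qed
    have d: "((\<lambda>s. arccos (?f s)) has_vector_derivative ?h' s) (at s within {0..1})" if s: "s \<in> {0..1}" for s
    proof -
      have "((\<lambda>s. \<gamma> s \<bullet> p) has_real_derivative D s \<bullet> p) (at s)"
        using has_derivative_inner_left[OF D[OF s, unfolded has_vector_derivative_def], of p]
        by (simp add: has_field_derivative_def mult.commute[of "D s \<bullet> p"] mult_commute_abs)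
      then have "(?f has_real_derivative (D s \<bullet> p) / (1 + \<epsilon>)) (at s)" by (rule DERIV_cdivide)
      moreover have "- 1 < ?f s" "?f s < 1" using f1[OF s] unfolding abs_less_iff by linarith+
      ultimately have "((\<lambda>s. arccos (?f s)) has_real_derivative ?h' s) (at s)"
        by (intro DERIV_chain2[OF DERIV_arccos])
      then show ?thesis
        by (simp add: has_real_derivative_iff_has_vector_derivative has_vector_derivative_at_within)
    qed
    have bound: "?h' s \<le> norm (D s)" if s: "s \<in> {0..1}" for s
    proof -
      define c where "c = \<gamma> s \<bullet> p"
      have c1: "c\<^sup>2 < (1 + \<epsilon>)\<^sup>2"
        using f1[OF s] \<epsilon> abs_square_less_1[of "?f s"] by (simp add: c_def power_divide)
      have "D s \<bullet> p = D s \<bullet> (p - c *\<^sub>R \<gamma> s)" using perp[OF s] by (simp add: inner_diff_right inner_commute)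
      then have a1: "\<bar>D s \<bullet> p\<bar> \<le> norm (D s) * norm (p - c *\<^sub>R \<gamma> s)" using Cauchy_Schwarz_ineq2 by simp
      have a2: "norm (p - c *\<^sub>R \<gamma> s) = sqrt (1 - c\<^sup>2)"
      proof -
        have "(p - c *\<^sub>R \<gamma> s) \<bullet> (p - c *\<^sub>R \<gamma> s) = p \<bullet> p - 2 * c * (\<gamma> s \<bullet> p) + c\<^sup>2 * (\<gamma> s \<bullet> \<gamma> s)"
          by (simp add: inner_diff_left inner_diff_right inner_commute power2_eq_square algebra_simps)
        then have "(p - c *\<^sub>R \<gamma> s) \<bullet> (p - c *\<^sub>R \<gamma> s) = 1 - c\<^sup>2"
          using p n[OF s] by (simp add: c_def[symmetric] dot_square_norm power2_eq_square)
        then show ?thesis by (simp add: norm_eq_sqrt_inner)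
      qed
      have a3: "sqrt (1 - c\<^sup>2) \<le> sqrt ((1 + \<epsilon>)\<^sup>2 - c\<^sup>2)" using \<epsilon> by (simp add: power2_eq_square algebra_simps)
      have le: "\<bar>D s \<bullet> p\<bar> \<le> norm (D s) * sqrt ((1 + \<epsilon>)\<^sup>2 - c\<^sup>2)"
        using a1 mult_left_mono[OF a3 norm_ge_zero[of "D s"]] unfolding a2 by linarith
      have sq: "sqrt (1 - (?f s)\<^sup>2) = sqrt ((1 + \<epsilon>)\<^sup>2 - c\<^sup>2) / (1 + \<epsilon>)"
      proof -
        have "1 - (?f s)\<^sup>2 = ((1 + \<epsilon>)\<^sup>2 - c\<^sup>2) / (1 + \<epsilon>)\<^sup>2" using \<epsilon> by (simp add: c_def power_divide diff_divide_distrib)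
        then show ?thesis using \<epsilon> by (simp add: real_sqrt_divide)
      qed
      define w where "w = sqrt ((1 + \<epsilon>)\<^sup>2 - c\<^sup>2)"
      have w: "w > 0" using c1 by (simp add: w_def)
      have "inverse (- (w / e)) * (a / e) = - a / w" if "e \<noteq> 0" for a e
        using that w by (simp add: field_simps)
      then have "?h' s = - (D s \<bullet> p) / w" unfolding sq w_def[symmetric] using \<epsilon> by simp
      also have "\<dots> \<le> norm (D s)" using le unfolding w_def[symmetric] pos_divide_le_eq[OF w] by linarith
      finally show ?thesis .
    qed
    have "(?h' has_integral arccos (?f 1) - arccos (?f 0)) {0..1}"
      by (rule fundamental_theorem_of_calculus) (use d in auto)
    from has_integral_le[OF this len bound]
    show ?thesis using p by (simp add: p_def[symmetric] dot_square_norm)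
  qed
  have "((\<lambda>\<epsilon>. arccos ((\<gamma> 1 \<bullet> p) / (1 + \<epsilon>)) - arccos (1 / (1 + \<epsilon>))) \<longlongrightarrow> arccos ((\<gamma> 1 \<bullet> p) / (1 + 0)) - arccos (1 / (1 + 0))) (at_right 0)"
  proof -
    have *: "((\<lambda>\<epsilon>. arccos (a / (1 + \<epsilon>))) \<longlongrightarrow> arccos (a / (1 + 0))) (at_right 0)" if "\<bar>a\<bar> \<le> 1" for a :: real
    proof -
      have c: "continuous_on {0..} (\<lambda>\<epsilon>. arccos (a / (1 + \<epsilon>)))"
      proof (rule continuous_on_compose2[OF continuous_on_arccos'])
        have b: "\<bar>a / (1 + \<epsilon>)\<bar> \<le> 1" if "\<epsilon> \<ge> 0" for \<epsilon> using that \<open>\<bar>a\<bar> \<le> 1\<close> by (simp add: abs_divide)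
        have "- 1 \<le> a / (1 + \<epsilon>) \<and> a / (1 + \<epsilon>) \<le> 1" if "\<epsilon> \<ge> 0" for \<epsilon>
          using b[OF that] by linarith
        then show "(\<lambda>\<epsilon>. a / (1 + \<epsilon>)) ` {0..} \<subseteq> {-1..1}" by (intro image_subsetI) simp
      qed (auto intro!: continuous_intros)
      then have "((\<lambda>\<epsilon>. arccos (a / (1 + \<epsilon>))) \<longlongrightarrow> arccos (a / (1 + 0))) (at 0 within {0..})"
        unfolding continuous_on_def by force
      then show ?thesis by (rule tendsto_within_subset) auto
    qed
    have "\<bar>\<gamma> 1 \<bullet> p\<bar> \<le> 1" using Cauchy_Schwarz_ineq2[of "\<gamma> 1" p] n[of 1] p by simp
    then show ?thesis by (intro tendsto_diff *) auto
  qed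
  then have "arccos ((\<gamma> 1 \<bullet> p) / (1 + 0)) - arccos (1 / (1 + 0)) \<le> curve_length \<gamma>"
    by (rule tendsto_upperbound) (use step in \<open>auto simp: eventually_at_filter\<close>)
  then show ?thesis by (simp add: p_def inner_commute)
qed

text \<open>An arc of the great circle through \<open>p\<close> and \<open>y\<close>. For equal or antipodal points the circle is not
  unique, and dimension two provides a direction \<open>e\<close> orthogonal to \<open>p\<close>.\<close>

lemma great_circle_curve:
  fixes p y :: "'a::euclidean_space"
  assumes p: "norm p = 1" and y: "norm y = 1" and dim: "DIM('a) \<ge> 2"
  obtains \<gamma> where "\<gamma> C1_differentiable_on {0..1}" "\<gamma> ` {0..1} \<subseteq> sphere 0 1" "\<gamma> 0 = p" "\<gamma> 1 = y"
    "curve_length \<gamma> = arccos (p \<bullet> y)"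
proof -
  define c where "c = p \<bullet> y"
  define \<theta> where "\<theta> = arccos c"
  have c1: "\<bar>c\<bar> \<le> 1" using Cauchy_Schwarz_ineq2[of p y] p y by (simp add: c_def)
  have cos: "cos \<theta> = c" and sin: "sin \<theta> = sqrt (1 - c\<^sup>2)" and \<theta>0: "\<theta> \<ge> 0"
    using c1 by (simp_all add: \<theta>_def cos_arccos_abs sin_arccos_abs arccos_lbound abs_le_iff)
  have pp: "p \<bullet> p = 1" and yy: "y \<bullet> y = 1" using p y by (simp_all add: dot_square_norm)
  define w where "w = y - c *\<^sub>R p"
  have wp: "p \<bullet> w = 0" using pp by (simp add: w_def inner_diff_right c_def)
  have ww: "norm w = sin \<theta>"
  proof -
    have "w \<bullet> w = 1 - c\<^sup>2"
      using pp yy by (simp add: w_def inner_diff_left inner_diff_right inner_commute c_def[symmetric] power2_eq_square)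
    then show ?thesis by (simp add: sin norm_eq_sqrt_inner)
  qed
  obtain e where e: "norm e = 1" "p \<bullet> e = 0" "w = sin \<theta> *\<^sub>R e"
  proof (cases "w = 0")
    case True
    obtain z :: 'a where z: "z \<noteq> 0" "orthogonal p z" using orthogonal_to_vector_exists[OF dim] by blast
    show ?thesis
      by (rule that[of "z /\<^sub>R norm z"]) (use True z ww in \<open>simp_all add: orthogonal_def\<close>)
  next
    case False
    show ?thesis
      by (rule that[of "w /\<^sub>R norm w"]) (use False wp in \<open>simp_all add: ww[symmetric]\<close>)
  qed
  have ee: "e \<bullet> e = 1" using e(1) by (simp add: dot_square_norm)
  define \<gamma> where "\<gamma> s = cos (\<theta> * s) *\<^sub>R p + sin (\<theta> * s) *\<^sub>R e" for s
  define D where "D s = (- sin (\<theta> * s) * \<theta>) *\<^sub>R p + (cos (\<theta> * s) * \<theta>) *\<^sub>R e" for s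
  have D: "(\<gamma> has_vector_derivative D s) (at s)" for s
    unfolding \<gamma>_def[abs_def] D_def
    by (rule derivative_eq_intros refl | simp)+
  have sq: "norm (a *\<^sub>R p + b *\<^sub>R e) = sqrt (a\<^sup>2 + b\<^sup>2)" for a b
    using pp ee e(2) by (simp add: norm_eq_sqrt_inner inner_add_left inner_add_right inner_commute power2_eq_square)
  show ?thesis
  proof (rule that[of \<gamma>])
    show "\<gamma> C1_differentiable_on {0..1}"
      unfolding C1_differentiable_on_def using D
      by (intro exI[of _ D]) (auto simp: D_def intro!: continuous_intros)
    show "\<gamma> ` {0..1} \<subseteq> sphere 0 1" by (auto simp: \<gamma>_def sq)
    show "\<gamma> 0 = p" by (simp add: \<gamma>_def)
    show "\<gamma> 1 = y" using e(3) by (simp add: \<gamma>_def cos w_def algebra_simps)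
    have "norm (D s) = \<theta>" for s
    proof -
      have "(- sin (\<theta> * s) * \<theta>)\<^sup>2 + (cos (\<theta> * s) * \<theta>)\<^sup>2 = \<theta>\<^sup>2"
        by (simp only: power_mult_distrib power2_minus distrib_right[symmetric] sin_cos_squared_add mult_1_left)
      then have "norm (D s) = sqrt (\<theta>\<^sup>2)" unfolding D_def sq by (rule arg_cong)
      then show ?thesis using \<theta>0 by simp
    qed
    then show "curve_length \<gamma> = arccos (p \<bullet> y)"
      by (simp add: curve_length_def vector_derivative_at[OF D] \<theta>_def c_def)
  qed
qed

lemma geodesic_dist_sphere:
  fixes p y :: "'a::euclidean_space"
  assumes p: "norm p = 1" and y: "norm y = 1" and dim: "DIM('a) \<ge> 2"
  shows "geodesic_dist (sphere 0 1) p y = arccos (p \<bullet> y)"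
  unfolding geodesic_dist_def
proof (rule cInf_eq_minimum)
  obtain \<gamma> where "\<gamma> C1_differentiable_on {0..1}" "\<gamma> ` {0..1} \<subseteq> sphere 0 1" "\<gamma> 0 = p" "\<gamma> 1 = y"
    "curve_length \<gamma> = arccos (p \<bullet> y)" by (rule great_circle_curve[OF assms]) (rule that)
  then show "arccos (p \<bullet> y) \<in> {curve_length \<gamma> |\<gamma>. \<gamma> C1_differentiable_on {0..1} \<and> \<gamma> ` {0..1} \<subseteq> sphere 0 1 \<and> \<gamma> 0 = p \<and> \<gamma> 1 = y}"
    by (intro CollectI exI[of _ \<gamma>]) simp
qed (use arccos_le_curve_length in blast)

text \<open>By compactness the infimum that defines the distance to \<open>Y\<close> is attained.\<close>

lemma geodesic_neighbourhood_sphere: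
  fixes Y :: "'a::euclidean_space set"
  assumes Y: "compact Y" "Y \<noteq> {}" "Y \<subseteq> sphere 0 1" and dim: "DIM('a) \<ge> 2"
  shows "geodesic_neighbourhood (sphere 0 1) Y t = {p \<in> sphere 0 1. \<exists>y\<in>Y. arccos (p \<bullet> y) \<le> t}"
proof -
  have "(INF y\<in>Y. geodesic_dist (sphere 0 1) p y) \<le> t \<longleftrightarrow> (\<exists>y\<in>Y. arccos (p \<bullet> y) \<le> t)" if p: "p \<in> sphere 0 1" for p
  proof -
    obtain y where y: "y \<in> Y" "\<And>z. z \<in> Y \<Longrightarrow> p \<bullet> z \<le> p \<bullet> y"
      using continuous_attains_sup[OF Y(1,2) continuous_on_inner[OF continuous_on_const continuous_on_id], of p] by blast
    have b: "\<bar>p \<bullet> z\<bar> \<le> 1" if "z \<in> Y" for z using Cauchy_Schwarz_ineq2[of p z] p Y(3) that by auto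
    have le: "arccos (p \<bullet> y) \<le> arccos (p \<bullet> z)" if "z \<in> Y" for z
      by (subst arccos_le_mono) (use b y that in auto)
    have "(INF y\<in>Y. geodesic_dist (sphere 0 1) p y) = (INF y\<in>Y. arccos (p \<bullet> y))"
      by (rule INF_cong[OF refl], rule geodesic_dist_sphere[OF _ _ dim]) (use p Y(3) in auto)
    also have "\<dots> = arccos (p \<bullet> y)"
      by (rule cInf_eq_minimum) (use y(1) le in auto)
    finally show ?thesis using le y(1) order_trans by auto
  qed
  then show ?thesis unfolding geodesic_neighbourhood_def by blast
qed

lemma arccos_le_iff:
  assumes "\<bar>x\<bar> \<le> 1" "0 \<le> t" "t \<le> pi"
  shows "arccos x \<le> t \<longleftrightarrow> cos t \<le> x"
  using arccos_le_mono[of x "cos t"] assms by (simp add: arccos_cos)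

lemma (in orthonormal_set) inner_span_le:
  assumes "y \<in> span Y" "norm y = 1"
  shows "(p \<bullet> y)\<^sup>2 \<le> v p"
proof -
  have "P (a + b) = P a + P b" "P (c *\<^sub>R a) = c *\<^sub>R P a" "P 0 = 0" for a b c
    by (simp_all add: P_def inner_add_right scaleR_add_left sum.distrib scaleR_sum_right)
  then have "subspace {z. P z = z}" by (intro subspaceI) auto
  moreover have "P t = t" if t: "t \<in> Y" for t
  proof -
    have "P t = (\<Sum>s\<in>Y. if s = t then t else 0)"
      unfolding P_def by (rule sum.cong) (use t nY oY in \<open>auto simp: dot_square_norm\<close>)
    then show ?thesis using finY t by simp
  qed
  ultimately have "span Y \<subseteq> {z. P z = z}" by (intro span_minimal) auto
  then have "P y = y" using assms by blast
  then have "p \<bullet> y = p \<bullet> P y" by simp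
  also have "\<dots> = P p \<bullet> y" by (simp add: P_def inner_sum_right inner_sum_left mult.commute inner_commute)
  finally have "\<bar>p \<bullet> y\<bar> \<le> norm (P p)" using Cauchy_Schwarz_ineq2[of "P p" y] assms by simp
  then have "(p \<bullet> y)\<^sup>2 \<le> (norm (P p))\<^sup>2" by (metis abs_le_square_iff abs_norm_cancel)
  then show ?thesis using P_P[of p] by (simp add: dot_square_norm)
qed

section \<open>Comparison of tube volumes\<close>

lemma sphere_measure_riemannian_volume:
  assumes dim: "DIM('a::euclidean_space) = CARD('n::finite) + 1"
  shows "sphere_measure (riemannian_volume TYPE('n) (sphere (0::'a) 1))"
proof -
  let ?\<mu> = "riemannian_volume TYPE('n) (sphere (0::'a) 1)"
  have emb: "embedded_submanifold TYPE('n) (sphere (0::'a) 1)" by (rule embedded_submanifold_sphere[OF dim])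
  have ne: "sphere (0::'a) 1 \<noteq> {}" by simp
  have vol: "is_riemannian_volume TYPE('n) (sphere (0::'a) 1) ?\<mu>"
    by (rule is_riemannian_volume_riemannian_volume[OF emb ne])
  have orth: "orthogonal_transformation (plane_rot i j s)" if "(i, j) \<in> planes" for i j :: 'a and s
    by (rule orthogonal_plane_rot[OF planes_orthonormal[OF that]])
  have img: "f ` sphere 0 1 = sphere 0 1" if f: "orthogonal_transformation f" for f :: "'a \<Rightarrow> 'a"
  proof (intro equalityI subsetI)
    fix y :: 'a assume y: "y \<in> sphere 0 1"
    obtain x where x: "y = f x" using orthogonal_transformation_surj[OF f] by blast
    then have "x \<in> sphere 0 1" using y orthogonal_transformation_norm[OF f] by simp
    then show "y \<in> f ` sphere 0 1" using x by blast
  qed (use orthogonal_transformation_norm[OF f] in auto)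
  show ?thesis
  proof
    show "sets ?\<mu> = sets (restrict_space borel (sphere 0 1))" using vol unfolding is_riemannian_volume_def by blast
    show "emeasure ?\<mu> (sphere 0 1) < \<infinity>" by (rule riemannian_volume_finite[OF emb compact_sphere vol])
    show "distr ?\<mu> ?\<mu> (plane_rot i j s) = ?\<mu>" "plane_rot i j s \<in> measurable ?\<mu> ?\<mu>"
      if "(i, j) \<in> planes" for i j s
      by (rule riemannian_volume_isometry[OF emb ne orth[OF that] img[OF orth[OF that]]])+
    show "emeasure ?\<mu> {x \<in> sphere 0 1. a \<bullet> x = 0} = 0" if "a \<noteq> 0" for a
      by (rule great_sphere_null[OF dim that vol])
  qed
qed

theorem proposition5p2:
  fixes X T :: "'a::euclidean_space set" and t :: real
  assumes dim_ambient: "DIM('a) = CARD('n::finite) + 1"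
    and nonempty: "X \<noteq> {}"
    and submanifold: "properly_embedded_submanifold TYPE('k::finite) (sphere 0 1) X"
    and critical: "volume_critical TYPE('k) (sphere 0 1) X"
    and standard: "subspace T" "dim T = CARD('k) + 1"
    and t: "t > 0"
  shows "emeasure (riemannian_volume TYPE('n) (sphere (0::'a) 1))
             (geodesic_neighbourhood (sphere 0 1) X t)
       \<ge> emeasure (riemannian_volume TYPE('n) (sphere (0::'a) 1))
             (geodesic_neighbourhood (sphere 0 1) (sphere 0 1 \<inter> T) t)"
proof -
  let ?\<mu> = "riemannian_volume TYPE('n) (sphere (0::'a) 1)"
  let ?N = "\<lambda>Y. geodesic_neighbourhood (sphere 0 1) Y t :: 'a set"
  have dim2: "DIM('a) \<ge> 2" using dim_ambient by (simp add: Suc_le_eq)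
  have X: "X \<subseteq> sphere 0 1" "compact X" "embedded_submanifold TYPE('k) X"
    using submanifold closedin_compact[OF compact_sphere] unfolding properly_embedded_submanifold_def by auto
  have dimT: "CARD('k) + 1 \<le> DIM('a)" using dim_subset_UNIV[of T] standard(2) by simp
  interpret M: sphere_measure ?\<mu> by (rule sphere_measure_riemannian_volume[OF dim_ambient])
  interpret M: critical_sphere ?\<mu> X "TYPE('k)"
    by unfold_locales (use X nonempty critical dimT in auto)
  obtain B where B: "B \<subseteq> T" "pairwise orthogonal B" "\<And>x. x \<in> B \<Longrightarrow> norm x = 1"
    "independent B" "card B = dim T" "span B = T"
    by (rule orthonormal_basis_subspace[OF standard(1)]) (rule that)
  interpret Y: orthonormal_set B
  proof
    show "finite B" by (rule independent_imp_finite[OF B(4)])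
    show "b \<bullet> b' = 0" if "b \<in> B" "b' \<in> B" "b \<noteq> b'" for b b'
      using B(2) that unfolding pairwise_def orthogonal_def by blast
  qed (rule B(3))
  have card: "card B = CARD('k) + 1" using B(5) standard(2) by simp
  have T: "compact (sphere 0 1 \<inter> T)" "sphere 0 1 \<inter> T \<noteq> {}"
  proof -
    show "compact (sphere 0 1 \<inter> T)"
      by (intro compact_Int_closed compact_sphere closed_subspace standard(1))
    have "B \<noteq> {}" using card by auto
    then obtain b where b: "b \<in> B" by blast
    then have "b \<in> sphere 0 1 \<inter> T" using B(1) B(3)[OF b] by auto
    then show "sphere 0 1 \<inter> T \<noteq> {}" by blast
  qed
  have NX: "?N X = {p \<in> sphere 0 1. \<exists>y\<in>X. arccos (p \<bullet> y) \<le> t}"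
    by (rule geodesic_neighbourhood_sphere[OF X(2) nonempty X(1) dim2])
  have NT: "?N (sphere 0 1 \<inter> T) = {p \<in> sphere 0 1. \<exists>y\<in>sphere 0 1 \<inter> T. arccos (p \<bullet> y) \<le> t}"
    by (rule geodesic_neighbourhood_sphere[OF T _ dim2]) blast
  have bound: "\<bar>p \<bullet> y\<bar> \<le> 1" if "p \<in> sphere 0 1" "y \<in> sphere 0 1" for p y :: 'a
    using Cauchy_Schwarz_ineq2[of p y] that by simp
  show ?thesis
  proof (cases "t < pi / 2")
    case True
    define z where "z = (cos t)\<^sup>2"
    have cos: "cos t > 0" using True t by (intro cos_gt_zero) auto
    have z: "0 < z" "z \<le> 1" using cos by (auto simp: z_def power_le_one)
    have iff: "arccos (p \<bullet> y) \<le> t \<longleftrightarrow> cos t \<le> p \<bullet> y" if "p \<in> sphere 0 1" "y \<in> sphere 0 1" for p y :: 'a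
      by (rule arccos_le_iff[OF bound[OF that]]) (use t True in auto)
    have NX': "?N X = {p \<in> space ?\<mu>. z \<le> (M.m p)\<^sup>2}"
    proof -
      have "(\<exists>y\<in>X. arccos (p \<bullet> y) \<le> t) \<longleftrightarrow> z \<le> (M.m p)\<^sup>2" if p: "p \<in> sphere 0 1" for p
      proof -
        obtain x where x: "x \<in> X" "x \<bullet> p = M.m p" by (rule M.attained[of p]) (rule that)
        have "(\<exists>y\<in>X. arccos (p \<bullet> y) \<le> t) \<longleftrightarrow> (\<exists>y\<in>X. cos t \<le> p \<bullet> y)" using iff[OF p] X(1) by blast
        also have "\<dots> \<longleftrightarrow> cos t \<le> M.m p"
        proof
          assume "\<exists>y\<in>X. cos t \<le> p \<bullet> y"
          then obtain y where "y \<in> X" "cos t \<le> p \<bullet> y" by blast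
          then show "cos t \<le> M.m p" using M.m_ge[of y p] by (simp add: inner_commute)
        next
          assume "cos t \<le> M.m p"
          then have "cos t \<le> p \<bullet> x" using x(2) inner_commute[of p x] by linarith
          then show "\<exists>y\<in>X. cos t \<le> p \<bullet> y" using x(1) by blast
        qed
        also have "\<dots> \<longleftrightarrow> z \<le> (M.m p)\<^sup>2"
          unfolding z_def using cos M.m_nonneg[of p] by (simp add: power_mono_iff)
        finally show ?thesis .
      qed
      then show ?thesis unfolding NX M.space by blast
    qed
    have NT': "?N (sphere 0 1 \<inter> T) \<subseteq> {p \<in> space ?\<mu>. z \<le> Y.v p}"
    proof
      fix p assume "p \<in> ?N (sphere 0 1 \<inter> T)"
      then obtain y where p: "p \<in> sphere 0 1" and y: "y \<in> sphere 0 1" "y \<in> T" "arccos (p \<bullet> y) \<le> t"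
        unfolding NT by blast
      have "cos t \<le> p \<bullet> y" using iff[OF p y(1)] y(3) by blast
      then have "z \<le> (p \<bullet> y)\<^sup>2" unfolding z_def using cos by (intro power_mono) auto
      also have "\<dots> \<le> Y.v p" by (rule Y.inner_span_le) (use y B(6) in auto)
      finally show "p \<in> {p \<in> space ?\<mu>. z \<le> Y.v p}" using p M.space by blast
    qed
    have "Y.v \<in> borel_measurable ?\<mu>" by (rule M.continuous_measurable[OF Y.v_continuous])
    then have "{p \<in> space ?\<mu>. z \<le> Y.v p} \<in> sets ?\<mu>" by measurable
    with NT' have "emeasure ?\<mu> (?N (sphere 0 1 \<inter> T)) \<le> emeasure ?\<mu> {p \<in> space ?\<mu>. z \<le> Y.v p}"
      by (rule emeasure_mono)
    also have "\<dots> \<le> emeasure ?\<mu> {p \<in> space ?\<mu>. z \<le> (M.m p)\<^sup>2}"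
      by (rule M.measure_superlevel_ge[OF Y.orthonormal_set_axioms card z])
    finally show ?thesis unfolding NX' .
  next
    case False
    have "?N X = sphere 0 1"
    proof -
      have "\<exists>y\<in>X. arccos (p \<bullet> y) \<le> t" if p: "p \<in> sphere 0 1" for p
      proof -
        obtain x where x: "x \<in> X" "x \<bullet> p = M.m p" by (rule M.attained[of p]) (rule that)
        have "0 \<le> p \<bullet> x" using M.m_nonneg[of p] x(2) by (simp add: inner_commute)
        moreover have "\<bar>p \<bullet> x\<bar> \<le> 1" using bound[OF p, of x] X(1) x(1) by blast
        ultimately have "arccos (p \<bullet> x) \<le> pi / 2" by (intro arccos_le_pi2) auto
        then show ?thesis using False x(1) by (intro bexI[of _ x]) auto
      qed
      then show ?thesis unfolding NX by blast
    qed
    moreover have "?N (sphere 0 1 \<inter> T) \<subseteq> sphere 0 1" unfolding NT by blast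
    ultimately show ?thesis using emeasure_mono[of "?N (sphere 0 1 \<inter> T)" "sphere 0 1" ?\<mu>] sets.top[of ?\<mu>] M.space by simp
  qed
qed

end
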